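(* Let $(u^s,v^s)(t,z)$ be the solution of the shear-flow problem $$\partial_t u^s-\partial_z^2u^s=0,\quad \partial_t v^s-\partial_z^2v^s=0,\quad (u^s,v^s)|_{z=0}=0,\quad \lim_{z\to+\infty}(u^s,v^s)=(U_0,V_0),\quad (u^s,v^s)|_{t=0}=(U_s,V_s)(z),$$ satisfying $$(u^s-U_0,v^s-V_0)\in C^0\big(\mathbb{R}^+; W_\alpha^{4,\infty}(\mathbb{R}^+)\cap H_\alpha^4(\mathbb{R}^+)\big)\cap C^1\big(\mathbb{R}^+; W_\alpha^{2,\infty}(\mathbb{R}^+)\cap H_\alpha^2(\mathbb{R}^+)\big).\qquad ( * )$$ Assume that there exists $z_0>0$ such that $$(U_s'(z_0))^2+(V_s'(z_0))^2\neq0\quad\text{and}\quad V_s'(z_0)U_s''(z_0)\neq U_s'(z_0)V_s''(z_0).\qquad ( ** )$$ Let $T(t,s)$ be the solution operator of the linearized Prandtl equations around $(u^s,v^s,0)$ (see context). Then, for each choice $\partial_{\mathcal{T}}\in\{\partial_x,\partial_y\}$ of tangential derivative, the following hold. (i) There exists $\sigma>0$ such that for all $\delta>0$, $$\sup_{0\leq s\leq t\leq\delta}\big\|e^{-\sigma(t-s)\sqrt{|\partial_{\mathcal{T}}|}}\,T(t,s)\big\|_{\mathcal{L}(\mathcal{H}_\alpha^m,\mathcal{H}_\alpha^{m-\mu})}=+\infty,\qquad \forall\, m>0,\ \mu\in[0,\tfrac14).$$ (ii) There exist an initial shear layer $(U_s,V_s)$ (for which $( * )$ and $( ** )$ hold)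 and $\sigma>0$ such that for all $\delta>0$, $$\sup_{0\leq s\leq t\leq\delta}\big\|e^{-\sigma(t-s)\sqrt{|\partial_{\mathcal{T}}|}}\,T(t,s)\big\|_{\mathcal{L}(\mathcal{H}_\alpha^{m_1},\mathcal{H}_\alpha^{m_2})}=+\infty,\qquad \forall\, m_1,m_2>0.$$
   Context: $U_0,V_0$ are positive constants, $\alpha>0$ is fixed, $\mathbb{T}=\mathbb{R}/2\pi\mathbb{Z}$; $(x,y)\in\mathbb{T}^2$ are tangential variables, $z\in\mathbb{R}^+$ is the normal variable; time intervals $\mathbb{R}^+$ include $t=0$. The shear flows considered are smooth solutions of the stated heat equations with $(u^s-U_0,v^s-V_0)$ tending rapidly to $0$ as $z\to+\infty$. Weighted spaces on $\mathbb{R}^+$: $\|f\|_{L^2_\alpha}=\|e^{\alpha z}f\|_{L^2(\mathbb{R}^+)}$, $\|f\|_{H^m_\alpha}=\|e^{\alpha z}f\|_{H^m(\mathbb{R}^+)}$, $\|f\|_{W^{m,\infty}_\alpha}=\|e^{\alpha z}f\|_{W^{m,\infty}(\mathbb{R}^+)}$; the corresponding spaces $L^2_\alpha(\mathbb{R}^+)$, $H^m_\alpha(\mathbb{R}^+)$, $W^{m,\infty}_\alpha(\mathbb{R}^+)$ consist of functions with finite norm. Set $\mathcal{H}_\alpha^m=H^m(\mathbb{T}^2_{x,y};L^2_\alpha(\mathbb{R}^+_z))$. For $\beta>0$, $E_{\alpha,\beta}$ is the space of $f(x,y,z)=\sum_{k_1,k_2\in\mathbb{Z}}e^{i(k_1x+k_2y)}f_{k_1,k_2}(z)$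 with $$\|f\|_{E_{\alpha,\beta}}=\sup_{k_1,k_2\in\mathbb{Z}}e^{\beta\sqrt{k_1^2+k_2^2}}\|f_{k_1,k_2}\|_{L^2_\alpha}<\infty.$$ The same notation is used for vector-valued functions. Linearized Prandtl equations around $(u^s,v^s,0)$, in $\{t>0,(x,y)\in\mathbb{T}^2,z\in\mathbb{R}^+\}$: $$\begin{cases}\partial_t u+(u^s\partial_x+v^s\partial_y)u+w\,\partial_zu^s-\partial_z^2u=0,\\ \partial_t v+(u^s\partial_x+v^s\partial_y)v+w\,\partial_zv^s-\partial_z^2v=0,\\ \partial_xu+\partial_yv+\partial_zw=0,\\ (u,v,w)|_{z=0}=0,\quad \lim_{z\to+\infty}(u,v)=0.\end{cases}\qquad (L)$$ It is known that there is $\rho>0$ such that for data $(u_0,v_0)\in E_{\alpha,\beta}$ at time $s$, (L) has a unique solution with $(u,v)(t,\cdot)\in E_{\alpha,\beta-\rho(t-s)}$ as long as $\rho(t-s)<\beta$. Define $T(t,s)(u_0,v_0):=(u,v)(t,\cdot)$, where $(u,v)$ solves (L) with $(u,v)|_{t=s}=(u_0,v_0)$. Set $$\|T(t,s)\|_{\mathcal{L}(\mathcal{H}_\alpha^{m_1},\mathcal{H}_\alpha^{m_2})}:=\sup_{0\ne(u_0,v_0)\in E_{\alpha,\beta}}\frac{\|T(t,s)(u_0,v_0)\|_{\mathcal{H}_\alpha^{m_2}}}{\|(u_0,v_0)\|_{\mathcal{H}_\alpha^{m_1}}}\in\mathbb{R}^+\cup\{\infty\},$$ where $\beta$ is taken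 with $\beta>\rho(t-s)$ ($E_{\alpha,\beta}$ is dense in $\mathcal{H}^m_\alpha$; the value $\infty$ means that $T(t,s)$ does not extend to a bounded operator $\mathcal{H}_\alpha^{m_1}\to\mathcal{H}_\alpha^{m_2}$). The norm of $e^{-\sigma(t-s)\sqrt{|\partial_{\mathcal{T}}|}}T(t,s)$ is defined in the same way, where $e^{-\sigma(t-s)\sqrt{|\partial_x|}}$ (resp. $e^{-\sigma(t-s)\sqrt{|\partial_y|}}$) is the Fourier multiplier multiplying the $(k_1,k_2)$ Fourier coefficient by $e^{-\sigma(t-s)\sqrt{|k_1|}}$ (resp. $e^{-\sigma(t-s)\sqrt{|k_2|}}$). *)

theory Defs
  imports "HOL-Analysis.Analysis" "HOL-Probability.Essential_Supremum"
begin

text \<open>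
  All norms take values in the extended nonnegative reals, and a space is the set of functions of
  finite norm. A function on the half-line \<open>z > 0\<close> is represented by a total function on the
  reals; its values for \<open>z \<le> 0\<close> never enter a norm.
\<close>

definition ennsqrt :: "ennreal \<Rightarrow> ennreal" where
  "ennsqrt a = (if a = \<infinity> then \<infinity> else ennreal (sqrt (enn2real a)))"

subsection \<open>Weighted spaces on the half-line\<close>

definition L2_norm :: "(real \<Rightarrow> 'a::real_normed_vector) \<Rightarrow> ennreal" where
  "L2_norm f =
     (if f \<in> borel_measurable (lebesgue_on {0<..})
      then ennsqrt (\<integral>\<^sup>+ z. (ennreal (norm (f z)))\<^sup>2 \<partial>lebesgue_on {0<..})
      else \<infinity>)"

definition test_function :: "(real \<Rightarrow> real) \<Rightarrow> bool" where
  "test_function \<phi> \<longleftrightarrow>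
     (\<forall>k x. ((deriv ^^ k) \<phi>) differentiable (at x)) \<and>
     (\<exists>a b. 0 < a \<and> a < b \<and> (\<forall>x. x \<notin> {a..b} \<longrightarrow> \<phi> x = 0))"

definition locally_integrable :: "(real \<Rightarrow> real) \<Rightarrow> bool" where
  "locally_integrable f \<longleftrightarrow> (\<forall>a b. 0 < a \<longrightarrow> a < b \<longrightarrow> set_integrable lebesgue {a..b} f)"

definition weak_deriv :: "nat \<Rightarrow> (real \<Rightarrow> real) \<Rightarrow> (real \<Rightarrow> real) \<Rightarrow> bool" where
  "weak_deriv k f g \<longleftrightarrow>
     locally_integrable f \<and> locally_integrable g \<and>
     (\<forall>\<phi>. test_function \<phi> \<longrightarrow>
        (LINT z:{0<..}|lebesgue. f z * (deriv ^^ k) \<phi> z) =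
        (-1) ^ k * (LINT z:{0<..}|lebesgue. g z * \<phi> z))"

text \<open>
  Weak derivatives are unique up to null sets, so the infima below range over at most one value;
  they are infinite if some weak derivative does not exist.
\<close>

definition H_norm :: "nat \<Rightarrow> (real \<Rightarrow> real) \<Rightarrow> ennreal" where
  "H_norm m f =
     (INF D \<in> {D. \<forall>k\<le>m. weak_deriv k f (D k)}. ennsqrt (\<Sum>k\<le>m. (L2_norm (D k))\<^sup>2))"

definition Winf_norm :: "nat \<Rightarrow> (real \<Rightarrow> real) \<Rightarrow> ennreal" where
  "Winf_norm m f =
     (INF D \<in> {D. \<forall>k\<le>m. weak_deriv k f (D k)}.
        SUP k\<in>{..m}. esssup (lebesgue_on {0<..}) (\<lambda>z. ennreal \<bar>D k z\<bar>))"

definition weighted :: "real \<Rightarrow> (real \<Rightarrow> 'a::real_vector) \<Rightarrow> real \<Rightarrow> 'a" where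
  "weighted \<alpha> f z = exp (\<alpha> * z) *\<^sub>R f z"

definition WH_norm :: "real \<Rightarrow> nat \<Rightarrow> (real \<Rightarrow> real) \<Rightarrow> ennreal" where
  "WH_norm \<alpha> m f = Winf_norm m (weighted \<alpha> f) + H_norm m (weighted \<alpha> f)"

text \<open>\<open>C\<^sup>0\<close> and \<open>C\<^sup>1\<close> maps of \<open>t \<ge> 0\<close> into the space of functions of finite norm \<open>N\<close>.\<close>

definition C0_into :: "((real \<Rightarrow> real) \<Rightarrow> ennreal) \<Rightarrow> (real \<Rightarrow> real \<Rightarrow> real) \<Rightarrow> bool" where
  "C0_into N f \<longleftrightarrow>
     (\<forall>t\<ge>0. N (f t) < \<infinity> \<and> ((\<lambda>r. N (\<lambda>z. f r z - f t z)) \<longlongrightarrow> 0) (at t within {0..}))"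

definition C1_into :: "((real \<Rightarrow> real) \<Rightarrow> ennreal) \<Rightarrow> (real \<Rightarrow> real \<Rightarrow> real) \<Rightarrow> bool" where
  "C1_into N f \<longleftrightarrow>
     C0_into N f \<and>
     (\<exists>g. C0_into N g \<and>
        (\<forall>t\<ge>0. ((\<lambda>r. N (\<lambda>z. (f r z - f t z) / (r - t) - g t z)) \<longlongrightarrow> 0) (at t within {0..})))"

subsection \<open>Shear flows\<close>

definition heat_profile :: "real \<Rightarrow> real \<Rightarrow> (real \<Rightarrow> real) \<Rightarrow> (real \<Rightarrow> real \<Rightarrow> real) \<Rightarrow> bool" where
  "heat_profile \<alpha> U0 Us us \<longleftrightarrow>
     continuous_on ({0..} \<times> {0..}) (\<lambda>(t, z). us t z) \<and>
     (\<forall>t>0. \<forall>z>0. us t differentiable (at z) \<and> deriv (us t) differentiable (at z) \<and>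
        ((\<lambda>r. us r z) has_real_derivative deriv (deriv (us t)) z) (at t)) \<and>
     (\<forall>t\<ge>0. us t 0 = 0) \<and>
     (\<forall>t\<ge>0. (us t \<longlongrightarrow> U0) at_top) \<and>
     (\<forall>z\<ge>0. us 0 z = Us z) \<and>
     C0_into (WH_norm \<alpha> 4) (\<lambda>t z. us t z - U0) \<and>
     C1_into (WH_norm \<alpha> 2) (\<lambda>t z. us t z - U0)"

definition shear_flow ::
  "real \<Rightarrow> real \<Rightarrow> real \<Rightarrow> (real \<Rightarrow> real) \<Rightarrow> (real \<Rightarrow> real) \<Rightarrow>
   (real \<Rightarrow> real \<Rightarrow> real) \<Rightarrow> (real \<Rightarrow> real \<Rightarrow> real) \<Rightarrow> bool" where
  "shear_flow \<alpha> U0 V0 Us Vs us vs \<longleftrightarrow> heat_profile \<alpha> U0 Us us \<and> heat_profile \<alpha> V0 Vs vs"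

definition nondegenerate_layer :: "(real \<Rightarrow> real) \<Rightarrow> (real \<Rightarrow> real) \<Rightarrow> bool" where
  "nondegenerate_layer Us Vs \<longleftrightarrow>
     (\<exists>z0>0. (deriv Us z0)\<^sup>2 + (deriv Vs z0)\<^sup>2 \<noteq> 0 \<and>
             deriv Vs z0 * deriv (deriv Us) z0 \<noteq> deriv Us z0 * deriv (deriv Vs) z0)"

subsection \<open>Functions of \<open>(x, y, z)\<close> and their tangential Fourier series\<close>

text \<open>
  A function on \<open>\<T>\<^sup>2 \<times> \<real>\<^sup>+\<close> is a complex-valued function of \<open>x y z\<close>, \<open>2\<pi>\<close>-periodic in \<open>x\<close> and \<open>y\<close>.
\<close>

type_synonym field3 = "real \<Rightarrow> real \<Rightarrow> real \<Rightarrow> complex"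

definition periodic_xy :: "field3 \<Rightarrow> bool" where
  "periodic_xy f \<longleftrightarrow>
     (\<forall>x y z. 0 < z \<longrightarrow> f (x + 2 * pi) y z = f x y z \<and> f x (y + 2 * pi) z = f x y z)"

definition phase :: "int \<times> int \<Rightarrow> real \<Rightarrow> real \<Rightarrow> real" where
  "phase k x y = of_int (fst k) * x + of_int (snd k) * y"

definition freq2 :: "int \<times> int \<Rightarrow> real" where
  "freq2 k = (of_int (fst k))\<^sup>2 + (of_int (snd k))\<^sup>2"

definition fcoeff :: "field3 \<Rightarrow> int \<times> int \<Rightarrow> real \<Rightarrow> complex" where
  "fcoeff f k z =
     (LINT x:{0..2*pi}|lebesgue. LINT y:{0..2*pi}|lebesgue. f x y z * cis (- phase k x y))
       / (4 * pi\<^sup>2)"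

definition fourier_mult :: "(int \<times> int \<Rightarrow> real) \<Rightarrow> field3 \<Rightarrow> field3" where
  "fourier_mult g f = (\<lambda>x y z. \<Sum>\<^sub>\<infinity>k. of_real (g k) * fcoeff f k z * cis (phase k x y))"

definition L2w_norm :: "real \<Rightarrow> (real \<Rightarrow> complex) \<Rightarrow> ennreal" where
  "L2w_norm \<alpha> f = L2_norm (weighted \<alpha> f)"

definition E_norm :: "real \<Rightarrow> real \<Rightarrow> field3 \<Rightarrow> ennreal" where
  "E_norm \<alpha> \<beta> f = (SUP k. ennreal (exp (\<beta> * sqrt (freq2 k))) * L2w_norm \<alpha> (fcoeff f k))"

definition E_space :: "real \<Rightarrow> real \<Rightarrow> field3 set" where
  "E_space \<alpha> \<beta> =
     {f. periodic_xy f \<and> E_norm \<alpha> \<beta> f < \<infinity> \<and>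
         (AE z in lebesgue_on {0<..}. \<forall>x y.
            ((\<lambda>k. fcoeff f k z * cis (phase k x y)) has_sum f x y z) UNIV)}"

text \<open>The norm of \<open>H\<^sup>m(\<T>\<^sup>2; L\<^sup>2\<^sub>\<alpha>)\<close>, for real \<open>m\<close> of either sign, on pairs \<open>(u, v)\<close>.\<close>

definition calH_norm :: "real \<Rightarrow> real \<Rightarrow> field3 \<times> field3 \<Rightarrow> ennreal" where
  "calH_norm \<alpha> m p =
     ennsqrt (\<Sum>\<^sub>\<infinity>k. ennreal ((1 + freq2 k) powr m) *
       ((L2w_norm \<alpha> (fcoeff (fst p) k))\<^sup>2 + (L2w_norm \<alpha> (fcoeff (snd p) k))\<^sup>2))"

subsection \<open>The linearized Prandtl equations\<close>

type_synonym flow = "real \<Rightarrow> field3"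

definition D_t :: "flow \<Rightarrow> flow" where
  "D_t u t x y z = vector_derivative (\<lambda>r. u r x y z) (at t)"
definition D_x :: "flow \<Rightarrow> flow" where
  "D_x u t x y z = vector_derivative (\<lambda>r. u t r y z) (at x)"
definition D_y :: "flow \<Rightarrow> flow" where
  "D_y u t x y z = vector_derivative (\<lambda>r. u t x r z) (at y)"
definition D_z :: "flow \<Rightarrow> flow" where
  "D_z u t x y z = vector_derivative (\<lambda>r. u t x y r) (at z)"

definition cont4 :: "(real \<times> real \<times> real \<times> real) set \<Rightarrow> flow \<Rightarrow> bool" where
  "cont4 Q u \<longleftrightarrow> continuous_on Q (\<lambda>(t, x, y, z). u t x y z)"

definition regular_velocity :: "(real \<times> real \<times> real \<times> real) set \<Rightarrow> flow \<Rightarrow> bool" where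
  "regular_velocity Q u \<longleftrightarrow>
     (\<forall>(t, x, y, z)\<in>Q.
        (\<lambda>r. u r x y z) differentiable (at t) \<and> (\<lambda>r. u t r y z) differentiable (at x) \<and>
        (\<lambda>r. u t x r z) differentiable (at y) \<and> (\<lambda>r. u t x y r) differentiable (at z) \<and>
        (\<lambda>r. D_z u t x y r) differentiable (at z)) \<and>
     cont4 Q (D_t u) \<and> cont4 Q (D_x u) \<and> cont4 Q (D_y u) \<and> cont4 Q (D_z u) \<and> cont4 Q (D_z (D_z u))"

definition regular_normal :: "(real \<times> real \<times> real \<times> real) set \<Rightarrow> flow \<Rightarrow> bool" where
  "regular_normal Q w \<longleftrightarrow>
     (\<forall>(t, x, y, z)\<in>Q. (\<lambda>r. w t x y r) differentiable (at z)) \<and> cont4 Q (D_z w)"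

text \<open>
  \<open>(u, v, w)\<close> is a classical solution on the time interval \<open>s < t < S\<close>. No boundary condition is
  imposed at \<open>t = s\<close>, where the data is merely square integrable in \<open>z\<close>.
\<close>

definition linearized_prandtl ::
  "(real \<Rightarrow> real \<Rightarrow> real) \<Rightarrow> (real \<Rightarrow> real \<Rightarrow> real) \<Rightarrow> real \<Rightarrow> real \<Rightarrow>
   flow \<Rightarrow> flow \<Rightarrow> flow \<Rightarrow> bool" where
  "linearized_prandtl us vs s S u v w \<longleftrightarrow>
     (let Q = {s<..<S} \<times> UNIV \<times> UNIV \<times> {0<..}; Qc = {s<..<S} \<times> UNIV \<times> UNIV \<times> {0..} in
        cont4 Qc u \<and> cont4 Qc v \<and> cont4 Qc w \<and>
        regular_velocity Q u \<and> regular_velocity Q v \<and> regular_normal Q w \<and>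
        (\<forall>(t, x, y, z)\<in>Q.
           D_t u t x y z + (of_real (us t z) * D_x u t x y z + of_real (vs t z) * D_y u t x y z)
             + w t x y z * of_real (deriv (us t) z) - D_z (D_z u) t x y z = 0 \<and>
           D_t v t x y z + (of_real (us t z) * D_x v t x y z + of_real (vs t z) * D_y v t x y z)
             + w t x y z * of_real (deriv (vs t) z) - D_z (D_z v) t x y z = 0 \<and>
           D_x u t x y z + D_y v t x y z + D_z w t x y z = 0) \<and>
        (\<forall>t\<in>{s<..<S}. \<forall>x y.
           u t x y 0 = 0 \<and> v t x y 0 = 0 \<and> w t x y 0 = 0 \<and>
           (u t x y \<longlongrightarrow> 0) at_top \<and> (v t x y \<longlongrightarrow> 0) at_top) \<and>
        (\<forall>t\<in>{s<..<S}. periodic_xy (u t) \<and> periodic_xy (v t) \<and> periodic_xy (w t)))"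

definition modes_continuous :: "real \<Rightarrow> real set \<Rightarrow> flow \<Rightarrow> bool" where
  "modes_continuous \<alpha> I u \<longleftrightarrow>
     (\<forall>t\<in>I. \<forall>k.
        ((\<lambda>r. L2w_norm \<alpha> (\<lambda>z. fcoeff (u r) k z - fcoeff (u t) k z)) \<longlongrightarrow> 0) (at t within I))"

text \<open>
  The Cauchy problem with data \<open>p\<close> at time \<open>s\<close>, in the class \<open>(u, v)(t) \<in> E\<close> of radius
  \<open>\<beta> - \<rho> (t - s)\<close> for all \<open>t \<ge> s\<close> with \<open>\<rho> (t - s) < \<beta>\<close>. Since \<open>modes_continuous\<close> includes
  \<open>t = s\<close>, the data is attained in the weighted \<open>L\<^sup>2\<close> norm.
\<close>

definition prandtl_solution ::
  "real \<Rightarrow> (real \<Rightarrow> real \<Rightarrow> real) \<Rightarrow> (real \<Rightarrow> real \<Rightarrow> real) \<Rightarrow> real \<Rightarrow> real \<Rightarrow> real \<Rightarrow>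
   field3 \<times> field3 \<Rightarrow> flow \<times> flow \<Rightarrow> bool" where
  "prandtl_solution \<alpha> us vs \<rho> \<beta> s = (\<lambda>(u0, v0) (u, v).
     (let I = {s..<s + \<beta> / \<rho>} in
       (\<exists>w. linearized_prandtl us vs s (s + \<beta> / \<rho>) u v w) \<and>
       (\<forall>t\<in>I. u t \<in> E_space \<alpha> (\<beta> - \<rho> * (t - s)) \<and> v t \<in> E_space \<alpha> (\<beta> - \<rho> * (t - s))) \<and>
       modes_continuous \<alpha> I u \<and> modes_continuous \<alpha> I v \<and>
       (\<forall>x y z. 0 < z \<longrightarrow> u s x y z = u0 x y z \<and> v s x y z = v0 x y z)))"

text \<open>
  \<open>\<rho>\<close> is an admissible loss of analyticity: the Cauchy problem is uniquely solvable with loss rate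
  \<open>\<rho>\<close>. Uniqueness is up to the values of the representing functions outside the domain of the
  problem.
\<close>

definition analytic_loss_rate ::
  "real \<Rightarrow> (real \<Rightarrow> real \<Rightarrow> real) \<Rightarrow> (real \<Rightarrow> real \<Rightarrow> real) \<Rightarrow> real \<Rightarrow> bool" where
  "analytic_loss_rate \<alpha> us vs \<rho> \<longleftrightarrow>
     0 < \<rho> \<and>
     (\<forall>s\<ge>0. \<forall>\<beta>>0. \<forall>p \<in> E_space \<alpha> \<beta> \<times> E_space \<alpha> \<beta>.
        (\<exists>q. prandtl_solution \<alpha> us vs \<rho> \<beta> s p q) \<and>
        (\<forall>u v u' v'. prandtl_solution \<alpha> us vs \<rho> \<beta> s p (u, v) \<longrightarrow>
           prandtl_solution \<alpha> us vs \<rho> \<beta> s p (u', v') \<longrightarrow>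
           (\<forall>t\<in>{s..<s + \<beta> / \<rho>}. \<forall>x y z. 0 < z \<longrightarrow>
              u t x y z = u' t x y z \<and> v t x y z = v' t x y z)))"

text \<open>
  The solution operator \<open>T(t, s)\<close> on pairs in \<open>E\<close> of radius \<open>\<beta>\<close>, meaningful for \<open>\<rho> (t - s) < \<beta>\<close>
  when \<open>\<rho>\<close> is an admissible loss rate; the choice is then immaterial for \<open>z > 0\<close>.
\<close>

definition prandtl_op ::
  "real \<Rightarrow> (real \<Rightarrow> real \<Rightarrow> real) \<Rightarrow> (real \<Rightarrow> real \<Rightarrow> real) \<Rightarrow> real \<Rightarrow> real \<Rightarrow> real \<Rightarrow> real \<Rightarrow>
   field3 \<times> field3 \<Rightarrow> field3 \<times> field3" where
  "prandtl_op \<alpha> us vs \<rho> \<beta> t s p =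
     (let q = (SOME q. prandtl_solution \<alpha> us vs \<rho> \<beta> s p q) in (fst q t, snd q t))"

text \<open>
  The multiplier \<open>e^(-c sqrt |\<partial>|)\<close>, where \<open>\<xi> = fst\<close> stands for \<open>\<partial>\<^sub>x\<close> and \<open>\<xi> = snd\<close> for \<open>\<partial>\<^sub>y\<close>.
\<close>

definition tangential_damping ::
  "(int \<times> int \<Rightarrow> int) \<Rightarrow> real \<Rightarrow> field3 \<times> field3 \<Rightarrow> field3 \<times> field3" where
  "tangential_damping \<xi> c =
     map_prod (fourier_mult (\<lambda>k. exp (- c * sqrt \<bar>of_int (\<xi> k)\<bar>)))
              (fourier_mult (\<lambda>k. exp (- c * sqrt \<bar>of_int (\<xi> k)\<bar>)))"

text \<open>
  The condition \<open>calH_norm \<alpha> m1 p \<noteq> 0\<close> says that \<open>p\<close> is not zero as an element of \<open>E\<close>, that is, up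
  to null sets.
\<close>

definition op_norm ::
  "real \<Rightarrow> real \<Rightarrow> real \<Rightarrow> real \<Rightarrow> (field3 \<times> field3 \<Rightarrow> field3 \<times> field3) \<Rightarrow> ennreal" where
  "op_norm \<alpha> \<beta> m1 m2 A =
     (SUP p \<in> {p \<in> E_space \<alpha> \<beta> \<times> E_space \<alpha> \<beta>. calH_norm \<alpha> m1 p \<noteq> 0}.
        calH_norm \<alpha> m2 (A p) / calH_norm \<alpha> m1 p)"

text \<open>
  The radius \<open>\<beta>\<close> of the space over which the norm of \<open>T(t, s)\<close> is computed may depend on \<open>(s, t)\<close>.
\<close>

definition sup_op_norm ::
  "real \<Rightarrow> (real \<Rightarrow> real \<Rightarrow> real) \<Rightarrow> (real \<Rightarrow> real \<Rightarrow> real) \<Rightarrow> real \<Rightarrow> (real \<Rightarrow> real \<Rightarrow> real) \<Rightarrow>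
   (int \<times> int \<Rightarrow> int) \<Rightarrow> real \<Rightarrow> real \<Rightarrow> real \<Rightarrow> real \<Rightarrow> ennreal" where
  "sup_op_norm \<alpha> us vs \<rho> \<beta> \<xi> \<sigma> \<delta> m1 m2 =
     (SUP (s, t) \<in> {(s, t). 0 \<le> s \<and> s \<le> t \<and> t \<le> \<delta>}.
        op_norm \<alpha> (\<beta> s t) m1 m2
          (\<lambda>p. tangential_damping \<xi> (\<sigma> * (t - s)) (prandtl_op \<alpha> us vs \<rho> (\<beta> s t) t s p)))"

end

theory Submission
  imports Defs "HOL-Real_Asymp.Real_Asymp" "HOL-Probability.Distributions"
begin

text \<open>
  Choose integers \<open>(p, q)\<close> such that \<open>U = p u\<^sup>s + q v\<^sup>s\<close> has at \<open>t = 0\<close> a critical point \<open>z0\<close> with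
  \<open>U'' = 2 a > 0\<close>. They exist because the ratio of the two derivatives is not locally constant, so
  it takes rational values. On the Fourier mode \<open>n (p, q)\<close> the combination \<open>\<phi>\<close> of the two velocities
  satisfies \<open>\<phi>\<^sub>t + i n U \<phi> + \<omega> U' = \<phi>''\<close> with \<open>\<omega>' = - i n \<phi>\<close>.

  No unstable solution is constructed. Instead \<open>\<phi>\<close> is tested against \<open>F (U(t,z) - U(t,z0))\<close>, where \<open>F\<close>
  is a truncation of \<open>v \<mapsto> exp (- \<kappa> v)\<close> and \<open>4 a \<kappa>\<^sup>2 = i n\<close>. Near \<open>z0\<close> this is the Gaussian
  \<open>exp (- \<kappa> a (z - z0)\<^sup>2)\<close>, an approximate eigenfunction of the adjoint equation with growth rate
  \<open>Re (2 a \<kappa>) = sqrt (a n / 2)\<close>. The data conjugate to the test function therefore produce this growth up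
  to an error measured by the distance of \<open>U\<close> from a parabola on the region \<open>t \<le> n powr (e - 1/2)\<close>,
  \<open>\<bar>z - z0\<bar> \<le> n powr (e - 1/4)\<close>. A finite operator norm with \<open>\<sigma>\<close> small allows only the rate
  \<open>sqrt (a n / 8)\<close>, at the price of a power of \<open>n\<close>. For a general shear flow the error is nearly
  \<open>n powr (- 1/4)\<close>, which gives the loss of \<open>\<mu> < 1/4\<close> derivatives. If the initial layer is exactly
  quadratic near \<open>z0\<close>, then the heat flow changes it there only by \<open>exp (- c / t)\<close>, the error
  decays faster than any power of \<open>n\<close>, and no finite loss of derivatives suffices.
\<close>

section \<open>Smooth functions on the line\<close>

text \<open>The obstacle is the nonlocal term \<open>\<omega> U'\<close>: integration by parts
  against a general test function leaves an uncontrolled antiderivative. For a test function F(V)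
  with V = U - U(z0), however, U' F(V) is the z-derivative of P(V), P' = F, so the term becomes a
  multiplication of \<open>\<phi>\<close> by P(V). For an exact parabola U'^2 = 4 a V, and then
  exp(- \<kappa> V) solves the adjoint problem precisely because 4 a \<kappa>^2 = i n.

  The estimate runs backwards in time. The pairing divided by its expected growth is almost
  constant, and a finite operator norm makes it small at the final time. It would then be small at
  time 0, where conjugate data turn it into a squared L2 norm.

  The exponent e > 0 enlarges the natural scales n^(-1/2) in time and n^(-1/4) in space by a small
  power. Up to constants in the exponents, the growth gap exp(n^e) and the truncation error exp(-
  n^(2e)) then beat every power of n, and only the deviation from the parabola decides which loss of
  derivatives is excluded. Integers p and q are forced by the torus, whose Fourier modes form a
  lattice.\<close>

definition smooth_fun :: "(real \<Rightarrow> real) \<Rightarrow> bool" where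
  "smooth_fun f \<longleftrightarrow> (\<forall>k x. ((deriv ^^ k) f) differentiable (at x))"

text \<open>A coinduction principle: by uniqueness of derivatives every iterated
  \<open>deriv\<close> of \<open>f\<close> stays in \<open>S\<close>. Smoothness is thus shown by
  exhibiting a family closed under differentiation, with no formula for the k-th derivative.\<close>

lemma smooth_funI:
  assumes "f \<in> S" and "\<And>g. g \<in> S \<Longrightarrow> \<exists>g'\<in>S. \<forall>x. (g has_real_derivative g' x) (at x)"
  shows "smooth_fun f"
proof -
  have "(deriv ^^ k) f \<in> S" for k
  proof (induction k)
    case (Suc k)
    then obtain g' where g': "g' \<in> S" "\<forall>x. ((deriv ^^ k) f has_real_derivative g' x) (at x)"
      using assms(2) by blast
    then have "deriv ((deriv ^^ k) f) = g'" by (auto intro!: ext DERIV_imp_deriv)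
    then show ?case using g' by simp
  qed (use assms in simp)
  then show ?thesis unfolding smooth_fun_def
    using assms(2) real_differentiable_def by blast
qed

lemma smooth_fun_has_deriv:
  assumes "smooth_fun f"
  shows "((deriv ^^ k) f has_real_derivative (deriv ^^ Suc k) f x) (at x)"
  using assms unfolding smooth_fun_def
  by (simp add: DERIV_deriv_iff_real_differentiable)

lemma smooth_fun_deriv: "smooth_fun f \<Longrightarrow> smooth_fun (deriv f)"
  unfolding smooth_fun_def by (metis funpow_Suc_right comp_apply)

lemma smooth_fun_cont: "smooth_fun f \<Longrightarrow> continuous_on A ((deriv ^^ k) f)"
  using smooth_fun_has_deriv[of f k]
  by (metis DERIV_isCont continuous_at_imp_continuous_on)

lemma smooth_fun_chain:
  assumes "D 0 = f" "\<And>k x. (D k has_real_derivative D (Suc k) x) (at x)"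
  shows "smooth_fun f"
  using assms by (intro smooth_funI[of f "range D"]) auto

lemma smooth_fun_primitive:
  assumes "\<And>x. (f has_real_derivative g x) (at x)" "smooth_fun g"
  shows "smooth_fun f"
  by (rule smooth_fun_chain[of "\<lambda>k. case k of 0 \<Rightarrow> f | Suc j \<Rightarrow> (deriv ^^ j) g"])
     (use assms smooth_fun_has_deriv in \<open>auto split: nat.split\<close>)

text \<open>Single products are not closed under differentiation, finite sums of them are; this
  replaces the Leibniz formula.\<close>

inductive_set prod_span :: "(real \<Rightarrow> real) set \<Rightarrow> (real \<Rightarrow> real) set \<Rightarrow> (real \<Rightarrow> real) set"
  for A B where
  prod: "f \<in> A \<Longrightarrow> g \<in> B \<Longrightarrow> (\<lambda>x. f x * g x) \<in> prod_span A B"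
| add: "f \<in> prod_span A B \<Longrightarrow> g \<in> prod_span A B \<Longrightarrow> (\<lambda>x. f x + g x) \<in> prod_span A B"

lemma smooth_fun_mult:
  assumes "smooth_fun f" "smooth_fun g"
  shows "smooth_fun (\<lambda>x. f x * g x)"
proof (rule smooth_funI)
  let ?A = "{f. smooth_fun f}"
  show "(\<lambda>x. f x * g x) \<in> prod_span ?A ?A" using assms by (auto intro: prod_span.intros)
  fix h assume "h \<in> prod_span ?A ?A"
  then show "\<exists>g'\<in>prod_span ?A ?A. \<forall>x. (h has_real_derivative g' x) (at x)"
  proof induction
    case (prod f g)
    then have d: "(f has_real_derivative deriv f x) (at x)" "(g has_real_derivative deriv g x) (at x)" for x
      using smooth_fun_has_deriv[of f 0 x] smooth_fun_has_deriv[of g 0 x] by auto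
    have "(\<lambda>x. deriv f x * g x + f x * deriv g x) \<in> prod_span ?A ?A"
      using prod by (intro prod_span.intros) (auto intro: smooth_fun_deriv)
    moreover have "((\<lambda>x. f x * g x) has_real_derivative deriv f x * g x + f x * deriv g x) (at x)" for x
      using d[of x] by (auto intro!: derivative_eq_intros)
    ultimately show ?case by (auto intro!: bexI[of _ "\<lambda>x. deriv f x * g x + f x * deriv g x"])
  next
    case (add f g)
    then obtain f' g' where "f' \<in> prod_span ?A ?A" "g' \<in> prod_span ?A ?A"
      "\<And>x. (f has_real_derivative f' x) (at x)" "\<And>x. (g has_real_derivative g' x) (at x)" by blast
    then show ?case
      by (intro bexI[of _ "\<lambda>x. f' x + g' x"]) (auto intro!: derivative_intros prod_span.intros)
  qed
qed

lemma smooth_fun_const: "smooth_fun (\<lambda>x. c)"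
  by (rule smooth_funI[of _ "range (\<lambda>c x. c)"]) (auto intro: exI[of _ 0])

lemma smooth_fun_add:
  assumes "smooth_fun f" "smooth_fun g" shows "smooth_fun (\<lambda>x. f x + g x)"
  using assms
  by (intro smooth_fun_chain[of "\<lambda>k x. (deriv ^^ k) f x + (deriv ^^ k) g x"])
     (auto intro!: derivative_intros smooth_fun_has_deriv simp del: funpow.simps simp: funpow_0)

lemma smooth_fun_affine:
  assumes "smooth_fun f" shows "smooth_fun (\<lambda>x. f (a * x + b))"
    and "(deriv ^^ k) (\<lambda>x. f (a * x + b)) = (\<lambda>x. a ^ k * (deriv ^^ k) f (a * x + b))"
proof -
  let ?D = "\<lambda>k x. a ^ k * (deriv ^^ k) f (a * x + b)"
  have D: "(?D k has_real_derivative ?D (Suc k) x) (at x)" for k x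
    using smooth_fun_has_deriv[OF assms, of k "a * x + b"]
    by (auto intro!: derivative_eq_intros DERIV_chain2[where f = "(deriv ^^ k) f"] simp del: funpow.simps)
  show "smooth_fun (\<lambda>x. f (a * x + b))"
    by (rule smooth_fun_chain[of ?D]) (use D in auto)
  show "(deriv ^^ k) (\<lambda>x. f (a * x + b)) = ?D k"
  proof (induction k)
    case (Suc k)
    then show ?case using D[of k] by (auto intro!: ext DERIV_imp_deriv)
  qed auto
qed

lemma smooth_fun_cmult: "smooth_fun f \<Longrightarrow> smooth_fun (\<lambda>x. c * f x)"
  using smooth_fun_mult[OF smooth_fun_const] .

lemma deriv_iter_cmult:
  assumes "smooth_fun f"
  shows "(deriv ^^ k) (\<lambda>x. c * f x) = (\<lambda>x. c * (deriv ^^ k) f x)"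
proof (induction k)
  case (Suc k)
  have "((\<lambda>x. c * (deriv ^^ k) f x) has_real_derivative c * (deriv ^^ Suc k) f x) (at x)" for x
    by (intro DERIV_cmult smooth_fun_has_deriv assms)
  then show ?case using Suc by (auto intro!: ext DERIV_imp_deriv)
qed auto

lemma smooth_fun_diff:
  "smooth_fun f \<Longrightarrow> smooth_fun g \<Longrightarrow> smooth_fun (\<lambda>x. f x - g x)"
  using smooth_fun_add[of f "\<lambda>x. (-1) * g x"] smooth_fun_cmult[of g "-1"] by simp

lemma deriv_iter_eq_0:
  assumes "open A" "\<And>x. x \<in> A \<Longrightarrow> f x = c" "x \<in> A" "0 < k"
  shows "(deriv ^^ k) f x = (0::real)"
proof -
  have "\<forall>x\<in>A. (deriv ^^ Suc j) f x = 0" for j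
  proof (induction j)
    case 0
    have "(f has_real_derivative 0) (at x)" if "x \<in> A" for x
      by (rule has_field_derivative_transform_within_open[OF DERIV_const assms(1) that])
         (use assms(2) in auto)
    then show ?case by (auto intro: DERIV_imp_deriv)
  next
    case (Suc j)
    have "((deriv ^^ Suc j) f has_real_derivative 0) (at x)" if "x \<in> A" for x
      by (rule has_field_derivative_transform_within_open[OF DERIV_const assms(1) that])
         (use Suc in auto)
    then show ?case by (auto intro: DERIV_imp_deriv)
  qed
  then show ?thesis using assms gr0_implies_Suc[OF \<open>0 < k\<close>] by blast
qed

section \<open>Flat exponentials, bumps and smooth steps\<close>

definition flat_exp :: "real poly \<Rightarrow> real \<Rightarrow> real" where
  "flat_exp p x = (if x \<le> 0 then 0 else poly p (1 / x) * exp (- (1 / x)))"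

lemma poly_times_exp_minus_tendsto_0:
  assumes "0 < c"
  shows "((\<lambda>y. poly p y * exp (- (c * y))) \<longlongrightarrow> (0::real)) at_top"
  using assms
proof (induction p arbitrary: c)
  case (pCons a p)
  have 1: "((\<lambda>y::real. a * exp (-(c*y))) \<longlongrightarrow> 0) at_top" using pCons.prems by real_asymp
  have 2: "((\<lambda>y::real. y * exp (- (c/2*y))) \<longlongrightarrow> 0) at_top" using pCons.prems by real_asymp
  have 3: "((\<lambda>y::real. poly p y * exp (- (c/2*y))) \<longlongrightarrow> 0) at_top"
    using pCons(2)[of "c/2"] pCons.prems by simp
  have "poly (pCons a p) y * exp (-(c*y)) = a * exp (-(c*y)) +
      (y * exp (- (c/2*y))) * (poly p y * exp (- (c/2*y)))" for y
  proof -
    have "exp (- (c * y)) = exp (- (c/2*y)) * exp (- (c/2*y))"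
      by (simp flip: exp_add)
    then show ?thesis unfolding poly_pCons by algebra
  qed
  then show ?case using tendsto_add[OF 1 tendsto_mult[OF 2 3]] by simp
qed auto

text \<open>With y = 1/x, differentiation in x is - y^2 d/dy, which sends p(y) exp(- y) to y^2 (p -
  p')(y) exp(- y); hence the new polynomial and the closure of the family. At the origin the
  difference quotient is of the same form, with p replaced by \<open>pCons 0 p\<close>, and tends to
  0.\<close>

lemma flat_exp_deriv:
  "(flat_exp p has_real_derivative flat_exp (monom 1 2 * (p - pderiv p)) x) (at x)"
proof -
  consider "x < 0" | "x > 0" | "x = 0" by linarith
  then show ?thesis
  proof cases
    case 1
    have "(flat_exp p has_real_derivative 0) (at x)"
      by (rule has_field_derivative_transform_within_open[OF DERIV_const, of "{..<0}" x 0])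
         (use 1 in \<open>auto simp: flat_exp_def\<close>)
    then show ?thesis using 1 by (simp add: flat_exp_def)
  next
    case 2
    have "((\<lambda>x. poly p (1 / x) * exp (- (1 / x))) has_real_derivative
       flat_exp (monom 1 2 * (p - pderiv p)) x) (at x)"
      using 2 unfolding flat_exp_def
      by (auto intro!: derivative_eq_intros DERIV_chain2[OF poly_DERIV]
          simp: poly_monom field_simps power2_eq_square)
    then show ?thesis
      by (rule has_field_derivative_transform_within_open[of _ _ _ "{0<..}"])
         (use 2 in \<open>auto simp: flat_exp_def\<close>)
  next
    case 3
    have l: "((\<lambda>h. flat_exp p h / h) \<longlongrightarrow> 0) (at_left 0)"
      by (rule tendsto_eventually) (auto simp: eventually_at_filter flat_exp_def)
    have "((\<lambda>h. poly (pCons 0 p) (inverse h) * exp (- (1 * inverse h))) \<longlongrightarrow> 0) (at_right 0)"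
      by (rule filterlim_compose[OF poly_times_exp_minus_tendsto_0 filterlim_inverse_at_top_right]) simp
    then have r: "((\<lambda>h. flat_exp p h / h) \<longlongrightarrow> 0) (at_right 0)"
      by (rule Lim_transform_eventually)
         (auto simp: eventually_at_filter flat_exp_def field_simps)
    have "((\<lambda>h. flat_exp p h / h) \<longlongrightarrow> 0) (at 0)"
      using l r by (simp add: filterlim_split_at)
    then have "(flat_exp p has_real_derivative 0) (at 0)"
      by (simp add: has_field_derivative_iff) (simp add: flat_exp_def)
    then show ?thesis using 3 by (simp add: flat_exp_def)
  qed
qed

lemma smooth_flat_exp: "smooth_fun (flat_exp p)"
  by (rule smooth_funI[of _ "range flat_exp"]) (use flat_exp_deriv in auto)

lemma smooth_bump_exists:
  "\<exists>b. smooth_fun b \<and> (\<forall>x. 0 \<le> b x) \<and> (\<forall>x. x \<notin> {0<..<1} \<longrightarrow> b x = 0) \<and> (b has_integral 1) {0..1}"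
proof -
  let ?b = "\<lambda>x. flat_exp 1 x * flat_exp 1 (1 - x)"
  have sm: "smooth_fun ?b"
    using smooth_fun_mult[OF smooth_flat_exp smooth_fun_affine(1)[OF smooth_flat_exp, of 1 "-1" 1], of 1] by simp
  have nn: "0 \<le> ?b x" for x by (simp add: flat_exp_def)
  have out: "?b x = 0" if "x \<notin> {0<..<1}" for x using that by (auto simp: flat_exp_def)
  have c: "continuous_on {0..1} ?b" using smooth_fun_cont[OF sm, of _ 0] by simp
  have int: "?b integrable_on {0..1}" by (rule integrable_continuous_real[OF c])
  have "integral {0..1} ?b \<noteq> 0"
  proof
    assume "integral {0..1} ?b = 0"
    then have "(?b has_integral 0) (cbox 0 1)" using int by (metis cbox_interval integrable_integral)
    then have "?b (1/2) = 0"
      by (rule has_integral_0_cbox_imp_0[rotated 2]) (use c nn in auto)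
    then show False by (simp add: flat_exp_def)
  qed
  moreover have "integral {0..1} ?b \<ge> 0" by (rule integral_nonneg[OF int]) (use nn in auto)
  ultimately have pos: "integral {0..1} ?b > 0" by simp
  have "((\<lambda>x. inverse (integral {0..1} ?b) * ?b x) has_integral inverse (integral {0..1} ?b) * integral {0..1} ?b) {0..1}"
    using int by (intro has_integral_mult_right integrable_integral)
  then show ?thesis
    using sm nn out pos
    by (intro exI[of _ "\<lambda>x. inverse (integral {0..1} ?b) * ?b x"]) (auto intro: smooth_fun_cmult)
qed

text \<open>Used in three roles: its derivative is a mollifier kernel of mass 1, its rescalings
  truncate the test function, and two affine copies glue a quadratic profile to its constant
  limits.\<close>

lemma smooth_step_exists:
  "\<exists>S. smooth_fun S \<and> (\<forall>x. x \<le> 0 \<longrightarrow> S x = 0) \<and> (\<forall>x. 1 \<le> x \<longrightarrow> S x = 1) \<and>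
    (\<forall>x. 0 \<le> deriv S x)"
proof -
  obtain b where b: "smooth_fun b" "\<And>x. 0 \<le> b x" "\<And>x. x \<notin> {0<..<1} \<Longrightarrow> b x = 0" "(b has_integral 1) {0..1}"
    using smooth_bump_exists by blast
  \<comment> \<open>Starting the integral at -1 makes 0 an interior point, so that the derivative is
    two-sided at every x \<ge> 0.\<close>
  define S where "S x = integral {-1..x} b" for x
  have c: "continuous_on A b" for A using smooth_fun_cont[OF b(1), of A 0] by simp
  have int: "b integrable_on {x..y}" for x y by (rule integrable_continuous_real[OF c])
  have S0: "S x = 0" if "x \<le> 0" for x
    unfolding S_def using that b(3) by (subst integral_cong[of _ b "\<lambda>_. 0"]) auto
  have "S x = 1" if "1 \<le> x" for x
  proof -
    have "integral {-1..0} b + integral {0..x} b = S x"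
      unfolding S_def by (rule Henstock_Kurzweil_Integration.integral_combine) (use that int in auto)
    moreover have "integral {0..1} b + integral {1..x} b = integral {0..x} b"
      by (rule Henstock_Kurzweil_Integration.integral_combine) (use that int in auto)
    moreover have "integral {1..x} b = 0"
      using b(3) by (subst integral_cong[of _ b "\<lambda>_. 0"]) auto
    moreover have "integral {0..1} b = 1" using b(4) by (rule integral_unique)
    moreover have "integral {-1..0} b = 0" using S0[of 0] by (simp add: S_def)
    ultimately show ?thesis by simp
  qed
  moreover have der: "(S has_real_derivative b x) (at x)" for x
  proof (cases "x < 0")
    case True
    have "(S has_real_derivative 0) (at x)"
      by (rule has_field_derivative_transform_within_open[OF DERIV_const, of "{..<0}" x 0])
         (use True S0 in auto)
    then show ?thesis using b(3)[of x] True by simp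
  next
    case False
    have "(S has_vector_derivative b x) (at x within {-1..x+1})"
      unfolding S_def[abs_def] by (rule integral_has_vector_derivative[OF c]) (use False in auto)
    then show ?thesis
      using False by (simp add: has_real_derivative_iff_has_vector_derivative at_within_Icc_at)
  qed
  moreover have "deriv S x = b x" for x using der[of x] by (rule DERIV_imp_deriv)
  moreover have "smooth_fun S" using der b(1) by (rule smooth_fun_primitive)
  ultimately show ?thesis using S0 b(2) by (intro exI[of _ S]) simp
qed

section \<open>Weak derivatives\<close>

text \<open>A uniform bound on the second derivatives puts the difference quotient of
  \<open>F j\<close> within \<open>M * \<bar>h\<bar>\<close> of \<open>G j z\<close>, uniformly in
  j. Convergence of \<open>F j\<close> at the two points z and z + h then makes \<open>G j z\<close>
  a Cauchy sequence, and the same estimate in the limit identifies its limit as the derivative of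
  f.\<close>

lemma DERIV_limit_of_bounded_second_deriv:
  fixes F G H :: "nat \<Rightarrow> real \<Rightarrow> real"
  assumes F: "\<And>j x. x \<in> {a<..<b} \<Longrightarrow> (F j has_real_derivative G j x) (at x)"
    and G: "\<And>j x. x \<in> {a<..<b} \<Longrightarrow> (G j has_real_derivative H j x) (at x)"
    and H: "\<And>j x. x \<in> {a<..<b} \<Longrightarrow> \<bar>H j x\<bar> \<le> M"
    and lim: "\<And>x. x \<in> {a<..<b} \<Longrightarrow> (\<lambda>j. F j x) \<longlonglongrightarrow> f x"
    and z: "z \<in> {a<..<b}"
  obtains g where "(\<lambda>j. G j z) \<longlonglongrightarrow> g" "(f has_real_derivative g) (at z)"
proof -
  define d where "d = min (z - a) (b - z) / 2"
  have d: "d > 0" using z by (auto simp: d_def)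
  have in_ab: "z + h \<in> {a<..<b}" if "\<bar>h\<bar> \<le> d" for h
    using that z by (auto simp: d_def)
  have M0: "M \<ge> 0" using H[OF z, of 0] by linarith
  have Glip: "\<bar>G j x - G j z\<bar> \<le> M * \<bar>x - z\<bar>" if "x \<in> {a<..<b}" for j x
    using field_differentiable_bound[of "{a<..<b}" "G j" "H j" M x z] G H that z
    by (auto intro: has_field_derivative_at_within)
  have quot: "\<bar>(F j (z + h) - F j z) / h - G j z\<bar> \<le> M * \<bar>h\<bar>" if h: "\<bar>h\<bar> \<le> d" "h \<noteq> 0" for j h
  proof -
    have I: "min z (z+h) > a" "max z (z+h) < b" using in_ab[OF h(1)] z by auto
    have "\<exists>x>min z (z+h). x < max z (z+h) \<and>
       F j (max z (z+h)) - F j (min z (z+h)) = (max z (z+h) - min z (z+h)) * G j x"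
      by (rule MVT2) (use I h(2) in \<open>auto intro!: F simp: min_def max_def split: if_splits\<close>)
    then obtain x where x: "x > min z (z+h)" "x < max z (z+h)"
       "F j (max z (z+h)) - F j (min z (z+h)) = (max z (z+h) - min z (z+h)) * G j x" by blast
    have "F j (z+h) - F j z = h * G j x"
      using x(3) h(2) by (cases "h > 0") (auto simp: min_def max_def algebra_simps)
    then have "(F j (z + h) - F j z) / h - G j z = G j x - G j z" using h(2) by simp
    also have "\<bar>\<dots>\<bar> \<le> M * \<bar>x - z\<bar>" 
      using x(1,2) I by (intro Glip) (auto simp: min_def max_def split: if_splits)
    also have "\<dots> \<le> M * \<bar>h\<bar>" 
      using M0 x(1,2) by (intro mult_left_mono) (auto simp: min_def max_def split: if_splits)
    finally show ?thesis .
  qed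
  have "Cauchy (\<lambda>j. G j z)"
  proof (rule metric_CauchyI)
    fix e :: real assume e: "e > 0"
    \<comment> \<open>\<open>M + 1\<close> avoids a division by zero when \<open>M = 0\<close>. The
      three errors, two quotients and one Cauchy gap, are at most e / 4 each.\<close>
    define h where "h = min d (e / (4 * (M + 1)))"
    have h: "h > 0" "\<bar>h\<bar> \<le> d" "M * h \<le> e / 4"
    proof -
      show "h > 0" "\<bar>h\<bar> \<le> d" using d e M0 by (auto simp: h_def)
      have "M * h \<le> M * (e / (4 * (M+1)))" using M0 by (intro mult_left_mono) (auto simp: h_def)
      also have "\<dots> \<le> e / 4" using M0 e by (simp add: field_simps)
      finally show "M * h \<le> e / 4" .
    qed
    have "(\<lambda>j. (F j (z + h) - F j z) / h) \<longlonglongrightarrow> (f (z + h) - f z) / h"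
      using h z in_ab[OF h(2)] by (intro tendsto_intros lim) auto
    then have C: "Cauchy (\<lambda>j. (F j (z + h) - F j z) / h)" by (rule LIMSEQ_imp_Cauchy)
    obtain N where N: "\<And>m n. m \<ge> N \<Longrightarrow> n \<ge> N \<Longrightarrow>
       dist ((F m (z + h) - F m z) / h) ((F n (z + h) - F n z) / h) < e / 4"
      using metric_CauchyD[OF C, of "e / 4"] e by auto
    show "\<exists>N. \<forall>m\<ge>N. \<forall>n\<ge>N. dist (G m z) (G n z) < e"
    proof (intro exI allI impI)
      fix m n assume "N \<le> m" "N \<le> n"
      have q: "\<bar>(F j (z + h) - F j z) / h - G j z\<bar> \<le> e / 4" for j
        using quot[OF h(2), of j] h(1,3) by simp
      from N[OF \<open>N \<le> m\<close> \<open>N \<le> n\<close>] q[of m] q[of n] e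
      show "dist (G m z) (G n z) < e" unfolding dist_real_def by linarith
    qed
  qed
  then obtain g where g: "(\<lambda>j. G j z) \<longlonglongrightarrow> g" using Cauchy_convergent_iff convergent_def by blast
  have "\<bar>(f (z + h) - f z) / h - g\<bar> \<le> M * \<bar>h\<bar>" if h: "\<bar>h\<bar> \<le> d" "h \<noteq> 0" for h
  proof -
    have "(\<lambda>j. \<bar>(F j (z + h) - F j z) / h - G j z\<bar>) \<longlonglongrightarrow> \<bar>(f (z + h) - f z) / h - g\<bar>"
      using h z in_ab[OF h(1)] by (intro tendsto_intros lim g) auto
    then show ?thesis by (rule Lim_bounded) (use quot[OF h] in auto)
  qed
  then have ev: "\<forall>\<^sub>F h in at 0. norm ((f (z + h) - f z) / h - g) \<le> M * \<bar>h\<bar>"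
    using d by (auto simp: eventually_at intro!: exI[of _ d])
  have "((\<lambda>h. M * \<bar>h\<bar>) \<longlongrightarrow> 0) (at 0)" by (auto intro!: tendsto_eq_intros)
  from Lim_null_comparison[OF ev this]
  have "((\<lambda>h. (f (z + h) - f z) / h) \<longlongrightarrow> g) (at 0)" by (simp add: LIM_zero_iff)
  then have "(f has_real_derivative g) (at z)" by (simp add: DERIV_def)
  with g that show ?thesis by blast
qed

text \<open>Proved by mollification. The k-th derivative of the mollified function is the k-th weak
  derivative averaged by a probability kernel, hence bounded by M. Each passage to the limit
  consumes a bound two orders higher, so the derivatives up to order m - 1 become classical and the
  last of them is Lipschitz.\<close>

lemma weak_deriv_imp_classical:
  fixes f :: "real \<Rightarrow> real"
  assumes cont: "continuous_on {0<..} f"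
    and weak: "\<And>k. k \<le> m \<Longrightarrow> weak_deriv k f (D k)"
    and bound: "\<And>k. k \<le> m \<Longrightarrow> AE z in lebesgue_on {0<..}. \<bar>D k z\<bar> \<le> M"
    and M: "0 \<le> M" and k: "k < m"
  shows "0 < z \<Longrightarrow> Suc k < m \<Longrightarrow> ((deriv ^^ k) f has_real_derivative (deriv ^^ Suc k) f z) (at z)"
    and "0 < z \<Longrightarrow> \<bar>(deriv ^^ k) f z\<bar> \<le> M"
    and "0 < z \<Longrightarrow> 0 < y \<Longrightarrow> \<bar>(deriv ^^ k) f z - (deriv ^^ k) f y\<bar> \<le> M * \<bar>z - y\<bar>"
proof -
  obtain S where S: "smooth_fun S" "\<And>x. x \<le> 0 \<Longrightarrow> S x = 0" "\<And>x. 1 \<le> x \<Longrightarrow> S x = 1" "\<And>x. 0 \<le> deriv S x"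
    using smooth_step_exists by blast
  define b where "b = deriv S"
  have b: "smooth_fun b" unfolding b_def using S(1) by (rule smooth_fun_deriv)
  have Sd: "(S has_real_derivative b x) (at x)" for x
    using smooth_fun_has_deriv[OF S(1), of 0] by (simp add: b_def)
  have b_out: "(deriv ^^ k) b x = 0" if "x \<notin> {0..1}" for k x
  proof -
    have "(deriv ^^ Suc k) S x = 0"
      using that deriv_iter_eq_0[of "{..<0}" S 0 x "Suc k"] deriv_iter_eq_0[of "{1<..}" S 1 x "Suc k"] S(2,3)
      by (cases "x < 0") auto
    then show ?thesis unfolding b_def by (simp add: funpow_swap1)
  qed
  have local: "(\<forall>k<m. \<forall>z\<in>{a<..<R}. (Suc k < m \<longrightarrow> ((deriv ^^ k) f has_real_derivative (deriv ^^ Suc k) f z) (at z))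
      \<and> \<bar>(deriv ^^ k) f z\<bar> \<le> M \<and> (\<forall>y\<in>{a<..<R}. \<bar>(deriv ^^ k) f z - (deriv ^^ k) f y\<bar> \<le> M * \<bar>z - y\<bar>))"
    if a: "0 < a" for a R
  proof -
    \<comment> \<open>The mollification length stays below a, which keeps the window
      \<open>{a - e j..R}\<close> inside the open half-line.\<close>
    define e where "e j = a / (real j + 2)" for j
    have e: "0 < e j" "e j < a" for j using a by (auto simp: e_def field_simps add_pos_nonneg)
    have e0: "e \<longlonglongrightarrow> 0" unfolding e_def by real_asymp
    \<comment> \<open>The k-th derivative in z of the rescaled kernel. As \<open>b\<close> lives on
      [0, 1], only the values of f on \<open>{z - e j..z}\<close> enter.\<close>
    define K where "K j k z y = (1 / e j) ^ (k + 1) * (deriv ^^ k) b ((z - y) / e j)" for j k z y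
    define G where "G j k z = integral {a - e j..R} (\<lambda>y. f y * K j k z y)" for j k z
    have K_out: "K j k z y = 0" if "z \<in> {a<..<R}" "y \<notin> {a - e j..R}" for j k z y
      unfolding K_def using that e[of j] by (subst b_out) (auto simp: field_simps)
    have contb: "continuous_on X ((deriv ^^ k) b)" for X k by (rule smooth_fun_cont[OF b])
    have contK: "continuous_on X (\<lambda>y. K j k z y)" for X j k z
      unfolding K_def using e[of j]
      by (intro continuous_intros continuous_on_compose2[OF contb[of UNIV]]) auto
    have contf: "continuous_on {a - e j..R} f" for j
      by (rule continuous_on_subset[OF cont]) (use e[of j] in auto)
    have fK: "continuous_on {a - e j..R} (\<lambda>y. f y * K j k z y)" for j k z
      by (intro continuous_intros contf contK)
    have dG: "(G j k has_real_derivative G j (Suc k) z) (at z)" if z: "z \<in> {a<..<R}" for j k z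
    proof -
      have "((\<lambda>z. integral (cbox (a - e j) R) (\<lambda>y. f y * K j k z y)) has_field_derivative
          integral (cbox (a - e j) R) (\<lambda>y. f y * K j (Suc k) z y)) (at z within {a<..<R})"
      proof (rule leibniz_rule_field_derivative[where U = "{a<..<R}"])
        show "(\<lambda>y. f y * K j k z y) integrable_on cbox (a - e j) R" for z
          using integrable_continuous_real[OF fK] by simp
        show "((\<lambda>z. f y * K j k z y) has_field_derivative f y * K j (Suc k) z y) (at z within {a<..<R})" for z y
          unfolding K_def using e(1)[of j] smooth_fun_has_deriv[OF b, of k "(z-y)/e j"]
          by (auto intro!: derivative_eq_intros DERIV_chain2[where f = "(deriv ^^ k) b"] simp: field_simps)
        have "continuous_on ({a<..<R} \<times> cbox (a - e j) R) (\<lambda>x. f (snd x) * K j (Suc k) (fst x) (snd x))"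
          unfolding K_def using e(1)[of j] contf[of j]
          by (intro continuous_intros continuous_on_compose2[OF contb[of UNIV]] continuous_on_compose2[OF contf[of j]]) auto
        then show "continuous_on ({a<..<R} \<times> cbox (a - e j) R) (\<lambda>(z, y). f y * K j (Suc k) z y)"
          by (simp add: case_prod_unfold)
      qed (use z in auto)
      moreover have "at z within {a<..<R} = at z" by (rule at_within_open[OF z]) simp
      ultimately show ?thesis unfolding G_def[abs_def] by (simp only: cbox_interval)
    qed
    have K0_nonneg: "K j 0 z y \<ge> 0" for j z y unfolding K_def using e(1)[of j] S(4) by (simp add: b_def)
    have K0_int: "((\<lambda>y. K j 0 z y) has_integral 1) {a - e j..R}" if z: "z \<in> {a<..<R}" for j z
    proof -
      have "((\<lambda>y. K j 0 z y) has_integral (- S ((z - R) / e j)) - (- S ((z - (a - e j)) / e j))) {a - e j..R}"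
      proof (rule fundamental_theorem_of_calculus)
        fix y
        show "((\<lambda>y. - S ((z - y) / e j)) has_vector_derivative K j 0 z y) (at y within {a - e j..R})"
          unfolding K_def has_real_derivative_iff_has_vector_derivative[symmetric]
          using e(1)[of j] by (auto intro!: derivative_eq_intros DERIV_chain2[OF Sd] simp: field_simps)
      qed (use z e(1)[of j] in auto)
      moreover have "S ((z - R) / e j) = 0" using z e(1)[of j] by (intro S(2)) (auto simp: field_simps)
      moreover have "S ((z - (a - e j)) / e j) = 1" using z e(1)[of j] by (intro S(3)) (auto simp: field_simps)
      ultimately show ?thesis by simp
    qed
    \<comment> \<open>As a function of y the kernel is a test function, and k derivatives in y give
      \<open>(-1) ^ k\<close> times k derivatives in z. This sign cancels the one in the definition
      of \<open>weak_deriv\<close>.\<close>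
    have GM: "\<bar>G j k z\<bar> \<le> M" if z: "z \<in> {a<..<R}" and k: "k \<le> m" for j k z
    proof -
      let ?phi = "\<lambda>y. (1 / e j) * b ((- 1 / e j) * y + z / e j)"
      have sm: "smooth_fun ?phi" by (intro smooth_fun_cmult smooth_fun_affine b)
      have phi: "?phi y = K j 0 z y" for y unfolding K_def by (simp add: diff_divide_distrib)
      have dphi: "(deriv ^^ k) ?phi y = (- 1) ^ k * K j k z y" for y
      proof -
        have arg: "(- 1 / e j) * y + z / e j = (z - y) / e j" by (simp add: diff_divide_distrib)
        have pow: "(- 1 / e j) ^ k = (- 1) ^ k * (1 / e j) ^ k" by (simp flip: power_mult_distrib)
        show ?thesis
          unfolding deriv_iter_cmult[OF smooth_fun_affine(1)[OF b]] smooth_fun_affine(2)[OF b] arg pow K_def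
          by simp
      qed
      have test: "test_function ?phi"
      proof -
        have "0 < a - e j \<and> a - e j < R \<and> (\<forall>y. y \<notin> {a - e j..R} \<longrightarrow> ?phi y = 0)"
          using e[of j] z K_out[OF z, of _ j 0] unfolding phi by auto
        then show ?thesis
          using sm unfolding test_function_def smooth_fun_def by blast
      qed
      from weak[OF k] test have
        eq: "(LINT y:{0<..}|lebesgue. f y * (deriv ^^ k) ?phi y) = (-1) ^ k * (LINT y:{0<..}|lebesgue. D k y * ?phi y)"
        unfolding weak_deriv_def by blast
      have "(LINT y:{0<..}|lebesgue. f y * (deriv ^^ k) ?phi y) = (-1) ^ k * (LINT y:{a - e j..R}|lebesgue. f y * K j k z y)"
      proof -
        have "indicat_real {0<..} y *\<^sub>R (f y * (deriv ^^ k) ?phi y) =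
          (-1) ^ k * (indicat_real {a - e j..R} y *\<^sub>R (f y * K j k z y))" for y
          unfolding dphi using K_out[OF z, of y j k] e[of j] by (cases "y \<in> {a - e j..R}") auto
        then show ?thesis unfolding set_lebesgue_integral_def by (simp only: integral_mult_right_zero)
      qed
      also have "(LINT y:{a - e j..R}|lebesgue. f y * K j k z y) = G j k z"
        unfolding G_def by (rule set_lebesgue_integral_eq_integral(2)) (rule absolutely_integrable_continuous_real[OF fK])
      finally have "G j k z = (LINT y:{0<..}|lebesgue. D k y * ?phi y)"
        using eq by (metis (no_types, lifting) mult_left_cancel power_eq_0_iff neg_equal_0_iff_equal zero_neq_one)
      then have "\<bar>G j k z\<bar> = \<bar>LINT y:{0<..}|lebesgue. D k y * ?phi y\<bar>" by simp
      also have "\<dots> \<le> (LINT y:{0<..}|lebesgue. \<bar>D k y * ?phi y\<bar>)"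
        unfolding set_lebesgue_integral_def
        using integral_norm_bound[of lebesgue "\<lambda>y. indicat_real {0<..} y *\<^sub>R (D k y * ?phi y)"]
        by (simp add: abs_mult)
      also have "\<dots> \<le> (LINT y:{a - e j..R}|lebesgue. M * K j 0 z y)"
        unfolding set_lebesgue_integral_def
      proof (rule integral_mono_AE')
        show "integrable lebesgue (\<lambda>y. indicat_real {a - e j..R} y *\<^sub>R (M * K j 0 z y))"
        proof -
          have "continuous_on {a - e j..R} (\<lambda>y. M * K j 0 z y)" by (intro continuous_intros contK)
          from absolutely_integrable_continuous_real[OF this] show ?thesis unfolding set_integrable_def .
        qed
        have "AE y in lebesgue. y \<in> {0<..} \<longrightarrow> \<bar>D k y\<bar> \<le> M"
          using bound[OF k] by (subst (asm) AE_restrict_space_iff) auto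
        then show "AE y in lebesgue. indicat_real {0<..} y *\<^sub>R \<bar>D k y * ?phi y\<bar> \<le> indicat_real {a - e j..R} y *\<^sub>R (M * K j 0 z y)"
        proof eventually_elim
          case (elim y)
          show ?case unfolding phi using K_out[OF z, of y j 0] e[of j] elim K0_nonneg[of j z y]
            by (cases "y \<in> {a - e j..R}") (auto simp: abs_mult intro: mult_right_mono)
        qed
      qed (use M K0_nonneg in auto)
      also have "\<dots> = integral {a - e j..R} (\<lambda>y. M * K j 0 z y)"
        by (rule set_lebesgue_integral_eq_integral(2))
           (intro absolutely_integrable_continuous_real continuous_intros contK)
      also have "\<dots> = M * 1" using has_integral_mult_right[OF K0_int[OF z], of M] by (rule integral_unique)
      finally show ?thesis by simp
    qed
    have G0: "(\<lambda>j. G j 0 z) \<longlonglongrightarrow> f z" if z: "z \<in> {a<..<R}" for z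
    proof (rule LIMSEQ_I)
      fix r :: real assume r: "0 < r"
      have "isCont f z" using cont z a by (simp add: continuous_on_eq_continuous_at)
      then obtain d where d: "0 < d" "\<And>y. \<bar>y - z\<bar> < d \<Longrightarrow> \<bar>f y - f z\<bar> < r / 2"
        using r unfolding continuous_at_eps_delta dist_real_def by (metis half_gt_zero)
      have "\<forall>\<^sub>F j in sequentially. e j < d" using e0 d(1) by (rule order_tendstoD)
      then obtain N where N: "\<And>j. j \<ge> N \<Longrightarrow> e j < d" by (auto simp: eventually_sequentially)
      have "norm (G j 0 z - f z) < r" if "j \<ge> N" for j
      proof -
        have 1: "((\<lambda>y. f z * K j 0 z y) has_integral f z * 1) {a - e j..R}"
          by (intro has_integral_mult_right K0_int[OF z])
        have 2: "((\<lambda>y. f y * K j 0 z y) has_integral G j 0 z) {a - e j..R}"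
          unfolding G_def by (intro integrable_integral integrable_continuous_real fK)
        have "G j 0 z - f z * 1 = integral {a - e j..R} (\<lambda>y. f y * K j 0 z y - f z * K j 0 z y)"
          using integral_unique[OF has_integral_diff[OF 2 1]] by simp
        also have "norm \<dots> \<le> integral {a - e j..R} (\<lambda>y. r / 2 * K j 0 z y)"
        proof (rule integral_norm_bound_integral)
          show "(\<lambda>y. f y * K j 0 z y - f z * K j 0 z y) integrable_on {a - e j..R}"
            using has_integral_diff[OF 2 1] by blast
          show "(\<lambda>y. r / 2 * K j 0 z y) integrable_on {a - e j..R}"
            using has_integral_mult_right[OF K0_int[OF z]] by blast
          fix y
          show "norm (f y * K j 0 z y - f z * K j 0 z y) \<le> r / 2 * K j 0 z y"
          proof (cases "\<bar>y - z\<bar> < d")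
            case True
            have "norm (f y * K j 0 z y - f z * K j 0 z y) = \<bar>f y - f z\<bar> * K j 0 z y"
              using K0_nonneg[of j z y] by (simp add: abs_mult left_diff_distrib[symmetric])
            also have "\<dots> \<le> r / 2 * K j 0 z y" using d(2)[OF True] K0_nonneg by (intro mult_right_mono) auto
            finally show ?thesis .
          next
            case False
            have "(z - y) / e j \<notin> {0..1}" using False N[OF that] e(1)[of j] by (auto simp: field_simps)
            then have "K j 0 z y = 0" using b_out[of _ 0] by (simp add: K_def)
            then show ?thesis by simp
          qed
        qed
        also have "\<dots> = r / 2 * 1" using has_integral_mult_right[OF K0_int[OF z], of "r/2"] by (rule integral_unique)
        finally show ?thesis using r by simp
      qed
      then show "\<exists>N. \<forall>j\<ge>N. norm (G j 0 z - f z) < r" by blast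
    qed
    \<comment> \<open>The step to \<open>Suc k\<close> needs the bound on
      \<open>G j (Suc (Suc k))\<close>, available as long as \<open>Suc (Suc k) \<le> m\<close>;
      this is the condition \<open>Suc k < m\<close>.\<close>
    have Glim: "k < m \<Longrightarrow> \<forall>z\<in>{a<..<R}. (\<lambda>j. G j k z) \<longlonglongrightarrow> (deriv ^^ k) f z \<and>
        (0 < k \<longrightarrow> ((deriv ^^ (k - 1)) f has_real_derivative (deriv ^^ k) f z) (at z))" for k
    proof (induction k)
      case 0 then show ?case using G0 by simp
    next
      case (Suc k)
      show ?case
      proof
        fix z assume z: "z \<in> {a<..<R}"
        obtain g where g: "(\<lambda>j. G j (Suc k) z) \<longlonglongrightarrow> g" "((deriv ^^ k) f has_real_derivative g) (at z)"
        proof (rule DERIV_limit_of_bounded_second_deriv[of a R "\<lambda>j. G j k" "\<lambda>j. G j (Suc k)" "\<lambda>j. G j (Suc (Suc k))" M "(deriv ^^ k) f" z])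
          show "\<bar>G j (Suc (Suc k)) x\<bar> \<le> M" if "x \<in> {a<..<R}" for j x
            using that Suc.prems by (intro GM) auto
        qed (use dG Suc z in auto)
        moreover have "(deriv ^^ Suc k) f z = g" using g(2) by (simp add: DERIV_imp_deriv)
        ultimately show "(\<lambda>j. G j (Suc k) z) \<longlonglongrightarrow> (deriv ^^ Suc k) f z \<and>
          (0 < Suc k \<longrightarrow> ((deriv ^^ (Suc k - 1)) f has_real_derivative (deriv ^^ Suc k) f z) (at z))" by simp
      qed
    qed
    have Glip: "\<bar>G j k z - G j k y\<bar> \<le> M * \<bar>z - y\<bar>" if "z \<in> {a<..<R}" "y \<in> {a<..<R}" "k < m" for j k z y
      using field_differentiable_bound[of "{a<..<R}" "G j k" "G j (Suc k)" M z y] dG GM that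
      by (auto intro: has_field_derivative_at_within)
    show ?thesis
    proof (intro allI impI ballI conjI)
      fix k z assume k: "k < m" and z: "z \<in> {a<..<R}"
      show "((deriv ^^ k) f has_real_derivative (deriv ^^ Suc k) f z) (at z)" if "Suc k < m"
        using Glim[OF that] z by simp
      have "(\<lambda>j. \<bar>G j k z\<bar>) \<longlonglongrightarrow> \<bar>(deriv ^^ k) f z\<bar>" using Glim[OF k] z by (intro tendsto_intros) auto
      then show "\<bar>(deriv ^^ k) f z\<bar> \<le> M" by (rule Lim_bounded) (use GM z k in auto)
      fix y assume y: "y \<in> {a<..<R}"
      have "(\<lambda>j. \<bar>G j k z - G j k y\<bar>) \<longlonglongrightarrow> \<bar>(deriv ^^ k) f z - (deriv ^^ k) f y\<bar>"
        using Glim[OF k] z y by (intro tendsto_intros) auto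
      then show "\<bar>(deriv ^^ k) f z - (deriv ^^ k) f y\<bar> \<le> M * \<bar>z - y\<bar>"
        by (rule Lim_bounded) (use Glip z y k in auto)
    qed
  qed
  show "((deriv ^^ k) f has_real_derivative (deriv ^^ Suc k) f z) (at z)" if "0 < z" "Suc k < m"
    using local[of "z/2" "z+1"] that k by auto
  show "\<bar>(deriv ^^ k) f z\<bar> \<le> M" if "0 < z"
    using local[of "z/2" "z+1"] that k by auto
  show "\<bar>(deriv ^^ k) f z - (deriv ^^ k) f y\<bar> \<le> M * \<bar>z - y\<bar>" if "0 < z" "0 < y"
    using local[of "min z y/2" "max z y+1"] that k by (auto simp: min_def max_def split: if_splits)
qed

section \<open>Weak derivatives with an essential bound\<close>

definition weak_bounded :: "nat \<Rightarrow> (real \<Rightarrow> real) \<Rightarrow> real \<Rightarrow> bool" where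
  "weak_bounded m f M \<longleftrightarrow>
     (\<exists>D. \<forall>k\<le>m. weak_deriv k f (D k) \<and> (AE z in lebesgue_on {0<..}. \<bar>D k z\<bar> \<le> M))"

text \<open>Strictness yields an actual family of weak derivatives below the infimum. From here on
  the estimates use \<open>weak_bounded\<close> with a real bound instead of infima in
  \<open>ennreal\<close>.\<close>

lemma Winf_norm_less_imp_weak_bounded:
  assumes "Winf_norm m f < ennreal M"
  shows "weak_bounded m f M"
proof -
  obtain D where D: "\<And>k. k \<le> m \<Longrightarrow> weak_deriv k f (D k)"
    and S: "(SUP k\<in>{..m}. esssup (lebesgue_on {0<..}) (\<lambda>z. ennreal \<bar>D k z\<bar>)) < ennreal M"
    using assms unfolding Winf_norm_def by (auto simp: INF_less_iff)
  have "AE z in lebesgue_on {0<..}. \<bar>D k z\<bar> \<le> M" if "k \<le> m" for k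
  proof -
    have "esssup (lebesgue_on {0<..}) (\<lambda>z. ennreal \<bar>D k z\<bar>) \<le> ennreal M"
      by (rule order_trans[OF SUP_upper less_imp_le[OF S]]) (use that in simp)
    note le = this
    have M: "0 < M" by (rule ccontr) (use assms in \<open>simp add: ennreal_neg\<close>)
    have "AE z in lebesgue_on {0<..}. ennreal \<bar>D k z\<bar> \<le> esssup (lebesgue_on {0<..}) (\<lambda>z. ennreal \<bar>D k z\<bar>)"
      by (rule esssup_AE)
    then show ?thesis
    proof eventually_elim
      case (elim z)
      then have "ennreal \<bar>D k z\<bar> \<le> ennreal M" using le by (rule order_trans)
      then show ?case using M by (simp add: ennreal_le_iff)
    qed
  qed
  with D show ?thesis unfolding weak_bounded_def by blast
qed

lemma test_function_smooth: "test_function \<phi> \<Longrightarrow> smooth_fun \<phi>"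
  by (simp add: test_function_def smooth_fun_def)

lemma test_function_support:
  assumes "test_function \<phi>"
  obtains a b where "0 < a" "a < b" "\<And>k x. x \<notin> {a..b} \<Longrightarrow> (deriv ^^ k) \<phi> x = 0"
proof -
  obtain a b where ab: "0 < a" "a < b" "\<And>x. x \<notin> {a..b} \<Longrightarrow> \<phi> x = 0"
    using assms unfolding test_function_def by blast
  have "(deriv ^^ k) \<phi> x = 0" if "x \<notin> {a..b}" for k x
    using deriv_iter_eq_0[of "- {a..b}" \<phi> 0 x k] ab(3) that by (cases k) (auto simp: open_Compl)
  with ab that show ?thesis by blast
qed

lemma set_integrable_mult_test_function:
  assumes f: "locally_integrable f" and phi: "test_function \<phi>"
  shows "set_integrable lebesgue {0<..} (\<lambda>z. f z * (deriv ^^ k) \<phi> z)"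
proof -
  obtain a b where ab: "0 < a" "a < b" "\<And>k x. x \<notin> {a..b} \<Longrightarrow> (deriv ^^ k) \<phi> x = 0"
    using test_function_support[OF phi] by blast
  let ?g = "(deriv ^^ k) \<phi>"
  have c: "continuous_on A ?g" for A by (rule smooth_fun_cont[OF test_function_smooth[OF phi]])
  have "compact (?g ` {a..b})" by (rule compact_continuous_image[OF c]) simp
  then obtain C where C: "\<And>x. x \<in> {a..b} \<Longrightarrow> \<bar>?g x\<bar> \<le> C"
    by (force dest!: compact_imp_bounded simp: bounded_iff)
  have int: "integrable lebesgue (\<lambda>x. indicat_real {a..b} x * f x)"
    using f ab unfolding locally_integrable_def set_integrable_def by simp
  have "?g \<in> borel_measurable borel" using c[of UNIV] by (rule borel_measurable_continuous_onI)
  then have gm: "?g \<in> borel_measurable lebesgue" by (intro measurable_completion) (simp only: measurable_lborel2)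
  have "integrable lebesgue (\<lambda>x. (indicat_real {a..b} x * f x) * ?g x)"
  proof (rule Bochner_Integration.integrable_bound)
    show "integrable lebesgue (\<lambda>x. C * (indicat_real {a..b} x * f x))" using int by (rule integrable_mult_right)
    show "(\<lambda>x. indicat_real {a..b} x * f x * ?g x) \<in> borel_measurable lebesgue"
      by (rule borel_measurable_times[OF borel_measurable_integrable[OF int] gm])
    show "AE x in lebesgue. norm (indicat_real {a..b} x * f x * ?g x) \<le> norm (C * (indicat_real {a..b} x * f x))"
    proof (rule AE_I2)
      fix x
      show "norm (indicat_real {a..b} x * f x * ?g x) \<le> norm (C * (indicat_real {a..b} x * f x))"
        using C[of x] by (auto simp: indicator_def abs_mult mult.commute[of "\<bar>f x\<bar>"] intro!: mult_right_mono)
    qed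
  qed
  moreover have "indicat_real {a..b} x * f x * ?g x = indicat_real {0<..} x * (f x * ?g x)" for x
    using ab(1) ab(3)[of x k] by (auto simp: indicator_def)
  ultimately show ?thesis unfolding set_integrable_def by simp
qed

lemma weak_deriv_add:
  assumes "weak_deriv k f f'" "weak_deriv k g g'"
  shows "weak_deriv k (\<lambda>z. f z + g z) (\<lambda>z. f' z + g' z)"
proof -
  have li: "locally_integrable f" "locally_integrable f'" "locally_integrable g" "locally_integrable g'"
    using assms by (auto simp: weak_deriv_def)
  have "(LINT z:{0<..}|lebesgue. (f z + g z) * (deriv ^^ k) \<phi> z) =
        (-1) ^ k * (LINT z:{0<..}|lebesgue. (f' z + g' z) * \<phi> z)" if phi: "test_function \<phi>" for \<phi>
  proof -
    note i = set_integrable_mult_test_function[OF _ phi, of _ k] set_integrable_mult_test_function[OF _ phi, of _ 0]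
    show ?thesis
      using assms phi i(1)[OF li(1)] i(1)[OF li(3)] i(2)[OF li(2)] i(2)[OF li(4)]
      unfolding weak_deriv_def by (simp add: distrib_right distrib_left set_integral_add)
  qed
  moreover have "locally_integrable (\<lambda>z. f z + g z)" "locally_integrable (\<lambda>z. f' z + g' z)"
    using li unfolding locally_integrable_def by (auto intro: set_integral_add)
  ultimately show ?thesis unfolding weak_deriv_def by blast
qed

lemma weak_deriv_cmult:
  assumes "weak_deriv k f f'"
  shows "weak_deriv k (\<lambda>z. c * f z) (\<lambda>z. c * f' z)"
  using assms unfolding weak_deriv_def locally_integrable_def by (simp add: mult.assoc)

lemma weak_bounded_add:
  assumes "weak_bounded m f M" "weak_bounded m g N"
  shows "weak_bounded m (\<lambda>z. f z + g z) (M + N)"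
proof -
  obtain D E where "\<forall>k\<le>m. weak_deriv k f (D k) \<and> (AE z in lebesgue_on {0<..}. \<bar>D k z\<bar> \<le> M)"
     "\<forall>k\<le>m. weak_deriv k g (E k) \<and> (AE z in lebesgue_on {0<..}. \<bar>E k z\<bar> \<le> N)"
    using assms unfolding weak_bounded_def by blast
  note DE = this
  show ?thesis unfolding weak_bounded_def
  proof (intro exI[of _ "\<lambda>k z. D k z + E k z"] allI impI conjI)
    fix k assume k: "k \<le> m"
    show "weak_deriv k (\<lambda>z. f z + g z) (\<lambda>z. D k z + E k z)" using DE k by (auto intro: weak_deriv_add)
    have "AE z in lebesgue_on {0<..}. \<bar>D k z\<bar> \<le> M" "AE z in lebesgue_on {0<..}. \<bar>E k z\<bar> \<le> N" using DE k by auto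
    then show "AE z in lebesgue_on {0<..}. \<bar>D k z + E k z\<bar> \<le> M + N" by eventually_elim linarith
  qed
qed

lemma weak_bounded_cmult:
  assumes "weak_bounded m f M"
  shows "weak_bounded m (\<lambda>z. c * f z) (\<bar>c\<bar> * M)"
proof -
  obtain D where "\<forall>k\<le>m. weak_deriv k f (D k) \<and> (AE z in lebesgue_on {0<..}. \<bar>D k z\<bar> \<le> M)"
    using assms unfolding weak_bounded_def by blast
  note D = this
  show ?thesis unfolding weak_bounded_def
  proof (intro exI[of _ "\<lambda>k z. c * D k z"] allI impI conjI)
    fix k assume k: "k \<le> m"
    show "weak_deriv k (\<lambda>z. c * f z) (\<lambda>z. c * D k z)" using D k by (auto intro: weak_deriv_cmult)
    have "AE z in lebesgue_on {0<..}. \<bar>D k z\<bar> \<le> M" using D k by auto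
    then show "AE z in lebesgue_on {0<..}. \<bar>c * D k z\<bar> \<le> \<bar>c\<bar> * M"
      by eventually_elim (simp add: abs_mult mult_left_mono)
  qed
qed

lemma weak_bounded_classical:
  assumes "continuous_on {0<..} f" "weak_bounded m f M" "k < m"
  shows "0 < z \<Longrightarrow> Suc k < m \<Longrightarrow> ((deriv ^^ k) f has_real_derivative (deriv ^^ Suc k) f z) (at z)"
    and "0 < z \<Longrightarrow> \<bar>(deriv ^^ k) f z\<bar> \<le> \<bar>M\<bar>"
    and "0 < z \<Longrightarrow> 0 < y \<Longrightarrow> \<bar>(deriv ^^ k) f z - (deriv ^^ k) f y\<bar> \<le> \<bar>M\<bar> * \<bar>z - y\<bar>"
proof -
  obtain D where D: "\<And>k. k \<le> m \<Longrightarrow> weak_deriv k f (D k)" "\<And>k. k \<le> m \<Longrightarrow> AE z in lebesgue_on {0<..}. \<bar>D k z\<bar> \<le> M"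
    using assms unfolding weak_bounded_def by blast
  have D2: "AE z in lebesgue_on {0<..}. \<bar>D k z\<bar> \<le> \<bar>M\<bar>" if "k \<le> m" for k
    using D(2)[OF that] by eventually_elim auto
  note * = weak_deriv_imp_classical[OF assms(1) D(1) D2 abs_ge_zero assms(3)]
  show "0 < z \<Longrightarrow> Suc k < m \<Longrightarrow> ((deriv ^^ k) f has_real_derivative (deriv ^^ Suc k) f z) (at z)"
    "0 < z \<Longrightarrow> \<bar>(deriv ^^ k) f z\<bar> \<le> \<bar>M\<bar>"
    "0 < z \<Longrightarrow> 0 < y \<Longrightarrow> \<bar>(deriv ^^ k) f z - (deriv ^^ k) f y\<bar> \<le> \<bar>M\<bar> * \<bar>z - y\<bar>"
    by (rule *; assumption)+
qed

section \<open>Classical regularity of the shear flow\<close>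

lemma DERIV_abs_le_of_lipschitz:
  fixes f :: "real \<Rightarrow> real"
  assumes "(f has_real_derivative D) (at z)" and z: "0 < z"
    and lip: "\<And>y. 0 < y \<Longrightarrow> \<bar>f y - f z\<bar> \<le> M * \<bar>y - z\<bar>"
  shows "\<bar>D\<bar> \<le> M"
proof (rule tendsto_upperbound)
  show "((\<lambda>y. \<bar>(f y - f z) / (y - z)\<bar>) \<longlongrightarrow> \<bar>D\<bar>) (at z)"
    using assms(1) unfolding has_field_derivative_iff by (rule tendsto_rabs)
  have "\<forall>\<^sub>F y in at z. y \<in> {0<..}"
    by (rule topological_tendstoD[OF tendsto_ident_at]) (use z in auto)
  moreover have "\<forall>\<^sub>F y in at z. y \<noteq> z" by (simp add: eventually_at_filter)
  ultimately show "\<forall>\<^sub>F y in at z. \<bar>(f y - f z) / (y - z)\<bar> \<le> M"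
  proof eventually_elim
    case (elim y)
    then show ?case using lip[of y] by (simp add: field_simps)
  qed
qed auto

lemma DERIV_transform_pos:
  fixes f g :: "real \<Rightarrow> real"
  assumes "(f has_real_derivative D) (at z)" "0 < z" "\<And>y. 0 < y \<Longrightarrow> f y = g y"
  shows "(g has_real_derivative D) (at z)"
  by (rule has_field_derivative_transform_within_open[OF assms(1), of "{0<..}"]) (use assms in auto)

text \<open>Write g = exp(- \<alpha> z) h with h the weighted function. The bound of order 4
  controls h and its first three derivatives, hence the third derivative of g; the binomial sum
  gives \<open>(1 + \<alpha>) ^ 3\<close>, and the factor exp(- \<alpha> z) is at most 1.\<close>

lemma weighted_weak_bounded_C2:
  assumes "0 < \<alpha>" and cont: "continuous_on {0<..} g" and wb: "weak_bounded 4 (weighted \<alpha> g) M"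
  shows "0 < z \<Longrightarrow> (g has_real_derivative deriv g z) (at z)"
    and "0 < z \<Longrightarrow> (deriv g has_real_derivative deriv (deriv g) z) (at z)"
    and "0 < z \<Longrightarrow> 0 < y \<Longrightarrow> \<bar>deriv (deriv g) z - deriv (deriv g) y\<bar> \<le> (1 + \<alpha>) ^ 3 * \<bar>M\<bar> * \<bar>z - y\<bar>"
proof -
  define h where "h k = (deriv ^^ k) (weighted \<alpha> g)" for k
  have contw: "continuous_on {0<..} (weighted \<alpha> g)"
    unfolding weighted_def[abs_def] by (intro continuous_intros cont)
  have dh: "(h k has_real_derivative h (Suc k) z) (at z)" if "0 < z" "k < 3" for k z
    unfolding h_def by (rule weak_bounded_classical(1)[OF contw wb]) (use that in auto)
  have bh: "\<bar>h k z\<bar> \<le> \<bar>M\<bar>" if "0 < z" "k < 4" for k z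
    unfolding h_def by (rule weak_bounded_classical(2)[OF contw wb]) (use that in auto)
  define e where "e z = exp (- \<alpha> * z)" for z :: real
  have g: "g z = e z * h 0 z" for z by (simp add: e_def h_def weighted_def flip: exp_add)
  define G1 where "G1 z = e z * (h 1 z - \<alpha> * h 0 z)" for z
  define G2 where "G2 z = e z * (h 2 z - 2 * \<alpha> * h 1 z + \<alpha>\<^sup>2 * h 0 z)" for z
  define G3 where "G3 z = e z * (h 3 z - 3 * \<alpha> * h 2 z + 3 * \<alpha>\<^sup>2 * h 1 z - \<alpha> ^ 3 * h 0 z)" for z
  have de: "(e has_real_derivative - \<alpha> * e z) (at z)" for z
    unfolding e_def[abs_def] by (auto intro!: derivative_eq_intros)
  have d0: "(h 0 has_real_derivative h 1 z) (at z)" and d1: "(h 1 has_real_derivative h 2 z) (at z)"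
    and d2: "(h 2 has_real_derivative h 3 z) (at z)" if "0 < z" for z
    using dh[OF that, of 0] dh[OF that, of 1] dh[OF that, of 2] by (simp_all add: numeral_eq_Suc)
  have D0: "(g has_real_derivative G1 z) (at z)" if "0 < z" for z
    unfolding g[abs_def] G1_def
    by (auto simp del: One_nat_def intro!: derivative_eq_intros de d0[OF that] simp: algebra_simps)
  have E1: "deriv g z = G1 z" if "0 < z" for z using D0[OF that] by (rule DERIV_imp_deriv)
  have D1': "(G1 has_real_derivative G2 z) (at z)" if "0 < z" for z
    unfolding G1_def[abs_def] G2_def
    by (auto simp del: One_nat_def intro!: derivative_eq_intros de d0[OF that] d1[OF that] simp: algebra_simps power2_eq_square)
  have D1: "(deriv g has_real_derivative G2 z) (at z)" if "0 < z" for z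
    by (rule DERIV_transform_pos[OF D1'[OF that] that]) (simp add: E1)
  have E2: "deriv (deriv g) z = G2 z" if "0 < z" for z using D1[OF that] by (rule DERIV_imp_deriv)
  have D2: "(G2 has_real_derivative G3 z) (at z)" if "0 < z" for z
    unfolding G2_def[abs_def] G3_def
    by (auto simp del: One_nat_def intro!: derivative_eq_intros de d0[OF that] d1[OF that] d2[OF that] simp: algebra_simps power2_eq_square power3_eq_cube)
  have B3: "\<bar>G3 z\<bar> \<le> (1 + \<alpha>) ^ 3 * \<bar>M\<bar>" if "0 < z" for z
  proof -
    have "\<bar>h 3 z - 3 * \<alpha> * h 2 z + 3 * \<alpha>\<^sup>2 * h 1 z - \<alpha> ^ 3 * h 0 z\<bar>
        \<le> \<bar>h 3 z\<bar> + 3 * \<alpha> * \<bar>h 2 z\<bar> + 3 * \<alpha>\<^sup>2 * \<bar>h 1 z\<bar> + \<alpha> ^ 3 * \<bar>h 0 z\<bar>"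
    proof -
      have "\<bar>3 * \<alpha> * h 2 z\<bar> = 3 * \<alpha> * \<bar>h 2 z\<bar>" "\<bar>3 * \<alpha>\<^sup>2 * h 1 z\<bar> = 3 * \<alpha>\<^sup>2 * \<bar>h 1 z\<bar>"
        "\<bar>\<alpha> ^ 3 * h 0 z\<bar> = \<alpha> ^ 3 * \<bar>h 0 z\<bar>" using \<open>0 < \<alpha>\<close> by (simp_all add: abs_mult)
      then show ?thesis by linarith
    qed
    also have "\<dots> \<le> \<bar>M\<bar> + 3 * \<alpha> * \<bar>M\<bar> + 3 * \<alpha>\<^sup>2 * \<bar>M\<bar> + \<alpha> ^ 3 * \<bar>M\<bar>"
      using \<open>0 < \<alpha>\<close> by (intro add_mono mult_left_mono bh that) auto
    also have "\<dots> = (1 + \<alpha>) ^ 3 * \<bar>M\<bar>" by (simp add: power3_eq_cube power2_eq_square algebra_simps)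
    finally have *: "\<bar>h 3 z - 3 * \<alpha> * h 2 z + 3 * \<alpha>\<^sup>2 * h 1 z - \<alpha> ^ 3 * h 0 z\<bar> \<le> (1 + \<alpha>) ^ 3 * \<bar>M\<bar>" .
    have "e z \<le> 1" "0 \<le> e z" using that \<open>0 < \<alpha>\<close> by (auto simp: e_def)
    then show ?thesis unfolding G3_def abs_mult
      using * by (smt (verit, best) abs_ge_zero mult_left_le_one_le abs_of_nonneg)
  qed
  show "0 < z \<Longrightarrow> (g has_real_derivative deriv g z) (at z)" using D0 E1 by simp
  show "0 < z \<Longrightarrow> (deriv g has_real_derivative deriv (deriv g) z) (at z)" using D1 E2 by simp
  show "\<bar>deriv (deriv g) z - deriv (deriv g) y\<bar> \<le> (1 + \<alpha>) ^ 3 * \<bar>M\<bar> * \<bar>z - y\<bar>" if "0 < z" "0 < y"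
    using field_differentiable_bound[of "{0<..}" G2 G3 "(1 + \<alpha>) ^ 3 * \<bar>M\<bar>" z y] D2 B3 that E2
    by (auto intro: has_field_derivative_at_within)
qed

text \<open>Differentiability in time is available only in the norm of order 2, which by itself
  gives no more than a Lipschitz first derivative. Since the second derivative is already known to
  exist classically, that Lipschitz constant bounds it, and differences in time are controlled up to
  second order.\<close>

lemma weighted_weak_bounded_small:
  assumes "0 < \<alpha>" and d0: "\<And>z. 0 < z \<Longrightarrow> (g has_real_derivative g1 z) (at z)"
    and d1: "\<And>z. 0 < z \<Longrightarrow> (g1 has_real_derivative g2 z) (at z)"
    and wb: "weak_bounded 2 (weighted \<alpha> g) M" and z: "0 < z"
  shows "\<bar>g z\<bar> \<le> (1 + \<alpha>)\<^sup>2 * \<bar>M\<bar>" "\<bar>g1 z\<bar> \<le> (1 + \<alpha>)\<^sup>2 * \<bar>M\<bar>" "\<bar>g2 z\<bar> \<le> (1 + \<alpha>)\<^sup>2 * \<bar>M\<bar>"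
proof -
  define E where "E z = exp (\<alpha> * z)" for z :: real
  have E: "(E has_real_derivative \<alpha> * E z) (at z)" "1 \<le> E z" if "0 < z" for z
    using \<open>0 < \<alpha>\<close> that unfolding E_def[abs_def] by (auto intro!: derivative_eq_intros)
  define h where "h = weighted \<alpha> g"
  have h: "h = (\<lambda>z. E z * g z)" by (simp add: h_def weighted_def[abs_def] E_def)
  define h1 where "h1 z = E z * (g1 z + \<alpha> * g z)" for z
  define h2 where "h2 z = E z * (g2 z + 2 * \<alpha> * g1 z + \<alpha>\<^sup>2 * g z)" for z
  have D0: "(h has_real_derivative h1 z) (at z)" if "0 < z" for z
    unfolding h h1_def by (auto intro!: derivative_eq_intros E d0 that simp: algebra_simps)
  have D1: "(h1 has_real_derivative h2 z) (at z)" if "0 < z" for z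
    unfolding h1_def[abs_def] h2_def
    by (auto intro!: derivative_eq_intros E d0 d1 that simp: algebra_simps power2_eq_square)
  have cont: "continuous_on {0<..} h"
    by (rule DERIV_continuous_on[of _ _ h1], rule has_field_derivative_at_within, rule D0) simp
  have dh: "deriv h z = h1 z" if "0 < z" for z using D0[OF that] by (rule DERIV_imp_deriv)
  note wb' = wb[folded h_def]
  have b0: "\<bar>h z\<bar> \<le> \<bar>M\<bar>" using weak_bounded_classical(2)[OF cont wb', of 0 z] z by simp
  have b1: "\<bar>h1 z\<bar> \<le> \<bar>M\<bar>" using weak_bounded_classical(2)[OF cont wb', of 1 z] z dh by simp
  have lip: "\<bar>h1 y - h1 z\<bar> \<le> \<bar>M\<bar> * \<bar>y - z\<bar>" if "0 < y" for y
    using weak_bounded_classical(3)[OF cont wb', of 1 y z] z that dh by simp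
  have b2: "\<bar>h2 z\<bar> \<le> \<bar>M\<bar>" by (rule DERIV_abs_le_of_lipschitz[OF D1[OF z] z lip])
  have Ez: "E z > 0" by (simp add: E_def)
  have div: "\<bar>x\<bar> \<le> c" if "\<bar>E z * x\<bar> \<le> c" for x c
  proof -
    have "1 * \<bar>x\<bar> \<le> E z * \<bar>x\<bar>" using E(2)[OF z] by (intro mult_right_mono) auto
    then show ?thesis using that Ez by (simp add: abs_mult)
  qed
  have e0: "E z * g z = h z" by (simp add: h)
  have e1: "E z * g1 z = h1 z - \<alpha> * h z" by (simp add: h h1_def algebra_simps)
  have e2: "E z * g2 z = h2 z - 2 * \<alpha> * h1 z + \<alpha>\<^sup>2 * h z"
    by (simp add: h h1_def h2_def algebra_simps power2_eq_square)
  have N: "(1 + \<alpha>)\<^sup>2 * \<bar>M\<bar> = \<bar>M\<bar> + 2 * \<alpha> * \<bar>M\<bar> + \<alpha>\<^sup>2 * \<bar>M\<bar>"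
    by (simp add: algebra_simps power2_eq_square)
  have p: "0 \<le> \<alpha> * \<bar>M\<bar>" "0 \<le> 2 * \<alpha> * \<bar>M\<bar>" "0 \<le> \<alpha>\<^sup>2 * \<bar>M\<bar>" using \<open>0 < \<alpha>\<close> by auto
  have "\<bar>E z * g z\<bar> \<le> (1 + \<alpha>)\<^sup>2 * \<bar>M\<bar>" unfolding e0 N using b0 p by linarith
  moreover have "\<bar>E z * g1 z\<bar> \<le> (1 + \<alpha>)\<^sup>2 * \<bar>M\<bar>"
  proof -
    have "\<bar>h1 z - \<alpha> * h z\<bar> \<le> \<bar>h1 z\<bar> + \<bar>\<alpha> * h z\<bar>" by linarith
    also have "\<dots> \<le> \<bar>M\<bar> + \<alpha> * \<bar>M\<bar>"
      using \<open>0 < \<alpha>\<close> b0 b1 by (auto simp: abs_mult intro!: add_mono mult_left_mono)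
    finally show ?thesis unfolding e1 N using p by linarith
  qed
  moreover have "\<bar>E z * g2 z\<bar> \<le> (1 + \<alpha>)\<^sup>2 * \<bar>M\<bar>"
  proof -
    have "\<bar>h2 z - 2 * \<alpha> * h1 z + \<alpha>\<^sup>2 * h z\<bar> \<le> \<bar>h2 z\<bar> + \<bar>2 * \<alpha> * h1 z\<bar> + \<bar>\<alpha>\<^sup>2 * h z\<bar>" by linarith
    also have "\<dots> \<le> \<bar>M\<bar> + 2 * \<alpha> * \<bar>M\<bar> + \<alpha>\<^sup>2 * \<bar>M\<bar>"
      using \<open>0 < \<alpha>\<close> b0 b1 b2 by (auto simp: abs_mult intro!: add_mono mult_left_mono)
    finally show ?thesis unfolding e2 N .
  qed
  ultimately show "\<bar>g z\<bar> \<le> (1 + \<alpha>)\<^sup>2 * \<bar>M\<bar>" "\<bar>g1 z\<bar> \<le> (1 + \<alpha>)\<^sup>2 * \<bar>M\<bar>" "\<bar>g2 z\<bar> \<le> (1 + \<alpha>)\<^sup>2 * \<bar>M\<bar>"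
    by (auto intro: div)
qed

lemma WH_norm_less_imp_weak_bounded:
  assumes "WH_norm \<alpha> m f < ennreal M"
  shows "weak_bounded m (weighted \<alpha> f) M"
proof (rule Winf_norm_less_imp_weak_bounded)
  have "Winf_norm m (weighted \<alpha> f) \<le> WH_norm \<alpha> m f" unfolding WH_norm_def by (rule order_trans[OF _ add_increasing2]) auto
  then show "Winf_norm m (weighted \<alpha> f) < ennreal M" using assms by (rule le_less_trans)
qed

lemma WH_norm_finite_imp_weak_bounded:
  assumes "WH_norm \<alpha> m f < \<infinity>"
  shows "\<exists>M. weak_bounded m (weighted \<alpha> f) M"
proof -
  obtain n :: nat where "WH_norm \<alpha> m f < of_nat n" using ennreal_Ex_less_of_nat assms by auto
  then have "WH_norm \<alpha> m f < ennreal (real n)" by (simp add: ennreal_of_nat_eq_real_of_nat)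
  then show ?thesis using WH_norm_less_imp_weak_bounded by blast
qed

section \<open>Pointwise consequences for one component of the shear flow\<close>

context
  fixes \<alpha> U0 :: real and Us :: "real \<Rightarrow> real" and us :: "real \<Rightarrow> real \<Rightarrow> real"
  assumes \<alpha>: "0 < \<alpha>" and hp: "heat_profile \<alpha> U0 Us us"
begin

lemma heat_profile_cont_z:
  assumes "0 \<le> t" shows "continuous_on {0<..} (us t)"
proof -
  have "continuous_on ({0..} \<times> {0..}) (\<lambda>(t, z). us t z)" using hp by (simp add: heat_profile_def)
  then have "continuous_on {0<..} (\<lambda>z. (\<lambda>(t, z). us t z) (t, z))"
    by (rule continuous_on_compose2) (use assms in \<open>auto intro!: continuous_intros\<close>)
  then show ?thesis by simp
qed

lemma heat_profile_weak_bounded4: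
  assumes "0 \<le> t" shows "\<exists>M. weak_bounded 4 (weighted \<alpha> (\<lambda>z. us t z - U0)) M"
  using hp assms by (intro WH_norm_finite_imp_weak_bounded) (auto simp: heat_profile_def C0_into_def)

text \<open>An identity of functions on the whole line, also where no derivative exists: both sides
  choose from the same set of candidate derivatives.\<close>

lemma heat_profile_deriv_shift:
  "deriv (\<lambda>z. us t z - U0) = deriv (us t)"
proof -
  have "((\<lambda>z. us t z - U0) has_field_derivative D) (at z) \<longleftrightarrow> (us t has_field_derivative D) (at z)" for z D
    by (simp add: has_field_derivative_iff)
  then show ?thesis unfolding deriv_def by simp
qed

lemma heat_profile_C2:
  assumes "0 \<le> t" "0 < z"
  shows "(us t has_real_derivative deriv (us t) z) (at z)"
    and "(deriv (us t) has_real_derivative deriv (deriv (us t)) z) (at z)"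
proof -
  obtain M where M: "weak_bounded 4 (weighted \<alpha> (\<lambda>z. us t z - U0)) M"
    using heat_profile_weak_bounded4[OF assms(1)] by blast
  have c: "continuous_on {0<..} (\<lambda>z. us t z - U0)" by (intro continuous_intros heat_profile_cont_z assms)
  note * = weighted_weak_bounded_C2[OF \<alpha> c M, unfolded heat_profile_deriv_shift]
  show "(us t has_real_derivative deriv (us t) z) (at z)"
    using DERIV_add[OF *(1)[OF assms(2)] DERIV_const[of U0]] by simp
  show "(deriv (us t) has_real_derivative deriv (deriv (us t)) z) (at z)" using *(2) assms by simp
qed

lemma heat_profile_lipschitz:
  assumes "0 \<le> t"
  obtains M where "0 \<le> M" "\<And>y z. 0 < y \<Longrightarrow> 0 < z \<Longrightarrow>
    \<bar>deriv (deriv (us t)) z - deriv (deriv (us t)) y\<bar> \<le> M * \<bar>z - y\<bar>"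
proof -
  obtain M where M: "weak_bounded 4 (weighted \<alpha> (\<lambda>z. us t z - U0)) M"
    using heat_profile_weak_bounded4[OF assms(1)] by blast
  have c: "continuous_on {0<..} (\<lambda>z. us t z - U0)" by (intro continuous_intros heat_profile_cont_z assms)
  note * = weighted_weak_bounded_C2[OF \<alpha> c M, unfolded heat_profile_deriv_shift]
  show ?thesis by (rule that[of "(1 + \<alpha>) ^ 3 * \<bar>M\<bar>"]) (use * \<alpha> in auto)
qed

lemma heat_profile_diff_bound:
  assumes "0 \<le> t" "0 \<le> r" "0 < z" "weak_bounded 2 (weighted \<alpha> (\<lambda>z. us r z - us t z)) M"
  shows "\<bar>us r z - us t z\<bar> \<le> (1 + \<alpha>)\<^sup>2 * \<bar>M\<bar>"
    "\<bar>deriv (us r) z - deriv (us t) z\<bar> \<le> (1 + \<alpha>)\<^sup>2 * \<bar>M\<bar>"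
    "\<bar>deriv (deriv (us r)) z - deriv (deriv (us t)) z\<bar> \<le> (1 + \<alpha>)\<^sup>2 * \<bar>M\<bar>"
proof -
  note * = weighted_weak_bounded_small[OF \<alpha> DERIV_diff[OF heat_profile_C2(1) heat_profile_C2(1)]
     DERIV_diff[OF heat_profile_C2(2) heat_profile_C2(2)] assms(4,3)]
  show "\<bar>us r z - us t z\<bar> \<le> (1 + \<alpha>)\<^sup>2 * \<bar>M\<bar>"
    "\<bar>deriv (us r) z - deriv (us t) z\<bar> \<le> (1 + \<alpha>)\<^sup>2 * \<bar>M\<bar>"
    "\<bar>deriv (deriv (us r)) z - deriv (deriv (us t)) z\<bar> \<le> (1 + \<alpha>)\<^sup>2 * \<bar>M\<bar>"
    by (rule *; use assms in simp)+
qed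

lemma heat_profile_continuous_time:
  assumes "0 \<le> t" "0 < e"
  obtains d where "0 < d" "\<And>r z. 0 \<le> r \<Longrightarrow> \<bar>r - t\<bar> < d \<Longrightarrow> 0 < z \<Longrightarrow>
    \<bar>us r z - us t z\<bar> \<le> e \<and> \<bar>deriv (us r) z - deriv (us t) z\<bar> \<le> e \<and>
    \<bar>deriv (deriv (us r)) z - deriv (deriv (us t)) z\<bar> \<le> e"
proof -
  define e' where "e' = e / (1 + \<alpha>)\<^sup>2"
  have e': "0 < e'" "(1 + \<alpha>)\<^sup>2 * \<bar>e'\<bar> = e" using assms \<alpha> by (auto simp: e'_def)
  have "((\<lambda>r. WH_norm \<alpha> 2 (\<lambda>z. (us r z - U0) - (us t z - U0))) \<longlongrightarrow> 0) (at t within {0..})"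
    using hp assms by (simp add: heat_profile_def C1_into_def C0_into_def)
  then have "\<forall>\<^sub>F r in at t within {0..}. WH_norm \<alpha> 2 (\<lambda>z. us r z - us t z) < ennreal e'"
    using e'(1) by (auto dest!: order_tendstoD(2)[where a = "ennreal e'"])
  then obtain d where d: "0 < d" "\<And>r. r \<in> {0..} \<Longrightarrow> r \<noteq> t \<Longrightarrow> dist r t < d \<Longrightarrow>
      WH_norm \<alpha> 2 (\<lambda>z. us r z - us t z) < ennreal e'"
    unfolding eventually_at by blast
  show ?thesis
  proof (rule that[OF d(1)])
    fix r z :: real assume r: "0 \<le> r" "\<bar>r - t\<bar> < d" and z: "0 < z"
    show "\<bar>us r z - us t z\<bar> \<le> e \<and> \<bar>deriv (us r) z - deriv (us t) z\<bar> \<le> e \<and>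
      \<bar>deriv (deriv (us r)) z - deriv (deriv (us t)) z\<bar> \<le> e"
    proof (cases "r = t")
      case False
      have "weak_bounded 2 (weighted \<alpha> (\<lambda>z. us r z - us t z)) e'"
        by (rule WH_norm_less_imp_weak_bounded) (use d(2)[of r] r False in \<open>auto simp: dist_real_def\<close>)
      from heat_profile_diff_bound[OF assms(1) r(1) z this] e'(2) show ?thesis by simp
    qed (use assms in auto)
  qed
qed

text \<open>Near time 0 the difference quotient is within 1, in the norm of order 2, of a fixed
  function of finite norm; multiplication by r gives the linear rate. It measures how fast the heat
  flow moves the slope and the curvature at the initial critical point.\<close>

lemma heat_profile_rate_at_0:
  obtains C d where "0 \<le> C" "0 < d" "\<And>r z. 0 \<le> r \<Longrightarrow> r < d \<Longrightarrow> 0 < z \<Longrightarrow>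
    \<bar>deriv (us r) z - deriv (us 0) z\<bar> \<le> C * r \<and>
    \<bar>deriv (deriv (us r)) z - deriv (deriv (us 0)) z\<bar> \<le> C * r"
proof -
  obtain g where g: "C0_into (WH_norm \<alpha> 2) g"
    "((\<lambda>r. WH_norm \<alpha> 2 (\<lambda>z. ((us r z - U0) - (us 0 z - U0)) / (r - 0) - g 0 z)) \<longlongrightarrow> 0) (at 0 within {0..})"
    using hp by (auto simp: heat_profile_def C1_into_def)
  obtain G where G: "weak_bounded 2 (weighted \<alpha> (g 0)) G"
    using WH_norm_finite_imp_weak_bounded g(1) unfolding C0_into_def by blast
  have "\<forall>\<^sub>F r in at 0 within {0..}. WH_norm \<alpha> 2 (\<lambda>z. ((us r z - U0) - (us 0 z - U0)) / (r - 0) - g 0 z) < ennreal 1"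
    using order_tendstoD(2)[OF g(2), of "ennreal 1"] by simp
  then obtain d where d: "0 < d" "\<And>r. r \<in> {0..} \<Longrightarrow> r \<noteq> 0 \<Longrightarrow> dist r 0 < d \<Longrightarrow>
      WH_norm \<alpha> 2 (\<lambda>z. ((us r z - U0) - (us 0 z - U0)) / (r - 0) - g 0 z) < ennreal 1"
    unfolding eventually_at by blast
  show ?thesis
  proof (rule that[OF _ d(1), of "(1 + \<alpha>)\<^sup>2 * \<bar>1 + G\<bar>"])
    fix r z :: real assume r: "0 \<le> r" "r < d" and z: "0 < z"
    show "\<bar>deriv (us r) z - deriv (us 0) z\<bar> \<le> (1 + \<alpha>)\<^sup>2 * \<bar>1 + G\<bar> * r \<and>
      \<bar>deriv (deriv (us r)) z - deriv (deriv (us 0)) z\<bar> \<le> (1 + \<alpha>)\<^sup>2 * \<bar>1 + G\<bar> * r"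
    proof (cases "r = 0")
      case False
      have "weak_bounded 2 (weighted \<alpha> (\<lambda>z. ((us r z - U0) - (us 0 z - U0)) / (r - 0) - g 0 z)) 1"
        by (rule WH_norm_less_imp_weak_bounded) (use d(2)[of r] r False in auto)
      note w1 = this
      have "weak_bounded 2 (weighted \<alpha> (\<lambda>z. us r z - us 0 z)) (\<bar>r\<bar> * (1 + G))"
      proof -
        have "(\<lambda>z. r * (weighted \<alpha> (\<lambda>z. ((us r z - U0) - (us 0 z - U0)) / (r - 0) - g 0 z) z + weighted \<alpha> (g 0) z))
            = weighted \<alpha> (\<lambda>z. us r z - us 0 z)"
          using False by (auto simp: weighted_def field_simps)
        then show ?thesis using weak_bounded_cmult[OF weak_bounded_add[OF w1 G], of r] by simp
      qed
      from heat_profile_diff_bound[OF _ r(1) z this] r(1)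
      show ?thesis by (simp add: abs_mult mult_ac)
    qed auto
  qed simp
qed

text \<open>Continuity in time is uniform in z, so it combines with continuity in z at a fixed time;
  for the second derivative the latter comes from its Lipschitz bound.\<close>

lemma heat_profile_jointly_continuous:
  shows "continuous_on ({0..} \<times> {0<..}) (\<lambda>(t, z). us t z)"
    and "continuous_on ({0..} \<times> {0<..}) (\<lambda>(t, z). deriv (us t) z)"
    and "continuous_on ({0..} \<times> {0<..}) (\<lambda>(t, z). deriv (deriv (us t)) z)"
proof -
  have *: "continuous_on ({0..} \<times> {0<..}) (\<lambda>(t, z). F t z)"
    if c: "\<And>t z. 0 \<le> t \<Longrightarrow> 0 < z \<Longrightarrow> isCont (F t) z"
      and u: "\<And>t e. 0 \<le> t \<Longrightarrow> 0 < e \<Longrightarrow> \<exists>d>0. \<forall>r z. 0 \<le> r \<longrightarrow> \<bar>r - t\<bar> < d \<longrightarrow> 0 < z \<longrightarrow> \<bar>F r z - F t z\<bar> \<le> e"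
    for F :: "real \<Rightarrow> real \<Rightarrow> real"
    unfolding continuous_on_iff
  proof (intro ballI allI impI)
    fix x :: "real \<times> real" and e :: real assume x: "x \<in> {0..} \<times> {0<..}" and e: "0 < e"
    obtain t z where tz: "x = (t, z)" "0 \<le> t" "0 < z" using x by auto
    obtain d1 where d1: "0 < d1" "\<And>r z. 0 \<le> r \<Longrightarrow> \<bar>r - t\<bar> < d1 \<Longrightarrow> 0 < z \<Longrightarrow> \<bar>F r z - F t z\<bar> \<le> e / 2"
      using u[OF tz(2), of "e/2"] e by auto
    obtain d2 where d2: "0 < d2" "\<And>y. \<bar>y - z\<bar> < d2 \<Longrightarrow> \<bar>F t y - F t z\<bar> < e / 2"
      using c[OF tz(2,3)] e unfolding continuous_at_eps_delta dist_real_def by (metis half_gt_zero)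
    show "\<exists>d>0. \<forall>x'\<in>{0..} \<times> {0<..}. dist x' x < d \<longrightarrow>
        dist (case x' of (t, z) \<Rightarrow> F t z) (case x of (t, z) \<Rightarrow> F t z) < e"
    proof (intro exI[of _ "min d1 d2"] conjI ballI impI)
      fix x' assume x': "x' \<in> {0..} \<times> {0<..}" "dist x' x < min d1 d2"
      obtain r y where ry: "x' = (r, y)" "0 \<le> r" "0 < y" using x' by auto
      have "\<bar>r - t\<bar> < d1" "\<bar>y - z\<bar> < d2"
        using x'(2) dist_fst_le[of x' x] dist_snd_le[of x' x] ry tz by (auto simp: dist_real_def)
      with d1(2)[of r y] d2(2)[of y] ry have "\<bar>F r y - F t y\<bar> \<le> e / 2" "\<bar>F t y - F t z\<bar> < e / 2" by auto
      then have "\<bar>F r y - F t z\<bar> < e" by linarith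
      then show "dist (case x' of (t, z) \<Rightarrow> F t z) (case x of (t, z) \<Rightarrow> F t z) < e"
        using ry tz by (simp add: dist_real_def)
    qed (use d1 d2 in auto)
  qed
  have u: "\<exists>d>0. \<forall>r z. 0 \<le> r \<longrightarrow> \<bar>r - t\<bar> < d \<longrightarrow> 0 < z \<longrightarrow>
     \<bar>us r z - us t z\<bar> \<le> e \<and> \<bar>deriv (us r) z - deriv (us t) z\<bar> \<le> e \<and>
     \<bar>deriv (deriv (us r)) z - deriv (deriv (us t)) z\<bar> \<le> e" if "0 \<le> t" "0 < e" for t e
    using heat_profile_continuous_time[OF that] by metis
  have c2: "isCont (deriv (deriv (us t))) z" if t: "0 \<le> t" and z: "0 < z" for t z
  proof -
    obtain M where M: "0 \<le> M" "\<And>y z. 0 < y \<Longrightarrow> 0 < z \<Longrightarrow>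
        \<bar>deriv (deriv (us t)) z - deriv (deriv (us t)) y\<bar> \<le> M * \<bar>z - y\<bar>"
      using heat_profile_lipschitz[OF t] by blast
    have "M-lipschitz_on {0<..} (deriv (deriv (us t)))"
      using M by (auto simp: lipschitz_on_def dist_real_def)
    then have "continuous_on {0<..} (deriv (deriv (us t)))" by (rule lipschitz_on_continuous_on)
    then show ?thesis using z by (simp add: continuous_on_eq_continuous_at)
  qed
  show "continuous_on ({0..} \<times> {0<..}) (\<lambda>(t, z). us t z)"
  proof (rule *[of "us"])
    show "isCont (us t) z" if "0 \<le> t" "0 < z" for t z
      using DERIV_isCont[OF heat_profile_C2(1)[OF that]] .
    show "\<exists>d>0. \<forall>r z. 0 \<le> r \<longrightarrow> \<bar>r - t\<bar> < d \<longrightarrow> 0 < z \<longrightarrow> \<bar>us r z - us t z\<bar> \<le> e"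
      if "0 \<le> t" "0 < e" for t e
    proof -
      from u[OF that] obtain d where "d > 0" "\<forall>r z. 0 \<le> r \<longrightarrow> \<bar>r - t\<bar> < d \<longrightarrow> 0 < z \<longrightarrow>
        \<bar>us r z - us t z\<bar> \<le> e \<and> \<bar>deriv (us r) z - deriv (us t) z\<bar> \<le> e \<and>
        \<bar>deriv (deriv (us r)) z - deriv (deriv (us t)) z\<bar> \<le> e" by blast
      then show ?thesis by (intro exI[of _ d]) simp
    qed
  qed
  show "continuous_on ({0..} \<times> {0<..}) (\<lambda>(t, z). deriv (us t) z)"
  proof (rule *[of "\<lambda>t. deriv (us t)"])
    show "isCont ((\<lambda>t. deriv (us t)) t) z" if "0 \<le> t" "0 < z" for t z
      using DERIV_isCont[OF heat_profile_C2(2)[OF that]] .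
    show "\<exists>d>0. \<forall>r z. 0 \<le> r \<longrightarrow> \<bar>r - t\<bar> < d \<longrightarrow> 0 < z \<longrightarrow> \<bar>(\<lambda>t. deriv (us t)) r z - (\<lambda>t. deriv (us t)) t z\<bar> \<le> e"
      if "0 \<le> t" "0 < e" for t e
    proof -
      from u[OF that] obtain d where "d > 0" "\<forall>r z. 0 \<le> r \<longrightarrow> \<bar>r - t\<bar> < d \<longrightarrow> 0 < z \<longrightarrow>
        \<bar>us r z - us t z\<bar> \<le> e \<and> \<bar>deriv (us r) z - deriv (us t) z\<bar> \<le> e \<and>
        \<bar>deriv (deriv (us r)) z - deriv (deriv (us t)) z\<bar> \<le> e" by blast
      then show ?thesis by (intro exI[of _ d]) simp
    qed
  qed
  show "continuous_on ({0..} \<times> {0<..}) (\<lambda>(t, z). deriv (deriv (us t)) z)"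
  proof (rule *[of "\<lambda>t. deriv (deriv (us t))"])
    show "isCont ((\<lambda>t. deriv (deriv (us t))) t) z" if "0 \<le> t" "0 < z" for t z
      using c2[OF that] .
    show "\<exists>d>0. \<forall>r z. 0 \<le> r \<longrightarrow> \<bar>r - t\<bar> < d \<longrightarrow> 0 < z \<longrightarrow> \<bar>(\<lambda>t. deriv (deriv (us t))) r z - (\<lambda>t. deriv (deriv (us t))) t z\<bar> \<le> e"
      if "0 \<le> t" "0 < e" for t e
    proof -
      from u[OF that] obtain d where "d > 0" "\<forall>r z. 0 \<le> r \<longrightarrow> \<bar>r - t\<bar> < d \<longrightarrow> 0 < z \<longrightarrow>
        \<bar>us r z - us t z\<bar> \<le> e \<and> \<bar>deriv (us r) z - deriv (us t) z\<bar> \<le> e \<and>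
        \<bar>deriv (deriv (us r)) z - deriv (deriv (us t)) z\<bar> \<le> e" by blast
      then show ?thesis by (intro exI[of _ d]) simp
    qed
  qed
qed

lemma heat_profile_time_deriv:
  "0 < t \<Longrightarrow> 0 < z \<Longrightarrow> ((\<lambda>r. us r z) has_real_derivative deriv (deriv (us t)) z) (at t)"
  using hp by (simp add: heat_profile_def)

end

section \<open>Tangential Fourier modes of a solution\<close>

text \<open>The coefficient \<open>fcoeff\<close> of a continuous function as a single integral over
  a box. In this form differentiation under the integral sign and exchange of the variables
  apply.\<close>

definition fc :: "int \<times> int \<Rightarrow> (real \<Rightarrow> real \<Rightarrow> complex) \<Rightarrow> complex" where
  "fc k g = integral (cbox (0, 0) (2 * pi, 2 * pi)) (\<lambda>(x, y). g x y * cis (- phase k x y)) / (4 * pi\<^sup>2)"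

lemma continuous_on_cis_phase [continuous_intros]:
  assumes "continuous_on A f" "continuous_on A g"
  shows "continuous_on A (\<lambda>p. cis (- phase k (f p) (g p)))"
  unfolding phase_def using assms by (intro continuous_intros)

lemma fc_integrand_continuous:
  assumes "continuous_on UNIV (\<lambda>(x, y). g x y)"
  shows "continuous_on A (\<lambda>(x, y). g x y * cis (- phase k x y))"
proof -
  have "continuous_on A (\<lambda>p. (case p of (x, y) \<Rightarrow> g x y) * cis (- phase k (fst p) (snd p)))"
    by (intro continuous_intros continuous_on_subset[OF assms]) auto
  then show ?thesis by (simp add: case_prod_unfold)
qed

lemma continuous_on_slices:
  assumes "continuous_on UNIV (\<lambda>(x, y). h x y)"
  shows "continuous_on A (\<lambda>y. h x y)" "continuous_on A (\<lambda>x. h x y)"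
    "continuous_on UNIV (\<lambda>(x, y). h y x)"
proof -
  have "continuous_on A (\<lambda>y. (\<lambda>(x, y). h x y) (x, y))" "continuous_on A (\<lambda>x. (\<lambda>(x, y). h x y) (x, y))"
    "continuous_on UNIV (\<lambda>p. (\<lambda>(x, y). h x y) (snd p, fst p))"
    by (rule continuous_on_compose2[OF assms]; auto intro!: continuous_intros)+
  then show "continuous_on A (\<lambda>y. h x y)" "continuous_on A (\<lambda>x. h x y)"
    "continuous_on UNIV (\<lambda>(x, y). h y x)" by (simp_all add: case_prod_unfold)
qed

lemma set_lebesgue_integral_continuous_Icc:
  fixes f :: "real \<Rightarrow> complex"
  assumes "continuous_on {a..b} f"
  shows "(LINT x:{a..b}|lebesgue. f x) = integral {a..b} f"
  by (rule set_lebesgue_integral_eq_integral(2)[OF absolutely_integrable_continuous_real[OF assms]])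

lemma fcoeff_eq_fc:
  assumes "continuous_on UNIV (\<lambda>(x, y). f x y z)"
  shows "fcoeff f k z = fc k (\<lambda>x y. f x y z)"
proof -
  let ?h = "\<lambda>x y. f x y z * cis (- phase k x y)"
  have c: "continuous_on A (\<lambda>(x, y). ?h x y)" for A by (rule fc_integrand_continuous[OF assms])
  have c1: "continuous_on A (\<lambda>y. ?h x y)" for A x
    using continuous_on_slices(1)[OF c] .
  have inner: "(LINT y:{0..2*pi}|lebesgue. ?h x y) = integral {0..2*pi} (?h x)" for x
    by (rule set_lebesgue_integral_continuous_Icc[OF c1])
  have c2: "continuous_on {0..2*pi} (\<lambda>x. integral {0..2*pi} (?h x))"
    using integral_continuous_on_param[of "{0..2*pi}" 0 "2*pi" ?h] c by simp
  have "(LINT x:{0..2*pi}|lebesgue. LINT y:{0..2*pi}|lebesgue. ?h x y)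
      = (LINT x:{0..2*pi}|lebesgue. integral {0..2*pi} (?h x))" by (simp only: inner)
  also have "\<dots> = integral {0..2*pi} (\<lambda>x. integral {0..2*pi} (?h x))"
    by (rule set_lebesgue_integral_continuous_Icc[OF c2])
  also have "\<dots> = integral (cbox (0, 0) (2*pi, 2*pi)) (\<lambda>(x, y). ?h x y)"
    using integral_prod_continuous[OF c, of 0 0 "2*pi" "2*pi"] by simp
  finally show ?thesis unfolding fcoeff_def fc_def by simp
qed

lemma fc_continuous:
  fixes g :: "'a::topological_space \<Rightarrow> real \<Rightarrow> real \<Rightarrow> complex"
  assumes "continuous_on (A \<times> UNIV) (\<lambda>(p, x, y). g p x y)"
  shows "continuous_on A (\<lambda>p. fc k (g p))"
proof -
  have "continuous_on (A \<times> cbox (0, 0) (2*pi, 2*pi))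
     (\<lambda>r. (case r of (p, x, y) \<Rightarrow> g p x y) * cis (- phase k (fst (snd r)) (snd (snd r))))"
    by (intro continuous_intros continuous_on_subset[OF assms]) auto
  then have "continuous_on (A \<times> cbox (0, 0) (2*pi, 2*pi))
     (\<lambda>(p, q). (\<lambda>(x, y). g p x y * cis (- phase k x y)) q)"
    by (simp add: case_prod_unfold)
  from integral_continuous_on_param[OF this] show ?thesis
    unfolding fc_def by (intro continuous_intros) auto
qed

lemma fc_has_vector_derivative:
  assumes A: "convex A" "open A" "r0 \<in> A"
    and der: "\<And>r x y. r \<in> A \<Longrightarrow> ((\<lambda>r. g r x y) has_vector_derivative g' r x y) (at r)"
    and c': "continuous_on (A \<times> UNIV) (\<lambda>(r, x, y). g' r x y)"
    and c: "\<And>r. r \<in> A \<Longrightarrow> continuous_on UNIV (\<lambda>(x, y). g r x y)"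
  shows "((\<lambda>r. fc k (g r)) has_vector_derivative fc k (g' r0)) (at r0)"
proof -
  let ?B = "cbox (0, 0) (2*pi, 2*pi)"
  have "((\<lambda>r. integral ?B (\<lambda>(x, y). g r x y * cis (- phase k x y))) has_vector_derivative
      integral ?B (\<lambda>(x, y). g' r0 x y * cis (- phase k x y))) (at r0 within A)"
  proof (rule leibniz_rule_vector_derivative)
    show "((\<lambda>r. (case t of (x, y) \<Rightarrow> g r x y * cis (- phase k x y))) has_vector_derivative
        (case t of (x, y) \<Rightarrow> g' r x y * cis (- phase k x y))) (at r within A)" if "r \<in> A" for r t
      unfolding case_prod_unfold
      by (intro has_vector_derivative_mult_left has_vector_derivative_at_within[OF der[OF that]])
    show "(\<lambda>(x, y). g r x y * cis (- phase k x y)) integrable_on ?B" if "r \<in> A" for r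
      by (intro integrable_continuous fc_integrand_continuous c that)
    have "continuous_on (A \<times> ?B)
       (\<lambda>r. (case r of (p, x, y) \<Rightarrow> g' p x y) * cis (- phase k (fst (snd r)) (snd (snd r))))"
      by (intro continuous_intros continuous_on_subset[OF c']) auto
    then show "continuous_on (A \<times> ?B) (\<lambda>(r, t). case t of (x, y) \<Rightarrow> g' r x y * cis (- phase k x y))"
      by (simp add: case_prod_unfold)
  qed (use A in auto)
  then have "((\<lambda>r. integral ?B (\<lambda>(x, y). g r x y * cis (- phase k x y))) has_vector_derivative
      integral ?B (\<lambda>(x, y). g' r0 x y * cis (- phase k x y))) (at r0)"
    using at_within_open[OF A(3,2)] by simp
  then have "((\<lambda>r. integral ?B (\<lambda>(x, y). g r x y * cis (- phase k x y)) / (4 * pi\<^sup>2)) has_vector_derivative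
      integral ?B (\<lambda>(x, y). g' r0 x y * cis (- phase k x y)) / (4 * pi\<^sup>2)) (at r0)"
    by (rule has_vector_derivative_divide)
  then show ?thesis unfolding fc_def .
qed

lemma fc_linear:
  assumes "continuous_on UNIV (\<lambda>(x, y). f x y)" "continuous_on UNIV (\<lambda>(x, y). g x y)"
  shows "fc k (\<lambda>x y. a * f x y + b * g x y) = a * fc k f + b * fc k g"
proof -
  let ?B = "cbox (0, 0) (2*pi, 2*pi)"
  have i: "(\<lambda>(x, y). f x y * cis (- phase k x y)) integrable_on ?B"
    "(\<lambda>(x, y). g x y * cis (- phase k x y)) integrable_on ?B"
    by (intro integrable_continuous fc_integrand_continuous assms)+
  have "integral ?B (\<lambda>(x, y). (a * f x y + b * g x y) * cis (- phase k x y)) =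
     integral ?B (\<lambda>p. a * (case p of (x, y) \<Rightarrow> f x y * cis (- phase k x y)) + b * (case p of (x, y) \<Rightarrow> g x y * cis (- phase k x y)))"
    by (rule integral_cong) (auto simp: algebra_simps)
  also have "\<dots> = a * integral ?B (\<lambda>(x, y). f x y * cis (- phase k x y))
      + b * integral ?B (\<lambda>(x, y). g x y * cis (- phase k x y))"
    using i by (subst integral_add) (auto intro: integrable_on_mult_right)
  finally show ?thesis unfolding fc_def by (simp add: add_divide_distrib)
qed

text \<open>Integration by parts in x; the boundary terms cancel because both g and the exponential
  are periodic.\<close>

lemma fc_deriv_x:
  assumes der: "\<And>x y. ((\<lambda>x. g x y) has_vector_derivative g' x y) (at x)"
    and c: "continuous_on UNIV (\<lambda>(x, y). g x y)" and c': "continuous_on UNIV (\<lambda>(x, y). g' x y)"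
    and per: "\<And>x y. g (x + 2 * pi) y = g x y"
  shows "fc k g' = \<i> * of_int (fst k) * fc k g"
proof -
  let ?e = "\<lambda>x y. cis (- phase k x y)"
  have cc: "continuous_on A (\<lambda>(x, y). g x y * ?e x y)" "continuous_on A (\<lambda>(x, y). g' x y * ?e x y)" for A
    by (intro fc_integrand_continuous c c')+
  have c1: "continuous_on A (\<lambda>x. g x y * ?e x y)" "continuous_on A (\<lambda>x. g' x y * ?e x y)" for A y
    using continuous_on_slices(2)[OF cc(1)] continuous_on_slices(2)[OF cc(2)] by blast+
  have swap: "integral (cbox (0, 0) (2*pi, 2*pi)) (\<lambda>(x, y). h x y * ?e x y)
     = integral {0..2*pi} (\<lambda>y. integral {0..2*pi} (\<lambda>x. h x y * ?e x y))"
    if "continuous_on (cbox (0, 0) (2*pi, 2*pi)) (\<lambda>(x, y). h x y * ?e x y)" for h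
    using integral_prod_continuous[OF that] integral_swap_continuous[OF that] by simp
  have inner: "integral {0..2*pi} (\<lambda>x. g' x y * ?e x y) = \<i> * of_int (fst k) * integral {0..2*pi} (\<lambda>x. g x y * ?e x y)" for y
  proof -
    have dc: "((\<lambda>x. ?e x y) has_vector_derivative (- \<i> * of_int (fst k)) * ?e x y) (at x)" for x
    proof -
      have "((\<lambda>x. - phase k x y) has_vector_derivative - of_int (fst k)) (at x)"
        unfolding phase_def by (auto intro!: derivative_eq_intros)
      from has_derivative_cis[OF this[unfolded has_vector_derivative_def]]
      show ?thesis unfolding has_vector_derivative_def
        by (rule has_derivative_eq_rhs) (auto simp: scaleR_conv_of_real)
    qed
    have "((\<lambda>x. g' x y * ?e x y + g x y * ((- \<i> * of_int (fst k)) * ?e x y)) has_integral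
       g (2*pi) y * ?e (2*pi) y - g 0 y * ?e 0 y) {0..2*pi}"
    proof (rule fundamental_theorem_of_calculus)
      fix x
      have "((\<lambda>x. g x y * ?e x y) has_vector_derivative g x y * ((- \<i> * of_int (fst k)) * ?e x y) + g' x y * ?e x y) (at x)"
        by (rule has_vector_derivative_mult[OF der dc])
      then show "((\<lambda>x. g x y * ?e x y) has_vector_derivative g' x y * ?e x y + g x y * ((- \<i> * of_int (fst k)) * ?e x y)) (at x within {0..2*pi})"
        by (simp add: add.commute has_vector_derivative_at_within)
    qed auto
    moreover have "?e (2*pi) y = ?e 0 y"
    proof -
      have "?e (2*pi) y = cis (- (of_int (fst k) * (2*pi))) * ?e 0 y" by (simp add: phase_def cis_mult)
      also have "cis (- (of_int (fst k) * (2*pi))) = 1"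
        using cis_multiple_2pi[of "- of_int (fst k)"] by (simp add: mult_ac)
      finally show ?thesis by simp
    qed
    moreover have "g (2*pi) y = g 0 y" using per[of 0 y] by simp
    ultimately have "((\<lambda>x. g' x y * ?e x y + (- \<i> * of_int (fst k)) * (g x y * ?e x y)) has_integral 0) {0..2*pi}"
      by (simp add: mult_ac)
    then have "0 = integral {0..2*pi} (\<lambda>x. g' x y * ?e x y + (- \<i> * of_int (fst k)) * (g x y * ?e x y))"
      by (rule integral_unique[symmetric])
    also have "\<dots> = integral {0..2*pi} (\<lambda>x. g' x y * ?e x y) + (- \<i> * of_int (fst k)) * integral {0..2*pi} (\<lambda>x. g x y * ?e x y)"
      by (subst integral_add) (auto intro!: integrable_continuous_real continuous_intros c1)
    finally show ?thesis by (simp add: algebra_simps add_eq_0_iff2)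
  qed
  have "integral (cbox (0, 0) (2*pi, 2*pi)) (\<lambda>(x, y). g' x y * ?e x y)
      = \<i> * of_int (fst k) * integral (cbox (0, 0) (2*pi, 2*pi)) (\<lambda>(x, y). g x y * ?e x y)"
    unfolding swap[OF cc(1)] swap[OF cc(2)] inner by simp
  then show ?thesis unfolding fc_def by simp
qed

lemma fc_swap:
  assumes c: "continuous_on UNIV (\<lambda>(x, y). g x y)"
  shows "fc k g = fc (prod.swap k) (\<lambda>x y. g y x)"
proof -
  have cc: "continuous_on A (\<lambda>(x, y). g x y * cis (- phase k x y))" for A by (rule fc_integrand_continuous[OF c])
  note c2 = continuous_on_slices(3)[OF c]
  have cc2: "continuous_on A (\<lambda>(x, y). g y x * cis (- phase (prod.swap k) x y))" for A
    by (rule fc_integrand_continuous[OF c2])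
  have ph: "phase (prod.swap k) x y = phase k y x" for x y by (simp add: phase_def)
  have "integral (cbox (0, 0) (2*pi, 2*pi)) (\<lambda>(x, y). g x y * cis (- phase k x y)) =
      integral (cbox (0, 0) (2*pi, 2*pi)) (\<lambda>(x, y). g y x * cis (- phase (prod.swap k) x y))"
    unfolding ph integral_prod_continuous[OF cc] integral_prod_continuous[OF cc2[unfolded ph]] prod.case
    by (rule integral_swap_continuous[OF cc])
  then show ?thesis unfolding fc_def by simp
qed

lemma fc_deriv_y:
  assumes der: "\<And>x y. ((\<lambda>y. g x y) has_vector_derivative g' x y) (at y)"
    and c: "continuous_on UNIV (\<lambda>(x, y). g x y)" and c': "continuous_on UNIV (\<lambda>(x, y). g' x y)"
    and per: "\<And>x y. g x (y + 2 * pi) = g x y"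
  shows "fc k g' = \<i> * of_int (snd k) * fc k g"
proof -
  have "fc (prod.swap k) (\<lambda>x y. g' y x) = \<i> * of_int (fst (prod.swap k)) * fc (prod.swap k) (\<lambda>x y. g y x)"
    by (rule fc_deriv_x) (use der continuous_on_slices(3)[OF c] continuous_on_slices(3)[OF c'] per in auto)
  then show ?thesis by (simp add: fc_swap[OF c] fc_swap[OF c'])
qed

section \<open>Fourier modes of the velocity and of the equations\<close>

lemma cont4_slices:
  assumes "cont4 ({s<..<S} \<times> UNIV \<times> UNIV \<times> {0<..}) h"
  shows "continuous_on (({s<..<S} \<times> {0<..}) \<times> UNIV) (\<lambda>(p, x, y). h (fst p) x y (snd p))"
    and "0 < z \<Longrightarrow> continuous_on ({s<..<S} \<times> UNIV) (\<lambda>(t, x, y). h t x y z)"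
    and "t \<in> {s<..<S} \<Longrightarrow> continuous_on ({0<..} \<times> UNIV) (\<lambda>(z, x, y). h t x y z)"
    and "t \<in> {s<..<S} \<Longrightarrow> 0 < z \<Longrightarrow> continuous_on UNIV (\<lambda>(x, y). h t x y z)"
proof -
  have c: "continuous_on ({s<..<S} \<times> UNIV \<times> UNIV \<times> {0<..}) (\<lambda>(t, x, y, z). h t x y z)"
    using assms by (simp add: cont4_def)
  have "continuous_on (({s<..<S} \<times> {0<..}) \<times> UNIV)
     (\<lambda>q. (\<lambda>(t, x, y, z). h t x y z) (fst (fst q), fst (snd q), snd (snd q), snd (fst q)))"
    by (rule continuous_on_compose2[OF c]) (auto intro!: continuous_intros)
  then show "continuous_on (({s<..<S} \<times> {0<..}) \<times> UNIV) (\<lambda>(p, x, y). h (fst p) x y (snd p))"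
    by (simp add: case_prod_unfold)
  have "continuous_on ({s<..<S} \<times> UNIV)
     (\<lambda>q. (\<lambda>(t, x, y, z). h t x y z) (fst q, fst (snd q), snd (snd q), z))" if "0 < z"
    by (rule continuous_on_compose2[OF c]) (use that in \<open>auto intro!: continuous_intros\<close>)
  then show "0 < z \<Longrightarrow> continuous_on ({s<..<S} \<times> UNIV) (\<lambda>(t, x, y). h t x y z)"
    by (simp add: case_prod_unfold)
  have "continuous_on ({0<..} \<times> UNIV)
     (\<lambda>q. (\<lambda>(t, x, y, z). h t x y z) (t, fst (snd q), snd (snd q), fst q))" if "t \<in> {s<..<S}"
    by (rule continuous_on_compose2[OF c]) (use that in \<open>auto intro!: continuous_intros\<close>)
  then show "t \<in> {s<..<S} \<Longrightarrow> continuous_on ({0<..} \<times> UNIV) (\<lambda>(z, x, y). h t x y z)"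
    by (simp add: case_prod_unfold)
  have "continuous_on UNIV
     (\<lambda>q. (\<lambda>(t, x, y, z). h t x y z) (t, fst q, snd q, z))" if "t \<in> {s<..<S}" "0 < z"
    by (rule continuous_on_compose2[OF c]) (use that in \<open>auto intro!: continuous_intros\<close>)
  then show "t \<in> {s<..<S} \<Longrightarrow> 0 < z \<Longrightarrow> continuous_on UNIV (\<lambda>(x, y). h t x y z)"
    by (simp add: case_prod_unfold)
qed

lemma velocity_modes:
  fixes u :: flow and k s S
  defines "Q \<equiv> {s<..<S} \<times> UNIV \<times> UNIV \<times> {0<..}"
  assumes rv: "regular_velocity Q u" and c: "cont4 Q u"
  shows "t \<in> {s<..<S} \<Longrightarrow> 0 < z \<Longrightarrow>
      ((\<lambda>r. fcoeff (u r) k z) has_vector_derivative fc k (\<lambda>x y. D_t u t x y z)) (at t)"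
    and "t \<in> {s<..<S} \<Longrightarrow> 0 < z \<Longrightarrow>
      ((\<lambda>r. fcoeff (u t) k r) has_vector_derivative fc k (\<lambda>x y. D_z u t x y z)) (at z)"
    and "t \<in> {s<..<S} \<Longrightarrow> 0 < z \<Longrightarrow>
      ((\<lambda>r. fc k (\<lambda>x y. D_z u t x y r)) has_vector_derivative fc k (\<lambda>x y. D_z (D_z u) t x y z)) (at z)"
    and "continuous_on ({s<..<S} \<times> {0<..}) (\<lambda>(t, z). fcoeff (u t) k z)"
    and "continuous_on ({s<..<S} \<times> {0<..}) (\<lambda>(t, z). fc k (\<lambda>x y. D_t u t x y z))"
    and "continuous_on ({s<..<S} \<times> {0<..}) (\<lambda>(t, z). fc k (\<lambda>x y. D_z (D_z u) t x y z))"
proof -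
  have ct: "cont4 Q (D_t u)" "cont4 Q (D_z u)" "cont4 Q (D_z (D_z u))"
    and dt: "((\<lambda>r. u r x y z) has_vector_derivative D_t u t x y z) (at t)"
    and dz: "((\<lambda>r. u t x y r) has_vector_derivative D_z u t x y z) (at z)"
    and dzz: "((\<lambda>r. D_z u t x y r) has_vector_derivative D_z (D_z u) t x y z) (at z)"
    if "t \<in> {s<..<S}" "0 < z" for t x y z
    using rv that unfolding regular_velocity_def Q_def D_t_def D_z_def
    by (auto simp: vector_derivative_works)
  have ct: "cont4 Q (D_t u)" "cont4 Q (D_z u)" "cont4 Q (D_z (D_z u))"
    using rv unfolding regular_velocity_def by auto
  note sl = cont4_slices[OF c[unfolded Q_def]] and slt = cont4_slices[OF ct(1)[unfolded Q_def]]
    and slz = cont4_slices[OF ct(2)[unfolded Q_def]] and slzz = cont4_slices[OF ct(3)[unfolded Q_def]]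
  have eq: "fcoeff (u t) k z = fc k (\<lambda>x y. u t x y z)" if "t \<in> {s<..<S}" "0 < z" for t z
    using sl(4)[OF that] by (rule fcoeff_eq_fc)
  show "((\<lambda>r. fcoeff (u r) k z) has_vector_derivative fc k (\<lambda>x y. D_t u t x y z)) (at t)"
    if t: "t \<in> {s<..<S}" and z: "0 < z"
  proof -
    have "((\<lambda>r. fc k (\<lambda>x y. u r x y z)) has_vector_derivative fc k (\<lambda>x y. D_t u t x y z)) (at t)"
      by (rule fc_has_vector_derivative[where A = "{s<..<S}"])
         (use t z dt slt(2)[OF z] sl(4) in auto)
    then show ?thesis
      by (rule has_vector_derivative_transform_within_open[of _ _ _ "{s<..<S}"]) (use t z eq in auto)
  qed
  show "((\<lambda>r. fcoeff (u t) k r) has_vector_derivative fc k (\<lambda>x y. D_z u t x y z)) (at z)"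
    if t: "t \<in> {s<..<S}" and z: "0 < z"
  proof -
    have "((\<lambda>r. fc k (\<lambda>x y. u t x y r)) has_vector_derivative fc k (\<lambda>x y. D_z u t x y z)) (at z)"
      by (rule fc_has_vector_derivative[where A = "{0<..}"])
         (use t z dz slz(3)[OF t] sl(4) in auto)
    then show ?thesis
      by (rule has_vector_derivative_transform_within_open[of _ _ _ "{0<..}"]) (use t z eq in auto)
  qed
  show "((\<lambda>r. fc k (\<lambda>x y. D_z u t x y r)) has_vector_derivative fc k (\<lambda>x y. D_z (D_z u) t x y z)) (at z)"
    if t: "t \<in> {s<..<S}" and z: "0 < z"
    by (rule fc_has_vector_derivative[where A = "{0<..}"])
       (use t z dzz slzz(3)[OF t] slz(4) in auto)
  have "continuous_on ({s<..<S} \<times> {0<..}) (\<lambda>p. fc k (\<lambda>x y. u (fst p) x y (snd p)))"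
    by (rule fc_continuous[OF sl(1)])
  then show "continuous_on ({s<..<S} \<times> {0<..}) (\<lambda>(t, z). fcoeff (u t) k z)"
    by (rule continuous_on_eq) (auto simp: eq)
  show "continuous_on ({s<..<S} \<times> {0<..}) (\<lambda>(t, z). fc k (\<lambda>x y. D_t u t x y z))"
    using fc_continuous[OF slt(1), of k] by (simp add: case_prod_unfold)
  show "continuous_on ({s<..<S} \<times> {0<..}) (\<lambda>(t, z). fc k (\<lambda>x y. D_z (D_z u) t x y z))"
    using fc_continuous[OF slzz(1), of k] by (simp add: case_prod_unfold)
qed

lemma fc_sum4:
  assumes "continuous_on UNIV (\<lambda>(x, y). f1 x y)" "continuous_on UNIV (\<lambda>(x, y). f2 x y)"
    "continuous_on UNIV (\<lambda>(x, y). f3 x y)" "continuous_on UNIV (\<lambda>(x, y). f4 x y)"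
  shows "fc k (\<lambda>x y. c1 * f1 x y + c2 * f2 x y + c3 * f3 x y + c4 * f4 x y)
     = c1 * fc k f1 + c2 * fc k f2 + c3 * fc k f3 + c4 * fc k f4"
proof -
  have c: "continuous_on UNIV (\<lambda>(x, y). a * f x y + b * g x y)"
    if "continuous_on UNIV (\<lambda>(x, y). f x y)" "continuous_on UNIV (\<lambda>(x, y). g x y)"
    for f g :: "real \<Rightarrow> real \<Rightarrow> complex" and a b
    using that unfolding case_prod_unfold by (intro continuous_intros)
  have "fc k (\<lambda>x y. c1 * f1 x y + c2 * f2 x y + c3 * f3 x y + c4 * f4 x y)
    = fc k (\<lambda>x y. 1 * (c1 * f1 x y + c2 * f2 x y) + 1 * (c3 * f3 x y + c4 * f4 x y))"
    by (simp add: add.assoc)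
  also have "\<dots> = 1 * fc k (\<lambda>x y. c1 * f1 x y + c2 * f2 x y) + 1 * fc k (\<lambda>x y. c3 * f3 x y + c4 * f4 x y)"
    by (rule fc_linear) (intro c assms)+
  also have "fc k (\<lambda>x y. c1 * f1 x y + c2 * f2 x y) = c1 * fc k f1 + c2 * fc k f2"
    by (rule fc_linear) (intro assms)+
  also have "fc k (\<lambda>x y. c3 * f3 x y + c4 * f4 x y) = c3 * fc k f3 + c4 * fc k f4"
    by (rule fc_linear) (intro assms)+
  finally show ?thesis by (simp add: add.assoc)
qed

lemma momentum_mode:
  fixes u w :: flow and k s S
  defines "Q \<equiv> {s<..<S} \<times> UNIV \<times> UNIV \<times> {0<..}"
  assumes rv: "regular_velocity Q u" and c: "cont4 Q u" and cw: "cont4 Q w"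
    and per: "periodic_xy (u t)" and t: "t \<in> {s<..<S}" and z: "0 < z"
    and eq: "\<And>x y. D_t u t x y z + (of_real U * D_x u t x y z + of_real V * D_y u t x y z)
       + w t x y z * of_real U' - D_z (D_z u) t x y z = 0"
  shows "fc k (\<lambda>x y. D_t u t x y z) = - (\<i> * of_real (of_int (fst k) * U + of_int (snd k) * V)) * fcoeff (u t) k z
       - of_real U' * fcoeff (w t) k z + fc k (\<lambda>x y. D_z (D_z u) t x y z)"
    and "fc k (\<lambda>x y. D_x u t x y z) = \<i> * of_int (fst k) * fcoeff (u t) k z"
    and "fc k (\<lambda>x y. D_y u t x y z) = \<i> * of_int (snd k) * fcoeff (u t) k z"
proof -
  have cs: "cont4 Q (D_x u)" "cont4 Q (D_y u)" "cont4 Q (D_z (D_z u))"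
    using rv unfolding regular_velocity_def by auto
  have dx: "((\<lambda>r. u t r y z) has_vector_derivative D_x u t x y z) (at x)"
    and dy: "((\<lambda>r. u t x r z) has_vector_derivative D_y u t x y z) (at y)" for x y
    using rv t z unfolding regular_velocity_def Q_def D_x_def D_y_def
    by (auto simp: vector_derivative_works)
  note s0 = cont4_slices(4)[OF c[unfolded Q_def] t z] and sw = cont4_slices(4)[OF cw[unfolded Q_def] t z]
    and sx = cont4_slices(4)[OF cs(1)[unfolded Q_def] t z] and sy = cont4_slices(4)[OF cs(2)[unfolded Q_def] t z]
    and szz = cont4_slices(4)[OF cs(3)[unfolded Q_def] t z]
  have e: "fcoeff (u t) k z = fc k (\<lambda>x y. u t x y z)" "fcoeff (w t) k z = fc k (\<lambda>x y. w t x y z)"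
    using s0 sw by (auto intro: fcoeff_eq_fc)
  show X: "fc k (\<lambda>x y. D_x u t x y z) = \<i> * of_int (fst k) * fcoeff (u t) k z"
    unfolding e by (rule fc_deriv_x[OF dx s0 sx]) (use per z in \<open>simp add: periodic_xy_def\<close>)
  show Y: "fc k (\<lambda>x y. D_y u t x y z) = \<i> * of_int (snd k) * fcoeff (u t) k z"
    unfolding e by (rule fc_deriv_y[OF dy s0 sy]) (use per z in \<open>simp add: periodic_xy_def\<close>)
  have "(\<lambda>x y. D_t u t x y z) = (\<lambda>x y. (- of_real U) * D_x u t x y z + (- of_real V) * D_y u t x y z
      + (- of_real U') * w t x y z + 1 * D_z (D_z u) t x y z)"
    using eq by (auto simp: fun_eq_iff algebra_simps add_eq_0_iff2 eq_neg_iff_add_eq_0)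
  then have "fc k (\<lambda>x y. D_t u t x y z) = fc k (\<lambda>x y. (- of_real U) * D_x u t x y z + (- of_real V) * D_y u t x y z
      + (- of_real U') * w t x y z + 1 * D_z (D_z u) t x y z)" by simp
  also have "\<dots> = (- of_real U) * fc k (\<lambda>x y. D_x u t x y z) + (- of_real V) * fc k (\<lambda>x y. D_y u t x y z)
      + (- of_real U') * fc k (\<lambda>x y. w t x y z) + 1 * fc k (\<lambda>x y. D_z (D_z u) t x y z)"
    by (rule fc_sum4[OF sx sy sw szz])
  finally show "fc k (\<lambda>x y. D_t u t x y z) = - (\<i> * of_real (of_int (fst k) * U + of_int (snd k) * V)) * fcoeff (u t) k z
       - of_real U' * fcoeff (w t) k z + fc k (\<lambda>x y. D_z (D_z u) t x y z)"
    unfolding X Y e by (simp add: algebra_simps)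
qed

text \<open>On the wave vector n (p, q) transport and divergence see the same combination: transport
  multiplies by i n (p us + q vs), and the tangential divergence of the mode is i n
  \<open>\<phi>\<close>. The mode therefore closes as a two-dimensional linearized Prandtl system
  with shear p us + q vs.\<close>

lemma prandtl_mode_equations:
  fixes p q n :: int
  assumes lp: "linearized_prandtl us vs s S u v w"
    and Q: "Q = {s<..<S} \<times> {0<..}" and k: "k = (n * p, n * q)"
    and \<phi>: "\<phi> = (\<lambda>t z. of_int p * fcoeff (u t) k z + of_int q * fcoeff (v t) k z)"
  obtains \<phi>t \<phi>z \<phi>zz where
    "continuous_on Q (\<lambda>(t, z). \<phi> t z)" "continuous_on Q (\<lambda>(t, z). \<phi>t t z)" "continuous_on Q (\<lambda>(t, z). \<phi>zz t z)"
    "\<And>t z. (t, z) \<in> Q \<Longrightarrow> ((\<lambda>r. \<phi> r z) has_vector_derivative \<phi>t t z) (at t)"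
    "\<And>t z. (t, z) \<in> Q \<Longrightarrow> ((\<lambda>r. \<phi> t r) has_vector_derivative \<phi>z t z) (at z)"
    "\<And>t z. (t, z) \<in> Q \<Longrightarrow> ((\<lambda>r. \<phi>z t r) has_vector_derivative \<phi>zz t z) (at z)"
    "\<And>t z. (t, z) \<in> Q \<Longrightarrow> ((\<lambda>r. fcoeff (w t) k r) has_vector_derivative - (\<i> * of_int n * \<phi> t z)) (at z)"
    "\<And>t z. (t, z) \<in> Q \<Longrightarrow> \<phi>t t z = - (\<i> * of_int n * of_real (of_int p * us t z + of_int q * vs t z) * \<phi> t z)
       - of_real (of_int p * deriv (us t) z + of_int q * deriv (vs t) z) * fcoeff (w t) k z + \<phi>zz t z"
proof -
  define R where "R = {s<..<S} \<times> (UNIV :: real set) \<times> (UNIV :: real set) \<times> {0::real<..}"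
  have reg: "cont4 R u" "cont4 R v" "cont4 R w" "regular_velocity R u" "regular_velocity R v" "regular_normal R w"
    and per: "\<And>t. t \<in> {s<..<S} \<Longrightarrow> periodic_xy (u t)" "\<And>t. t \<in> {s<..<S} \<Longrightarrow> periodic_xy (v t)"
    and eqs: "\<And>t x y z. t \<in> {s<..<S} \<Longrightarrow> 0 < z \<Longrightarrow>
           D_t u t x y z + (of_real (us t z) * D_x u t x y z + of_real (vs t z) * D_y u t x y z)
             + w t x y z * of_real (deriv (us t) z) - D_z (D_z u) t x y z = 0"
       "\<And>t x y z. t \<in> {s<..<S} \<Longrightarrow> 0 < z \<Longrightarrow>
           D_t v t x y z + (of_real (us t z) * D_x v t x y z + of_real (vs t z) * D_y v t x y z)
             + w t x y z * of_real (deriv (vs t) z) - D_z (D_z v) t x y z = 0"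
       "\<And>t x y z. t \<in> {s<..<S} \<Longrightarrow> 0 < z \<Longrightarrow> D_x u t x y z + D_y v t x y z + D_z w t x y z = 0"
  proof -
    have "R \<subseteq> {s<..<S} \<times> UNIV \<times> UNIV \<times> {0..}" by (auto simp: R_def)
    then show "cont4 R u" "cont4 R v" "cont4 R w"
      using lp unfolding linearized_prandtl_def Let_def cont4_def by (auto intro: continuous_on_subset)
  qed (use lp in \<open>auto simp: linearized_prandtl_def Let_def R_def\<close>)
  note mu = velocity_modes[OF reg(4,1)[unfolded R_def], where k = k] and mv = velocity_modes[OF reg(5,2)[unfolded R_def], where k = k]
  note eu = momentum_mode[OF reg(4,1,3)[unfolded R_def] per(1) _ _ eqs(1), where k = k]
    and ev = momentum_mode[OF reg(5,2,3)[unfolded R_def] per(2) _ _ eqs(2), where k = k]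
  show ?thesis
  proof (rule that[of "\<lambda>t z. of_int p * fc k (\<lambda>x y. D_t u t x y z) + of_int q * fc k (\<lambda>x y. D_t v t x y z)"
        "\<lambda>t z. of_int p * fc k (\<lambda>x y. D_z (D_z u) t x y z) + of_int q * fc k (\<lambda>x y. D_z (D_z v) t x y z)"
        "\<lambda>t z. of_int p * fc k (\<lambda>x y. D_z u t x y z) + of_int q * fc k (\<lambda>x y. D_z v t x y z)"])
    have lin: "continuous_on Q (\<lambda>(t, z). of_int p * f t z + of_int q * g t z)"
      if "continuous_on Q (\<lambda>(t, z). f t z)" "continuous_on Q (\<lambda>(t, z). g t z)" for f g :: "real \<Rightarrow> real \<Rightarrow> complex"
      using that unfolding case_prod_unfold by (intro continuous_intros)
    show "continuous_on Q (\<lambda>(t, z). \<phi> t z)" unfolding \<phi> by (rule lin; unfold Q; rule mu(4) mv(4))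
    show "continuous_on Q (\<lambda>(t, z). of_int p * fc k (\<lambda>x y. D_t u t x y z) + of_int q * fc k (\<lambda>x y. D_t v t x y z))"
      by (rule lin; unfold Q; rule mu(5) mv(5))
    show "continuous_on Q (\<lambda>(t, z). of_int p * fc k (\<lambda>x y. D_z (D_z u) t x y z) + of_int q * fc k (\<lambda>x y. D_z (D_z v) t x y z))"
      by (rule lin; unfold Q; rule mu(6) mv(6))
    have dlin: "((\<lambda>r. of_int p * f r + of_int q * g r) has_vector_derivative of_int p * f' + of_int q * g') F"
      if "(f has_vector_derivative f') F" "(g has_vector_derivative g') F" for f g :: "real \<Rightarrow> complex" and f' g' F
      by (intro has_vector_derivative_add has_vector_derivative_mult_right that)
    fix t z assume "(t, z) \<in> Q"
    then have t: "t \<in> {s<..<S}" and z: "0 < z" by (auto simp: Q)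
    show "((\<lambda>r. \<phi> r z) has_vector_derivative of_int p * fc k (\<lambda>x y. D_t u t x y z) + of_int q * fc k (\<lambda>x y. D_t v t x y z)) (at t)"
      unfolding \<phi> by (rule dlin; rule mu(1) mv(1); fact t z)
    show "((\<lambda>r. \<phi> t r) has_vector_derivative of_int p * fc k (\<lambda>x y. D_z u t x y z) + of_int q * fc k (\<lambda>x y. D_z v t x y z)) (at z)"
      unfolding \<phi> by (rule dlin; rule mu(2) mv(2); fact t z)
    show "((\<lambda>r. of_int p * fc k (\<lambda>x y. D_z u t x y r) + of_int q * fc k (\<lambda>x y. D_z v t x y r)) has_vector_derivative
        of_int p * fc k (\<lambda>x y. D_z (D_z u) t x y z) + of_int q * fc k (\<lambda>x y. D_z (D_z v) t x y z)) (at z)"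
      by (rule dlin; rule mu(3) mv(3); fact t z)
    show "of_int p * fc k (\<lambda>x y. D_t u t x y z) + of_int q * fc k (\<lambda>x y. D_t v t x y z)
       = - (\<i> * of_int n * of_real (of_int p * us t z + of_int q * vs t z) * \<phi> t z)
       - of_real (of_int p * deriv (us t) z + of_int q * deriv (vs t) z) * fcoeff (w t) k z
       + (of_int p * fc k (\<lambda>x y. D_z (D_z u) t x y z) + of_int q * fc k (\<lambda>x y. D_z (D_z v) t x y z))"
      unfolding eu(1)[OF t t z t z] ev(1)[OF t t z t z] \<phi> by (simp add: k algebra_simps)
    have cw: "cont4 R (D_z w)" and dw: "((\<lambda>r. w t x y r) has_vector_derivative D_z w t x y z) (at z)"
      if "0 < z" for x y z
      using reg(6) t that unfolding regular_normal_def R_def D_z_def by (auto simp: vector_derivative_works)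
    have cw: "cont4 R (D_z w)" using reg(6) unfolding regular_normal_def by auto
    note sw = cont4_slices[OF reg(3)[unfolded R_def]] and swz = cont4_slices[OF cw[unfolded R_def]]
    have "((\<lambda>r. fc k (\<lambda>x y. w t x y r)) has_vector_derivative fc k (\<lambda>x y. D_z w t x y z)) (at z)"
      by (rule fc_has_vector_derivative[where A = "{0<..}"]) (use t z dw swz(3)[OF t] sw(4) in auto)
    then have "((\<lambda>r. fcoeff (w t) k r) has_vector_derivative fc k (\<lambda>x y. D_z w t x y z)) (at z)"
      by (rule has_vector_derivative_transform_within_open[of _ _ _ "{0<..}"])
         (use t z sw(4) in \<open>auto simp: fcoeff_eq_fc\<close>)
    moreover have "fc k (\<lambda>x y. D_z w t x y z) = - (\<i> * of_int n * \<phi> t z)"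
    proof -
      have cx: "cont4 R (D_x u)" "cont4 R (D_y v)" using reg(4,5) unfolding regular_velocity_def by auto
      note sx = cont4_slices(4)[OF cx(1)[unfolded R_def] t z] and sy = cont4_slices(4)[OF cx(2)[unfolded R_def] t z]
      have "(\<lambda>x y. D_z w t x y z) = (\<lambda>x y. (- 1) * D_x u t x y z + (- 1) * D_y v t x y z)"
        using eqs(3)[OF t z] by (auto simp: fun_eq_iff algebra_simps eq_neg_iff_add_eq_0)
      then have "fc k (\<lambda>x y. D_z w t x y z) = (- 1) * fc k (\<lambda>x y. D_x u t x y z) + (- 1) * fc k (\<lambda>x y. D_y v t x y z)"
        using fc_linear[OF sx sy, of k "-1" "-1"] by simp
      then show ?thesis unfolding eu(2)[OF t t z t z] ev(3)[OF t t z t z] \<phi> by (simp add: k algebra_simps)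
    qed
    ultimately show "((\<lambda>r. fcoeff (w t) k r) has_vector_derivative - (\<i> * of_int n * \<phi> t z)) (at z)" by simp
  qed
qed

section \<open>Growth of a tested mode\<close>

text \<open>
  \<open>x0, \<dots>, x3\<close> are the derivatives of the truncation and \<open>u1, u2\<close> those of \<open>U\<close>; \<open>u20\<close> is \<open>U''\<close> at the
  critical point. All terms of the first line on the right vanish for an exact parabola, where
  \<open>U'\<^sup>2 = 4 a (U - U(z0))\<close>; the second line lives where the truncation is not constant and is
  exponentially small there.
\<close>

lemma residual_identity:
  fixes \<kappa> e x0 x1 x2 x3 u1 u2 u20 a v :: complex
  assumes "\<kappa> \<noteq> 0"
  shows "- 4 * a * \<kappa>\<^sup>2 * v * (e * (x0 - x1 / \<kappa>)) - 4 * a * \<kappa>\<^sup>2 * (- (e * x0 / \<kappa>)) - 2 * a * \<kappa> * (e * (x0 - x1 / \<kappa>))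
       + e * (\<kappa>\<^sup>2 * x0 - 3 * \<kappa> * x1 + 3 * x2 - x3 / \<kappa>) * u1\<^sup>2
       + e * (- \<kappa> * x0 + 2 * x1 - x2 / \<kappa>) * (2 * u2 - u20)
     = e * (x0 * (\<kappa>\<^sup>2 * (u1\<^sup>2 - 4 * a * v) - \<kappa> * (u2 - 2 * a) - \<kappa> * (u2 - u20)))
       + e * (4 * a * \<kappa> * v * x1 + 2 * a * x1 + u1\<^sup>2 * (- 3 * \<kappa> * x1 + 3 * x2 - x3 / \<kappa>)
          + (2 * u2 - u20) * (2 * x1 - x2 / \<kappa>))"
  using assms by (simp add: field_simps power2_eq_square)

text \<open>The terms with \<open>x0\<close> are bounded everywhere:
  \<open>k0 * W\<^sup>2 * E \<le> 1\<close> keeps the exponential below exp 2 although v may be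
  slightly negative. The terms with \<open>x1\<close>, \<open>x2\<close>, \<open>x3\<close> live on
  r/2 \<le> v \<le> r, where the exponential is at most exp(- k0 r / 2); the derivatives of the
  cutoff are absorbed there by \<open>r * D = 2\<close> and \<open>D \<le> k0\<close>.\<close>

lemma residual_bound:
  fixes \<kappa> :: complex and a v u1 u2 u20 W E r D C k0 x0 x1 x2 x3 :: real
  assumes pos: "0 < a" "0 < W" "0 \<le> E" "0 < k0" "1 \<le> C" and \<kappa>: "\<kappa> = Complex k0 k0"
    and r: "r = a * W\<^sup>2 / 2" and D: "D = 2 / r" "D \<le> k0" and E: "8 * E \<le> a" and kE: "k0 * W\<^sup>2 * E \<le> 1"
    and x: "\<bar>x0\<bar> \<le> C" "\<bar>x1\<bar> \<le> C * D" "\<bar>x2\<bar> \<le> C * D\<^sup>2" "\<bar>x3\<bar> \<le> C * D ^ 3"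
    and supp: "v < r / 2 \<or> r < v \<Longrightarrow> x1 = 0 \<and> x2 = 0 \<and> x3 = 0"
    and v: "- 2 * W\<^sup>2 * E \<le> v" and main: "\<bar>u1\<^sup>2 - 4 * a * v\<bar> \<le> 17 * a * W\<^sup>2 * E"
    and u1: "\<bar>u1\<bar> \<le> 3 * a * W" and u2: "\<bar>u2 - 2 * a\<bar> \<le> E" "\<bar>u20 - 2 * a\<bar> \<le> E"
  shows "norm (exp (- \<kappa> * v) * (x0 * (\<kappa>\<^sup>2 * (u1\<^sup>2 - 4 * a * v) - \<kappa> * (u2 - 2 * a) - \<kappa> * (u2 - u20)))
       + exp (- \<kappa> * v) * (4 * a * \<kappa> * v * x1 + 2 * a * x1 + u1\<^sup>2 * (- 3 * \<kappa> * x1 + 3 * x2 - x3 / \<kappa>)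
          + (2 * u2 - u20) * (2 * x1 - x2 / \<kappa>)))
     \<le> C * k0 * (exp 2 * (34 * a * k0 * W\<^sup>2 * E + 6 * E) + 400 * a * exp (- (k0 * r / 2)))"
proof -
  have K2: "(norm \<kappa>)\<^sup>2 = 2 * k0\<^sup>2" by (simp add: \<kappa> cmod_def)
  have K1: "norm \<kappa> \<le> 2 * k0"
    by (rule power2_le_imp_le) (use K2 pos in \<open>auto simp: power_mult_distrib\<close>)
  have K1': "k0 \<le> norm \<kappa>" using complex_Re_le_cmod[of \<kappa>] by (simp add: \<kappa>)
  have ne: "norm (exp (- \<kappa> * v)) = exp (- (k0 * v))" by (simp add: norm_exp_eq_Re \<kappa>)
  have r0: "r > 0" using pos by (simp add: r)
  have D0: "D > 0" using r0 by (simp add: D)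
  have u22: "\<bar>u2 - u20\<bar> \<le> 2 * E" "\<bar>2 * u2 - u20\<bar> \<le> 3 * a" using u2 E pos by linarith+
  have A: "norm (exp (- \<kappa> * v) * (x0 * (\<kappa>\<^sup>2 * (u1\<^sup>2 - 4 * a * v) - \<kappa> * (u2 - 2 * a) - \<kappa> * (u2 - u20))))
      \<le> exp 2 * (C * (2 * k0\<^sup>2 * (17 * a * W\<^sup>2 * E) + 2 * k0 * E + 2 * k0 * (2 * E)))"
  proof -
    have e2: "exp (- (k0 * v)) \<le> exp 2"
    proof -
      have "k0 * (- 2 * W\<^sup>2 * E) \<le> k0 * v" using pos v by (intro mult_left_mono) auto
      then have "- (k0 * v) \<le> 2" using kE by (simp add: mult_ac)
      then show ?thesis by simp
    qed
    have t1: "norm (\<kappa>\<^sup>2 * (u1\<^sup>2 - 4 * a * v)) \<le> 2 * k0\<^sup>2 * (17 * a * W\<^sup>2 * E)"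
    proof -
      have "norm (\<kappa>\<^sup>2 * (u1\<^sup>2 - 4 * a * v)) = 2 * k0\<^sup>2 * \<bar>u1\<^sup>2 - 4 * a * v\<bar>"
      proof -
        have "(complex_of_real u1)\<^sup>2 - 4 * a * v = of_real (u1\<^sup>2 - 4 * a * v)" by simp
        then show ?thesis using K2 by (simp only: norm_mult norm_power norm_of_real)
      qed
      also have "\<dots> \<le> 2 * k0\<^sup>2 * (17 * a * W\<^sup>2 * E)" using main by (intro mult_left_mono) auto
      finally show ?thesis .
    qed
    have t2: "norm (\<kappa> * (u2 - 2 * a)) \<le> 2 * k0 * E"
    proof -
      have "norm (\<kappa> * (u2 - 2 * a)) = norm \<kappa> * \<bar>u2 - 2 * a\<bar>"
      proof -
        have "complex_of_real u2 - 2 * a = of_real (u2 - 2 * a)" by simp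
        then show ?thesis by (simp only: norm_mult norm_of_real)
      qed
      also have "\<dots> \<le> 2 * k0 * E" using K1 u2 pos by (intro mult_mono) auto
      finally show ?thesis .
    qed
    have t3: "norm (\<kappa> * (u2 - u20)) \<le> 2 * k0 * (2 * E)"
    proof -
      have "norm (\<kappa> * (u2 - u20)) = norm \<kappa> * \<bar>u2 - u20\<bar>"
      proof -
        have "complex_of_real u2 - u20 = of_real (u2 - u20)" by simp
        then show ?thesis by (simp only: norm_mult norm_of_real)
      qed
      also have "\<dots> \<le> 2 * k0 * (2 * E)" using K1 u22 pos by (intro mult_mono) auto
      finally show ?thesis .
    qed
    have "norm (\<kappa>\<^sup>2 * (u1\<^sup>2 - 4 * a * v) - \<kappa> * (u2 - 2 * a) - \<kappa> * (u2 - u20))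
        \<le> 2 * k0\<^sup>2 * (17 * a * W\<^sup>2 * E) + 2 * k0 * E + 2 * k0 * (2 * E)"
      by (rule norm_triangle_le_diff[OF add_mono[OF norm_triangle_le_diff[OF add_mono[OF t1 t2]] t3]])
    then have "norm (x0 * (\<kappa>\<^sup>2 * (u1\<^sup>2 - 4 * a * v) - \<kappa> * (u2 - 2 * a) - \<kappa> * (u2 - u20)))
        \<le> C * (2 * k0\<^sup>2 * (17 * a * W\<^sup>2 * E) + 2 * k0 * E + 2 * k0 * (2 * E))"
      unfolding norm_mult using x(1) pos by (intro mult_mono) auto
    then show ?thesis unfolding norm_mult[of "exp _"] ne using e2 by (intro mult_mono) auto
  qed
  have B: "norm (exp (- \<kappa> * v) * (4 * a * \<kappa> * v * x1 + 2 * a * x1 + u1\<^sup>2 * (- 3 * \<kappa> * x1 + 3 * x2 - x3 / \<kappa>)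
          + (2 * u2 - u20) * (2 * x1 - x2 / \<kappa>)))
      \<le> exp (- (k0 * r / 2)) * (C * (400 * a * k0))"
  proof (cases "v < r / 2 \<or> r < v")
    case True
    then show ?thesis using supp pos by simp
  next
    case False
    then have vr: "r / 2 \<le> v" "v \<le> r" by auto
    have e2: "exp (- (k0 * v)) \<le> exp (- (k0 * r / 2))"
      using vr pos mult_left_mono[OF vr(1), of k0] by simp
    have rD: "r * D = 2" using r0 by (simp add: D)
    have b1: "norm (4 * a * \<kappa> * v * x1) \<le> C * (16 * a * k0)"
    proof -
      have "norm (4 * a * \<kappa> * v * x1) = 4 * a * norm \<kappa> * v * \<bar>x1\<bar>"
        using pos vr r0 by (simp add: norm_mult)
      also have "\<dots> \<le> 4 * a * (2 * k0) * r * (C * D)"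
        using pos vr r0 K1 x D0 by (intro mult_mono) auto
      also have "\<dots> = 8 * a * k0 * C * (r * D)" by simp
      finally show ?thesis unfolding rD by (simp add: mult_ac)
    qed
    have b2: "norm (2 * a * x1 :: complex) \<le> C * (2 * a * k0)"
    proof -
      have "norm (2 * a * x1 :: complex) = 2 * a * \<bar>x1\<bar>" using pos by (simp add: norm_mult)
      also have "\<dots> \<le> 2 * a * (C * k0)" using pos x(2) D mult_left_mono[OF D(2), of C] by (intro mult_left_mono) auto
      finally show ?thesis by (simp add: mult_ac)
    qed
    have d2: "\<bar>x2\<bar> \<le> C * D * k0" "\<bar>x3\<bar> \<le> C * D * k0 * k0"
    proof -
      have "C * D\<^sup>2 \<le> C * D * k0" using mult_left_mono[OF D(2), of "C * D"] D0 pos by (simp add: power2_eq_square mult.assoc)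
      then show "\<bar>x2\<bar> \<le> C * D * k0" using x(3) by linarith
      have "D * D \<le> k0 * k0" using D0 D(2) pos by (intro mult_mono) auto
      then have "C * D * (D * D) \<le> C * D * (k0 * k0)" using D0 pos by (intro mult_left_mono) auto
      then show "\<bar>x3\<bar> \<le> C * D * k0 * k0" using x(4) by (simp add: power3_eq_cube mult_ac)
    qed
    have dv: "norm (of_real y / \<kappa>) \<le> \<bar>y\<bar> / k0" for y
      unfolding norm_divide using K1' pos by (simp add: frac_le)
    have b3: "norm (- 3 * \<kappa> * x1 + 3 * x2 - x3 / \<kappa>) \<le> 10 * C * D * k0"
    proof -
      have "norm (- 3 * \<kappa> * x1) \<le> 6 * C * D * k0"
      proof -
        have "norm (- 3 * \<kappa> * x1) = 3 * (norm \<kappa> * \<bar>x1\<bar>)" by (simp add: norm_mult)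
        also have "\<dots> \<le> 3 * ((2 * k0) * (C * D))" using K1 x pos by (intro mult_left_mono mult_mono) auto
        also have "\<dots> = 6 * C * D * k0" by simp
        finally show ?thesis .
      qed
      moreover have "norm (3 * x2 :: complex) \<le> 3 * C * D * k0" using d2 by (simp add: norm_mult)
      moreover have "norm (x3 / \<kappa>) \<le> C * D * k0"
        using dv[of x3] d2(2) pos by (smt (verit, best) divide_le_eq)
      ultimately show ?thesis
        using norm_triangle_ineq4[of "- 3 * \<kappa> * x1 + 3 * x2" "x3 / \<kappa>"] norm_triangle_ineq[of "- 3 * \<kappa> * x1" "3 * x2"]
        by linarith
    qed
    have b4: "norm (u1\<^sup>2 * (- 3 * \<kappa> * x1 + 3 * x2 - x3 / \<kappa>)) \<le> C * (360 * a * k0)"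
    proof -
      have "\<bar>u1\<bar>\<^sup>2 \<le> (3 * a * W)\<^sup>2" using u1 by (intro power_mono) auto
      then have "u1\<^sup>2 \<le> 18 * a * r" by (simp add: r power_mult_distrib power2_eq_square mult_ac)
      then have "norm (u1\<^sup>2 * (- 3 * \<kappa> * x1 + 3 * x2 - x3 / \<kappa>)) \<le> 18 * a * r * (10 * C * D * k0)"
        unfolding norm_mult using b3 pos r0 by (intro mult_mono) (auto simp: norm_power)
      also have "\<dots> = 180 * a * C * k0 * (r * D)" by simp
      finally show ?thesis unfolding rD by (simp add: mult_ac)
    qed
    have b5: "norm ((2 * u2 - u20) * (2 * x1 - x2 / \<kappa>)) \<le> C * (9 * a * k0)"
    proof -
      have "norm (2 * x1 :: complex) \<le> 2 * C * D" using x by (simp add: norm_mult)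
      moreover have "norm (x2 / \<kappa>) \<le> C * D"
        using dv[of x2] d2(1) pos by (smt (verit, best) divide_le_eq)
      ultimately have "norm (2 * x1 - x2 / \<kappa>) \<le> 3 * C * D"
        using norm_triangle_ineq4[of "2 * x1" "x2 / \<kappa>"] by linarith
      also have "\<dots> \<le> 3 * C * k0" using D(2) pos by simp
      finally have "norm (2 * x1 - x2 / \<kappa>) \<le> 3 * C * k0" .
      moreover have "norm (2 * u2 - u20 :: complex) \<le> 3 * a"
      proof -
        have "2 * complex_of_real u2 - u20 = of_real (2 * u2 - u20)" by simp
        then show ?thesis using u22(2) by (simp only: norm_of_real)
      qed
      ultimately have "norm ((2 * u2 - u20) * (2 * x1 - x2 / \<kappa>)) \<le> 3 * a * (3 * C * k0)"
        unfolding norm_mult using pos by (intro mult_mono) auto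
      then show ?thesis by (simp add: mult_ac)
    qed
    have "norm (4 * a * \<kappa> * v * x1 + 2 * a * x1 + u1\<^sup>2 * (- 3 * \<kappa> * x1 + 3 * x2 - x3 / \<kappa>)
          + (2 * u2 - u20) * (2 * x1 - x2 / \<kappa>)) \<le> C * (16 * a * k0) + C * (2 * a * k0) + C * (360 * a * k0) + C * (9 * a * k0)"
      by (intro norm_triangle_le add_mono b1 b2 b4 b5)
    \<comment> \<open>16 + 2 + 360 + 9 = 387, from \<open>b1\<close>, \<open>b2\<close>,
      \<open>b4\<close> and \<open>b5\<close>; rounded up to 400 next.\<close>
    also have "\<dots> = C * (387 * a * k0)" by (simp add: algebra_simps)
    also have "\<dots> \<le> C * (400 * a * k0)" using pos by (intro mult_left_mono mult_right_mono) auto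
    finally show ?thesis unfolding norm_mult[of "exp _"] ne using e2 by (intro mult_mono) auto
  qed
  show ?thesis
    by (rule order_trans[OF norm_triangle_le[OF add_mono[OF A B]]])
       (simp add: algebra_simps power2_eq_square)
qed

text \<open>The scalar problem left after projection on one mode. \<open>U_t\<close>, with
  \<open>U2\<close> on the right, is the heat equation. All conditions are interior ones, to be
  tested against functions supported in a compact window of z > 0; the data at time 0 enter later,
  through a limit.\<close>

locale mode_growth =
  fixes U U1 U2 :: "real \<Rightarrow> real \<Rightarrow> real" and \<phi> \<phi>t \<phi>z \<phi>zz \<omega> :: "real \<Rightarrow> real \<Rightarrow> complex" and S \<nu> :: real
  assumes U_z: "\<And>t z. 0 \<le> t \<Longrightarrow> 0 < z \<Longrightarrow> (U t has_real_derivative U1 t z) (at z)"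
    and U1_z: "\<And>t z. 0 \<le> t \<Longrightarrow> 0 < z \<Longrightarrow> (U1 t has_real_derivative U2 t z) (at z)"
    and U_t: "\<And>t z. 0 < t \<Longrightarrow> 0 < z \<Longrightarrow> ((\<lambda>r. U r z) has_real_derivative U2 t z) (at t)"
    and U_cont: "continuous_on ({0..} \<times> {0<..}) (\<lambda>(t, z). U t z)"
    and U1_cont: "continuous_on ({0..} \<times> {0<..}) (\<lambda>(t, z). U1 t z)"
    and U2_cont: "continuous_on ({0..} \<times> {0<..}) (\<lambda>(t, z). U2 t z)"
    and \<phi>_cont: "continuous_on ({0<..<S} \<times> {0<..}) (\<lambda>(t, z). \<phi> t z)"
    and \<phi>t_cont: "continuous_on ({0<..<S} \<times> {0<..}) (\<lambda>(t, z). \<phi>t t z)"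
    and \<phi>zz_cont: "continuous_on ({0<..<S} \<times> {0<..}) (\<lambda>(t, z). \<phi>zz t z)"
    and \<phi>_t: "\<And>t z. t \<in> {0<..<S} \<Longrightarrow> 0 < z \<Longrightarrow> ((\<lambda>r. \<phi> r z) has_vector_derivative \<phi>t t z) (at t)"
    and \<phi>_z: "\<And>t z. t \<in> {0<..<S} \<Longrightarrow> 0 < z \<Longrightarrow> ((\<lambda>r. \<phi> t r) has_vector_derivative \<phi>z t z) (at z)"
    and \<phi>z_z: "\<And>t z. t \<in> {0<..<S} \<Longrightarrow> 0 < z \<Longrightarrow> ((\<lambda>r. \<phi>z t r) has_vector_derivative \<phi>zz t z) (at z)"
    and \<omega>_z: "\<And>t z. t \<in> {0<..<S} \<Longrightarrow> 0 < z \<Longrightarrow> ((\<lambda>r. \<omega> t r) has_vector_derivative - (\<i> * \<nu> * \<phi> t z)) (at z)"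
    and mode_eq: "\<And>t z. t \<in> {0<..<S} \<Longrightarrow> 0 < z \<Longrightarrow>
       \<phi>t t z = - (\<i> * \<nu> * U t z * \<phi> t z) - U1 t z * \<omega> t z + \<phi>zz t z"
begin

lemma slice_t:
  fixes h :: "real \<Rightarrow> real \<Rightarrow> 'a::topological_space"
  assumes "continuous_on (A \<times> B) (\<lambda>(t, z). h t z)" "t \<in> A" "J \<subseteq> B"
  shows "continuous_on J (\<lambda>z. h t z)"
proof -
  have "continuous_on J (\<lambda>z. (\<lambda>(t, z). h t z) (t, z))"
    by (rule continuous_on_compose2[OF assms(1)]) (use assms in \<open>auto intro!: continuous_intros\<close>)
  then show ?thesis by simp
qed

lemma slice_z:
  fixes h :: "real \<Rightarrow> real \<Rightarrow> 'a::topological_space"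
  assumes "continuous_on (A \<times> B) (\<lambda>(t, z). h t z)" "z \<in> B" "I \<subseteq> A"
  shows "continuous_on I (\<lambda>t. h t z)"
proof -
  have "continuous_on I (\<lambda>t. (\<lambda>(t, z). h t z) (t, z))"
    by (rule continuous_on_compose2[OF assms(1)]) (use assms in \<open>auto intro!: continuous_intros\<close>)
  then show ?thesis by simp
qed

definition V :: "real \<Rightarrow> real \<Rightarrow> real \<Rightarrow> real" where "V z0 t z = U t z - U t z0"

lemma V_cont:
  assumes "0 < z0" "A \<subseteq> {0..} \<times> {0<..}"
  shows "continuous_on A (\<lambda>(t, z). V z0 t z)"
proof -
  have "continuous_on A (\<lambda>p. (\<lambda>(t, z). U t z) (fst p, z0))"
    by (rule continuous_on_compose2[OF U_cont]) (use assms in \<open>auto intro!: continuous_intros\<close>)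
  moreover have "continuous_on A (\<lambda>(t, z). U t z)" using continuous_on_subset[OF U_cont assms(2)] .
  ultimately show ?thesis unfolding V_def by (simp add: case_prod_unfold continuous_on_diff)
qed

text \<open>The bracket is the adjoint operator applied to F(V). The factor
  \<open>2 * U2 t z - U2 t z0\<close> collects \<open>U2 t z\<close> from the second z-derivative of
  F(V) and \<open>U2 t z - U2 t z0\<close> from its time derivative, by the heat equation; the
  nonlocal term has become the product with the primitive P.\<close>

lemma tested_mode_deriv:
  fixes P F F1 F2 :: "real \<Rightarrow> complex" and z0 W t :: real
  assumes PF: "\<And>v. (P has_vector_derivative F v) (at v)" "\<And>v. (F has_vector_derivative F1 v) (at v)"
      "\<And>v. (F1 has_vector_derivative F2 v) (at v)" and F2_cont: "continuous_on UNIV F2"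
    and W: "0 < W" "W < z0" and t: "t \<in> {0<..<S}"
    and bdry: "\<And>z. z \<in> {z0 - W, z0 + W} \<Longrightarrow> P (V z0 t z) = 0 \<and> F (V z0 t z) = 0 \<and> F1 (V z0 t z) = 0"
  shows "((\<lambda>r. integral {z0 - W..z0 + W} (\<lambda>z. \<phi> r z * F (V z0 r z))) has_vector_derivative
     integral {z0 - W..z0 + W} (\<lambda>z. \<phi> t z * (- (\<i> * \<nu> * U t z * F (V z0 t z)) - \<i> * \<nu> * P (V z0 t z)
        + F2 (V z0 t z) * (U1 t z)\<^sup>2 + F1 (V z0 t z) * (2 * U2 t z - U2 t z0)))) (at t)"
proof -
  let ?J = "cbox (z0 - W) (z0 + W)"
  let ?D = "\<lambda>r z. \<phi>t r z * F (V z0 r z) + \<phi> r z * (F1 (V z0 r z) * (U2 r z - U2 r z0))"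
  let ?H = "\<lambda>z. - (\<i> * \<nu> * U t z * F (V z0 t z)) - \<i> * \<nu> * P (V z0 t z)
        + F2 (V z0 t z) * (U1 t z)\<^sup>2 + F1 (V z0 t z) * (2 * U2 t z - U2 t z0)"
  have J: "?J \<subseteq> {0<..}" using W by auto
  have z0: "0 < z0" using W by simp
  have cP: "continuous_on A P" and cF: "continuous_on A F" and cF1: "continuous_on A F1" for A
    by (rule continuous_at_imp_continuous_on, rule ballI, rule has_vector_derivative_continuous, rule PF)+
  have sub: "{0<..<S} \<times> ?J \<subseteq> {0..} \<times> {0<..}" "{0<..<S} \<times> ?J \<subseteq> {0<..<S} \<times> {0<..}" using J by auto
  have cV: "continuous_on ({0<..<S} \<times> ?J) (\<lambda>p. V z0 (fst p) (snd p))"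
    using V_cont[OF z0 sub(1)] by (simp add: case_prod_unfold)
  have cFV: "continuous_on ({0<..<S} \<times> ?J) (\<lambda>p. F (V z0 (fst p) (snd p)))"
    by (rule continuous_on_compose2[OF cF[of UNIV] cV]) auto
  have cF1V: "continuous_on ({0<..<S} \<times> ?J) (\<lambda>p. F1 (V z0 (fst p) (snd p)))"
    by (rule continuous_on_compose2[OF cF1[of UNIV] cV]) auto
  have cU2: "continuous_on ({0<..<S} \<times> ?J) (\<lambda>p. U2 (fst p) (snd p))"
    using continuous_on_subset[OF U2_cont sub(1)] by (simp add: case_prod_unfold)
  have cU20: "continuous_on ({0<..<S} \<times> ?J) (\<lambda>p. U2 (fst p) z0)"
  proof -
    have "continuous_on ({0<..<S} \<times> ?J) (\<lambda>p. (\<lambda>(t, z). U2 t z) (fst p, z0))"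
      by (rule continuous_on_compose2[OF U2_cont]) (use z0 in \<open>auto intro!: continuous_intros\<close>)
    then show ?thesis by simp
  qed
  have c\<phi>: "continuous_on ({0<..<S} \<times> ?J) (\<lambda>p. \<phi> (fst p) (snd p))"
    "continuous_on ({0<..<S} \<times> ?J) (\<lambda>p. \<phi>t (fst p) (snd p))"
    using continuous_on_subset[OF \<phi>_cont sub(2)] continuous_on_subset[OF \<phi>t_cont sub(2)]
    by (simp_all add: case_prod_unfold)
  have comp: "((\<lambda>r. F (g r)) has_vector_derivative F1 (g x) * of_real g') (at x)"
    "((\<lambda>r. F1 (g r)) has_vector_derivative F2 (g x) * of_real g') (at x)"
    "((\<lambda>r. P (g r)) has_vector_derivative F (g x) * of_real g') (at x)"
    if "(g has_real_derivative g') (at x)" for g g' x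
    using vector_diff_chain_at[of g g' x F "F1 (g x)"] vector_diff_chain_at[of g g' x F1 "F2 (g x)"]
      vector_diff_chain_at[of g g' x P "F (g x)"] that PF
    by (simp_all add: has_real_derivative_iff_has_vector_derivative o_def scaleR_conv_of_real mult.commute)
  have Vt: "((\<lambda>r. V z0 r z) has_real_derivative U2 r z - U2 r z0) (at r)" if "0 < r" "0 < z" for r z
    unfolding V_def by (intro DERIV_diff U_t that z0)
  have Vz: "((\<lambda>z. V z0 r z) has_real_derivative U1 r z) (at z)" if "0 \<le> r" "0 < z" for r z
    unfolding V_def using DERIV_diff[OF U_z[OF that] DERIV_const] by simp
  have L: "((\<lambda>r. integral ?J (\<lambda>z. \<phi> r z * F (V z0 r z))) has_vector_derivative integral ?J (?D t)) (at t within {0<..<S})"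
  proof (rule leibniz_rule_vector_derivative)
    fix r z assume r: "r \<in> {0<..<S}" and z: "z \<in> ?J"
    then have z': "0 < z" using J by blast
    have "((\<lambda>r. \<phi> r z * F (V z0 r z)) has_vector_derivative
        \<phi> r z * (F1 (V z0 r z) * of_real (U2 r z - U2 r z0)) + \<phi>t r z * F (V z0 r z)) (at r)"
      by (rule has_vector_derivative_mult[OF \<phi>_t comp(1)[OF Vt]]) (use r z' in auto)
    then show "((\<lambda>r. \<phi> r z * F (V z0 r z)) has_vector_derivative ?D r z) (at r within {0<..<S})"
      by (simp add: add.commute has_vector_derivative_at_within)
  next
    fix r assume r: "r \<in> {0<..<S}"
    have c: "continuous_on ({0<..<S} \<times> ?J) (\<lambda>(r, z). \<phi> r z * F (V z0 r z))"
      using continuous_on_mult[OF c\<phi>(1) cFV] by (simp add: case_prod_unfold)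
    show "(\<lambda>z. \<phi> r z * F (V z0 r z)) integrable_on ?J"
      by (rule integrable_continuous[OF slice_t[OF c r order_refl]])
  next
    have "continuous_on ({0<..<S} \<times> ?J) (\<lambda>p. \<phi>t (fst p) (snd p) * F (V z0 (fst p) (snd p))
        + \<phi> (fst p) (snd p) * (F1 (V z0 (fst p) (snd p)) * (of_real (U2 (fst p) (snd p)) - of_real (U2 (fst p) z0))))"
      by (intro continuous_intros c\<phi> cFV cF1V cU2 cU20)
    then show "continuous_on ({0<..<S} \<times> ?J) (\<lambda>(r, z). ?D r z)" by (simp add: case_prod_unfold)
  qed (use t in auto)
  have ct: "continuous_on ?J (\<lambda>z. \<phi> t z)" "continuous_on ?J (\<lambda>z. \<phi>t t z)" "continuous_on ?J (\<lambda>z. U t z)"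
      "continuous_on ?J (\<lambda>z. U1 t z)" "continuous_on ?J (\<lambda>z. U2 t z)"
    using slice_t[OF \<phi>_cont t J] slice_t[OF \<phi>t_cont t J] slice_t[OF U_cont _ J, of t]
      slice_t[OF U1_cont _ J, of t] slice_t[OF U2_cont _ J, of t] t by auto
  have cVt: "continuous_on ?J (\<lambda>z. V z0 t z)" unfolding V_def by (intro continuous_intros ct)
  have cc: "continuous_on ?J (\<lambda>z. P (V z0 t z))" "continuous_on ?J (\<lambda>z. F (V z0 t z))"
    "continuous_on ?J (\<lambda>z. F1 (V z0 t z))" "continuous_on ?J (\<lambda>z. F2 (V z0 t z))"
    by (rule continuous_on_compose2[OF cP[of UNIV] cVt] continuous_on_compose2[OF cF[of UNIV] cVt]
        continuous_on_compose2[OF cF1[of UNIV] cVt] continuous_on_compose2[OF F2_cont cVt]; simp)+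
  have iD: "?D t integrable_on ?J" and iH: "(\<lambda>z. \<phi> t z * ?H z) integrable_on ?J"
    by (intro integrable_continuous continuous_intros ct cc)+
  \<comment> \<open>One antiderivative performs all integrations by parts at once: two for
    \<open>\<phi>zz\<close>, and one for the nonlocal term, as F(V) \<open>U1\<close> is the
    z-derivative of P(V). By \<open>bdry\<close> it vanishes at both ends.\<close>
  have "((\<lambda>z. ?D t z - \<phi> t z * ?H z) has_integral
     (\<phi>z t (z0 + W) * F (V z0 t (z0 + W)) - \<phi> t (z0 + W) * (F1 (V z0 t (z0 + W)) * U1 t (z0 + W)) - \<omega> t (z0 + W) * P (V z0 t (z0 + W)))
     - (\<phi>z t (z0 - W) * F (V z0 t (z0 - W)) - \<phi> t (z0 - W) * (F1 (V z0 t (z0 - W)) * U1 t (z0 - W)) - \<omega> t (z0 - W) * P (V z0 t (z0 - W)))) {z0 - W..z0 + W}"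
  proof (rule fundamental_theorem_of_calculus)
    fix z assume "z \<in> {z0 - W..z0 + W}"
    then have z: "0 < z" using W by auto
    have t0: "0 \<le> t" using t by auto
    have U1v: "((\<lambda>z. of_real (U1 t z)) has_vector_derivative complex_of_real (U2 t z)) (at z)"
      using U1_z[OF t0 z] by (simp add: has_real_derivative_iff_has_vector_derivative has_vector_derivative_of_real)
    note FV = comp[OF Vz[OF t0 z]]
    have "((\<lambda>z. \<phi>z t z * F (V z0 t z) - \<phi> t z * (F1 (V z0 t z) * U1 t z) - \<omega> t z * P (V z0 t z)) has_vector_derivative
       (\<phi>z t z * (F1 (V z0 t z) * U1 t z) + \<phi>zz t z * F (V z0 t z))
       - (\<phi> t z * (F1 (V z0 t z) * U2 t z + (F2 (V z0 t z) * U1 t z) * U1 t z) + \<phi>z t z * (F1 (V z0 t z) * U1 t z))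
       - (\<omega> t z * (F (V z0 t z) * U1 t z) + (- (\<i> * \<nu> * \<phi> t z)) * P (V z0 t z))) (at z)"
      by (intro has_vector_derivative_diff has_vector_derivative_mult \<phi>z_z \<phi>_z \<omega>_z FV U1v t z)
    moreover have "(\<phi>z t z * (F1 (V z0 t z) * U1 t z) + \<phi>zz t z * F (V z0 t z))
       - (\<phi> t z * (F1 (V z0 t z) * U2 t z + (F2 (V z0 t z) * U1 t z) * U1 t z) + \<phi>z t z * (F1 (V z0 t z) * U1 t z))
       - (\<omega> t z * (F (V z0 t z) * U1 t z) + (- (\<i> * \<nu> * \<phi> t z)) * P (V z0 t z)) = ?D t z - \<phi> t z * ?H z"
      unfolding mode_eq[OF t z] by (simp add: algebra_simps power2_eq_square)
    ultimately show "((\<lambda>z. \<phi>z t z * F (V z0 t z) - \<phi> t z * (F1 (V z0 t z) * U1 t z) - \<omega> t z * P (V z0 t z)) has_vector_derivative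
        ?D t z - \<phi> t z * ?H z) (at z within {z0 - W..z0 + W})"
      by (simp only: has_vector_derivative_at_within)
  qed (use W in auto)
  then have "((\<lambda>z. ?D t z - \<phi> t z * ?H z) has_integral 0) ?J" using bdry by simp
  then have eq: "integral ?J (?D t) = integral ?J (\<lambda>z. \<phi> t z * ?H z)"
    using integral_diff[OF iD iH] by (simp add: integral_unique)
  have at: "at t within {0<..<S} = at t" by (rule at_within_open[OF t]) simp
  show ?thesis using L unfolding eq at unfolding cbox_interval .
qed

end

text \<open>\<open>C\<close> is fixed before r: all cutoffs are rescalings of one step, so the
  derivative of order j costs just \<open>(2 / r) ^ j\<close>. This matters because r will shrink
  with the frequency. Order 3 is the highest that enters \<open>F''\<close>. The cutoff is
  one-sided, since V is bounded below by nearly 0 on the window.\<close>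

lemma cutoff_exists:
  obtains C :: real where "1 \<le> C" "\<And>r. 0 < r \<Longrightarrow> \<exists>\<eta> :: nat \<Rightarrow> real \<Rightarrow> real.
     (\<forall>j v. (\<eta> j has_real_derivative \<eta> (Suc j) v) (at v)) \<and> (\<forall>j\<le>3. \<forall>v. \<bar>\<eta> j v\<bar> \<le> C * (2 / r) ^ j) \<and>
     (\<forall>v. v \<le> r / 2 \<longrightarrow> \<eta> 0 v = 1) \<and> (\<forall>v j. r < v \<longrightarrow> \<eta> j v = 0) \<and> (\<forall>v j. v < r / 2 \<longrightarrow> 0 < j \<longrightarrow> \<eta> j v = 0)"
proof -
  obtain S where S: "smooth_fun S" "\<And>x. x \<le> 0 \<Longrightarrow> S x = 0" "\<And>x. 1 \<le> x \<Longrightarrow> S x = 1"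
    using smooth_step_exists by blast
  have bd: "\<exists>C. \<forall>x. \<bar>(deriv ^^ j) S x\<bar> \<le> C" for j
  proof -
    have "compact ((deriv ^^ j) S ` {-1..2})"
      by (intro compact_continuous_image smooth_fun_cont S(1)) simp
    then obtain C where C: "\<And>x. x \<in> {-1..2} \<Longrightarrow> \<bar>(deriv ^^ j) S x\<bar> \<le> C"
      by (force dest!: compact_imp_bounded simp: bounded_iff)
    have "\<bar>(deriv ^^ j) S x\<bar> \<le> C + 1" for x
    proof (cases "x \<in> {-1..2}")
      case True then show ?thesis using C[OF True] by simp
    next
      case False
      have "C \<ge> 0" using C[of 0] by (smt (verit) abs_ge_zero atLeastAtMost_iff)
      moreover have "\<bar>(deriv ^^ j) S x\<bar> \<le> 1"
      proof (cases j)
        case 0 then show ?thesis using False S(2)[of x] S(3)[of x] by (cases "x < 0") auto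
      next
        case (Suc i)
        then have "(deriv ^^ j) S x = 0"
          using False deriv_iter_eq_0[of "{..<0}" S 0 x j] deriv_iter_eq_0[of "{1<..}" S 1 x j] S(2,3)
          by (cases "x < 0") auto
        then show ?thesis by simp
      qed
      ultimately show ?thesis by simp
    qed
    then show ?thesis by blast
  qed
  then obtain B where B: "\<And>j x. \<bar>(deriv ^^ j) S x\<bar> \<le> B j" by metis
  define C where "C = 2 + \<bar>B 0\<bar> + \<bar>B 1\<bar> + \<bar>B 2\<bar> + \<bar>B 3\<bar>"
  have BC: "1 + \<bar>(deriv ^^ j) S x\<bar> \<le> C" if "j \<le> 3" for j x
  proof -
    have "j = 0 \<or> j = 1 \<or> j = 2 \<or> j = 3" using that by auto
    moreover have "\<bar>(deriv ^^ j) S x\<bar> \<le> \<bar>B j\<bar>" using B[of j x] by linarith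
    ultimately show ?thesis unfolding C_def by auto
  qed
  show ?thesis
  proof (rule that[of C])
    show "1 \<le> C" by (simp add: C_def)
    fix r :: real assume r: "0 < r"
    define \<eta> where "\<eta> j = (if j = 0 then (\<lambda>v. 1 - S (2 / r * v + (- 1))) else (\<lambda>v. - ((2 / r) ^ j * (deriv ^^ j) S (2 / r * v + (- 1)))))" for j
    have d: "(\<eta> j has_real_derivative \<eta> (Suc j) v) (at v)" for j v
    proof -
      have D: "((\<lambda>v. (deriv ^^ j) S (2 / r * v + (- 1))) has_real_derivative (deriv ^^ Suc j) S (2 / r * v + (- 1)) * (2 / r)) (at v)"
        by (rule DERIV_chain2[OF smooth_fun_has_deriv[OF S(1)]]) (use r in \<open>auto intro!: derivative_eq_intros\<close>)
      show ?thesis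
      proof (cases "j = 0")
        case True
        then show ?thesis using DERIV_diff[OF DERIV_const[of 1] D] by (simp add: \<eta>_def mult.commute)
      next
        case False
        have "\<eta> j = (\<lambda>v. - ((2 / r) ^ j * (deriv ^^ j) S (2 / r * v + (- 1))))" using False by (simp add: \<eta>_def)
        moreover have "\<eta> (Suc j) v = - ((2 / r) ^ j * ((deriv ^^ Suc j) S (2 / r * v + (- 1)) * (2 / r)))"
          by (simp add: \<eta>_def mult_ac)
        ultimately show ?thesis using DERIV_minus[OF DERIV_cmult[OF D]] by simp
      qed
    qed
    have b: "\<bar>\<eta> j v\<bar> \<le> C * (2 / r) ^ j" if "j \<le> 3" for j v
    proof (cases "j = 0")
      case True then show ?thesis using BC[of 0 "2 / r * v + (- 1)"] by (simp add: \<eta>_def)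
    next
      case False
      have "(2 / r) ^ j * \<bar>(deriv ^^ j) S (2 / r * v + (- 1))\<bar> \<le> (2 / r) ^ j * C"
        using BC[OF that, of "2 / r * v + (- 1)"] r by (intro mult_left_mono) auto
      then show ?thesis using False r by (simp add: \<eta>_def abs_mult mult_ac)
    qed
    have c1: "\<eta> 0 v = 1" if "v \<le> r / 2" for v
      using that r S(2)[of "2 / r * v + (- 1)"] by (simp add: \<eta>_def field_simps)
    have c2: "\<eta> j v = 0" if "r < v" for j v
    proof -
      have x: "2 / r * v + (- 1) > 1" using that r by (simp add: field_simps)
      then show ?thesis using S(3)[of "2 / r * v + (- 1)"] deriv_iter_eq_0[of "{1<..}" S 1 "2 / r * v + (- 1)" j] S(3)
        by (auto simp: \<eta>_def)
    qed
    have c3: "\<eta> j v = 0" if "v < r / 2" "0 < j" for j v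
    proof -
      have x: "2 / r * v + (- 1) < 0" using that r by (simp add: field_simps)
      then show ?thesis using deriv_iter_eq_0[of "{..<0}" S 0 "2 / r * v + (- 1)" j] S(2) that
        by (auto simp: \<eta>_def)
    qed
    show "\<exists>\<eta> :: nat \<Rightarrow> real \<Rightarrow> real.
     (\<forall>j v. (\<eta> j has_real_derivative \<eta> (Suc j) v) (at v)) \<and> (\<forall>j\<le>3. \<forall>v. \<bar>\<eta> j v\<bar> \<le> C * (2 / r) ^ j) \<and>
     (\<forall>v. v \<le> r / 2 \<longrightarrow> \<eta> 0 v = 1) \<and> (\<forall>v j. r < v \<longrightarrow> \<eta> j v = 0) \<and> (\<forall>v j. v < r / 2 \<longrightarrow> 0 < j \<longrightarrow> \<eta> j v = 0)"
      using d b c1 c2 c3 by (intro exI[of _ \<eta>]) auto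
  qed
qed

text \<open>
  \<open>prof_P\<close> is a primitive of the test profile \<open>prof_F\<close>: since \<open>\<omega>' = - i \<nu> \<phi>\<close>, integrating \<open>\<omega> U' F(V)\<close> by
  parts moves the nonlocal term onto \<open>P(V)\<close>.
\<close>

definition wexp :: "complex \<Rightarrow> real \<Rightarrow> complex" where
  "wexp \<kappa> v = exp (- \<kappa> * v)"
definition prof_P :: "complex \<Rightarrow> (nat \<Rightarrow> real \<Rightarrow> real) \<Rightarrow> real \<Rightarrow> complex" where
  "prof_P \<kappa> \<eta> v = - (wexp \<kappa> v * \<eta> 0 v / \<kappa>)"
definition prof_F :: "complex \<Rightarrow> (nat \<Rightarrow> real \<Rightarrow> real) \<Rightarrow> real \<Rightarrow> complex" where
  "prof_F \<kappa> \<eta> v = wexp \<kappa> v * (\<eta> 0 v - \<eta> 1 v / \<kappa>)"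
definition prof_F1 :: "complex \<Rightarrow> (nat \<Rightarrow> real \<Rightarrow> real) \<Rightarrow> real \<Rightarrow> complex" where
  "prof_F1 \<kappa> \<eta> v = wexp \<kappa> v * (- \<kappa> * \<eta> 0 v + 2 * \<eta> 1 v - \<eta> 2 v / \<kappa>)"
definition prof_F2 :: "complex \<Rightarrow> (nat \<Rightarrow> real \<Rightarrow> real) \<Rightarrow> real \<Rightarrow> complex" where
  "prof_F2 \<kappa> \<eta> v = wexp \<kappa> v * (\<kappa>\<^sup>2 * \<eta> 0 v - 3 * \<kappa> * \<eta> 1 v + 3 * \<eta> 2 v - \<eta> 3 v / \<kappa>)"

context
  fixes \<kappa> :: complex and \<eta> :: "nat \<Rightarrow> real \<Rightarrow> real"
  assumes \<kappa>: "\<kappa> \<noteq> 0" and \<eta>: "\<And>j v. (\<eta> j has_real_derivative \<eta> (Suc j) v) (at v)"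
begin

lemma wexp_deriv: "(wexp \<kappa> has_vector_derivative - \<kappa> * wexp \<kappa> v) (at v)"
proof -
  have "((\<lambda>x. exp (- \<kappa> * x)) has_field_derivative - \<kappa> * exp (- \<kappa> * v)) (at (complex_of_real v))"
    by (auto intro!: derivative_eq_intros)
  from has_vector_derivative_real_field[OF this] show ?thesis
    unfolding wexp_def[abs_def] .
qed

lemma eta_deriv: "((\<lambda>v. complex_of_real (\<eta> j v)) has_vector_derivative complex_of_real (\<eta> (Suc j) v)) (at v)"
  using \<eta>[of j v] by (simp add: has_real_derivative_iff_has_vector_derivative has_vector_derivative_of_real)

lemma prof_derivs:
  "(prof_P \<kappa> \<eta> has_vector_derivative prof_F \<kappa> \<eta> v) (at v)"
  "(prof_F \<kappa> \<eta> has_vector_derivative prof_F1 \<kappa> \<eta> v) (at v)"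
  "(prof_F1 \<kappa> \<eta> has_vector_derivative prof_F2 \<kappa> \<eta> v) (at v)"
  "continuous_on UNIV (prof_F2 \<kappa> \<eta>)"
proof -
  have c0: "((\<lambda>v. complex_of_real (\<eta> 0 v)) has_vector_derivative complex_of_real (\<eta> 1 v)) (at v)"
    and c1: "((\<lambda>v. complex_of_real (\<eta> 1 v)) has_vector_derivative complex_of_real (\<eta> 2 v)) (at v)"
    and c2: "((\<lambda>v. complex_of_real (\<eta> 2 v)) has_vector_derivative complex_of_real (\<eta> 3 v)) (at v)" for v
    using eta_deriv[of 0 v] eta_deriv[of 1 v] eta_deriv[of 2 v] by (simp_all add: numeral_eq_Suc)
  have c1': "((\<lambda>v. complex_of_real (2 * \<eta> 1 v)) has_vector_derivative complex_of_real (2 * \<eta> 2 v)) (at v)" for v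
    using has_vector_derivative_mult_right[OF c1, of 2] by simp
  have "((\<lambda>v. - (wexp \<kappa> v * \<eta> 0 v / \<kappa>)) has_vector_derivative - ((wexp \<kappa> v * \<eta> 1 v + (- \<kappa> * wexp \<kappa> v) * \<eta> 0 v) / \<kappa>)) (at v)"
    by (intro has_vector_derivative_minus has_vector_derivative_divide has_vector_derivative_mult wexp_deriv c0)
  moreover have "- ((wexp \<kappa> v * \<eta> 1 v + (- \<kappa> * wexp \<kappa> v) * \<eta> 0 v) / \<kappa>) = prof_F \<kappa> \<eta> v"
    using \<kappa> by (simp add: prof_F_def field_simps)
  ultimately show "(prof_P \<kappa> \<eta> has_vector_derivative prof_F \<kappa> \<eta> v) (at v)" unfolding prof_P_def[abs_def] by simp
  have "((\<lambda>v. wexp \<kappa> v * (\<eta> 0 v - \<eta> 1 v / \<kappa>)) has_vector_derivative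
      (wexp \<kappa> v * (\<eta> 1 v - \<eta> 2 v / \<kappa>) + (- \<kappa> * wexp \<kappa> v) * (\<eta> 0 v - \<eta> 1 v / \<kappa>))) (at v)"
    by (intro has_vector_derivative_diff has_vector_derivative_divide has_vector_derivative_mult wexp_deriv c0 c1)
  moreover have "(wexp \<kappa> v * (\<eta> 1 v - \<eta> 2 v / \<kappa>) + (- \<kappa> * wexp \<kappa> v) * (\<eta> 0 v - \<eta> 1 v / \<kappa>)) = prof_F1 \<kappa> \<eta> v"
    using \<kappa> by (simp add: prof_F1_def field_simps)
  ultimately show "(prof_F \<kappa> \<eta> has_vector_derivative prof_F1 \<kappa> \<eta> v) (at v)" unfolding prof_F_def[abs_def] by simp
  have "((\<lambda>v. wexp \<kappa> v * (- \<kappa> * \<eta> 0 v + 2 * \<eta> 1 v - \<eta> 2 v / \<kappa>)) has_vector_derivative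
      (wexp \<kappa> v * (- \<kappa> * \<eta> 1 v + 2 * \<eta> 2 v - \<eta> 3 v / \<kappa>) + (- \<kappa> * wexp \<kappa> v) * (- \<kappa> * \<eta> 0 v + 2 * \<eta> 1 v - \<eta> 2 v / \<kappa>))) (at v)"
    by (intro has_vector_derivative_diff has_vector_derivative_add has_vector_derivative_divide
        has_vector_derivative_mult has_vector_derivative_mult_right wexp_deriv c0 c1 c1' c2)
  moreover have "(wexp \<kappa> v * (- \<kappa> * \<eta> 1 v + 2 * \<eta> 2 v - \<eta> 3 v / \<kappa>) + (- \<kappa> * wexp \<kappa> v) * (- \<kappa> * \<eta> 0 v + 2 * \<eta> 1 v - \<eta> 2 v / \<kappa>)) = prof_F2 \<kappa> \<eta> v"
    using \<kappa> by (simp add: prof_F2_def field_simps power2_eq_square)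
  ultimately show "(prof_F1 \<kappa> \<eta> has_vector_derivative prof_F2 \<kappa> \<eta> v) (at v)" unfolding prof_F1_def[abs_def] by simp
  have cw: "continuous_on UNIV (wexp \<kappa>)"
    by (rule continuous_at_imp_continuous_on, rule ballI, rule has_vector_derivative_continuous, rule wexp_deriv)
  have cx: "continuous_on UNIV (\<eta> j)" for j
    using \<eta> DERIV_isCont by (blast intro: continuous_at_imp_continuous_on)
  show "continuous_on UNIV (prof_F2 \<kappa> \<eta>)" unfolding prof_F2_def[abs_def]
    by (intro continuous_intros cw cx) (use \<kappa> in simp)
qed

end

section \<open>Parabolic approximation and the growth estimate\<close>

lemma Lim_upperbound_at_right:
  fixes f :: "real \<Rightarrow> 'a::real_normed_vector"
  assumes "(f \<longlongrightarrow> l) (at_right a)" "a < b" "\<And>t. a < t \<Longrightarrow> t < b \<Longrightarrow> norm (f t) \<le> c"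
  shows "norm l \<le> c"
proof (rule tendsto_upperbound[OF tendsto_norm[OF assms(1)]])
  show "\<forall>\<^sub>F t in at_right a. norm (f t) \<le> c"
    using assms by (auto simp: eventually_at_right intro!: exI[of _ b])
qed simp

text \<open>The mean value inequality, twice, from z0 outwards. The point z0 stays fixed although
  the heat flow moves the critical point: a slope of size \<open>W * E\<close> at z0 costs no more
  than the curvature error E accumulated across the window.\<close>

lemma quadratic_approx:
  fixes f f1 f2 :: "real \<Rightarrow> real" and z0 W :: real
  defines "J \<equiv> {z0 - W..z0 + W}"
  assumes W: "0 < W" and E: "0 \<le> E"
    and d: "\<And>z. z \<in> J \<Longrightarrow> (f has_real_derivative f1 z) (at z)" "\<And>z. z \<in> J \<Longrightarrow> (f1 has_real_derivative f2 z) (at z)"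
    and f2: "\<And>z. z \<in> J \<Longrightarrow> \<bar>f2 z - 2 * a\<bar> \<le> E" and f1: "\<bar>f1 z0\<bar> \<le> W * E"
    and z: "z \<in> J"
  shows "\<bar>f1 z - 2 * a * (z - z0)\<bar> \<le> 2 * W * E" "\<bar>f z - f z0 - a * (z - z0)\<^sup>2\<bar> \<le> 2 * W\<^sup>2 * E"
proof -
  have J: "convex J" "z0 \<in> J" using W by (auto simp: J_def)
  have dist: "\<bar>y - z0\<bar> \<le> W" if "y \<in> J" for y using that by (auto simp: J_def)
  have b1: "\<bar>f1 z - 2 * a * (z - z0)\<bar> \<le> 2 * W * E" if z: "z \<in> J" for z
  proof -
    have "norm ((f1 z - 2 * a * (z - z0)) - (f1 z0 - 2 * a * (z0 - z0))) \<le> E * norm (z - z0)"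
    proof (rule field_differentiable_bound[OF J(1) _ _ z J(2)])
      fix y assume y: "y \<in> J"
      show "((\<lambda>y. f1 y - 2 * a * (y - z0)) has_field_derivative f2 y - 2 * a) (at y within J)"
        by (auto intro!: derivative_eq_intros has_field_derivative_at_within[OF d(2)[OF y]])
      show "norm (f2 y - 2 * a) \<le> E" using f2[OF y] by simp
    qed
    also have "\<dots> \<le> E * W" using dist[OF z] E by (intro mult_left_mono) auto
    finally show ?thesis using f1 by (simp add: mult.commute)
  qed
  then show "\<bar>f1 z - 2 * a * (z - z0)\<bar> \<le> 2 * W * E" using z .
  have "norm ((f z - a * (z - z0)\<^sup>2) - (f z0 - a * (z0 - z0)\<^sup>2)) \<le> 2 * W * E * norm (z - z0)"
  proof (rule field_differentiable_bound[OF J(1) _ _ z J(2)])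
    fix y assume y: "y \<in> J"
    show "((\<lambda>y. f y - a * (y - z0)\<^sup>2) has_field_derivative f1 y - 2 * a * (y - z0)) (at y within J)"
      by (auto intro!: derivative_eq_intros has_field_derivative_at_within[OF d(1)[OF y]])
    show "norm (f1 y - 2 * a * (y - z0)) \<le> 2 * W * E" using b1[OF y] by simp
  qed
  also have "\<dots> \<le> 2 * W * E * W" using dist[OF z] W E by (intro mult_left_mono) auto
  finally have "\<bar>(f z - a * (z - z0)\<^sup>2) - (f z0 - a * (z0 - z0)\<^sup>2)\<bar> \<le> 2 * W\<^sup>2 * E"
    by (simp add: power2_eq_square mult_ac)
  then show "\<bar>f z - f z0 - a * (z - z0)\<^sup>2\<bar> \<le> 2 * W\<^sup>2 * E" by (simp add: algebra_simps)
qed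

context mode_growth
begin

lemma V_quadratic_approx:
  assumes W: "0 < W" "W < z0" and t: "0 \<le> t" and E: "0 \<le> E"
    and U2: "\<And>z. z \<in> {z0 - W..z0 + W} \<Longrightarrow> \<bar>U2 t z - 2 * a\<bar> \<le> E" and U1: "\<bar>U1 t z0\<bar> \<le> W * E"
    and z: "z \<in> {z0 - W..z0 + W}"
  shows "\<bar>U1 t z - 2 * a * (z - z0)\<bar> \<le> 2 * W * E" "\<bar>V z0 t z - a * (z - z0)\<^sup>2\<bar> \<le> 2 * W\<^sup>2 * E"
proof -
  have J: "0 < y" if "y \<in> {z0 - W..z0 + W}" for y using W that by auto
  note * = quadratic_approx[where f = "U t" and ?f1.0 = "U1 t" and ?f2.0 = "U2 t", OF W(1) E U_z[OF t J] U1_z[OF t J] U2 U1 z]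
  show "\<bar>U1 t z - 2 * a * (z - z0)\<bar> \<le> 2 * W * E" "\<bar>V z0 t z - a * (z - z0)\<^sup>2\<bar> \<le> 2 * W\<^sup>2 * E"
    using * by (simp_all add: V_def)
qed

text \<open>The pairing y, divided by its expected growth and by the phase of transport at z0, has
  as derivative the pairing of \<open>\<phi>\<close> with the residual \<open>G\<close>, with the
  same factor, and \<open>G\<close> is at most \<open>Gb\<close>. The a priori bound grows only like
  exp(s t) with \<open>s < 2 * a * k0\<close>, so both y and y' are controlled by exp(- (2 a k0 - s)
  t). Integrating back from T bounds the initial pairing.\<close>

lemma growth_estimate:
  fixes z0 W a E k0 T C s p0 r :: real and \<eta> :: "nat \<Rightarrow> real \<Rightarrow> real" and \<kappa> :: complex and \<phi>0 :: "real \<Rightarrow> complex"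
  defines "J \<equiv> {z0 - W..z0 + W}"
  defines "Gb \<equiv> C * k0 * (exp 2 * (34 * a * k0 * W\<^sup>2 * E + 6 * E) + 400 * a * exp (- (k0 * r / 2)))"
  assumes pos: "0 < a" "0 < W" "W < z0" "0 \<le> E" "0 < k0" "1 \<le> C" "0 < T" "T < S" "s < 2 * a * k0" "0 \<le> p0"
    and \<nu>: "\<nu> = 8 * a * k0\<^sup>2" and \<kappa>: "\<kappa> = Complex k0 k0" and r: "r = a * W\<^sup>2 / 2"
    and small: "16 * E \<le> a" "k0 * W\<^sup>2 * E \<le> 1" "2 / r \<le> k0"
    and \<eta>: "\<And>j v. (\<eta> j has_real_derivative \<eta> (Suc j) v) (at v)" "\<And>j v. j \<le> 3 \<Longrightarrow> \<bar>\<eta> j v\<bar> \<le> C * (2 / r) ^ j"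
      "\<And>j v. r < v \<Longrightarrow> \<eta> j v = 0" "\<And>j v. v < r / 2 \<Longrightarrow> 0 < j \<Longrightarrow> \<eta> j v = 0"
    and U2_E: "\<And>t z. 0 \<le> t \<Longrightarrow> t \<le> T \<Longrightarrow> z \<in> J \<Longrightarrow> \<bar>U2 t z - 2 * a\<bar> \<le> E"
    and U1_E: "\<And>t. 0 \<le> t \<Longrightarrow> t \<le> T \<Longrightarrow> \<bar>U1 t z0\<bar> \<le> W * E"
    and apriori: "\<And>t h B. 0 < t \<Longrightarrow> t \<le> T \<Longrightarrow> continuous_on J h \<Longrightarrow> (\<And>z. z \<in> J \<Longrightarrow> norm (h z) \<le> B) \<Longrightarrow>
        norm (integral J (\<lambda>z. \<phi> t z * h z)) \<le> B * (p0 * exp (s * t))"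
    and init: "((\<lambda>t. integral J (\<lambda>z. norm (\<phi> t z - \<phi>0 z))) \<longlongrightarrow> 0) (at_right 0)" "continuous_on J \<phi>0"
  shows "norm (integral J (\<lambda>z. \<phi>0 z * prof_F \<kappa> \<eta> (V z0 0 z)))
     \<le> p0 * (Gb / (2 * a * k0 - s) + 2 * exp 2 * C * exp (- (2 * a * k0 - s) * T))"
proof -
  have \<kappa>0: "\<kappa> \<noteq> 0" using pos by (auto simp: \<kappa> complex_eq_iff)
  have r0: "0 < r" using pos by (simp add: r)
  have z0: "0 < z0" using pos by simp
  have J: "J \<subseteq> {0<..}" "z0 \<in> J" using pos by (auto simp: J_def)
  have Jne: "z0 - W \<le> z0 + W" using pos by simp
  note PF = prof_derivs[where \<kappa> = \<kappa> and \<eta> = \<eta>, OF \<kappa>0 \<eta>(1)]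
  let ?P = "prof_P \<kappa> \<eta>" and ?F = "prof_F \<kappa> \<eta>" and ?F1 = "prof_F1 \<kappa> \<eta>" and ?F2 = "prof_F2 \<kappa> \<eta>"
  \<comment> \<open>(1 + i)^2 = 2 i, so \<open>\<kappa>\<close> = k0 (1 + i) is the root of 4 a
    \<kappa>^2 = i \<nu> with positive real part.\<close>
  have i\<nu>: "\<i> * complex_of_real \<nu> = 4 * a * \<kappa>\<^sup>2"
    by (simp add: \<nu> \<kappa> complex_eq_iff power2_eq_square)
  have reg: "\<bar>U1 t z - 2 * a * (z - z0)\<bar> \<le> 2 * W * E" "\<bar>V z0 t z - a * (z - z0)\<^sup>2\<bar> \<le> 2 * W\<^sup>2 * E"
    if "0 \<le> t" "t \<le> T" "z \<in> J" for t z
    using V_quadratic_approx[of W z0 t E a z] U2_E[OF that(1,2)] U1_E[OF that(1,2)] that pos by (auto simp: J_def)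
  have Vlow: "- 2 * W\<^sup>2 * E \<le> V z0 t z" if "0 \<le> t" "t \<le> T" "z \<in> J" for t z
  proof -
    have "0 \<le> a * (z - z0)\<^sup>2" using pos by simp
    with reg(2)[OF that] show ?thesis by linarith
  qed
  have wexp_le: "norm (wexp \<kappa> (V z0 t z)) \<le> exp 2" if "0 \<le> t" "t \<le> T" "z \<in> J" for t z
  proof -
    have "k0 * (- 2 * W\<^sup>2 * E) \<le> k0 * V z0 t z" using pos Vlow[OF that] by (intro mult_left_mono) auto
    then have "- (k0 * V z0 t z) \<le> 2" using small by (simp add: mult_ac)
    then show ?thesis by (simp add: wexp_def norm_exp_eq_Re \<kappa>)
  qed
  have F_le: "norm (?F (V z0 t z)) \<le> 2 * exp 2 * C" if "0 \<le> t" "t \<le> T" "z \<in> J" for t z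
  proof -
    let ?v = "V z0 t z"
    have "norm (\<eta> 1 ?v / \<kappa>) \<le> C"
    proof -
      have "\<bar>\<eta> 1 ?v\<bar> \<le> C * (2 / r)" using \<eta>(2)[of 1 ?v] by simp
      also have "\<dots> \<le> C * k0" using small pos by (intro mult_left_mono) auto
      also have "\<dots> \<le> C * norm \<kappa>" using complex_Re_le_cmod[of \<kappa>] pos by (simp add: \<kappa>)
      finally show ?thesis using \<kappa>0 by (simp add: norm_divide divide_le_eq)
    qed
    moreover have "\<bar>\<eta> 0 ?v\<bar> \<le> C" using \<eta>(2)[of 0 ?v] by simp
    ultimately have "norm (\<eta> 0 ?v - \<eta> 1 ?v / \<kappa>) \<le> 2 * C"
      using norm_triangle_ineq4[of "of_real (\<eta> 0 ?v)" "\<eta> 1 ?v / \<kappa>"] by simp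
    then have "norm (?F ?v) \<le> exp 2 * (2 * C)"
      unfolding prof_F_def norm_mult using wexp_le[OF that] by (intro mult_mono) auto
    then show ?thesis by simp
  qed
  \<comment> \<open>At the ends of the window V is at least a W^2 - a W^2 / 8, which exceeds r = a
    W^2 / 2; the cutoff and its derivatives vanish there.\<close>
  have bdry: "r < V z0 t z" if "0 \<le> t" "t \<le> T" "z \<in> {z0 - W, z0 + W}" for t z
  proof -
    have e: "a * (z - z0)\<^sup>2 = a * W\<^sup>2" using that by auto
    have "W\<^sup>2 * (16 * E) \<le> W\<^sup>2 * a" using small by (intro mult_left_mono) auto
    then have E: "2 * W\<^sup>2 * E \<le> a * W\<^sup>2 / 8" by (simp add: mult_ac)
    have p: "0 < a * W\<^sup>2" using pos by simp
    have "\<bar>V z0 t z - a * (z - z0)\<^sup>2\<bar> \<le> 2 * W\<^sup>2 * E"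
      by (rule reg(2)) (use that pos in \<open>auto simp: J_def\<close>)
    then show ?thesis unfolding r e using E p by linarith
  qed
  have F_cont: "continuous_on UNIV ?F"
    by (rule continuous_at_imp_continuous_on, rule ballI, rule has_vector_derivative_continuous, rule PF)
  have \<Theta>_cont: "continuous_on (A \<times> J) (\<lambda>(t, z). ?F (V z0 t z))" if "A \<subseteq> {0..}" for A
  proof -
    have "continuous_on (A \<times> J) (\<lambda>p. V z0 (fst p) (snd p))"
      using V_cont[OF z0, of "A \<times> J"] J that by (auto simp: case_prod_unfold)
    then have "continuous_on (A \<times> J) (\<lambda>p. ?F (V z0 (fst p) (snd p)))"
      by (rule continuous_on_compose2[OF F_cont]) auto
    then show ?thesis by (simp add: case_prod_unfold)
  qed
  \<comment> \<open>The phase accumulated by transport with the velocity at z0. Factoring it out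
    replaces U by V in the transport term and does not change absolute values.\<close>
  define Cc where "Cc t = integral {0..t} (\<lambda>r. U r z0)" for t
  have Ucz: "continuous_on {0..x} (\<lambda>r. U r z0)" for x
    by (rule slice_z[OF U_cont]) (use z0 in auto)
  have Cc': "(Cc has_real_derivative U t z0) (at t)" if "0 < t" for t
  proof -
    have "(Cc has_vector_derivative U t z0) (at t within {0..t+1})"
      unfolding Cc_def[abs_def] by (rule integral_has_vector_derivative[OF Ucz]) (use that in auto)
    then show ?thesis using that by (simp add: has_real_derivative_iff_has_vector_derivative at_within_Icc_at)
  qed
  have Cc0: "(Cc \<longlongrightarrow> 0) (at_right 0)"
  proof -
    have "continuous_on {0..1} Cc" unfolding Cc_def[abs_def]
      by (rule indefinite_integral_continuous_1) (rule integrable_continuous_real[OF Ucz])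
    then have "(Cc \<longlongrightarrow> Cc 0) (at 0 within {0..1})" by (simp add: continuous_on_def)
    moreover have "Cc 0 = 0" by (simp add: Cc_def)
    ultimately show ?thesis by (simp add: at_within_Icc_at_right)
  qed
  define lam where "lam = 2 * a * \<kappa>"
  define g where "g t = exp (\<i> * \<nu> * Cc t - lam * t)" for t :: real
  define I where "I t = integral J (\<lambda>z. \<phi> t z * ?F (V z0 t z))" for t
  define y where "y t = g t * I t" for t
  define H where "H t z = - (\<i> * \<nu> * U t z * ?F (V z0 t z)) - \<i> * \<nu> * ?P (V z0 t z)
        + ?F2 (V z0 t z) * (U1 t z)\<^sup>2 + ?F1 (V z0 t z) * (2 * U2 t z - U2 t z0)" for t z
  \<comment> \<open>The residual of the approximate eigenfunction: with eigenvalue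
    \<open>lam\<close> = 2 a \<kappa> it is 0 for an exact parabola wherever the cutoff equals
    1.\<close>
  define G where "G t z = (\<i> * \<nu> * U t z0 - lam) * ?F (V z0 t z) + H t z" for t z
  have ng: "norm (g t) = exp (- (2 * a * k0 * t))" for t
    by (simp add: g_def norm_exp_eq_Re lam_def \<kappa>)
  have g': "(g has_vector_derivative (\<i> * \<nu> * U t z0 - lam) * g t) (at t)" if "0 < t" for t
  proof -
    have "((\<lambda>t. complex_of_real (Cc t)) has_vector_derivative of_real (U t z0)) (at t)"
      using Cc'[OF that] by (simp add: has_real_derivative_iff_has_vector_derivative has_vector_derivative_of_real)
    moreover have "((\<lambda>t. complex_of_real t) has_vector_derivative 1) (at t)"
      using has_vector_derivative_of_real[OF DERIV_ident] by simp
    ultimately have "((\<lambda>t. \<i> * \<nu> * Cc t - lam * t) has_vector_derivative \<i> * \<nu> * of_real (U t z0) - lam * 1) (at t)"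
      by (intro has_vector_derivative_diff has_vector_derivative_mult_right)
    from field_vector_diff_chain_at[OF this DERIV_exp] show ?thesis
      unfolding g_def[abs_def] by (simp add: o_def mult_ac)
  qed
  have ct: "continuous_on J (\<lambda>z. h t z)" if "continuous_on ({0..} \<times> {0<..}) (\<lambda>(t, z). h t z)" "0 \<le> t" for h :: "real \<Rightarrow> real \<Rightarrow> real" and t
    by (rule slice_t[OF that(1)]) (use that J in auto)
  have comp: "continuous_on J (\<lambda>z. K (V z0 t z))" if "continuous_on UNIV K" "0 \<le> t" for K :: "real \<Rightarrow> complex" and t
  proof -
    have "continuous_on J (\<lambda>z. V z0 t z)" unfolding V_def using ct[OF U_cont that(2)] by (intro continuous_intros)
    then show ?thesis by (rule continuous_on_compose2[OF that(1)]) auto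
  qed
  have PF_cont: "continuous_on UNIV ?P" "continuous_on UNIV ?F1"
    by (rule continuous_at_imp_continuous_on, rule ballI, rule has_vector_derivative_continuous, rule PF)+
  have \<phi>c: "continuous_on J (\<lambda>z. \<phi> t z)" if "0 < t" "t \<le> T" for t
    by (rule slice_t[OF \<phi>_cont]) (use that pos J in auto)
  have H_cont: "continuous_on J (H t)" if "0 \<le> t" for t
    unfolding H_def[abs_def]
    by (intro continuous_intros comp[OF _ that] PF_cont F_cont PF(4) ct[OF U_cont that] ct[OF U1_cont that] ct[OF U2_cont that])
  have G_cont: "continuous_on J (G t)" if "0 \<le> t" for t
    unfolding G_def[abs_def] by (intro continuous_intros H_cont comp[OF _ that] F_cont that)
  have I': "(I has_vector_derivative integral J (\<lambda>z. \<phi> t z * H t z)) (at t)" if "0 < t" "t \<le> T" for t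
    unfolding I_def[abs_def] H_def J_def
  proof (rule tested_mode_deriv[OF PF(1) PF(2) PF(3) PF(4) pos(2) pos(3)])
    show "t \<in> {0<..<S}" using that pos by auto
    fix z assume "z \<in> {z0 - W, z0 + W}"
    then show "?P (V z0 t z) = 0 \<and> ?F (V z0 t z) = 0 \<and> ?F1 (V z0 t z) = 0"
      using \<eta>(3)[OF bdry[of t z]] that by (simp add: prof_P_def prof_F_def prof_F1_def)
  qed
  have y': "(y has_vector_derivative g t * integral J (\<lambda>z. \<phi> t z * G t z)) (at t)" if "0 < t" "t \<le> T" for t
  proof -
    have i1: "(\<lambda>z. \<phi> t z * ?F (V z0 t z)) integrable_on J" "(\<lambda>z. \<phi> t z * H t z) integrable_on J"
      using \<phi>c[OF that] comp[OF F_cont less_imp_le[OF that(1)]] H_cont[OF less_imp_le[OF that(1)]] unfolding J_def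
      by - (rule integrable_continuous_real, (intro continuous_on_mult; assumption))+
    have "integral J (\<lambda>z. \<phi> t z * G t z) = integral J (\<lambda>z. (\<i> * \<nu> * U t z0 - lam) * (\<phi> t z * ?F (V z0 t z)) + \<phi> t z * H t z)"
      by (simp add: G_def algebra_simps)
    also have "\<dots> = (\<i> * \<nu> * U t z0 - lam) * I t + integral J (\<lambda>z. \<phi> t z * H t z)"
      unfolding I_def by (subst integral_add) (use i1 in \<open>simp_all add: integrable_on_mult_right\<close>)
    finally have e: "integral J (\<lambda>z. \<phi> t z * G t z) = (\<i> * \<nu> * U t z0 - lam) * I t + integral J (\<lambda>z. \<phi> t z * H t z)" .
    have "(y has_vector_derivative g t * integral J (\<lambda>z. \<phi> t z * H t z) + ((\<i> * \<nu> * U t z0 - lam) * g t) * I t) (at t)"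
      unfolding y_def[abs_def] by (rule has_vector_derivative_mult[OF g'[OF that(1)] I'[OF that]])
    then show ?thesis unfolding e by (simp add: algebra_simps)
  qed
  have GE: "norm (G t z) \<le> Gb" if t: "0 \<le> t" "t \<le> T" and z: "z \<in> J" for t z
  proof -
    let ?v = "V z0 t z" and ?Z = "z - z0"
    have Z: "\<bar>?Z\<bar> \<le> W" using z by (auto simp: J_def)
    have E2: "2 * W * E \<le> a * W"
    proof -
      have "W * (2 * E) \<le> W * a" using small pos by (intro mult_left_mono) auto
      then show ?thesis by (simp add: mult_ac)
    qed
    have aZ: "\<bar>2 * a * ?Z\<bar> \<le> 2 * a * W" using Z pos by (simp add: abs_mult)
    have u1: "\<bar>U1 t z\<bar> \<le> 3 * a * W" using reg(1)[OF t z] aZ E2 by linarith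
    \<comment> \<open>Both terms are compared with (2 a (z - z0))^2, the first through a difference
      of squares, the second through the parabola; the constants 17/2 + 8 are rounded up to
      17.\<close>
    have main: "\<bar>(U1 t z)\<^sup>2 - 4 * a * ?v\<bar> \<le> 17 * a * W\<^sup>2 * E"
    proof -
      have "(U1 t z)\<^sup>2 - 4 * a * ?v = (U1 t z - 2 * a * ?Z) * (U1 t z + 2 * a * ?Z) - 4 * a * (?v - a * ?Z\<^sup>2)"
        by (simp add: algebra_simps power2_eq_square)
      moreover have "\<bar>(U1 t z - 2 * a * ?Z) * (U1 t z + 2 * a * ?Z)\<bar> \<le> (2 * W * E) * (2 * W * E + 4 * a * W)"
      proof -
        have "\<bar>U1 t z + 2 * a * ?Z\<bar> \<le> 2 * W * E + 4 * a * W" using reg(1)[OF t z] aZ by linarith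
        then show ?thesis unfolding abs_mult using reg(1)[OF t z] pos by (intro mult_mono) auto
      qed
      moreover have "(2 * W * E) * (2 * W * E + 4 * a * W) \<le> (2 * W * E) * (17 / 4 * a * W)"
      proof (rule mult_left_mono)
        have "W * (8 * E) \<le> W * a" using small pos by (intro mult_left_mono) auto
        then show "2 * W * E + 4 * a * W \<le> 17 / 4 * a * W" by (simp add: algebra_simps)
      qed (use pos in auto)
      moreover have "\<bar>4 * a * (?v - a * ?Z\<^sup>2)\<bar> \<le> 4 * a * (2 * W\<^sup>2 * E)"
        unfolding abs_mult using reg(2)[OF t z] pos by (intro mult_mono) auto
      moreover have "(2 * W * E) * (17 / 4 * a * W) + 4 * a * (2 * W\<^sup>2 * E) \<le> 17 * a * W\<^sup>2 * E"
        using pos by (simp add: power2_eq_square)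
      ultimately show ?thesis by linarith
    qed
    have Gid: "G t z = - 4 * a * \<kappa>\<^sup>2 * ?v * ?F ?v - 4 * a * \<kappa>\<^sup>2 * ?P ?v - 2 * a * \<kappa> * ?F ?v
       + ?F2 ?v * (U1 t z)\<^sup>2 + ?F1 ?v * (2 * U2 t z - U2 t z0)"
      unfolding G_def H_def i\<nu> lam_def V_def by (simp add: algebra_simps)
    have "G t z = wexp \<kappa> ?v * (\<eta> 0 ?v * (\<kappa>\<^sup>2 * ((U1 t z)\<^sup>2 - 4 * a * ?v) - \<kappa> * (U2 t z - 2 * a) - \<kappa> * (U2 t z - U2 t z0)))
       + wexp \<kappa> ?v * (4 * a * \<kappa> * ?v * \<eta> 1 ?v + 2 * a * \<eta> 1 ?v + (U1 t z)\<^sup>2 * (- 3 * \<kappa> * \<eta> 1 ?v + 3 * \<eta> 2 ?v - \<eta> 3 ?v / \<kappa>)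
          + (2 * U2 t z - U2 t z0) * (2 * \<eta> 1 ?v - \<eta> 2 ?v / \<kappa>))"
      using residual_identity[OF \<kappa>0, of "of_real a" "of_real ?v" "wexp \<kappa> ?v" "of_real (\<eta> 0 ?v)" "of_real (\<eta> 1 ?v)" "of_real (\<eta> 2 ?v)"
          "of_real (\<eta> 3 ?v)" "of_real (U1 t z)" "of_real (U2 t z)" "of_real (U2 t z0)"]
      unfolding Gid prof_P_def prof_F_def prof_F1_def prof_F2_def by simp
    also have "norm \<dots> \<le> Gb"
      unfolding Gb_def wexp_def
    proof (rule residual_bound[where D = "2 / r"])
      show "\<bar>\<eta> 0 ?v\<bar> \<le> C" "\<bar>\<eta> 1 ?v\<bar> \<le> C * (2 / r)" "\<bar>\<eta> 2 ?v\<bar> \<le> C * (2 / r)\<^sup>2" "\<bar>\<eta> 3 ?v\<bar> \<le> C * (2 / r) ^ 3"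
        using \<eta>(2)[of 0 ?v] \<eta>(2)[of 1 ?v] \<eta>(2)[of 2 ?v] \<eta>(2)[of 3 ?v] by auto
      show "\<eta> 1 ?v = 0 \<and> \<eta> 2 ?v = 0 \<and> \<eta> 3 ?v = 0" if "?v < r / 2 \<or> r < ?v"
        using that \<eta>(3,4) by auto
    qed (use pos \<kappa> r small Vlow[OF t z] main u1 U2_E[OF t z] U2_E[OF t J(2)] in auto)
    finally show ?thesis .
  qed
  define \<Lambda> where "\<Lambda> = 2 * a * k0 - s"
  have \<Lambda>: "0 < \<Lambda>" using pos by (simp add: \<Lambda>_def)
  have Gb0: "0 \<le> Gb" using norm_ge_zero[of "G 0 z0"] GE[of 0 z0] pos J by linarith
  have expc: "exp (- (2 * a * k0 * t)) * (B * (p0 * exp (s * t))) = B * p0 * exp (- \<Lambda> * t)" for t B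
    by (simp add: \<Lambda>_def algebra_simps flip: exp_add)
  have y'_le: "norm (g t * integral J (\<lambda>z. \<phi> t z * G t z)) \<le> Gb * p0 * exp (- \<Lambda> * t)" if "0 < t" "t \<le> T" for t
  proof -
    have "norm (integral J (\<lambda>z. \<phi> t z * G t z)) \<le> Gb * (p0 * exp (s * t))"
      by (rule apriori) (use that G_cont GE in auto)
    then have "norm (g t * integral J (\<lambda>z. \<phi> t z * G t z)) \<le> exp (- (2 * a * k0 * t)) * (Gb * (p0 * exp (s * t)))"
      unfolding norm_mult ng by (intro mult_left_mono) auto
    then show ?thesis unfolding expc .
  qed
  have yT: "norm (y T) \<le> 2 * exp 2 * C * p0 * exp (- \<Lambda> * T)"
  proof -
    have "norm (I T) \<le> 2 * exp 2 * C * (p0 * exp (s * T))"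
      unfolding I_def by (rule apriori) (use pos F_le comp[OF F_cont] in auto)
    then have "norm (y T) \<le> exp (- (2 * a * k0 * T)) * (2 * exp 2 * C * (p0 * exp (s * T)))"
      unfolding y_def norm_mult ng by (intro mult_left_mono) auto
    then show ?thesis unfolding expc .
  qed
  have y_le: "norm (y t) \<le> p0 * (Gb / \<Lambda> + 2 * exp 2 * C * exp (- \<Lambda> * T))" if t: "0 < t" "t < T" for t
  proof -
    \<comment> \<open>A primitive of the bound on y', which makes the integral of y' at most
      \<open>Gb * p0 / \<Lambda>\<close> whatever T is.\<close>
    define b where "b x = - (Gb * p0 / \<Lambda>) * exp (- \<Lambda> * x)" for x
    have b': "(b has_vector_derivative Gb * p0 * exp (- \<Lambda> * x)) (at x)" for x
      unfolding b_def[abs_def] has_real_derivative_iff_has_vector_derivative[symmetric]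
      using \<Lambda> by (auto intro!: derivative_eq_intros)
    have "norm (y T - y t) \<le> b T - b t"
    proof (rule differentiable_bound_general[OF t(2), where f' = "\<lambda>t. g t * integral J (\<lambda>z. \<phi> t z * G t z)"])
      show "continuous_on {t..T} y"
        by (rule continuous_at_imp_continuous_on, rule ballI, rule has_vector_derivative_continuous, rule y') (use t in auto)
      show "continuous_on {t..T} b"
        by (rule continuous_at_imp_continuous_on, rule ballI, rule has_vector_derivative_continuous, rule b')
    qed (use t y' b' y'_le in auto)
    also have "\<dots> \<le> Gb * p0 / \<Lambda>"
    proof -
      have "b T \<le> 0" using Gb0 pos \<Lambda> by (simp add: b_def)
      moreover have "- b t \<le> Gb * p0 / \<Lambda> * 1"
        unfolding b_def using Gb0 pos \<Lambda> t by (simp only: minus_mult_left[symmetric] minus_minus) (intro mult_left_mono, auto)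
      ultimately show ?thesis by linarith
    qed
    finally have "norm (y T - y t) \<le> Gb * p0 / \<Lambda>" .
    then have "norm (y t) \<le> Gb * p0 / \<Lambda> + 2 * exp 2 * C * p0 * exp (- \<Lambda> * T)"
      using yT norm_triangle_ineq3[of "y t" "y T"] by (simp add: norm_minus_commute)
    then show ?thesis by (simp add: algebra_simps)
  qed
  \<comment> \<open>The equation holds only for t > 0, and \<open>\<phi>\<close> reaches its data
    only in L1 on the window. Splitting off the product of \<open>\<phi>\<close> -
    \<open>\<phi>0\<close> with F(V), where F(V) is uniformly bounded, leaves an integral that is
    continuous up to t = 0.\<close>
  have y_lim: "(y \<longlongrightarrow> integral J (\<lambda>z. \<phi>0 z * ?F (V z0 0 z))) (at_right 0)"
  proof -
    have g1: "(g \<longlongrightarrow> 1) (at_right 0)"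
    proof -
      have "((\<lambda>t. exp (\<i> * \<nu> * Cc t - lam * t)) \<longlongrightarrow> exp (\<i> * \<nu> * of_real 0 - lam * of_real 0)) (at_right 0)"
        by (intro tendsto_intros Cc0)
      then show ?thesis by (simp add: g_def[abs_def])
    qed
    have "continuous_on ({0..T} \<times> cbox (z0 - W) (z0 + W)) (\<lambda>p. \<phi>0 (snd p) * (case p of (t, z) \<Rightarrow> ?F (V z0 t z)))"
      using \<Theta>_cont[of "{0..T}"] init(2) unfolding J_def
      by (intro continuous_intros continuous_on_compose2[of "{z0 - W..z0 + W}" \<phi>0 _ snd]) auto
    then have "continuous_on ({0..T} \<times> cbox (z0 - W) (z0 + W)) (\<lambda>(t, z). \<phi>0 z * ?F (V z0 t z))"
      by (simp add: case_prod_unfold)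
    from integral_continuous_on_param[OF this]
    have "((\<lambda>t. integral J (\<lambda>z. \<phi>0 z * ?F (V z0 t z))) \<longlongrightarrow> integral J (\<lambda>z. \<phi>0 z * ?F (V z0 0 z))) (at 0 within {0..T})"
      using pos by (auto simp: continuous_on_def J_def)
    then have l1: "((\<lambda>t. integral J (\<lambda>z. \<phi>0 z * ?F (V z0 t z))) \<longlongrightarrow> integral J (\<lambda>z. \<phi>0 z * ?F (V z0 0 z))) (at_right 0)"
      using pos by (simp add: at_within_Icc_at_right)
    have l2: "((\<lambda>t. I t - integral J (\<lambda>z. \<phi>0 z * ?F (V z0 t z))) \<longlongrightarrow> 0) (at_right 0)"
    proof (rule Lim_null_comparison)
      show "((\<lambda>t. 2 * exp 2 * C * integral J (\<lambda>z. norm (\<phi> t z - \<phi>0 z))) \<longlongrightarrow> 0) (at_right 0)"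
        using tendsto_mult_right_zero[OF init(1)] .
      have "norm (I t - integral J (\<lambda>z. \<phi>0 z * ?F (V z0 t z))) \<le> 2 * exp 2 * C * integral J (\<lambda>z. norm (\<phi> t z - \<phi>0 z))"
        if t: "0 < t" "t < T" for t
      proof -
        have tT: "t \<le> T" "0 \<le> t" using t by auto
        have i: "(\<lambda>z. \<phi> t z * ?F (V z0 t z)) integrable_on J" "(\<lambda>z. \<phi>0 z * ?F (V z0 t z)) integrable_on J"
          "(\<lambda>z. \<phi> t z * ?F (V z0 t z) - \<phi>0 z * ?F (V z0 t z)) integrable_on J"
          "(\<lambda>z. 2 * exp 2 * C * norm (\<phi> t z - \<phi>0 z)) integrable_on J"
          using \<phi>c[OF t(1) tT(1)] comp[OF F_cont tT(2)] init(2) unfolding J_def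
          by - (rule integrable_continuous_real, (intro continuous_intros; assumption))+
        have e: "I t - integral J (\<lambda>z. \<phi>0 z * ?F (V z0 t z)) = integral J (\<lambda>z. \<phi> t z * ?F (V z0 t z) - \<phi>0 z * ?F (V z0 t z))"
          unfolding I_def by (rule integral_diff[OF i(1,2), symmetric])
        have "norm (integral J (\<lambda>z. \<phi> t z * ?F (V z0 t z) - \<phi>0 z * ?F (V z0 t z))) \<le> integral J (\<lambda>z. 2 * exp 2 * C * norm (\<phi> t z - \<phi>0 z))"
        proof (rule integral_norm_bound_integral[OF i(3,4)])
          fix z assume z: "z \<in> J"
          have "norm (\<phi> t z * ?F (V z0 t z) - \<phi>0 z * ?F (V z0 t z)) = norm (?F (V z0 t z)) * norm (\<phi> t z - \<phi>0 z)"
            by (simp add: norm_mult left_diff_distrib[symmetric] mult.commute)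
          also have "\<dots> \<le> 2 * exp 2 * C * norm (\<phi> t z - \<phi>0 z)" using F_le[OF tT(2,1) z] by (intro mult_right_mono) auto
          finally show "norm (\<phi> t z * ?F (V z0 t z) - \<phi>0 z * ?F (V z0 t z)) \<le> 2 * exp 2 * C * norm (\<phi> t z - \<phi>0 z)" .
        qed
        then show ?thesis unfolding e Henstock_Kurzweil_Integration.integral_mult_right .
      qed
      then show "\<forall>\<^sub>F t in at_right 0. norm (I t - integral J (\<lambda>z. \<phi>0 z * ?F (V z0 t z))) \<le> 2 * exp 2 * C * integral J (\<lambda>z. norm (\<phi> t z - \<phi>0 z))"
        using pos by (auto simp: eventually_at_right intro!: exI[of _ T])
    qed
    have "(I \<longlongrightarrow> integral J (\<lambda>z. \<phi>0 z * ?F (V z0 0 z))) (at_right 0)"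
      using tendsto_add[OF l2 l1] by simp
    from tendsto_mult[OF g1 this] show ?thesis by (simp add: y_def[abs_def])
  qed
  show ?thesis using Lim_upperbound_at_right[OF y_lim pos(7) y_le] by (simp add: \<Lambda>_def)
qed

end

section \<open>Single-mode data and the operator norm\<close>

text \<open>Orthogonality without evaluating integrals: the coefficient of a derivative of the
  exponential is i times a component of k on the one hand, and i times a component of
  \<open>k0\<close> by \<open>fc_deriv_x\<close> and \<open>fc_deriv_y\<close> on the other. If some
  component differs, the coefficient is 0.\<close>

lemma fc_cis_phase:
  "fc k0 (\<lambda>x y. cis (phase k x y)) = (if k = k0 then 1 else 0)"
proof -
  have c: "continuous_on UNIV (\<lambda>(x, y). cis (phase k x y))"
  proof -
    have "continuous_on UNIV (\<lambda>p. cis (phase k (fst p) (snd p)))"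
      unfolding phase_def by (intro continuous_intros)
    then show ?thesis by (simp add: case_prod_unfold)
  qed
  have cm: "continuous_on UNIV (\<lambda>(x, y). a * cis (phase k x y))" for a
    using continuous_on_mult[OF continuous_on_const c, of a] by (simp add: case_prod_unfold)
  have dcis: "((\<lambda>r. cis (g r)) has_vector_derivative \<i> * of_real g' * cis (g x)) (at x)"
    if "(g has_real_derivative g') (at x)" for g g' x
  proof -
    have "(g has_derivative (\<lambda>h. h * g')) (at x)"
    proof -
      have "(\<lambda>h. h * g') = (*) g'" by (auto simp: mult.commute)
      then show ?thesis using that by (simp add: has_field_derivative_def)
    qed
    from has_derivative_cis[OF this] show ?thesis
      unfolding has_vector_derivative_def
      by (rule has_derivative_eq_rhs) (auto simp: scaleR_conv_of_real)
  qed
  have dx: "((\<lambda>x. cis (phase k x y)) has_vector_derivative \<i> * of_int (fst k) * cis (phase k x y)) (at x)" for x y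
  proof -
    have "((\<lambda>x. phase k x y) has_real_derivative of_int (fst k)) (at x)"
      unfolding phase_def by (auto intro!: derivative_eq_intros)
    from dcis[OF this] show ?thesis by simp
  qed
  have dy: "((\<lambda>y. cis (phase k x y)) has_vector_derivative \<i> * of_int (snd k) * cis (phase k x y)) (at y)" for x y
  proof -
    have "((\<lambda>y. phase k x y) has_real_derivative of_int (snd k)) (at y)"
      unfolding phase_def by (auto intro!: derivative_eq_intros)
    from dcis[OF this] show ?thesis by simp
  qed
  have per: "cis (phase k (x + 2 * pi) y) = cis (phase k x y)" "cis (phase k x (y + 2 * pi)) = cis (phase k x y)" for x y
  proof -
    have m: "cis (2 * pi * of_int j) = 1" for j by (simp add: cis_multiple_2pi)
    have "phase k (x + 2 * pi) y = phase k x y + 2 * pi * of_int (fst k)"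
      "phase k x (y + 2 * pi) = phase k x y + 2 * pi * of_int (snd k)" by (simp_all add: phase_def algebra_simps)
    then show "cis (phase k (x + 2 * pi) y) = cis (phase k x y)" "cis (phase k x (y + 2 * pi)) = cis (phase k x y)"
      using m by (simp_all flip: cis_mult)
  qed
  have lin: "fc k0 (\<lambda>x y. a * cis (phase k x y)) = a * fc k0 (\<lambda>x y. cis (phase k x y))" for a
    using fc_linear[OF c c, of k0 a 0] by simp
  have "\<i> * of_int (fst k) * fc k0 (\<lambda>x y. cis (phase k x y)) = \<i> * of_int (fst k0) * fc k0 (\<lambda>x y. cis (phase k x y))"
    using fc_deriv_x[OF dx c cm per(1), of k0] by (simp add: lin)
  moreover have "\<i> * of_int (snd k) * fc k0 (\<lambda>x y. cis (phase k x y)) = \<i> * of_int (snd k0) * fc k0 (\<lambda>x y. cis (phase k x y))"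
    using fc_deriv_y[OF dy c cm per(2), of k0] by (simp add: lin)
  ultimately have "k \<noteq> k0 \<Longrightarrow> fc k0 (\<lambda>x y. cis (phase k x y)) = 0"
    by (auto simp: prod_eq_iff)
  moreover have "fc k (\<lambda>x y. cis (phase k x y)) = 1"
    unfolding fc_def by (simp add: cis_mult case_prod_unfold content_Pair power2_eq_square scaleR_conv_of_real)
  ultimately show ?thesis by auto
qed

lemma continuous_cis_phase: "continuous_on A (\<lambda>(x, y). a * cis (phase k x y))"
proof -
  have "continuous_on A (\<lambda>p. a * cis (phase k (fst p) (snd p)))"
    unfolding phase_def by (intro continuous_intros)
  then show ?thesis by (simp add: case_prod_unfold)
qed

lemma fc_sum_cis_phase:
  assumes "finite A"
  shows "fc k0 (\<lambda>x y. \<Sum>k\<in>A. c k * cis (phase k x y)) = (if k0 \<in> A then c k0 else 0)"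
  using assms
proof (induction A rule: finite_induct)
  case empty
  then show ?case by (simp add: fc_def case_prod_unfold)
next
  case (insert j A)
  have "continuous_on UNIV (\<lambda>p. \<Sum>k\<in>A. c k * cis (phase k (fst p) (snd p)))"
    unfolding phase_def by (intro continuous_intros)
  then have cA: "continuous_on UNIV (\<lambda>(x, y). \<Sum>k\<in>A. c k * cis (phase k x y))" by (simp add: case_prod_unfold)
  have cj: "continuous_on UNIV (\<lambda>(x, y). cis (phase j x y))" using continuous_cis_phase[of UNIV 1 j] by simp
  have "fc k0 (\<lambda>x y. \<Sum>k\<in>insert j A. c k * cis (phase k x y))
      = fc k0 (\<lambda>x y. c j * cis (phase j x y) + 1 * (\<Sum>k\<in>A. c k * cis (phase k x y)))"
    using insert by simp
  also have "\<dots> = c j * fc k0 (\<lambda>x y. cis (phase j x y)) + 1 * fc k0 (\<lambda>x y. \<Sum>k\<in>A. c k * cis (phase k x y))"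
    by (rule fc_linear[OF cj cA])
  finally show ?case using insert by (auto simp: fc_cis_phase)
qed

text \<open>At x = y = 0 all phases are 1, so the assumed unconditional sum makes the coefficients
  summable, which for complex numbers means absolutely summable. A multiplier bounded by 1 preserves
  this; the series converges uniformly by the Weierstrass test and may be integrated term by
  term.\<close>

lemma fcoeff_fourier_mult:
  assumes hs: "\<forall>x y. ((\<lambda>k. fcoeff f k z * cis (phase k x y)) has_sum f x y z) UNIV"
    and g: "\<And>k. \<bar>g k\<bar> \<le> 1"
  shows "fcoeff (fourier_mult g f) k0 z = of_real (g k0) * fcoeff f k0 z"
proof -
  let ?c = "\<lambda>k. fcoeff f k z"
  have "((\<lambda>k. ?c k) has_sum f 0 0 z) UNIV" using hs[rule_format, of 0 0] by (simp add: phase_def)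
  then have "?c summable_on UNIV" by (rule has_sum_imp_summable)
  then have sm: "(\<lambda>k. norm (?c k)) summable_on UNIV" by (simp add: summable_on_iff_abs_summable_on_complex)
  define h where "h = (\<lambda>k (x, y). of_real (g k) * ?c k * cis (phase k x y))"
  define F where "F = (\<lambda>p. \<Sum>\<^sub>\<infinity>k. h k p)"
  have fm: "fourier_mult g f x y z = F (x, y)" for x y
    by (simp add: fourier_mult_def F_def h_def)
  have ul: "uniform_limit UNIV (\<lambda>X p. \<Sum>k\<in>X. h k p) F (finite_subsets_at_top UNIV)"
    unfolding F_def
  proof (rule Weierstrass_m_test_general[OF _ sm])
    fix k :: "int \<times> int" and p :: "real \<times> real"
    show "norm (h k p) \<le> norm (?c k)"
      using g[of k] by (auto simp: h_def norm_mult case_prod_unfold intro!: mult_left_le_one_le)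
  qed
  have hc: "continuous_on A (\<lambda>p. \<Sum>k\<in>X. h k p)" for A X
    unfolding h_def by (intro continuous_intros continuous_cis_phase)
  have Fc: "continuous_on UNIV F"
    by (rule uniform_limit_theorem[OF _ ul]) (auto intro: hc)
  let ?B = "cbox (0, 0) (2*pi, 2*pi) :: (real \<times> real) set"
  let ?e = "\<lambda>p. cis (- phase k0 (fst p) (snd p))"
  have ec: "continuous_on A ?e" for A unfolding phase_def by (intro continuous_intros)
  have ul2: "uniform_limit ?B (\<lambda>X p. (\<Sum>k\<in>X. h k p) * ?e p) (\<lambda>p. F p * ?e p) (finite_subsets_at_top UNIV)"
  proof (rule uniform_limitI)
    fix e :: real assume "0 < e"
    from uniform_limitD[OF ul this]
    show "\<forall>\<^sub>F X in finite_subsets_at_top UNIV. \<forall>p\<in>?B. dist ((\<Sum>k\<in>X. h k p) * ?e p) (F p * ?e p) < e"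
    proof eventually_elim
      case (elim X)
      show ?case
      proof
        fix p
        have "(\<Sum>k\<in>X. h k p) * ?e p - F p * ?e p = ((\<Sum>k\<in>X. h k p) - F p) * ?e p"
          by (simp only: left_diff_distrib)
        then have "dist ((\<Sum>k\<in>X. h k p) * ?e p) (F p * ?e p) = dist (\<Sum>k\<in>X. h k p) (F p)"
          unfolding dist_norm by (simp only: norm_mult norm_cis mult_1_right)
        then show "dist ((\<Sum>k\<in>X. h k p) * ?e p) (F p * ?e p) < e" using elim by (simp only: UNIV_I)
      qed
    qed
  qed
  have c: "continuous_on ?B (\<lambda>p. (\<Sum>k\<in>X. h k p) * ?e p)" for X
    by (rule continuous_on_mult[OF hc ec])
  obtain I J where I: "\<And>X. ((\<lambda>p. (\<Sum>k\<in>X. h k p) * ?e p) has_integral I X) ?B"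
    and J: "((\<lambda>p. F p * ?e p) has_integral J) ?B" and lim: "(I \<longlongrightarrow> J) (finite_subsets_at_top UNIV)"
    by (rule uniform_limit_integral_cbox[OF ul2 c finite_subsets_at_top_neq_bot], rule that)
  have IX: "I X / (4 * pi\<^sup>2) = (if k0 \<in> X then of_real (g k0) * ?c k0 else 0)" if "finite X" for X
    using fc_sum_cis_phase[OF that, of k0 "\<lambda>k. of_real (g k) * ?c k"] integral_unique[OF I[of X]]
    by (simp add: fc_def h_def case_prod_unfold)
  have "\<forall>\<^sub>F X in finite_subsets_at_top UNIV. I X / (4 * pi\<^sup>2) = of_real (g k0) * ?c k0"
    unfolding eventually_finite_subsets_at_top using IX by (intro exI[of _ "{k0}"]) auto
  then have "((\<lambda>X. I X / (4 * pi\<^sup>2)) \<longlongrightarrow> of_real (g k0) * ?c k0) (finite_subsets_at_top UNIV)"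
    by (rule tendsto_eventually)
  moreover have "((\<lambda>X. I X / (4 * pi\<^sup>2)) \<longlongrightarrow> J / (4 * pi\<^sup>2)) (finite_subsets_at_top UNIV)"
    by (intro tendsto_intros lim) simp
  ultimately have "J / (4 * pi\<^sup>2) = of_real (g k0) * ?c k0"
    using tendsto_unique[OF finite_subsets_at_top_neq_bot] by blast
  moreover have "fcoeff (fourier_mult g f) k0 z = fc k0 (\<lambda>x y. F (x, y))"
  proof -
    have "fcoeff (fourier_mult g f) k0 z = fcoeff (\<lambda>x y z'. F (x, y)) k0 z"
      unfolding fcoeff_def by (simp add: fm)
    also have "\<dots> = fc k0 (\<lambda>x y. F (x, y))" by (rule fcoeff_eq_fc) (simp add: Fc)
    finally show ?thesis .
  qed
  moreover have "fc k0 (\<lambda>x y. F (x, y)) = J / (4 * pi\<^sup>2)"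
    unfolding fc_def using integral_unique[OF J] by (simp add: case_prod_unfold)
  ultimately show ?thesis by simp
qed

section \<open>Calculus of the weighted norms and of single modes\<close>

lemma ennsqrt_power2 [simp]: "(ennsqrt a)\<^sup>2 = a"
proof (cases a)
  case (real r)
  then show ?thesis by (simp add: ennsqrt_def ennreal_power)
next
  case top
  then show ?thesis by (simp add: ennsqrt_def power2_eq_square ennreal_top_mult)
qed

lemma ennsqrt_square [simp]: "ennsqrt (a\<^sup>2) = a"
proof (cases a)
  case (real r)
  then show ?thesis by (simp add: ennsqrt_def ennreal_power)
next
  case top
  then show ?thesis by (simp add: ennsqrt_def power2_eq_square ennreal_top_mult)
qed

lemma ennsqrt_mono: "a \<le> b \<Longrightarrow> ennsqrt a \<le> ennsqrt b"
  unfolding ennsqrt_def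
  by (cases a; cases b) (auto simp: ennreal_le_iff2 top_unique)

text \<open>\<open>L2_norm\<close> is infinite by convention on non-measurable functions, so for
  such g the inequality is trivial. It is applied to a damped Fourier coefficient, which is
  identified only for almost every z.\<close>

lemma L2_norm_le_AE_cong:
  assumes "f \<in> borel_measurable (lebesgue_on {0<..})" "AE z in lebesgue_on {0<..}. f z = g z"
  shows "L2_norm f \<le> L2_norm g"
proof (cases "g \<in> borel_measurable (lebesgue_on {0<..})")
  case True
  have "(\<integral>\<^sup>+ z. (ennreal (norm (f z)))\<^sup>2 \<partial>lebesgue_on {0<..}) = (\<integral>\<^sup>+ z. (ennreal (norm (g z)))\<^sup>2 \<partial>lebesgue_on {0<..})"
    by (rule nn_integral_cong_AE) (use assms(2) in \<open>eventually_elim, simp\<close>)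
  then show ?thesis using assms True by (simp add: L2_norm_def)
qed (simp add: L2_norm_def)

lemma L2_norm_cong:
  assumes "\<And>z. 0 < z \<Longrightarrow> f z = g z"
  shows "L2_norm f = L2_norm g"
proof -
  have m: "f \<in> borel_measurable (lebesgue_on {0<..}) \<longleftrightarrow> g \<in> borel_measurable (lebesgue_on {0<..})"
    by (rule measurable_cong) (use assms in auto)
  have "(\<integral>\<^sup>+ z. (ennreal (norm (f z)))\<^sup>2 \<partial>lebesgue_on {0<..}) = (\<integral>\<^sup>+ z. (ennreal (norm (g z)))\<^sup>2 \<partial>lebesgue_on {0<..})"
    by (rule nn_integral_cong) (use assms in auto)
  with m show ?thesis by (simp add: L2_norm_def)
qed

lemma L2_norm_cmult:
  fixes f :: "real \<Rightarrow> complex"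
  assumes "f \<in> borel_measurable (lebesgue_on {0<..})"
  shows "L2_norm (\<lambda>z. c * f z) = ennreal (norm c) * L2_norm f"
proof -
  have m: "(\<lambda>z. c * f z) \<in> borel_measurable (lebesgue_on {0<..})" using assms by measurable
  have "(L2_norm (\<lambda>z. c * f z))\<^sup>2 = (\<integral>\<^sup>+ z. (ennreal (norm c))\<^sup>2 * (ennreal (norm (f z)))\<^sup>2 \<partial>lebesgue_on {0<..})"
    using m by (simp add: L2_norm_def norm_mult ennreal_mult power_mult_distrib)
  also have "\<dots> = (ennreal (norm c) * L2_norm f)\<^sup>2"
    using assms by (subst nn_integral_cmult) (auto simp: L2_norm_def power_mult_distrib)
  finally have "ennsqrt ((L2_norm (\<lambda>z. c * f z))\<^sup>2) = ennsqrt ((ennreal (norm c) * L2_norm f)\<^sup>2)" by simp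
  then show ?thesis by (simp only: ennsqrt_square)
qed

lemma L2w_norm_cong: "(\<And>z. 0 < z \<Longrightarrow> f z = g z) \<Longrightarrow> L2w_norm \<alpha> f = L2w_norm \<alpha> g"
  unfolding L2w_norm_def by (rule L2_norm_cong) (simp add: weighted_def)

lemma fcoeff_cong: "(\<And>x y. f x y z = g x y z) \<Longrightarrow> fcoeff f k z = fcoeff g k z"
  unfolding fcoeff_def by simp

lemma ennreal_power2_le_imp_le: "(a::ennreal)\<^sup>2 \<le> b\<^sup>2 \<Longrightarrow> a \<le> b"
  using ennsqrt_mono[of "a\<^sup>2" "b\<^sup>2"] by simp

lemma ennreal_le_mult_of_divide_le:
  assumes "a / ennreal B \<le> ennreal M" "0 < B" "0 \<le> M"
  shows "a \<le> ennreal (M * B)"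
proof (cases a)
  case (real r)
  then show ?thesis using assms by (simp add: divide_ennreal ennreal_le_iff pos_divide_le_eq)
next
  case top
  then show ?thesis using assms by (simp add: ennreal_top_divide top_unique)
qed

lemma E_space_mono:
  assumes "f \<in> E_space \<alpha> \<beta>" "\<beta>' \<le> \<beta>"
  shows "f \<in> E_space \<alpha> \<beta>'"
proof -
  have "E_norm \<alpha> \<beta>' f \<le> E_norm \<alpha> \<beta> f"
    unfolding E_norm_def using assms(2)
    by (intro SUP_mono' mult_right_mono) (auto simp: freq2_def intro!: mult_right_mono)
  then show ?thesis using assms(1) by (auto simp: E_space_def)
qed

lemma E_space_coeff:
  assumes "f \<in> E_space \<alpha> \<beta>"
  shows "L2w_norm \<alpha> (fcoeff f k) < \<infinity>" and "fcoeff f k \<in> borel_measurable (lebesgue_on {0<..})"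
proof -
  have "ennreal (exp (\<beta> * sqrt (freq2 k))) * L2w_norm \<alpha> (fcoeff f k) \<le> E_norm \<alpha> \<beta> f"
    unfolding E_norm_def by (rule SUP_upper) simp
  also have "\<dots> < top" using assms by (simp add: E_space_def)
  finally show fin: "L2w_norm \<alpha> (fcoeff f k) < \<infinity>" by (auto simp: ennreal_mult_less_top)
  then have m: "weighted \<alpha> (fcoeff f k) \<in> borel_measurable (lebesgue_on {0<..})"
    by (auto simp: L2w_norm_def L2_norm_def split: if_splits)
  have e: "(\<lambda>z. exp (- \<alpha> * z)) \<in> borel_measurable (lebesgue_on {0<..})"
    by (intro measurable_restrict_space1 measurable_completion) measurable
  have "(\<lambda>z. exp (- \<alpha> * z) *\<^sub>R weighted \<alpha> (fcoeff f k) z) \<in> borel_measurable (lebesgue_on {0<..})"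
    by (rule borel_measurable_scaleR[OF e m])
  moreover have "exp (- \<alpha> * z) *\<^sub>R weighted \<alpha> (fcoeff f k) z = fcoeff f k z" for z
    by (simp add: weighted_def flip: exp_add)
  ultimately show "fcoeff f k \<in> borel_measurable (lebesgue_on {0<..})" by simp
qed

lemma weighted_measurable:
  fixes f :: "real \<Rightarrow> complex"
  assumes "f \<in> borel_measurable (lebesgue_on {0<..})"
  shows "weighted \<alpha> f \<in> borel_measurable (lebesgue_on {0<..})"
proof -
  have e: "(\<lambda>z. exp (\<alpha> * z)) \<in> borel_measurable (lebesgue_on {0<..})"
    by (intro measurable_restrict_space1 measurable_completion) measurable
  show ?thesis unfolding weighted_def[abs_def] by (rule borel_measurable_scaleR[OF e assms])
qed

lemma L2w_norm_cmult:
  assumes "f \<in> borel_measurable (lebesgue_on {0<..})"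
  shows "L2w_norm \<alpha> (\<lambda>z. c * f z) = ennreal (norm c) * L2w_norm \<alpha> f"
proof -
  have "weighted \<alpha> (\<lambda>z. c * f z) = (\<lambda>z. c * weighted \<alpha> f z)" by (auto simp: weighted_def)
  then show ?thesis unfolding L2w_norm_def by (simp add: L2_norm_cmult weighted_measurable assms)
qed

lemma L2w_norm_damped:
  assumes f: "f \<in> E_space \<alpha> \<beta>" and g: "\<And>k. \<bar>g k\<bar> \<le> 1" "0 \<le> g k"
  shows "ennreal (g k) * L2w_norm \<alpha> (fcoeff f k) \<le> L2w_norm \<alpha> (fcoeff (fourier_mult g f) k)"
proof -
  note m = E_space_coeff(2)[OF f, of k]
  have "ennreal (g k) * L2w_norm \<alpha> (fcoeff f k) = L2w_norm \<alpha> (\<lambda>z. of_real (g k) * fcoeff f k z)"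
    using L2w_norm_cmult[OF m, of \<alpha> "of_real (g k)"] g(2) by simp
  also have "\<dots> \<le> L2w_norm \<alpha> (fcoeff (fourier_mult g f) k)"
    unfolding L2w_norm_def
  proof (rule L2_norm_le_AE_cong)
    have "(\<lambda>z. of_real (g k) * fcoeff f k z) \<in> borel_measurable (lebesgue_on {0<..})" using m by measurable
    then show "weighted \<alpha> (\<lambda>z. of_real (g k) * fcoeff f k z) \<in> borel_measurable (lebesgue_on {0<..})"
      by (rule weighted_measurable)
    have "AE z in lebesgue_on {0<..}. \<forall>x y. ((\<lambda>k. fcoeff f k z * cis (phase k x y)) has_sum f x y z) UNIV"
      using f by (simp add: E_space_def)
    then show "AE z in lebesgue_on {0<..}. weighted \<alpha> (\<lambda>z. of_real (g k) * fcoeff f k z) z = weighted \<alpha> (fcoeff (fourier_mult g f) k) z"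
      by eventually_elim (simp add: weighted_def fcoeff_fourier_mult[OF _ g(1)])
  qed
  finally show ?thesis .
qed

lemma calH_norm_ge:
  "ennreal ((1 + freq2 k) powr m) * (L2w_norm \<alpha> (fcoeff (fst p) k))\<^sup>2 \<le> (calH_norm \<alpha> m p)\<^sup>2"
  "ennreal ((1 + freq2 k) powr m) * (L2w_norm \<alpha> (fcoeff (snd p) k))\<^sup>2 \<le> (calH_norm \<alpha> m p)\<^sup>2"
proof -
  let ?h = "\<lambda>k. ennreal ((1 + freq2 k) powr m) *
       ((L2w_norm \<alpha> (fcoeff (fst p) k))\<^sup>2 + (L2w_norm \<alpha> (fcoeff (snd p) k))\<^sup>2)"
  have "?h k = sum ?h {k}" by simp
  also have "\<dots> \<le> infsum ?h UNIV"
    unfolding nonneg_infsum_complete[of UNIV ?h, simplified] by (rule SUP_upper) simp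
  finally have "?h k \<le> (calH_norm \<alpha> m p)\<^sup>2" by (simp add: calH_norm_def)
  note le = this
  show "ennreal ((1 + freq2 k) powr m) * (L2w_norm \<alpha> (fcoeff (fst p) k))\<^sup>2 \<le> (calH_norm \<alpha> m p)\<^sup>2"
    by (rule order_trans[OF mult_left_mono le]) auto
  show "ennreal ((1 + freq2 k) powr m) * (L2w_norm \<alpha> (fcoeff (snd p) k))\<^sup>2 \<le> (calH_norm \<alpha> m p)\<^sup>2"
    by (rule order_trans[OF mult_left_mono le]) auto
qed

definition mode_field :: "int \<times> int \<Rightarrow> complex \<Rightarrow> (real \<Rightarrow> complex) \<Rightarrow> field3" where
  "mode_field k c f = (\<lambda>x y z. c * f z * cis (phase k x y))"

lemma fcoeff_mode_field:
  "fcoeff (mode_field k c f) j z = (if j = k then c * f z else 0)"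
proof -
  have c: "continuous_on UNIV (\<lambda>(x, y). mode_field k c f x y z)"
    unfolding mode_field_def by (rule continuous_cis_phase)
  have cc: "continuous_on UNIV (\<lambda>(x, y). cis (phase k x y))" using continuous_cis_phase[of UNIV 1 k] by simp
  have "fcoeff (mode_field k c f) j z = fc j (\<lambda>x y. (c * f z) * cis (phase k x y))"
    unfolding fcoeff_eq_fc[where f = "mode_field k c f" and z = z, OF c] by (simp add: mode_field_def)
  also have "\<dots> = (c * f z) * fc j (\<lambda>x y. cis (phase k x y))"
    using fc_linear[OF cc cc, of j "c * f z" 0] by simp
  finally show ?thesis by (simp add: fc_cis_phase)
qed

lemma L2w_norm_zero: "L2w_norm \<alpha> (\<lambda>z. 0) = 0"
  by (simp add: L2w_norm_def L2_norm_def weighted_def[abs_def] ennsqrt_def)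

lemma L2w_norm_mode_field:
  assumes "f \<in> borel_measurable (lebesgue_on {0<..})"
  shows "L2w_norm \<alpha> (fcoeff (mode_field k c f) j) = (if j = k then ennreal (norm c) * L2w_norm \<alpha> f else 0)"
proof (cases "j = k")
  case True
  then have "fcoeff (mode_field k c f) j = (\<lambda>z. c * f z)" by (auto simp: fcoeff_mode_field)
  then show ?thesis using True L2w_norm_cmult[OF assms] by simp
next
  case False
  then have "fcoeff (mode_field k c f) j = (\<lambda>z. 0)" by (auto simp: fcoeff_mode_field)
  then show ?thesis using False by (simp add: L2w_norm_zero)
qed

lemma mode_field_in_E_space:
  assumes f: "f \<in> borel_measurable (lebesgue_on {0<..})" and fin: "L2w_norm \<alpha> f < \<infinity>"
  shows "mode_field k c f \<in> E_space \<alpha> \<beta>"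
proof -
  have per: "periodic_xy (mode_field k c f)"
  proof -
    have m: "cis (2 * pi * of_int j) = 1" for j by (simp add: cis_multiple_2pi)
    have "phase k (x + 2 * pi) y = phase k x y + 2 * pi * of_int (fst k)"
      "phase k x (y + 2 * pi) = phase k x y + 2 * pi * of_int (snd k)" for x y by (simp_all add: phase_def algebra_simps)
    then show ?thesis using m by (simp add: periodic_xy_def mode_field_def flip: cis_mult)
  qed
  have "E_norm \<alpha> \<beta> (mode_field k c f) \<le> ennreal (exp (\<beta> * sqrt (freq2 k))) * (ennreal (norm c) * L2w_norm \<alpha> f)"
    unfolding E_norm_def L2w_norm_mode_field[OF f] by (rule SUP_least) auto
  also have "\<dots> < \<infinity>" using fin by (simp add: ennreal_mult_less_top)
  finally have en: "E_norm \<alpha> \<beta> (mode_field k c f) < \<infinity>" .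
  have "((\<lambda>j. fcoeff (mode_field k c f) j z * cis (phase j x y)) has_sum mode_field k c f x y z) UNIV" for x y z
    by (rule has_sum_finite_neutralI[of "{k}"]) (auto simp: fcoeff_mode_field, simp add: mode_field_def)
  then show ?thesis using per en by (simp add: E_space_def)
qed

lemma calH_norm_mode_field:
  assumes f: "f \<in> borel_measurable (lebesgue_on {0<..})" and A: "L2w_norm \<alpha> f = ennreal A" "0 \<le> A"
  shows "calH_norm \<alpha> m (mode_field k c f, mode_field k d f)
    = ennreal ((1 + freq2 k) powr (m / 2) * sqrt ((norm c)\<^sup>2 + (norm d)\<^sup>2) * A)"
proof -
  let ?h = "\<lambda>j. ennreal ((1 + freq2 j) powr m) *
       ((L2w_norm \<alpha> (fcoeff (mode_field k c f) j))\<^sup>2 + (L2w_norm \<alpha> (fcoeff (mode_field k d f) j))\<^sup>2)"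
  have N: "1 + freq2 k > 0" by (simp add: freq2_def add_pos_nonneg)
  have "infsum ?h UNIV = infsum ?h {k}"
    by (rule infsum_cong_neutral) (auto simp: L2w_norm_mode_field[OF f])
  also have "\<dots> = ?h k" by simp
  also have "\<dots> = ennreal ((1 + freq2 k) powr m) * ((ennreal (norm c) * ennreal A)\<^sup>2 + (ennreal (norm d) * ennreal A)\<^sup>2)"
    by (simp add: L2w_norm_mode_field[OF f] A)
  also have "\<dots> = ennreal ((1 + freq2 k) powr m * ((norm c * A)\<^sup>2 + (norm d * A)\<^sup>2))"
  proof -
    have "(ennreal (norm e) * ennreal A)\<^sup>2 = ennreal ((norm e * A)\<^sup>2)" for e :: complex
      using A(2) by (simp add: ennreal_power flip: ennreal_mult)
    then show ?thesis by (simp add: ennreal_mult flip: ennreal_plus)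
  qed
  also have "(1 + freq2 k) powr m * ((norm c * A)\<^sup>2 + (norm d * A)\<^sup>2)
     = ((1 + freq2 k) powr (m / 2) * sqrt ((norm c)\<^sup>2 + (norm d)\<^sup>2) * A)\<^sup>2"
    using N by (simp add: power_mult_distrib powr_power algebra_simps)
  also have "ennreal \<dots> = (ennreal ((1 + freq2 k) powr (m / 2) * sqrt ((norm c)\<^sup>2 + (norm d)\<^sup>2) * A))\<^sup>2"
    using A(2) by (simp add: ennreal_power)
  finally show ?thesis by (simp add: calH_norm_def)
qed

text \<open>Solutions with different radii live on different time intervals and in different spaces.
  Restricting both to the smaller radius puts them into one uniqueness class.\<close>

lemma prandtl_solution_restrict:
  assumes sol: "prandtl_solution \<alpha> us vs \<rho> \<beta> s p q" and le: "\<beta>' \<le> \<beta>" and \<rho>: "0 < \<rho>"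
  shows "prandtl_solution \<alpha> us vs \<rho> \<beta>' s p q"
proof -
  obtain u0 v0 u v where pq: "p = (u0, v0)" "q = (u, v)" by (cases p; cases q) auto
  let ?S = "s + \<beta> / \<rho>" and ?S' = "s + \<beta>' / \<rho>"
  have S: "?S' \<le> ?S" using le \<rho> by (simp add: divide_right_mono)
  obtain w where w: "linearized_prandtl us vs s ?S u v w"
    using sol by (auto simp: pq prandtl_solution_def Let_def)
  have "linearized_prandtl us vs s ?S' u v w"
  proof -
    have Q: "{s<..<?S'} \<times> UNIV \<times> UNIV \<times> {0<..} \<subseteq> {s<..<?S} \<times> UNIV \<times> UNIV \<times> {0::real<..}"
      "{s<..<?S'} \<times> UNIV \<times> UNIV \<times> {0..} \<subseteq> {s<..<?S} \<times> UNIV \<times> UNIV \<times> {0::real..}"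
      using S by auto
    have c: "cont4 B h \<Longrightarrow> A \<subseteq> B \<Longrightarrow> cont4 A h" for A B h
      unfolding cont4_def by (rule continuous_on_subset)
    have rv: "regular_velocity B h \<Longrightarrow> A \<subseteq> B \<Longrightarrow> regular_velocity A h" for A B h
      unfolding regular_velocity_def using c by blast
    have rn: "regular_normal B h \<Longrightarrow> A \<subseteq> B \<Longrightarrow> regular_normal A h" for A B h
      unfolding regular_normal_def using c by blast
    have I: "{s<..<?S'} \<subseteq> {s<..<?S}" using S by auto
    show ?thesis
      using w c[OF _ Q(2)] rv[OF _ Q(1)] rn[OF _ Q(1)] Q(1) I unfolding linearized_prandtl_def Let_def
      by (intro conjI; (elim conjE)?; blast)
  qed
  moreover have "u t \<in> E_space \<alpha> (\<beta>' - \<rho> * (t - s)) \<and> v t \<in> E_space \<alpha> (\<beta>' - \<rho> * (t - s))"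
    if "t \<in> {s..<?S'}" for t
  proof -
    have "t \<in> {s..<?S}" using that S by auto
    then have "u t \<in> E_space \<alpha> (\<beta> - \<rho> * (t - s)) \<and> v t \<in> E_space \<alpha> (\<beta> - \<rho> * (t - s))"
      using sol by (auto simp: pq prandtl_solution_def Let_def)
    then show ?thesis using le by (auto intro: E_space_mono)
  qed
  moreover have "modes_continuous \<alpha> {s..<?S'} h" if "modes_continuous \<alpha> {s..<?S} h" for h
  proof -
    have "{s..<?S'} \<subseteq> {s..<?S}" using S by auto
    then show ?thesis using that unfolding modes_continuous_def
      by (meson subsetD tendsto_within_subset)
  qed
  ultimately show ?thesis using sol by (auto simp: pq prandtl_solution_def Let_def)
qed

text \<open>
  A single mode lies in \<open>E\<close> for every radius. Hence one solution with a large radius exists on all of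
  \<open>[0, T]\<close>, and by uniqueness it represents \<open>T(t, 0)\<close> for every radius \<open>\<beta> 0 t\<close>.
\<close>

lemma mode_apriori_bound:
  assumes loss: "analytic_loss_rate \<alpha> us vs \<rho>"
    and \<beta>: "\<And>s t. 0 \<le> s \<Longrightarrow> s \<le> t \<Longrightarrow> \<rho> * (t - s) < \<beta> s t"
    and fin: "sup_op_norm \<alpha> us vs \<rho> \<beta> \<xi> \<sigma> \<delta> m1 m2 \<noteq> \<infinity>" and \<sigma>: "0 < \<sigma>"
  obtains M where "0 \<le> M" and
    "\<And>p q k f A T. f \<in> borel_measurable (lebesgue_on {0<..}) \<Longrightarrow> L2w_norm \<alpha> f = ennreal A \<Longrightarrow> 0 < A \<Longrightarrow>
      0 < T \<Longrightarrow> T \<le> \<delta> \<Longrightarrow> (p, q) \<noteq> (0, 0) \<Longrightarrow>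
      \<exists>u v w S. T < S \<and> linearized_prandtl us vs 0 S u v w \<and>
        modes_continuous \<alpha> {0..<S} u \<and> modes_continuous \<alpha> {0..<S} v \<and>
        (\<forall>z>0. fcoeff (u 0) k z = of_int p * f z \<and> fcoeff (v 0) k z = of_int q * f z) \<and>
        (\<forall>t. 0 \<le> t \<longrightarrow> t \<le> T \<longrightarrow>
          L2w_norm \<alpha> (fcoeff (u t) k) \<le> ennreal (M * (1 + freq2 k) powr ((m1 - m2) / 2) *
            exp (\<sigma> * t * sqrt \<bar>of_int (\<xi> k)\<bar>) * sqrt ((of_int p)\<^sup>2 + (of_int q)\<^sup>2) * A) \<and>
          L2w_norm \<alpha> (fcoeff (v t) k) \<le> ennreal (M * (1 + freq2 k) powr ((m1 - m2) / 2) *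
            exp (\<sigma> * t * sqrt \<bar>of_int (\<xi> k)\<bar>) * sqrt ((of_int p)\<^sup>2 + (of_int q)\<^sup>2) * A))"
proof -
  have \<rho>: "0 < \<rho>" using loss by (simp add: analytic_loss_rate_def)
  obtain M where M: "0 \<le> M" "sup_op_norm \<alpha> us vs \<rho> \<beta> \<xi> \<sigma> \<delta> m1 m2 = ennreal M"
    using fin by (cases "sup_op_norm \<alpha> us vs \<rho> \<beta> \<xi> \<sigma> \<delta> m1 m2") auto
  \<comment> \<open>The supremum is evaluated at the pairs \<open>(0, t)\<close>: the growth starts
    at time 0, where the shape of the layer is given.\<close>
  have opn: "calH_norm \<alpha> m2 (tangential_damping \<xi> (\<sigma> * t) (prandtl_op \<alpha> us vs \<rho> (\<beta> 0 t) t 0 P)) \<le> ennreal (M * B)"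
    if t: "0 \<le> t" "t \<le> \<delta>" and P: "P \<in> E_space \<alpha> (\<beta> 0 t) \<times> E_space \<alpha> (\<beta> 0 t)"
      and B: "calH_norm \<alpha> m1 P = ennreal B" "0 < B" for t P B
  proof -
    have "calH_norm \<alpha> m2 (tangential_damping \<xi> (\<sigma> * (t - 0)) (prandtl_op \<alpha> us vs \<rho> (\<beta> 0 t) t 0 P)) / calH_norm \<alpha> m1 P
        \<le> op_norm \<alpha> (\<beta> 0 t) m1 m2 (\<lambda>p. tangential_damping \<xi> (\<sigma> * (t - 0)) (prandtl_op \<alpha> us vs \<rho> (\<beta> 0 t) t 0 p))"
      unfolding op_norm_def by (rule SUP_upper) (use P B in \<open>auto simp: ennreal_eq_0_iff\<close>)
    also have "\<dots> \<le> sup_op_norm \<alpha> us vs \<rho> \<beta> \<xi> \<sigma> \<delta> m1 m2"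
      unfolding sup_op_norm_def by (rule SUP_upper2[of "(0, t)"]) (use t in auto)
    finally show ?thesis unfolding M(2) B(1) diff_zero by (rule ennreal_le_mult_of_divide_le) (use B M in auto)
  qed
  show ?thesis
  proof (rule that[OF M(1)])
    fix p q :: int and k :: "int \<times> int" and f :: "real \<Rightarrow> complex" and A T :: real
    assume f: "f \<in> borel_measurable (lebesgue_on {0<..})" and A: "L2w_norm \<alpha> f = ennreal A" "0 < A"
      and T: "0 < T" "T \<le> \<delta>" and pq: "(p, q) \<noteq> (0, 0)"
    define P where "P = (mode_field k (of_int p) f, mode_field k (of_int q) f)"
    have PE: "P \<in> E_space \<alpha> b \<times> E_space \<alpha> b" for b
      unfolding P_def using mode_field_in_E_space[OF f] A by auto
    define N where "N = 1 + freq2 k"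
    have N: "0 < N" by (simp add: N_def freq2_def add_pos_nonneg)
    define R where "R = sqrt ((of_int p)\<^sup>2 + (of_int q)\<^sup>2 :: real)"
    have R: "0 < R"
    proof -
      have "0 < (of_int p :: real)\<^sup>2 + (of_int q)\<^sup>2 \<longleftrightarrow> (of_int p :: real) \<noteq> 0 \<or> (of_int q :: real) \<noteq> 0"
        by (rule sum_power2_gt_zero_iff)
      then show ?thesis using pq by (auto simp: R_def)
    qed
    have cH: "calH_norm \<alpha> m1 P = ennreal (N powr (m1 / 2) * R * A)"
      using calH_norm_mode_field[OF f A(1) less_imp_le[OF A(2)], of m1 k "of_int p" "of_int q"]
      by (simp add: P_def N_def R_def)
    \<comment> \<open>The radius \<open>\<rho> * S\<close> with S > T gives a solution that exists
      beyond T.\<close>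
    define S where "S = T + 1"
    have ex: "\<exists>q. prandtl_solution \<alpha> us vs \<rho> b 0 P q" if "0 < b" for b
      by (rule loss[unfolded analytic_loss_rate_def, THEN conjunct2, THEN spec, THEN mp, OF order_refl,
            THEN spec, THEN mp, OF that, THEN bspec, OF PE, THEN conjunct1])
    obtain Q where Q: "prandtl_solution \<alpha> us vs \<rho> (\<rho> * S) 0 P Q"
      using ex[of "\<rho> * S"] \<rho> T by (auto simp: S_def)
    obtain u v where uv: "Q = (u, v)" by (cases Q)
    have SS: "0 + \<rho> * S / \<rho> = S" using \<rho> by simp
    obtain w where w: "linearized_prandtl us vs 0 S u v w"
      and mc: "modes_continuous \<alpha> {0..<S} u" "modes_continuous \<alpha> {0..<S} v"
      and ini: "\<And>x y z. 0 < z \<Longrightarrow> u 0 x y z = fst P x y z \<and> v 0 x y z = snd P x y z"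
      using Q unfolding uv prandtl_solution_def Let_def SS by (auto simp: case_prod_unfold)
    have bound: "L2w_norm \<alpha> (fcoeff (u t) k) \<le> ennreal (M * N powr ((m1 - m2) / 2) * exp (\<sigma> * t * sqrt \<bar>of_int (\<xi> k)\<bar>) * R * A) \<and>
        L2w_norm \<alpha> (fcoeff (v t) k) \<le> ennreal (M * N powr ((m1 - m2) / 2) * exp (\<sigma> * t * sqrt \<bar>of_int (\<xi> k)\<bar>) * R * A)"
      if t: "0 \<le> t" "t \<le> T" for t
    proof -
      let ?b = "\<beta> 0 t"
      have b: "\<rho> * t < ?b" using \<beta>[of 0 t] t by simp
      then have b0: "0 < ?b" using \<rho> t by (smt (verit, best) mult_nonneg_nonneg)
      define Qt where "Qt = (SOME q. prandtl_solution \<alpha> us vs \<rho> ?b 0 P q)"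
      have Qt: "prandtl_solution \<alpha> us vs \<rho> ?b 0 P Qt" unfolding Qt_def using ex[OF b0] by (rule someI_ex)
      obtain u' v' where uv': "Qt = (u', v')" by (cases Qt)
      have op: "prandtl_op \<alpha> us vs \<rho> ?b t 0 P = (u' t, v' t)"
        unfolding prandtl_op_def Let_def Qt_def[symmetric] uv' by simp
      \<comment> \<open>Both radii exceed \<open>\<rho> * t\<close>, so t lies in the common time
        interval on which uniqueness identifies the two solutions.\<close>
      define b' where "b' = min ?b (\<rho> * S)"
      have b': "0 < b'" "\<rho> * t < b'" using b b0 \<rho> t T by (auto simp: b'_def S_def)
      have tI: "t \<in> {0..<0 + b' / \<rho>}" using b' t \<rho> by (simp add: pos_less_divide_eq mult.commute)
      have r1: "prandtl_solution \<alpha> us vs \<rho> b' 0 P (u, v)"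
        using prandtl_solution_restrict[OF Q _ \<rho>, of b'] by (simp add: uv b'_def)
      have r2: "prandtl_solution \<alpha> us vs \<rho> b' 0 P (u', v')"
        using prandtl_solution_restrict[OF Qt _ \<rho>, of b'] by (simp add: uv' b'_def)
      have uniq: "\<forall>u v u' v'. prandtl_solution \<alpha> us vs \<rho> b' 0 P (u, v) \<longrightarrow> prandtl_solution \<alpha> us vs \<rho> b' 0 P (u', v') \<longrightarrow>
           (\<forall>t\<in>{0..<0 + b' / \<rho>}. \<forall>x y z. 0 < z \<longrightarrow> u t x y z = u' t x y z \<and> v t x y z = v' t x y z)"
        by (rule loss[unfolded analytic_loss_rate_def, THEN conjunct2, THEN spec, THEN mp, OF order_refl,
              THEN spec, THEN mp, OF b'(1), THEN bspec, OF PE, THEN conjunct2])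
      have eq: "u t x y z = u' t x y z" "v t x y z = v' t x y z" if "0 < z" for x y z
        using uniq[rule_format, OF r1 r2 tI that] by auto
      have E': "u' t \<in> E_space \<alpha> (?b - \<rho> * (t - 0))" "v' t \<in> E_space \<alpha> (?b - \<rho> * (t - 0))"
      proof -
        have "t \<in> {0..<0 + ?b / \<rho>}" using b t \<rho> by (simp add: pos_less_divide_eq mult.commute)
        then show "u' t \<in> E_space \<alpha> (?b - \<rho> * (t - 0))" "v' t \<in> E_space \<alpha> (?b - \<rho> * (t - 0))"
          using Qt unfolding uv' prandtl_solution_def Let_def by (auto simp: case_prod_unfold)
      qed
      define g where "g j = exp (- (\<sigma> * t) * sqrt \<bar>of_int (\<xi> j)\<bar>)" for j
      have g: "\<bar>g j\<bar> \<le> 1" "0 \<le> g j" "0 < g j" for j using \<sigma> t by (auto simp: g_def)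
      have td: "tangential_damping \<xi> (\<sigma> * t) (u' t, v' t) = (fourier_mult g (u' t), fourier_mult g (v' t))"
        by (simp add: tangential_damping_def g_def[abs_def])
      define H where "H = calH_norm \<alpha> m2 (fourier_mult g (u' t), fourier_mult g (v' t))"
      have H: "H \<le> ennreal (M * (N powr (m1 / 2) * R * A))"
        unfolding H_def using opn[OF t(1) _ PE cH] t T N R A unfolding op td by simp
      have main: "L2w_norm \<alpha> (fcoeff h k) \<le> ennreal (M * N powr ((m1 - m2) / 2) * exp (\<sigma> * t * sqrt \<bar>of_int (\<xi> k)\<bar>) * R * A)"
        if h: "h \<in> E_space \<alpha> (?b - \<rho> * (t - 0))"
          and le: "ennreal (N powr m2) * (L2w_norm \<alpha> (fcoeff (fourier_mult g h) k))\<^sup>2 \<le> H\<^sup>2" for h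
      proof -
        obtain X where X: "L2w_norm \<alpha> (fcoeff h k) = ennreal X" "0 \<le> X"
          using E_space_coeff(1)[OF h, of k] by (cases "L2w_norm \<alpha> (fcoeff h k)") auto
        have "ennreal (N powr (m2 / 2) * g k * X) = ennreal (N powr (m2 / 2)) * (ennreal (g k) * L2w_norm \<alpha> (fcoeff h k))"
          using X g(2)[of k] by (simp add: ennreal_mult mult.assoc)
        also have "\<dots> \<le> ennreal (N powr (m2 / 2)) * L2w_norm \<alpha> (fcoeff (fourier_mult g h) k)"
          by (intro mult_left_mono L2w_norm_damped[OF h g(1,2)]) simp
        also have "\<dots> \<le> H"
        proof (rule ennreal_power2_le_imp_le)
          have "(ennreal (N powr (m2 / 2)))\<^sup>2 = ennreal (N powr m2)" using N by (simp add: ennreal_power powr_power)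
          then show "(ennreal (N powr (m2 / 2)) * L2w_norm \<alpha> (fcoeff (fourier_mult g h) k))\<^sup>2 \<le> H\<^sup>2"
            using le by (simp add: power_mult_distrib)
        qed
        also note H
        finally have "N powr (m2 / 2) * g k * X \<le> M * (N powr (m1 / 2) * R * A)"
          using M N R A by (simp add: ennreal_le_iff)
        then have "X \<le> M * (N powr (m1 / 2) * R * A) / (N powr (m2 / 2) * g k)"
          using N g(3)[of k] by (simp add: pos_le_divide_eq mult_ac)
        also have "\<dots> = M * (N powr (m1 / 2) / N powr (m2 / 2)) * (1 / g k) * R * A" by simp
        also have "N powr (m1 / 2) / N powr (m2 / 2) = N powr ((m1 - m2) / 2)"
          by (simp add: powr_diff diff_divide_distrib)
        also have "1 / g k = exp (\<sigma> * t * sqrt \<bar>of_int (\<xi> k)\<bar>)" by (simp add: g_def exp_minus field_simps)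
        finally show ?thesis unfolding X(1) by (rule ennreal_leI)
      qed
      have "L2w_norm \<alpha> (fcoeff (u t) k) = L2w_norm \<alpha> (fcoeff (u' t) k)" "L2w_norm \<alpha> (fcoeff (v t) k) = L2w_norm \<alpha> (fcoeff (v' t) k)"
        by (rule L2w_norm_cong, rule fcoeff_cong, simp add: eq)+
      then show ?thesis
        using main[OF E'(1)] main[OF E'(2)] calH_norm_ge(1)[of k m2 \<alpha> "(fourier_mult g (u' t), fourier_mult g (v' t))"]
          calH_norm_ge(2)[of k m2 \<alpha> "(fourier_mult g (u' t), fourier_mult g (v' t))"]
        unfolding H_def N_def by simp
    qed
    show "\<exists>u v w S. T < S \<and> linearized_prandtl us vs 0 S u v w \<and>
        modes_continuous \<alpha> {0..<S} u \<and> modes_continuous \<alpha> {0..<S} v \<and>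
        (\<forall>z>0. fcoeff (u 0) k z = of_int p * f z \<and> fcoeff (v 0) k z = of_int q * f z) \<and>
        (\<forall>t. 0 \<le> t \<longrightarrow> t \<le> T \<longrightarrow>
          L2w_norm \<alpha> (fcoeff (u t) k) \<le> ennreal (M * (1 + freq2 k) powr ((m1 - m2) / 2) *
            exp (\<sigma> * t * sqrt \<bar>of_int (\<xi> k)\<bar>) * sqrt ((of_int p)\<^sup>2 + (of_int q)\<^sup>2) * A) \<and>
          L2w_norm \<alpha> (fcoeff (v t) k) \<le> ennreal (M * (1 + freq2 k) powr ((m1 - m2) / 2) *
            exp (\<sigma> * t * sqrt \<bar>of_int (\<xi> k)\<bar>) * sqrt ((of_int p)\<^sup>2 + (of_int q)\<^sup>2) * A))"
    proof (rule exI[of _ u], rule exI[of _ v], rule exI[of _ w], rule exI[of _ S], intro conjI allI impI w mc)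
      show "T < S" by (simp add: S_def)
      fix z :: real assume z: "0 < z"
      show "fcoeff (u 0) k z = of_int p * f z"
        using fcoeff_cong[of "u 0" z "fst P" k] ini[OF z] by (simp add: P_def fcoeff_mode_field)
      show "fcoeff (v 0) k z = of_int q * f z"
        using fcoeff_cong[of "v 0" z "snd P" k] ini[OF z] by (simp add: P_def fcoeff_mode_field)
    next
      fix t assume "0 \<le> t" "t \<le> T"
      from bound[OF this]
      show "L2w_norm \<alpha> (fcoeff (u t) k) \<le> ennreal (M * (1 + freq2 k) powr ((m1 - m2) / 2) *
            exp (\<sigma> * t * sqrt \<bar>of_int (\<xi> k)\<bar>) * sqrt ((of_int p)\<^sup>2 + (of_int q)\<^sup>2) * A)"
        "L2w_norm \<alpha> (fcoeff (v t) k) \<le> ennreal (M * (1 + freq2 k) powr ((m1 - m2) / 2) *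
            exp (\<sigma> * t * sqrt \<bar>of_int (\<xi> k)\<bar>) * sqrt ((of_int p)\<^sup>2 + (of_int q)\<^sup>2) * A)"
        by (auto simp: N_def R_def)
    qed
  qed
qed

section \<open>Pairings on a window controlled by the weighted norm\<close>

lemma nn_integral_indicator_continuous:
  fixes g :: "real \<Rightarrow> real"
  assumes "continuous_on {a..b} g" "\<And>z. z \<in> {a..b} \<Longrightarrow> 0 \<le> g z"
  shows "(\<integral>\<^sup>+ z. ennreal (indicat_real {a..b} z * g z) \<partial>lebesgue) = ennreal (integral {a..b} g)"
proof -
  have i: "set_integrable lebesgue {a..b} g" by (rule absolutely_integrable_continuous_real[OF assms(1)])
  have "(\<integral>\<^sup>+ z. ennreal (indicat_real {a..b} z * g z) \<partial>lebesgue) = ennreal (LINT z|lebesgue. indicat_real {a..b} z * g z)"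
    by (rule nn_integral_eq_integral)
       (use i assms(2) in \<open>auto simp: set_integrable_def indicator_def\<close>)
  also have "(LINT z|lebesgue. indicat_real {a..b} z * g z) = integral {a..b} g"
    using set_lebesgue_integral_eq_integral(2)[OF i] by (simp add: set_lebesgue_integral_def)
  finally show ?thesis .
qed

lemma integral_power2_le_L2w_norm:
  fixes f :: "real \<Rightarrow> complex"
  assumes c: "continuous_on {a..b} f" and a: "0 < a" and \<alpha>: "0 < \<alpha>"
    and X: "L2w_norm \<alpha> f \<le> ennreal X" "0 \<le> X"
  shows "integral {a..b} (\<lambda>z. (norm (f z))\<^sup>2) \<le> X\<^sup>2"
proof -
  let ?w = "weighted \<alpha> f"
  have m: "?w \<in> borel_measurable (lebesgue_on {0<..})"
    using X by (auto simp: L2w_norm_def L2_norm_def top_unique split: if_splits)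
  have cf: "continuous_on {a..b} (\<lambda>z. (norm (f z))\<^sup>2)" by (intro continuous_intros c)
  have "ennreal (integral {a..b} (\<lambda>z. (norm (f z))\<^sup>2)) = (\<integral>\<^sup>+ z. ennreal (indicat_real {a..b} z * (norm (f z))\<^sup>2) \<partial>lebesgue)"
    by (rule nn_integral_indicator_continuous[OF cf, symmetric]) simp
  also have "\<dots> \<le> (\<integral>\<^sup>+ z. (ennreal (norm (?w z)))\<^sup>2 * indicator {0<..} z \<partial>lebesgue)"
  proof (rule nn_integral_mono)
    fix z :: real
    show "ennreal (indicat_real {a..b} z * (norm (f z))\<^sup>2) \<le> (ennreal (norm (?w z)))\<^sup>2 * indicator {0<..} z"
    proof (cases "z \<in> {a..b}")
      case True
      then have z: "0 < z" using a by auto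
      have "1 * norm (f z) \<le> exp (\<alpha> * z) * norm (f z)" using z \<alpha> by (intro mult_right_mono) auto
      then have "(norm (f z))\<^sup>2 \<le> (norm (?w z))\<^sup>2" by (simp add: weighted_def power_mono)
      then show ?thesis using True z by (simp add: ennreal_power)
    qed simp
  qed
  also have "\<dots> = (\<integral>\<^sup>+ z. (ennreal (norm (?w z)))\<^sup>2 \<partial>lebesgue_on {0<..})"
    by (rule nn_integral_restrict_space[symmetric]) simp
  also have "\<dots> = (L2w_norm \<alpha> f)\<^sup>2" using m by (simp add: L2w_norm_def L2_norm_def)
  also have "\<dots> \<le> (ennreal X)\<^sup>2" using X(1) by (rule power_mono) simp
  also have "\<dots> = ennreal (X\<^sup>2)" using X(2) by (simp add: ennreal_power)
  finally show ?thesis by (simp add: ennreal_le_iff)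
qed

text \<open>Cauchy-Schwarz through the pointwise inequality 2 x \<le> s x^2 + 1/s, with s = sqrt (b
  - a) / X chosen so that both terms contribute equally.\<close>

lemma integral_norm_le_L2w_norm:
  fixes f :: "real \<Rightarrow> complex"
  assumes c: "continuous_on {a..b} f" and a: "0 < a" "a < b" and \<alpha>: "0 < \<alpha>"
    and X: "L2w_norm \<alpha> f \<le> ennreal X" "0 < X"
  shows "integral {a..b} (\<lambda>z. norm (f z)) \<le> sqrt (b - a) * X"
proof -
  define s where "s = sqrt (b - a) / X"
  have s: "0 < s" using a X by (simp add: s_def)
  have i: "(\<lambda>z. norm (f z)) integrable_on {a..b}" "(\<lambda>z. (s * (norm (f z))\<^sup>2 + 1 / s) / 2) integrable_on {a..b}"
    "(\<lambda>z. (norm (f z))\<^sup>2) integrable_on {a..b}"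
    by (intro integrable_continuous_real continuous_intros c; use s in simp)+
  have "integral {a..b} (\<lambda>z. norm (f z)) \<le> integral {a..b} (\<lambda>z. (s * (norm (f z))\<^sup>2 + 1 / s) / 2)"
  proof (rule integral_le[OF i(1,2)])
    fix z
    have "0 \<le> (s * norm (f z) - 1)\<^sup>2 / (2 * s)" using s by simp
    also have "\<dots> = (s * (norm (f z))\<^sup>2 + 1 / s) / 2 - norm (f z)" using s by (simp add: power2_eq_square field_simps)
    finally show "norm (f z) \<le> (s * (norm (f z))\<^sup>2 + 1 / s) / 2" by simp
  qed
  also have "\<dots> = (s * integral {a..b} (\<lambda>z. (norm (f z))\<^sup>2) + (b - a) / s) / 2"
  proof -
    have "((\<lambda>z. (s * (norm (f z))\<^sup>2 + 1 / s) / 2) has_integral (s * integral {a..b} (\<lambda>z. (norm (f z))\<^sup>2) + (b - a) *\<^sub>R (1 / s)) / 2) {a..b}"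
      using has_integral_const_real[of "1 / s" a b] a integrable_integral[OF i(3)]
      by (intro has_integral_divide has_integral_add has_integral_mult_right) auto
    from integral_unique[OF this] show ?thesis by simp
  qed
  also have "\<dots> \<le> (s * X\<^sup>2 + (b - a) / s) / 2"
    using integral_power2_le_L2w_norm[OF c a(1) \<alpha> X(1)] X(2) s by (intro divide_right_mono add_right_mono mult_left_mono) auto
  also have "\<dots> = sqrt (b - a) * X"
  proof -
    have "(b - a) / s = sqrt (b - a) * X"
      using a X real_sqrt_mult_self[of "b - a"] unfolding s_def by (simp add: field_simps)
    moreover have "s * X\<^sup>2 = sqrt (b - a) * X" using X by (simp add: s_def power2_eq_square)
    ultimately show ?thesis by simp
  qed
  finally show ?thesis .
qed

lemma integral_mult_le_L2w_norm:
  fixes f h :: "real \<Rightarrow> complex"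
  assumes c: "continuous_on {a..b} f" "continuous_on {a..b} h" and a: "0 < a" "a < b" and \<alpha>: "0 < \<alpha>"
    and X: "L2w_norm \<alpha> f \<le> ennreal X" "0 < X" and B: "\<And>z. z \<in> {a..b} \<Longrightarrow> norm (h z) \<le> B"
  shows "norm (integral {a..b} (\<lambda>z. f z * h z)) \<le> B * (sqrt (b - a) * X)"
proof -
  have B0: "0 \<le> B" by (rule order_trans[OF norm_ge_zero B[of a]]) (use a in simp)
  have "norm (integral {a..b} (\<lambda>z. f z * h z)) \<le> integral {a..b} (\<lambda>z. B * norm (f z))"
  proof (rule integral_norm_bound_integral)
    show "(\<lambda>z. f z * h z) integrable_on {a..b}" "(\<lambda>z. B * norm (f z)) integrable_on {a..b}"
      by (intro integrable_continuous_real continuous_intros c)+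
    show "norm (f z * h z) \<le> B * norm (f z)" if "z \<in> {a..b}" for z
      using mult_right_mono[OF B[OF that] norm_ge_zero[of "f z"]] by (simp add: norm_mult mult.commute)
  qed
  also have "\<dots> = B * integral {a..b} (\<lambda>z. norm (f z))" by (rule Henstock_Kurzweil_Integration.integral_mult_right)
  also have "\<dots> \<le> B * (sqrt (b - a) * X)"
    by (intro mult_left_mono integral_norm_le_L2w_norm[OF c(1) a \<alpha> X] B0)
  finally show ?thesis .
qed

text \<open>On the window the weight lies between 1 and exp(\<alpha> b). The lower bound makes A
  positive, so that the data are admissible in a quotient of norms; the upper bound compares A with
  the unweighted norm.\<close>

lemma L2w_norm_cutoff:
  fixes g :: "real \<Rightarrow> complex" and a b :: real
  defines "f \<equiv> \<lambda>z. if z \<in> {a..b} then g z else 0"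
  assumes c: "continuous_on {a..b} g" and a: "0 < a" "a < b" and \<alpha>: "0 < \<alpha>"
    and I0: "I0 = integral {a..b} (\<lambda>z. (norm (g z))\<^sup>2)" "0 < I0"
  obtains A where "f \<in> borel_measurable (lebesgue_on {0<..})" "L2w_norm \<alpha> f = ennreal A" "0 < A" "A \<le> exp (\<alpha> * b) * sqrt I0"
proof -
  have m: "f \<in> borel_measurable (lebesgue_on {0<..})"
  proof -
    have "(\<lambda>z. indicat_real {a..b} z *\<^sub>R g z) \<in> borel_measurable lebesgue"
      using absolutely_integrable_continuous_real[OF c] unfolding set_integrable_def
      by (rule borel_measurable_integrable)
    moreover have "(\<lambda>z. indicat_real {a..b} z *\<^sub>R g z) = f" by (auto simp: f_def indicator_def)
    ultimately show ?thesis by (simp add: measurable_restrict_space1)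
  qed
  let ?h = "\<lambda>z. (exp (\<alpha> * z) * norm (g z))\<^sup>2"
  have ch: "continuous_on {a..b} ?h" by (intro continuous_intros c)
  have cg: "continuous_on {a..b} (\<lambda>z. (norm (g z))\<^sup>2)" by (intro continuous_intros c)
  define A2 where "A2 = integral {a..b} ?h"
  have "(L2w_norm \<alpha> f)\<^sup>2 = (\<integral>\<^sup>+ z. (ennreal (norm (weighted \<alpha> f z)))\<^sup>2 \<partial>lebesgue_on {0<..})"
    using weighted_measurable[OF m] by (simp add: L2w_norm_def L2_norm_def)
  also have "\<dots> = (\<integral>\<^sup>+ z. (ennreal (norm (weighted \<alpha> f z)))\<^sup>2 * indicator {0<..} z \<partial>lebesgue)"
    by (rule nn_integral_restrict_space) simp
  also have "\<dots> = (\<integral>\<^sup>+ z. ennreal (indicat_real {a..b} z * ?h z) \<partial>lebesgue)"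
    by (rule nn_integral_cong)
       (use a in \<open>auto simp: f_def weighted_def indicator_def ennreal_power power_mult_distrib\<close>)
  also have "\<dots> = ennreal A2" unfolding A2_def by (rule nn_integral_indicator_continuous[OF ch]) simp
  finally have L: "(L2w_norm \<alpha> f)\<^sup>2 = ennreal A2" .
  have lo: "I0 \<le> A2" unfolding I0 A2_def
  proof (rule integral_le)
    fix z assume "z \<in> {a..b}"
    then have "1 * norm (g z) \<le> exp (\<alpha> * z) * norm (g z)" using a \<alpha> by (intro mult_right_mono) auto
    then show "(norm (g z))\<^sup>2 \<le> ?h z" by (simp add: power_mono)
  qed (intro integrable_continuous_real ch cg)+
  have hi: "A2 \<le> (exp (\<alpha> * b))\<^sup>2 * I0"
  proof -
    have "A2 \<le> integral {a..b} (\<lambda>z. (exp (\<alpha> * b))\<^sup>2 * (norm (g z))\<^sup>2)" unfolding A2_def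
    proof (rule integral_le)
      fix z assume "z \<in> {a..b}"
      then have "exp (\<alpha> * z) * norm (g z) \<le> exp (\<alpha> * b) * norm (g z)" using \<alpha> by (intro mult_right_mono) auto
      then have "?h z \<le> (exp (\<alpha> * b) * norm (g z))\<^sup>2" by (rule power_mono) simp
      then show "?h z \<le> (exp (\<alpha> * b))\<^sup>2 * (norm (g z))\<^sup>2" by (simp only: power_mult_distrib)
    qed (intro integrable_continuous_real ch continuous_on_mult continuous_on_const cg)+
    also have "\<dots> = (exp (\<alpha> * b))\<^sup>2 * I0" unfolding I0 by (rule Henstock_Kurzweil_Integration.integral_mult_right)
    finally show ?thesis .
  qed
  show ?thesis
  proof (rule that[OF m, of "sqrt A2"])
    have "L2w_norm \<alpha> f = ennsqrt (ennreal A2)" by (simp flip: L)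
    then show "L2w_norm \<alpha> f = ennreal (sqrt A2)" using lo I0 by (simp add: ennsqrt_def)
    show "0 < sqrt A2" using lo I0 by simp
    have "sqrt A2 \<le> sqrt ((exp (\<alpha> * b))\<^sup>2 * I0)" using hi by (rule real_sqrt_le_mono)
    then show "sqrt A2 \<le> exp (\<alpha> * b) * sqrt I0" by (simp add: real_sqrt_mult)
  qed
qed

lemma linearized_prandtl_modes_continuous:
  assumes lp: "linearized_prandtl us vs s S u v w" and t: "t \<in> {s<..<S}"
  shows "continuous_on {0<..} (fcoeff (u t) k)" "continuous_on {0<..} (fcoeff (v t) k)"
proof -
  have sub: "{s<..<S} \<times> UNIV \<times> UNIV \<times> {0<..} \<subseteq> {s<..<S} \<times> UNIV \<times> UNIV \<times> {0::real..}" by auto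
  have reg: "cont4 ({s<..<S} \<times> UNIV \<times> UNIV \<times> {0<..}) u" "cont4 ({s<..<S} \<times> UNIV \<times> UNIV \<times> {0<..}) v"
    "regular_velocity ({s<..<S} \<times> UNIV \<times> UNIV \<times> {0<..}) u" "regular_velocity ({s<..<S} \<times> UNIV \<times> UNIV \<times> {0<..}) v"
    using lp continuous_on_subset[OF _ sub] unfolding linearized_prandtl_def Let_def cont4_def by auto
  show "continuous_on {0<..} (fcoeff (u t) k)"
    by (rule continuous_at_imp_continuous_on, rule ballI, rule has_vector_derivative_continuous,
        rule velocity_modes(2)[OF reg(3,1) t]) simp
  show "continuous_on {0<..} (fcoeff (v t) k)"
    by (rule continuous_at_imp_continuous_on, rule ballI, rule has_vector_derivative_continuous,
        rule velocity_modes(2)[OF reg(4,2) t]) simp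
qed

definition combine :: "int \<Rightarrow> int \<Rightarrow> (real \<Rightarrow> real \<Rightarrow> real) \<Rightarrow> (real \<Rightarrow> real \<Rightarrow> real) \<Rightarrow> real \<Rightarrow> real \<Rightarrow> real" where
  "combine p q us vs t z = of_int p * us t z + of_int q * vs t z"

lemma modes_tendsto_integral:
  assumes mc: "modes_continuous \<alpha> {0..<S} u" and S: "0 < S" and \<alpha>: "0 < \<alpha>" and a: "0 < a" "a < b"
    and c: "\<And>t. t \<in> {0<..<S} \<Longrightarrow> continuous_on {a..b} (fcoeff (u t) k)" "continuous_on {a..b} (fcoeff (u 0) k)"
  shows "((\<lambda>t. integral {a..b} (\<lambda>z. norm (fcoeff (u t) k z - fcoeff (u 0) k z))) \<longlongrightarrow> 0) (at_right 0)"
proof (rule tendstoI)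
  fix e :: real assume e: "0 < e"
  define e' where "e' = e / (2 * sqrt (b - a))"
  have e': "0 < e'" "sqrt (b - a) * e' = e / 2" using e a by (auto simp: e'_def)
  have "((\<lambda>r. L2w_norm \<alpha> (\<lambda>z. fcoeff (u r) k z - fcoeff (u 0) k z)) \<longlongrightarrow> 0) (at 0 within {0..<S})"
    by (rule mc[unfolded modes_continuous_def, rule_format]) (use S in simp)
  then have "((\<lambda>r. L2w_norm \<alpha> (\<lambda>z. fcoeff (u r) k z - fcoeff (u 0) k z)) \<longlongrightarrow> 0) (at 0 within {0<..<S})"
    by (rule tendsto_within_subset) auto
  moreover have "at 0 within {0<..<S} = at_right 0"
    by (rule at_within_nhd[of _ "{-1<..<S}"]) (use S in auto)
  ultimately have "((\<lambda>r. L2w_norm \<alpha> (\<lambda>z. fcoeff (u r) k z - fcoeff (u 0) k z)) \<longlongrightarrow> 0) (at_right 0)"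
    by simp
  then have "\<forall>\<^sub>F r in at_right 0. L2w_norm \<alpha> (\<lambda>z. fcoeff (u r) k z - fcoeff (u 0) k z) < ennreal e'"
    using e'(1) by (auto dest!: order_tendstoD(2)[where a = "ennreal e'"])
  moreover have "\<forall>\<^sub>F r in at_right 0. r \<in> {0<..<S}" using S by (auto simp: eventually_at_right)
  ultimately show "\<forall>\<^sub>F t in at_right 0. dist (integral {a..b} (\<lambda>z. norm (fcoeff (u t) k z - fcoeff (u 0) k z))) 0 < e"
  proof eventually_elim
    case (elim t)
    have ct: "continuous_on {a..b} (\<lambda>z. fcoeff (u t) k z - fcoeff (u 0) k z)"
      by (intro continuous_on_diff c elim)
    have "integral {a..b} (\<lambda>z. norm (fcoeff (u t) k z - fcoeff (u 0) k z)) \<le> sqrt (b - a) * e'"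
      by (rule integral_norm_le_L2w_norm[OF ct a \<alpha>]) (use elim e' in auto)
    moreover have "0 \<le> integral {a..b} (\<lambda>z. norm (fcoeff (u t) k z - fcoeff (u 0) k z))"
      by (rule integral_nonneg) (intro integrable_continuous_real continuous_on_norm ct, simp)
    ultimately show ?case using e e'(2) by simp
  qed
qed

text \<open>The data p g and q g, with g conjugate to the test function, give the initial mode (p^2
  + q^2) g, so the initial pairing is the left-hand side. On the right, sqrt (2 W) is the
  Cauchy-Schwarz factor of the window and P the constant of the a priori bound.\<close>

lemma mode_growth_inequality:
  fixes \<alpha> U0 V0 z0 W a E k0 T C s P r S :: real and \<eta> :: "nat \<Rightarrow> real \<Rightarrow> real" and \<kappa> :: complex and p q n :: int
    and us vs :: "real \<Rightarrow> real \<Rightarrow> real"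
  defines "U \<equiv> combine p q us vs"
    and "U1 \<equiv> combine p q (\<lambda>t. deriv (us t)) (\<lambda>t. deriv (vs t))"
    and "U2 \<equiv> combine p q (\<lambda>t. deriv (deriv (us t))) (\<lambda>t. deriv (deriv (vs t)))"
  defines "J \<equiv> {z0 - W..z0 + W}"
  defines "Gb \<equiv> C * k0 * (exp 2 * (34 * a * k0 * W\<^sup>2 * E + 6 * E) + 400 * a * exp (- (k0 * r / 2)))"
  defines "g \<equiv> \<lambda>z. cnj (prof_F \<kappa> \<eta> (U 0 z - U 0 z0))"
  defines "k \<equiv> (n * p, n * q)"
  assumes \<alpha>: "0 < \<alpha>" and hu: "heat_profile \<alpha> U0 Us us" and hv: "heat_profile \<alpha> V0 Vs vs"
    and pos: "0 < a" "0 < W" "W < z0" "0 \<le> E" "0 < k0" "1 \<le> C" "0 < T" "T < S" "s < 2 * a * k0" "0 < P"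
    and n: "of_int n = 8 * a * k0\<^sup>2" and \<kappa>: "\<kappa> = Complex k0 k0" and r: "r = a * W\<^sup>2 / 2"
    and small: "16 * E \<le> a" "k0 * W\<^sup>2 * E \<le> 1" "2 / r \<le> k0"
    and \<eta>: "\<And>j v. (\<eta> j has_real_derivative \<eta> (Suc j) v) (at v)" "\<And>j v. j \<le> 3 \<Longrightarrow> \<bar>\<eta> j v\<bar> \<le> C * (2 / r) ^ j"
      "\<And>j v. r < v \<Longrightarrow> \<eta> j v = 0" "\<And>j v. v < r / 2 \<Longrightarrow> 0 < j \<Longrightarrow> \<eta> j v = 0"
    and U2_E: "\<And>t z. 0 \<le> t \<Longrightarrow> t \<le> T \<Longrightarrow> z \<in> J \<Longrightarrow> \<bar>U2 t z - 2 * a\<bar> \<le> E"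
    and U1_E: "\<And>t. 0 \<le> t \<Longrightarrow> t \<le> T \<Longrightarrow> \<bar>U1 t z0\<bar> \<le> W * E"
    and lp: "linearized_prandtl us vs 0 S u v w"
    and mc: "modes_continuous \<alpha> {0..<S} u" "modes_continuous \<alpha> {0..<S} v"
    and data: "\<And>z. z \<in> J \<Longrightarrow> fcoeff (u 0) k z = of_int p * g z" "\<And>z. z \<in> J \<Longrightarrow> fcoeff (v 0) k z = of_int q * g z"
    and apriori: "\<And>t. 0 \<le> t \<Longrightarrow> t \<le> T \<Longrightarrow> L2w_norm \<alpha> (fcoeff (u t) k) \<le> ennreal (P * exp (s * t))"
       "\<And>t. 0 \<le> t \<Longrightarrow> t \<le> T \<Longrightarrow> L2w_norm \<alpha> (fcoeff (v t) k) \<le> ennreal (P * exp (s * t))"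
  shows "((of_int p)\<^sup>2 + (of_int q)\<^sup>2) * integral J (\<lambda>z. (norm (g z))\<^sup>2)
     \<le> (\<bar>of_int p\<bar> + \<bar>of_int q\<bar>) * (sqrt (2 * W) * P) * (Gb / (2 * a * k0 - s) + 2 * exp 2 * C * exp (- (2 * a * k0 - s) * T))"
proof -
  have \<kappa>0: "\<kappa> \<noteq> 0" using pos by (auto simp: \<kappa> complex_eq_iff)
  define \<phi> where "\<phi> = (\<lambda>t z. of_int p * fcoeff (u t) k z + of_int q * fcoeff (v t) k z)"
  obtain \<phi>t \<phi>z \<phi>zz where \<phi>:
    "continuous_on ({0<..<S} \<times> {0<..}) (\<lambda>(t, z). \<phi> t z)" "continuous_on ({0<..<S} \<times> {0<..}) (\<lambda>(t, z). \<phi>t t z)"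
    "continuous_on ({0<..<S} \<times> {0<..}) (\<lambda>(t, z). \<phi>zz t z)"
    "\<And>t z. (t, z) \<in> {0<..<S} \<times> {0<..} \<Longrightarrow> ((\<lambda>r. \<phi> r z) has_vector_derivative \<phi>t t z) (at t)"
    "\<And>t z. (t, z) \<in> {0<..<S} \<times> {0<..} \<Longrightarrow> ((\<lambda>r. \<phi> t r) has_vector_derivative \<phi>z t z) (at z)"
    "\<And>t z. (t, z) \<in> {0<..<S} \<times> {0<..} \<Longrightarrow> ((\<lambda>r. \<phi>z t r) has_vector_derivative \<phi>zz t z) (at z)"
    "\<And>t z. (t, z) \<in> {0<..<S} \<times> {0<..} \<Longrightarrow> ((\<lambda>r. fcoeff (w t) k r) has_vector_derivative - (\<i> * of_int n * \<phi> t z)) (at z)"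
    "\<And>t z. (t, z) \<in> {0<..<S} \<times> {0<..} \<Longrightarrow> \<phi>t t z = - (\<i> * of_int n * of_real (of_int p * us t z + of_int q * vs t z) * \<phi> t z)
       - of_real (of_int p * deriv (us t) z + of_int q * deriv (vs t) z) * fcoeff (w t) k z + \<phi>zz t z"
    by (rule prandtl_mode_equations[OF lp refl k_def[THEN meta_eq_to_obj_eq] \<phi>_def], rule that)
  have lin: "continuous_on A (\<lambda>(t, z). combine p q f h t z)"
    if "continuous_on A (\<lambda>(t, z). f t z)" "continuous_on A (\<lambda>(t, z). h t z)" for A and f h :: "real \<Rightarrow> real \<Rightarrow> real"
    using that unfolding combine_def case_prod_unfold by (intro continuous_intros)
  interpret mode_growth U U1 U2 \<phi> \<phi>t \<phi>z \<phi>zz "\<lambda>t. fcoeff (w t) k" S "of_int n"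
  proof
    show "(U t has_real_derivative U1 t z) (at z)" if "0 \<le> t" "0 < z" for t z
      unfolding U_def U1_def combine_def
      by (intro DERIV_add DERIV_cmult heat_profile_C2(1)[OF \<alpha> hu that] heat_profile_C2(1)[OF \<alpha> hv that])
    show "(U1 t has_real_derivative U2 t z) (at z)" if "0 \<le> t" "0 < z" for t z
      unfolding U1_def U2_def combine_def
      by (intro DERIV_add DERIV_cmult heat_profile_C2(2)[OF \<alpha> hu that] heat_profile_C2(2)[OF \<alpha> hv that])
    show "((\<lambda>r. U r z) has_real_derivative U2 t z) (at t)" if "0 < t" "0 < z" for t z
      unfolding U_def U2_def combine_def
      by (intro DERIV_add DERIV_cmult heat_profile_time_deriv[OF \<alpha> hu that] heat_profile_time_deriv[OF \<alpha> hv that])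
    show "continuous_on ({0..} \<times> {0<..}) (\<lambda>(t, z). U t z)" "continuous_on ({0..} \<times> {0<..}) (\<lambda>(t, z). U1 t z)"
      "continuous_on ({0..} \<times> {0<..}) (\<lambda>(t, z). U2 t z)"
      unfolding U_def U1_def U2_def
      by (intro lin heat_profile_jointly_continuous[OF \<alpha> hu] heat_profile_jointly_continuous[OF \<alpha> hv])+
  qed (use \<phi> in \<open>auto simp: U_def U1_def combine_def\<close>)
  define R2 where "R2 = ((of_int p)\<^sup>2 + (of_int q)\<^sup>2 :: real)"
  have JJ: "0 < z0 - W" "z0 - W < z0 + W" "J \<subseteq> {0<..}" using pos by (auto simp: J_def)
  have gc: "continuous_on J g"
  proof -
    have c: "continuous_on J (\<lambda>z. U 0 z - U 0 z0)"
      by (intro continuous_intros slice_t[OF U_cont]) (use JJ in auto)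
    have F: "continuous_on UNIV (prof_F \<kappa> \<eta>)"
      by (rule continuous_at_imp_continuous_on, rule ballI, rule has_vector_derivative_continuous,
          rule prof_derivs(2)[where \<kappa> = \<kappa> and \<eta> = \<eta>, OF \<kappa>0 \<eta>(1)])
    show ?thesis unfolding g_def by (intro continuous_on_cnj continuous_on_compose2[OF F c]) auto
  qed
  have uc: "continuous_on J (fcoeff (u t) k)" "continuous_on J (fcoeff (v t) k)" if "t \<in> {0<..<S}" for t
    using linearized_prandtl_modes_continuous[OF lp that] continuous_on_subset[OF _ JJ(3)] by blast+
  have u0c: "continuous_on J (fcoeff (u 0) k)" "continuous_on J (fcoeff (v 0) k)"
    using data by (auto intro!: continuous_on_eq[OF continuous_on_mult[OF continuous_on_const gc]])
  have ap: "norm (integral J (\<lambda>z. \<phi> t z * h z)) \<le> B * ((\<bar>of_int p\<bar> + \<bar>of_int q\<bar>) * (sqrt (2 * W) * P) * exp (s * t))"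
    if t: "0 < t" "t \<le> T" and h: "continuous_on J h" "\<And>z. z \<in> J \<Longrightarrow> norm (h z) \<le> B" for t h B
  proof -
    have tS: "t \<in> {0<..<S}" using t pos by auto
    have Pe: "0 < P * exp (s * t)" using pos by simp
    have b: "norm (integral J (\<lambda>z. f z * h z)) \<le> B * (sqrt (2 * W) * (P * exp (s * t)))"
      if "continuous_on J f" "L2w_norm \<alpha> f \<le> ennreal (P * exp (s * t))" for f
      using integral_mult_le_L2w_norm[of "z0 - W" "z0 + W" f h \<alpha> "P * exp (s * t)" B] that h JJ Pe \<alpha>
      by (simp add: J_def)
    have i: "(\<lambda>z. fcoeff (u t) k z * h z) integrable_on J" "(\<lambda>z. fcoeff (v t) k z * h z) integrable_on J"
      using uc[OF tS] h(1) unfolding J_def by - (rule integrable_continuous_real, (intro continuous_on_mult; assumption))+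
    have "integral J (\<lambda>z. \<phi> t z * h z) = integral J (\<lambda>z. of_int p * (fcoeff (u t) k z * h z) + of_int q * (fcoeff (v t) k z * h z))"
      by (simp add: \<phi>_def algebra_simps)
    also have "\<dots> = of_int p * integral J (\<lambda>z. fcoeff (u t) k z * h z) + of_int q * integral J (\<lambda>z. fcoeff (v t) k z * h z)"
      by (subst integral_add) (use i in \<open>simp_all add: integrable_on_mult_right\<close>)
    finally have e: "integral J (\<lambda>z. \<phi> t z * h z) = of_int p * integral J (\<lambda>z. fcoeff (u t) k z * h z) + of_int q * integral J (\<lambda>z. fcoeff (v t) k z * h z)" .
    have "norm (integral J (\<lambda>z. \<phi> t z * h z))
        \<le> \<bar>of_int p\<bar> * (B * (sqrt (2 * W) * (P * exp (s * t)))) + \<bar>of_int q\<bar> * (B * (sqrt (2 * W) * (P * exp (s * t))))"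
      unfolding e
    proof (intro norm_triangle_le add_mono)
      show "norm (of_int p * integral J (\<lambda>z. fcoeff (u t) k z * h z)) \<le> \<bar>of_int p\<bar> * (B * (sqrt (2 * W) * (P * exp (s * t))))"
        unfolding norm_mult norm_of_int using b[OF uc(1)[OF tS] apriori(1)] t by (intro mult_left_mono) auto
      show "norm (of_int q * integral J (\<lambda>z. fcoeff (v t) k z * h z)) \<le> \<bar>of_int q\<bar> * (B * (sqrt (2 * W) * (P * exp (s * t))))"
        unfolding norm_mult norm_of_int using b[OF uc(2)[OF tS] apriori(2)] t by (intro mult_left_mono) auto
    qed
    then show ?thesis by (simp add: algebra_simps)
  qed
  define \<phi>0 where "\<phi>0 z = of_int p * fcoeff (u 0) k z + of_int q * fcoeff (v 0) k z" for z
  have \<phi>0c: "continuous_on J \<phi>0" unfolding \<phi>0_def by (intro continuous_intros u0c)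
  have init: "((\<lambda>t. integral J (\<lambda>z. norm (\<phi> t z - \<phi>0 z))) \<longlongrightarrow> 0) (at_right 0)"
  proof (rule Lim_null_comparison)
    let ?d = "\<lambda>h t. integral J (\<lambda>z. norm (fcoeff (h t) k z - fcoeff (h 0) k z))"
    have S0: "0 < S" using pos by simp
    have "((\<lambda>t. \<bar>of_int p\<bar> * ?d u t + \<bar>of_int q\<bar> * ?d v t) \<longlongrightarrow> \<bar>of_int p\<bar> * 0 + \<bar>of_int q\<bar> * 0) (at_right 0)"
      using modes_tendsto_integral[OF mc(1) S0 \<alpha> JJ(1,2)] modes_tendsto_integral[OF mc(2) S0 \<alpha> JJ(1,2)] uc u0c
      unfolding J_def by (intro tendsto_add tendsto_mult_left) auto
    then show "((\<lambda>t. \<bar>of_int p\<bar> * ?d u t + \<bar>of_int q\<bar> * ?d v t) \<longlongrightarrow> 0) (at_right 0)" by simp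
    have "norm (integral J (\<lambda>z. norm (\<phi> t z - \<phi>0 z))) \<le> \<bar>of_int p\<bar> * ?d u t + \<bar>of_int q\<bar> * ?d v t" if t: "t \<in> {0<..<S}" for t
    proof -
      have cu: "continuous_on J (\<lambda>z. norm (fcoeff (u t) k z - fcoeff (u 0) k z))"
        and cv: "continuous_on J (\<lambda>z. norm (fcoeff (v t) k z - fcoeff (v 0) k z))"
        by (intro continuous_on_norm continuous_on_diff uc[OF t] u0c)+
      have iu: "(\<lambda>z. \<bar>of_int p\<bar> * norm (fcoeff (u t) k z - fcoeff (u 0) k z)) integrable_on J"
        "(\<lambda>z. \<bar>of_int q\<bar> * norm (fcoeff (v t) k z - fcoeff (v 0) k z)) integrable_on J"
        using cu cv unfolding J_def by (auto intro!: integrable_continuous_real continuous_on_mult_left)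
      have i\<phi>: "(\<lambda>z. norm (\<phi> t z - \<phi>0 z)) integrable_on J"
      proof -
        have "continuous_on J (\<lambda>z. norm (\<phi> t z - \<phi>0 z))"
          unfolding \<phi>_def by (intro continuous_on_norm continuous_on_diff \<phi>0c continuous_on_add continuous_on_mult_left uc[OF t])
        then show ?thesis unfolding J_def by (rule integrable_continuous_real)
      qed
      have "integral J (\<lambda>z. norm (\<phi> t z - \<phi>0 z)) \<le> integral J (\<lambda>z. \<bar>of_int p\<bar> * norm (fcoeff (u t) k z - fcoeff (u 0) k z) + \<bar>of_int q\<bar> * norm (fcoeff (v t) k z - fcoeff (v 0) k z))"
      proof (rule integral_le[OF i\<phi> integrable_add[OF iu]])
        fix z
        have "\<phi> t z - \<phi>0 z = of_int p * (fcoeff (u t) k z - fcoeff (u 0) k z) + of_int q * (fcoeff (v t) k z - fcoeff (v 0) k z)"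
          by (simp add: \<phi>_def \<phi>0_def algebra_simps)
        then show "norm (\<phi> t z - \<phi>0 z) \<le> \<bar>of_int p\<bar> * norm (fcoeff (u t) k z - fcoeff (u 0) k z) + \<bar>of_int q\<bar> * norm (fcoeff (v t) k z - fcoeff (v 0) k z)"
          using norm_triangle_ineq[of "of_int p * (fcoeff (u t) k z - fcoeff (u 0) k z)" "of_int q * (fcoeff (v t) k z - fcoeff (v 0) k z)"]
          by (simp add: norm_mult)
      qed
      also have "\<dots> = \<bar>of_int p\<bar> * ?d u t + \<bar>of_int q\<bar> * ?d v t"
        unfolding integral_add[OF iu] Henstock_Kurzweil_Integration.integral_mult_right ..
      finally have "integral J (\<lambda>z. norm (\<phi> t z - \<phi>0 z)) \<le> \<bar>of_int p\<bar> * ?d u t + \<bar>of_int q\<bar> * ?d v t" .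
      moreover have "0 \<le> integral J (\<lambda>z. norm (\<phi> t z - \<phi>0 z))" by (rule integral_nonneg[OF i\<phi>]) simp
      ultimately show ?thesis by simp
    qed
    then show "\<forall>\<^sub>F t in at_right 0. norm (integral J (\<lambda>z. norm (\<phi> t z - \<phi>0 z))) \<le> \<bar>of_int p\<bar> * ?d u t + \<bar>of_int q\<bar> * ?d v t"
      using S0 by (auto simp: eventually_at_right intro!: exI[of _ S])
  qed
  have p0: "0 \<le> (\<bar>of_int p\<bar> + \<bar>of_int q\<bar>) * (sqrt (2 * W) * P)" using pos by simp
  have G: "norm (integral J (\<lambda>z. \<phi>0 z * prof_F \<kappa> \<eta> (V z0 0 z)))
     \<le> (\<bar>of_int p\<bar> + \<bar>of_int q\<bar>) * (sqrt (2 * W) * P) * (Gb / (2 * a * k0 - s) + 2 * exp 2 * C * exp (- (2 * a * k0 - s) * T))"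
    unfolding Gb_def J_def
    by (rule growth_estimate[OF pos(1-9) p0 n \<kappa> r small \<eta> U2_E[unfolded J_def] U1_E ap[unfolded J_def] init[unfolded J_def] \<phi>0c[unfolded J_def]])
  have "integral J (\<lambda>z. \<phi>0 z * prof_F \<kappa> \<eta> (V z0 0 z)) = integral J (\<lambda>z. complex_of_real (R2 * (norm (g z))\<^sup>2))"
  proof (rule integral_cong)
    fix z assume z: "z \<in> J"
    have "\<phi>0 z = of_real R2 * g z" by (simp add: \<phi>0_def data[OF z] R2_def power2_eq_square algebra_simps)
    moreover have "g z * prof_F \<kappa> \<eta> (V z0 0 z) = of_real ((norm (g z))\<^sup>2)"
      by (simp add: g_def V_def complex_norm_square[symmetric] mult.commute)
    ultimately show "\<phi>0 z * prof_F \<kappa> \<eta> (V z0 0 z) = complex_of_real (R2 * (norm (g z))\<^sup>2)" by (simp add: mult.assoc)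
  qed
  also have "\<dots> = of_real (R2 * integral J (\<lambda>z. (norm (g z))\<^sup>2))"
  proof -
    have c: "continuous_on J (\<lambda>z. (norm (g z))\<^sup>2)" by (intro continuous_intros gc)
    have "((\<lambda>z. R2 * (norm (g z))\<^sup>2) has_integral R2 * integral J (\<lambda>z. (norm (g z))\<^sup>2)) J"
      using c unfolding J_def by (intro has_integral_mult_right integrable_integral integrable_continuous_real)
    then have "((\<lambda>z. complex_of_real (R2 * (norm (g z))\<^sup>2)) has_integral of_real (R2 * integral J (\<lambda>z. (norm (g z))\<^sup>2))) J"
      by (rule has_integral_of_real)
    then show ?thesis by (rule integral_unique)
  qed
  finally have "norm (integral J (\<lambda>z. \<phi>0 z * prof_F \<kappa> \<eta> (V z0 0 z))) = \<bar>R2 * integral J (\<lambda>z. (norm (g z))\<^sup>2)\<bar>"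
    by (simp only: norm_of_real)
  with G show ?thesis unfolding R2_def by linarith
qed

section \<open>The ill-posedness criterion\<close>

lemma powr_mult_exp_neg_powr_tendsto_0:
  fixes b c d :: real
  assumes "0 < c" "0 < d"
  shows "((\<lambda>x. x powr b * exp (- (c * x powr d))) \<longlongrightarrow> 0) at_top"
proof -
  obtain m :: nat where m: "b / d \<le> real m" using real_arch_simple by blast
  have "((\<lambda>y::real. y ^ m * exp (- (c * y))) \<longlongrightarrow> 0) at_top" using assms by real_asymp
  moreover have "filterlim (\<lambda>x::real. x powr d) at_top at_top" using assms by real_asymp
  ultimately have "((\<lambda>x. (x powr d) ^ m * exp (- (c * x powr d))) \<longlongrightarrow> 0) at_top"
    by (rule filterlim_compose)
  then show ?thesis
  proof (rule Lim_null_comparison[rotated])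
    show "\<forall>\<^sub>F x in at_top. norm (x powr b * exp (- (c * x powr d))) \<le> (x powr d) ^ m * exp (- (c * x powr d))"
      using eventually_ge_at_top[of 1]
    proof eventually_elim
      case (elim x)
      have "b \<le> d * real m" using m assms by (simp add: pos_divide_le_eq mult.commute)
      then have "x powr b \<le> x powr (d * real m)" using elim by (intro powr_mono) auto
      also have "\<dots> = (x powr d) ^ m" using elim by (simp add: powr_powr powr_realpow[symmetric])
      finally show ?case by (simp add: abs_mult mult_right_mono)
    qed
  qed
qed

text \<open>
  The bound of \<open>mode_growth_inequality\<close> at time \<open>N powr (e - 1/2)\<close>, relative to the size
  \<open>N powr (- 1/4)\<close> of the initial pairing and up to constants.
\<close>

definition growth_defect :: "real \<Rightarrow> real \<Rightarrow> real \<Rightarrow> real \<Rightarrow> real \<Rightarrow> real \<Rightarrow> real" where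
  "growth_defect a C e K N E = N powr (K + e / 2) *
     (C / a * (exp 2 * (34 * a / sqrt (8 * a) * (N powr (2 * e) * E) + 6 * E) + 400 * a * exp (- (a / (4 * sqrt (8 * a)) * N powr (2 * e))))
      + 2 * exp 2 * C * exp (- (a / sqrt (8 * a) * N powr e)))"

text \<open>The terms with E carry at most the power K + 5e/2 of n, below the K + 3e of
  \<open>lim\<close>; the other terms are exponentially small in a power of n.\<close>

lemma growth_defect_tendsto_0:
  assumes a: "0 < a" and e: "0 < e" and E: "\<And>n. 0 \<le> E n"
    and lim: "(\<lambda>n. real n powr (K + 3 * e) * E n) \<longlonglongrightarrow> 0"
  shows "(\<lambda>n. growth_defect a C e K (real n) (E n)) \<longlonglongrightarrow> 0"
proof -
  have nat: "filterlim real at_top sequentially" by (rule filterlim_real_sequentially)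
  have l1: "(\<lambda>n. real n powr (K + e / 2) * E n) \<longlonglongrightarrow> 0"
  proof (rule Lim_null_comparison[OF _ lim])
    show "\<forall>\<^sub>F n in sequentially. norm (real n powr (K + e / 2) * E n) \<le> real n powr (K + 3 * e) * E n"
      using eventually_ge_at_top[of 1]
    proof eventually_elim
      case (elim n)
      then have "real n powr (K + e / 2) \<le> real n powr (K + 3 * e)" using e by (intro powr_mono) auto
      then show ?case using E[of n] by (simp add: abs_mult mult_right_mono)
    qed
  qed
  have l2: "(\<lambda>n. real n powr (K + e / 2) * (real n powr (2 * e) * E n)) \<longlonglongrightarrow> 0"
  proof (rule Lim_null_comparison[OF _ lim])
    show "\<forall>\<^sub>F n in sequentially. norm (real n powr (K + e / 2) * (real n powr (2 * e) * E n)) \<le> real n powr (K + 3 * e) * E n"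
      using eventually_ge_at_top[of 1]
    proof eventually_elim
      case (elim n)
      then have "real n powr (K + e / 2) * real n powr (2 * e) \<le> real n powr (K + 3 * e)"
        using e unfolding powr_add[symmetric] by (intro powr_mono) auto
      then have "real n powr (K + e / 2) * real n powr (2 * e) * E n \<le> real n powr (K + 3 * e) * E n"
        using E[of n] by (rule mult_right_mono)
      then show ?case using E[of n] by (simp add: abs_mult mult.assoc)
    qed
  qed
  have l3: "(\<lambda>n. real n powr (K + e / 2) * exp (- (a / (4 * sqrt (8 * a)) * real n powr (2 * e)))) \<longlonglongrightarrow> 0"
    by (rule filterlim_compose[OF powr_mult_exp_neg_powr_tendsto_0 nat]) (use a e in auto)
  have l4: "(\<lambda>n. real n powr (K + e / 2) * exp (- (a / sqrt (8 * a) * real n powr e))) \<longlonglongrightarrow> 0"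
    by (rule filterlim_compose[OF powr_mult_exp_neg_powr_tendsto_0 nat]) (use a e in auto)
  have "(\<lambda>n. C / a * (exp 2 * (34 * a / sqrt (8 * a) * (real n powr (K + e / 2) * (real n powr (2 * e) * E n)) + 6 * (real n powr (K + e / 2) * E n))
        + 400 * a * (real n powr (K + e / 2) * exp (- (a / (4 * sqrt (8 * a)) * real n powr (2 * e)))))
      + 2 * exp 2 * C * (real n powr (K + e / 2) * exp (- (a / sqrt (8 * a) * real n powr e)))) \<longlonglongrightarrow>
     C / a * (exp 2 * (34 * a / sqrt (8 * a) * 0 + 6 * 0) + 400 * a * 0) + 2 * exp 2 * C * 0"
    by (intro tendsto_add tendsto_mult_left l1 l2 l3 l4)
  moreover have "growth_defect a C e K N F = C / a * (exp 2 * (34 * a / sqrt (8 * a) * (N powr (K + e / 2) * (N powr (2 * e) * F)) + 6 * (N powr (K + e / 2) * F))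
        + 400 * a * (N powr (K + e / 2) * exp (- (a / (4 * sqrt (8 * a)) * N powr (2 * e)))))
      + 2 * exp 2 * C * (N powr (K + e / 2) * exp (- (a / sqrt (8 * a) * N powr e)))" for N F
    unfolding growth_defect_def by (simp only: distrib_left mult.assoc mult.left_commute)
  ultimately show ?thesis by simp
qed

text \<open>With W = N^(e - 1/4), T = N^(e - 1/2) and k0 proportional to N^(1/2), the exponents of
  the growth inequality become k0 W^2, proportional to N^(2e), and k0 T, proportional to N^e. The
  passage from m1 to m2 costs at most a multiple of N^K. By \<open>step\<close> a fixed multiple of
  \<open>growth_defect\<close> stays above a positive constant, whereas \<open>decay\<close> makes
  it tend to 0.\<close>

lemma ill_posedness_criterion:
  fixes \<alpha> U0 V0 z0 a e K \<rho> \<delta> \<sigma> m1 m2 :: real and p q :: int and us vs :: "real \<Rightarrow> real \<Rightarrow> real"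
    and E :: "nat \<Rightarrow> real"
  defines "U1 \<equiv> combine p q (\<lambda>t. deriv (us t)) (\<lambda>t. deriv (vs t))"
    and "U2 \<equiv> combine p q (\<lambda>t. deriv (deriv (us t))) (\<lambda>t. deriv (deriv (vs t)))"
  assumes \<alpha>: "0 < \<alpha>" and hu: "heat_profile \<alpha> U0 Us us" and hv: "heat_profile \<alpha> V0 Vs vs"
    and pq: "(p, q) \<noteq> (0, 0)" and z0: "0 < z0" and a: "0 < a" and e: "0 < e" "e < 1 / 4"
    and E: "\<And>n. 0 \<le> E n"
    and region: "\<forall>\<^sub>F n in sequentially. \<forall>t z. 0 \<le> t \<longrightarrow> t \<le> real n powr (e - 1/2) \<longrightarrow>
       z \<in> {z0 - real n powr (e - 1/4)..z0 + real n powr (e - 1/4)} \<longrightarrow>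
       \<bar>U2 t z - 2 * a\<bar> \<le> E n \<and> \<bar>U1 t z0\<bar> \<le> real n powr (e - 1/4) * E n"
    and K: "0 \<le> K" "m1 - m2 \<le> K" and decay: "(\<lambda>n. real n powr (K + 3 * e) * E n) \<longlonglongrightarrow> 0"
    and \<xi>: "\<xi> \<in> {fst, snd}" and \<sigma>: "0 < \<sigma>" "\<sigma> * sqrt (\<bar>of_int p\<bar> + \<bar>of_int q\<bar>) \<le> sqrt (a / 8)" and \<delta>: "0 < \<delta>"
    and loss: "analytic_loss_rate \<alpha> us vs \<rho>"
    and \<beta>: "\<And>s t. 0 \<le> s \<Longrightarrow> s \<le> t \<Longrightarrow> \<rho> * (t - s) < \<beta> s t"
  shows "sup_op_norm \<alpha> us vs \<rho> \<beta> \<xi> \<sigma> \<delta> m1 m2 = \<infinity>"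
proof (rule ccontr)
  assume fin: "sup_op_norm \<alpha> us vs \<rho> \<beta> \<xi> \<sigma> \<delta> m1 m2 \<noteq> \<infinity>"
  obtain M' where M': "0 \<le> M'" and apr: "\<And>p q k f A T. f \<in> borel_measurable (lebesgue_on {0<..}) \<Longrightarrow> L2w_norm \<alpha> f = ennreal A \<Longrightarrow> 0 < A \<Longrightarrow>
      0 < T \<Longrightarrow> T \<le> \<delta> \<Longrightarrow> (p, q) \<noteq> (0, 0) \<Longrightarrow>
      \<exists>u v w S. T < S \<and> linearized_prandtl us vs 0 S u v w \<and>
        modes_continuous \<alpha> {0..<S} u \<and> modes_continuous \<alpha> {0..<S} v \<and>
        (\<forall>z>0. fcoeff (u 0) k z = of_int p * f z \<and> fcoeff (v 0) k z = of_int q * f z) \<and>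
        (\<forall>t. 0 \<le> t \<longrightarrow> t \<le> T \<longrightarrow>
          L2w_norm \<alpha> (fcoeff (u t) k) \<le> ennreal (M' * (1 + freq2 k) powr ((m1 - m2) / 2) *
            exp (\<sigma> * t * sqrt \<bar>of_int (\<xi> k)\<bar>) * sqrt ((of_int p)\<^sup>2 + (of_int q)\<^sup>2) * A) \<and>
          L2w_norm \<alpha> (fcoeff (v t) k) \<le> ennreal (M' * (1 + freq2 k) powr ((m1 - m2) / 2) *
            exp (\<sigma> * t * sqrt \<bar>of_int (\<xi> k)\<bar>) * sqrt ((of_int p)\<^sup>2 + (of_int q)\<^sup>2) * A))"
    by (rule mode_apriori_bound[OF loss \<beta> fin \<sigma>(1)], assumption, assumption, rule that)
  obtain C where C: "1 \<le> C" and cutoff: "\<And>r. 0 < r \<Longrightarrow> \<exists>\<eta> :: nat \<Rightarrow> real \<Rightarrow> real.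
     (\<forall>j v. (\<eta> j has_real_derivative \<eta> (Suc j) v) (at v)) \<and> (\<forall>j\<le>3. \<forall>v. \<bar>\<eta> j v\<bar> \<le> C * (2 / r) ^ j) \<and>
     (\<forall>v. v \<le> r / 2 \<longrightarrow> \<eta> 0 v = 1) \<and> (\<forall>v j. r < v \<longrightarrow> \<eta> j v = 0) \<and> (\<forall>v j. v < r / 2 \<longrightarrow> 0 < j \<longrightarrow> \<eta> j v = 0)"
    by (rule cutoff_exists, rule that)
  define R2 where "R2 = ((of_int p)\<^sup>2 + (of_int q)\<^sup>2 :: real)"
  define L where "L = \<bar>of_int p\<bar> + (\<bar>of_int q\<bar> :: real)"
  define q8 where "q8 = sqrt (8 * a)"
  \<comment> \<open>A lower bound for the squared modulus of the test function on the core \<bar>z -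
    z0\<bar> \<le> N^(-1/4): there k0 v \<le> a / q8 + 2, and squaring doubles the exponent.\<close>
  define c0 where "c0 = exp (- (2 * a / q8) - 4)"
  define K0 where "K0 = (1 + R2) powr (K / 2)"
  define c2 where "c2 = L * sqrt 2 * (M' + 1) * K0 * sqrt R2 * exp (\<alpha> * (z0 + 1))"
  define U where "U = combine p q us vs"
  have q8: "0 < q8" "q8\<^sup>2 = 8 * a" using a by (auto simp: q8_def)
  have R2: "0 < R2"
  proof -
    have "0 < (of_int p :: real)\<^sup>2 + (of_int q)\<^sup>2 \<longleftrightarrow> (of_int p :: real) \<noteq> 0 \<or> (of_int q :: real) \<noteq> 0"
      by (rule sum_power2_gt_zero_iff)
    then show ?thesis using pq by (auto simp: R2_def)
  qed
  have L: "0 \<le> L" by (simp add: L_def)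
  have step: "R2 * sqrt (2 * c0) \<le> c2 * growth_defect a C e K N En"
    if N: "N = real n" "1 \<le> N" and En: "0 \<le> En"
      and cW: "N powr (e - 1/4) < z0" "N powr (e - 1/4) \<le> 1" and cT: "N powr (e - 1/2) \<le> \<delta>"
      and cE: "16 * En \<le> a" "N powr (2 * e) * En \<le> q8"
      and cN: "4 * q8 / a \<le> N powr (2 * e)" "17 \<le> N powr (2 * e)"
      and reg: "\<And>t z. 0 \<le> t \<Longrightarrow> t \<le> N powr (e - 1/2) \<Longrightarrow> z \<in> {z0 - N powr (e - 1/4)..z0 + N powr (e - 1/4)} \<Longrightarrow>
       \<bar>U2 t z - 2 * a\<bar> \<le> En" "\<And>t. 0 \<le> t \<Longrightarrow> t \<le> N powr (e - 1/2) \<Longrightarrow> \<bar>U1 t z0\<bar> \<le> N powr (e - 1/4) * En"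
    for n :: nat and N En :: real
  proof -
    define W where "W = N powr (e - 1/4)"
    define T where "T = N powr (e - 1/2)"
    define k0 where "k0 = N powr (1/2) / q8"
    define r where "r = a * W\<^sup>2 / 2"
    define \<kappa> where "\<kappa> = Complex k0 k0"
    \<comment> \<open>The natural width of the Gaussian: k0 l^2 does not depend on N, so the squared
      norm of the test function is at least of size l.\<close>
    define l where "l = N powr (- 1/4)"
    \<comment> \<open>Half of the growth rate \<open>2 * a * k0\<close>; the gap left for the
      contradiction is then s again.\<close>
    define s where "s = a * k0"
    have pos: "0 < W" "0 < T" "0 < k0" "0 < r" "0 < l" "0 < s"
      using N q8 a by (auto simp: W_def T_def k0_def r_def l_def s_def)
    have W2: "W\<^sup>2 = N powr (2 * e - 1/2)" using N by (simp add: W_def powr_power algebra_simps)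
    have l2: "l\<^sup>2 = N powr (- 1/2)" using N by (simp add: l_def powr_power)
    have Wl: "W\<^sup>2 = N powr (2 * e) * l\<^sup>2" unfolding W2 l2 using N by (simp flip: powr_add)
    have k0W2: "k0 * W\<^sup>2 = N powr (2 * e) / q8" unfolding W2 k0_def using N by (simp flip: powr_add)
    have k0T: "k0 * T = N powr e / q8" unfolding T_def k0_def using N by (simp flip: powr_add)
    have k0l2: "k0 * l\<^sup>2 = 1 / q8" unfolding l2 k0_def using N by (simp flip: powr_add)
    have k02: "8 * a * k0\<^sup>2 = N"
    proof -
      have "k0\<^sup>2 = N / q8\<^sup>2" using N by (simp add: k0_def power_divide powr_power)
      then show ?thesis using q8 a by simp
    qed
    have ll: "l < W" "l\<^sup>2 \<le> W\<^sup>2 / 17"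
    proof -
      have "17 * l\<^sup>2 \<le> W\<^sup>2" unfolding Wl using cN(2) by (intro mult_right_mono) auto
      then show 17: "l\<^sup>2 \<le> W\<^sup>2 / 17" by simp
      have "0 < l\<^sup>2" using pos by simp
      with 17 have "l\<^sup>2 < W\<^sup>2" by linarith
      then show "l < W" using pos by (simp add: power2_less_imp_less)
    qed
    have kE: "k0 * W\<^sup>2 * En \<le> 1" unfolding k0W2 using cE(2) q8 by (simp add: divide_le_eq)
    have rk: "2 / r \<le> k0"
    proof -
      have "4 \<le> a * (N powr (2 * e) / q8)" using cN(1) a q8 by (simp add: field_simps)
      then have "4 \<le> a * (k0 * W\<^sup>2)" unfolding k0W2 .
      then have "2 \<le> k0 * r" by (simp add: r_def algebra_simps)
      then show ?thesis using pos by (simp add: divide_le_eq)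
    qed
    obtain \<eta> :: "nat \<Rightarrow> real \<Rightarrow> real" where \<eta>: "\<And>j v. (\<eta> j has_real_derivative \<eta> (Suc j) v) (at v)"
      "\<And>j v. j \<le> 3 \<Longrightarrow> \<bar>\<eta> j v\<bar> \<le> C * (2 / r) ^ j" "\<And>v. v \<le> r / 2 \<Longrightarrow> \<eta> 0 v = 1"
      "\<And>j v. r < v \<Longrightarrow> \<eta> j v = 0" "\<And>j v. v < r / 2 \<Longrightarrow> 0 < j \<Longrightarrow> \<eta> j v = 0"
    proof -
      from cutoff[OF pos(4)] obtain \<eta> :: "nat \<Rightarrow> real \<Rightarrow> real" where
        "(\<forall>j v. (\<eta> j has_real_derivative \<eta> (Suc j) v) (at v)) \<and> (\<forall>j\<le>3. \<forall>v. \<bar>\<eta> j v\<bar> \<le> C * (2 / r) ^ j) \<and>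
         (\<forall>v. v \<le> r / 2 \<longrightarrow> \<eta> 0 v = 1) \<and> (\<forall>v j. r < v \<longrightarrow> \<eta> j v = 0) \<and> (\<forall>v j. v < r / 2 \<longrightarrow> 0 < j \<longrightarrow> \<eta> j v = 0)" ..
      then show ?thesis by (intro that[of \<eta>]) simp_all
    qed
    have \<kappa>0: "\<kappa> \<noteq> 0" using pos by (auto simp: \<kappa>_def complex_eq_iff)
    define J where "J = {z0 - W..z0 + W}"
    have J: "0 < z0 - W" "z0 - W < z0 + W" "J \<subseteq> {0<..}" using pos cW by (auto simp: J_def W_def)
    define g where "g z = cnj (prof_F \<kappa> \<eta> (U 0 z - U 0 z0))" for z
    have dU: "(U 0 has_real_derivative U1 0 z) (at z)" "(U1 0 has_real_derivative U2 0 z) (at z)" if "z \<in> J" for z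
    proof -
      have z: "0 < z" using that J by auto
      show "(U 0 has_real_derivative U1 0 z) (at z)" unfolding U_def U1_def combine_def
        by (intro DERIV_add DERIV_cmult heat_profile_C2(1)[OF \<alpha> hu order_refl z] heat_profile_C2(1)[OF \<alpha> hv order_refl z])
      show "(U1 0 has_real_derivative U2 0 z) (at z)" unfolding U1_def U2_def combine_def
        by (intro DERIV_add DERIV_cmult heat_profile_C2(2)[OF \<alpha> hu order_refl z] heat_profile_C2(2)[OF \<alpha> hv order_refl z])
    qed
    have gc: "continuous_on J g"
    proof -
      have "continuous_on J (U 0)" using dU(1) DERIV_isCont continuous_at_imp_continuous_on by blast
      then have c: "continuous_on J (\<lambda>z. U 0 z - U 0 z0)" by (intro continuous_intros)
      have F: "continuous_on UNIV (prof_F \<kappa> \<eta>)"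
        by (rule continuous_at_imp_continuous_on, rule ballI, rule has_vector_derivative_continuous,
            rule prof_derivs(2)[where \<kappa> = \<kappa> and \<eta> = \<eta>, OF \<kappa>0 \<eta>(1)])
      show ?thesis unfolding g_def by (intro continuous_on_cnj continuous_on_compose2[OF F c]) auto
    qed
    define I0 where "I0 = integral J (\<lambda>z. (norm (g z))\<^sup>2)"
    have I0: "2 * l * c0 \<le> I0"
    proof -
      have gl: "c0 \<le> (norm (g z))\<^sup>2" if z: "z \<in> {z0 - l..z0 + l}" for z
      proof -
        have zJ: "z \<in> J" using z ll pos by (auto simp: J_def)
        define v where "v = U 0 z - U 0 z0"
        have q: "\<bar>v - a * (z - z0)\<^sup>2\<bar> \<le> 2 * W\<^sup>2 * En" unfolding v_def
          by (rule quadratic_approx(2)[where ?f1.0 = "U1 0" and ?f2.0 = "U2 0"])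
             (use pos dU reg zJ En in \<open>auto simp: J_def W_def\<close>)
        have "\<bar>z - z0\<bar> \<le> l" using z by auto
        then have "(z - z0)\<^sup>2 \<le> l\<^sup>2" using pos by (simp add: abs_le_square_iff[symmetric])
        then have "a * (z - z0)\<^sup>2 \<le> a * l\<^sup>2" using a by (intro mult_left_mono) auto
        then have v: "v \<le> a * l\<^sup>2 + 2 * W\<^sup>2 * En" using q by linarith
        have "a * l\<^sup>2 \<le> a * (W\<^sup>2 / 17)" using ll a by (intro mult_left_mono) auto
        moreover have "2 * W\<^sup>2 * En \<le> a * W\<^sup>2 / 8" using mult_left_mono[OF cE(1), of "W\<^sup>2"] by (simp add: algebra_simps)
        moreover have "0 < a * W\<^sup>2" using a pos by simp
        ultimately have vr: "v < r / 2" using v unfolding r_def by (simp add: algebra_simps)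
        have "prof_F \<kappa> \<eta> v = exp (- \<kappa> * v)"
          using \<eta>(3)[of v] \<eta>(5)[of v 1] vr by (simp add: prof_F_def wexp_def)
        then have "norm (g z) = exp (- (k0 * v))" by (simp add: g_def v_def[symmetric] norm_exp_eq_Re \<kappa>_def)
        moreover have "k0 * v \<le> a / q8 + 2"
        proof -
          have "k0 * v \<le> k0 * (a * l\<^sup>2 + 2 * W\<^sup>2 * En)" using v pos by (intro mult_left_mono) auto
          also have "\<dots> = a * (k0 * l\<^sup>2) + 2 * (k0 * W\<^sup>2 * En)" by (simp add: algebra_simps)
          also have "\<dots> \<le> a / q8 + 2" unfolding k0l2 using kE by simp
          finally show ?thesis .
        qed
        ultimately have "exp (- (a / q8 + 2)) \<le> norm (g z)" by simp
        then have "(exp (- (a / q8 + 2)))\<^sup>2 \<le> (norm (g z))\<^sup>2" by (intro power_mono) auto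
        then show ?thesis by (simp add: c0_def exp_double[symmetric] power2_eq_square flip: exp_add)
      qed
      have sub: "{z0 - l..z0 + l} \<subseteq> J" using ll pos by (auto simp: J_def)
      have cg: "continuous_on J (\<lambda>z. (norm (g z))\<^sup>2)" by (intro continuous_intros gc)
      have "((\<lambda>z. c0) has_integral ((z0 + l) - (z0 - l)) *\<^sub>R c0) {z0 - l..z0 + l}"
        using pos by (intro has_integral_const_real[THEN has_integral_eq_rhs]) auto
      then have "((\<lambda>z. c0) has_integral 2 * l * c0) {z0 - l..z0 + l}" by simp
      then have "2 * l * c0 \<le> integral {z0 - l..z0 + l} (\<lambda>z. (norm (g z))\<^sup>2)"
        by (rule has_integral_le[OF _ integrable_integral])
           (use gl continuous_on_subset[OF cg sub] in \<open>auto intro: integrable_continuous_real\<close>)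
      also have "\<dots> \<le> I0" unfolding I0_def
        by (rule integral_subset_le[OF sub])
           (use cg continuous_on_subset[OF cg sub] in \<open>auto intro: integrable_continuous_real simp: J_def\<close>)
      finally show ?thesis .
    qed
    have c0: "0 < c0" by (simp add: c0_def)
    have I0p: "0 < I0" using I0 pos c0 by (smt (verit, best) mult_pos_pos)
    define f where "f = (\<lambda>z. if z \<in> {z0 - W..z0 + W} then g z else 0)"
    obtain A where A: "f \<in> borel_measurable (lebesgue_on {0<..})" "L2w_norm \<alpha> f = ennreal A" "0 < A"
        "A \<le> exp (\<alpha> * (z0 + W)) * sqrt I0"
      unfolding f_def
      by (rule L2w_norm_cutoff[OF gc[unfolded J_def] J(1,2) \<alpha> I0_def[unfolded J_def] I0p], rule that[unfolded f_def])
    define k where "k = (int n * p, int n * q)"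
    define P where "P = (M' + 1) * (1 + freq2 k) powr ((m1 - m2) / 2) * sqrt R2 * A"
    have fr: "1 + freq2 k = 1 + N\<^sup>2 * R2"
      by (simp add: freq2_def k_def N R2_def power_mult_distrib algebra_simps)
    have Pp: "0 < P"
    proof -
      have "0 < 1 + N\<^sup>2 * R2" using R2 by (simp add: add_pos_nonneg)
      moreover have "0 < M' + 1" using M' by simp
      ultimately show ?thesis unfolding P_def fr using A(3) R2 by (intro mult_pos_pos) auto
    qed
    \<comment> \<open>Either component of n (p, q) is at most N L in absolute value, so undoing the
      damping costs at most the rate \<sigma> sqrt (N L). The smallness of \<sigma> bounds it by s,
      because sqrt (N a / 8) = a k0.\<close>
    have \<xi>k: "\<sigma> * t * sqrt \<bar>of_int (\<xi> k)\<bar> \<le> s * t" if "0 \<le> t" for t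
    proof -
      have "\<bar>of_int (\<xi> k)\<bar> \<le> N * L"
        using \<xi> N by (auto simp: k_def L_def abs_mult algebra_simps)
      then have "sqrt \<bar>of_int (\<xi> k)\<bar> \<le> sqrt N * sqrt L" by (simp flip: real_sqrt_mult)
      then have "\<sigma> * sqrt \<bar>of_int (\<xi> k)\<bar> \<le> \<sigma> * (sqrt N * sqrt L)" using \<sigma> by (intro mult_left_mono) auto
      also have "\<dots> = sqrt N * (\<sigma> * sqrt L)" by simp
      also have "\<dots> \<le> sqrt N * sqrt (a / 8)" using \<sigma>(2) N by (intro mult_left_mono) (auto simp: L_def)
      also have "\<dots> = s"
      proof -
        have "sqrt (a / 8) = a / q8"
        proof (rule real_sqrt_unique)
          show "(a / q8)\<^sup>2 = a / 8" using q8 a by (simp add: power_divide power2_eq_square)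
        qed (use a q8 in simp)
        then show ?thesis using N by (simp add: s_def k0_def powr_half_sqrt)
      qed
      finally have "\<sigma> * sqrt \<bar>of_int (\<xi> k)\<bar> \<le> s" .
      from mult_right_mono[OF this that] show ?thesis by (simp add: mult_ac)
    qed
    obtain u v w S where sol: "T < S" "linearized_prandtl us vs 0 S u v w"
        "modes_continuous \<alpha> {0..<S} u" "modes_continuous \<alpha> {0..<S} v"
        "\<forall>z>0. fcoeff (u 0) k z = of_int p * f z \<and> fcoeff (v 0) k z = of_int q * f z"
        and bnd: "\<forall>t. 0 \<le> t \<longrightarrow> t \<le> T \<longrightarrow>
          L2w_norm \<alpha> (fcoeff (u t) k) \<le> ennreal (M' * (1 + freq2 k) powr ((m1 - m2) / 2) *
            exp (\<sigma> * t * sqrt \<bar>of_int (\<xi> k)\<bar>) * sqrt ((of_int p)\<^sup>2 + (of_int q)\<^sup>2) * A) \<and>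
          L2w_norm \<alpha> (fcoeff (v t) k) \<le> ennreal (M' * (1 + freq2 k) powr ((m1 - m2) / 2) *
            exp (\<sigma> * t * sqrt \<bar>of_int (\<xi> k)\<bar>) * sqrt ((of_int p)\<^sup>2 + (of_int q)\<^sup>2) * A)"
      using apr[OF A(1,2,3) pos(2) cT[folded T_def] pq, of k] by blast
    have le: "M' * (1 + freq2 k) powr ((m1 - m2) / 2) * exp (\<sigma> * t * sqrt \<bar>of_int (\<xi> k)\<bar>) * sqrt ((of_int p)\<^sup>2 + (of_int q)\<^sup>2) * A
        \<le> P * exp (s * t)" if "0 \<le> t" for t
    proof -
      have "M' * (1 + freq2 k) powr ((m1 - m2) / 2) * exp (\<sigma> * t * sqrt \<bar>of_int (\<xi> k)\<bar>) * sqrt R2 * A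
         \<le> (M' + 1) * (1 + freq2 k) powr ((m1 - m2) / 2) * exp (s * t) * sqrt R2 * A"
        using M' A(3) R2 \<xi>k[OF that] by (intro mult_right_mono mult_mono) auto
      then show ?thesis unfolding P_def R2_def[symmetric] by (simp add: mult_ac)
    qed
    have data: "fcoeff (u 0) k z = of_int p * g z" "fcoeff (v 0) k z = of_int q * g z" if "z \<in> J" for z
      using sol(5) that J(3) by (auto simp: f_def J_def)
    have ap: "L2w_norm \<alpha> (fcoeff (u t) k) \<le> ennreal (P * exp (s * t))" "L2w_norm \<alpha> (fcoeff (v t) k) \<le> ennreal (P * exp (s * t))"
      if "0 \<le> t" "t \<le> T" for t
      using bnd that order_trans[OF _ ennreal_leI[OF le[OF that(1)]]] by blast+
    have s2: "2 * a * k0 - s = s" by (simp add: s_def)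
    have main: "R2 * I0 \<le> L * (sqrt (2 * W) * P) * (C * k0 * (exp 2 * (34 * a * k0 * W\<^sup>2 * En + 6 * En) + 400 * a * exp (- (k0 * r / 2))) / (2 * a * k0 - s)
        + 2 * exp 2 * C * exp (- (2 * a * k0 - s) * T))"
      unfolding R2_def L_def I0_def J_def g_def U_def
    proof (rule mode_growth_inequality[OF \<alpha> hu hv])
      show "fcoeff (u 0) (int n * p, int n * q) z = of_int p * cnj (prof_F \<kappa> \<eta> (combine p q us vs 0 z - combine p q us vs 0 z0))"
        "fcoeff (v 0) (int n * p, int n * q) z = of_int q * cnj (prof_F \<kappa> \<eta> (combine p q us vs 0 z - combine p q us vs 0 z0))"
        if "z \<in> {z0 - W..z0 + W}" for z
        using data[of z] that by (auto simp: J_def g_def U_def k_def)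
      show "L2w_norm \<alpha> (fcoeff (u t) (int n * p, int n * q)) \<le> ennreal (P * exp (s * t))"
        "L2w_norm \<alpha> (fcoeff (v t) (int n * p, int n * q)) \<le> ennreal (P * exp (s * t))" if "0 \<le> t" "t \<le> T" for t
        using ap[OF that] by (auto simp: k_def)
      show "\<bar>combine p q (\<lambda>t. deriv (deriv (us t))) (\<lambda>t. deriv (deriv (vs t))) t z - 2 * a\<bar> \<le> En"
        if "0 \<le> t" "t \<le> T" "z \<in> {z0 - W..z0 + W}" for t z
        using reg(1)[of t z] that by (simp add: U2_def T_def W_def)
      show "\<bar>combine p q (\<lambda>t. deriv (us t)) (\<lambda>t. deriv (vs t)) t z0\<bar> \<le> W * En"
        if "0 \<le> t" "t \<le> T" for t
        using reg(2)[of t] that by (simp add: U1_def T_def W_def)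
      show "s < 2 * a * k0" using pos a by (simp add: s_def)
      show "of_int (int n) = 8 * a * k0\<^sup>2" using k02 N by simp
    qed (use a pos cW En C sol Pp \<kappa>_def r_def cE kE rk \<eta> in \<open>auto simp: W_def\<close>)
    have "L * (sqrt (2 * W) * P) * (C * k0 * (exp 2 * (34 * a * k0 * W\<^sup>2 * En + 6 * En) + 400 * a * exp (- (k0 * r / 2))) / (2 * a * k0 - s)
        + 2 * exp 2 * C * exp (- (2 * a * k0 - s) * T))
       \<le> L * (sqrt (2 * W) * ((M' + 1) * (N powr K * K0) * sqrt R2 * (exp (\<alpha> * (z0 + 1)) * sqrt I0))) *
        (C / a * (exp 2 * (34 * a / q8 * (N powr (2 * e) * En) + 6 * En) + 400 * a * exp (- (a / (4 * q8) * N powr (2 * e))))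
        + 2 * exp 2 * C * exp (- (a / q8 * N powr e)))"
    proof (rule mult_mono)
      have "P \<le> (M' + 1) * (N powr K * K0) * sqrt R2 * (exp (\<alpha> * (z0 + 1)) * sqrt I0)"
        unfolding P_def
      proof (intro mult_mono order_refl)
        have b1: "1 \<le> 1 + freq2 k" by (simp add: freq2_def)
        have "(1 + freq2 k) powr ((m1 - m2) / 2) \<le> (1 + freq2 k) powr (K / 2)"
          using K b1 by (intro powr_mono) auto
        also have "\<dots> \<le> (N\<^sup>2 * (1 + R2)) powr (K / 2)"
        proof (rule powr_mono2)
          have "1 \<le> N\<^sup>2" using N by (simp add: one_le_power)
          then show "1 + freq2 k \<le> N\<^sup>2 * (1 + R2)" unfolding fr by (simp add: algebra_simps)
        qed (use K b1 in auto)
        also have "\<dots> = N powr K * K0"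
        proof -
          have "N\<^sup>2 = N powr 2" using N by (simp add: powr_numeral)
          then have "(N\<^sup>2) powr (K / 2) = N powr K" by (simp only: powr_powr) simp
          then show ?thesis using N R2 by (subst powr_mult) (simp_all add: K0_def)
        qed
        finally show "(1 + freq2 k) powr ((m1 - m2) / 2) \<le> N powr K * K0" .
        have "exp (\<alpha> * (z0 + W)) \<le> exp (\<alpha> * (z0 + 1))" using cW \<alpha> by (simp add: W_def)
        then have "exp (\<alpha> * (z0 + W)) * sqrt I0 \<le> exp (\<alpha> * (z0 + 1)) * sqrt I0" using I0p by (intro mult_right_mono) auto
        then show "A \<le> exp (\<alpha> * (z0 + 1)) * sqrt I0" using A(4) by linarith
      qed (use M' R2 A K0_def in auto)
      then show "L * (sqrt (2 * W) * P) \<le> L * (sqrt (2 * W) * ((M' + 1) * (N powr K * K0) * sqrt R2 * (exp (\<alpha> * (z0 + 1)) * sqrt I0)))"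
        using L pos by (intro mult_left_mono) auto
      have e1: "34 * a * k0 * W\<^sup>2 * En = 34 * a / q8 * (N powr (2 * e) * En)"
        using k0W2 by (simp add: mult.assoc[of _ k0] mult.assoc)
      have e2: "k0 * r / 2 = a / (4 * q8) * N powr (2 * e)"
      proof -
        have "k0 * r / 2 = a * (k0 * W\<^sup>2) / 4" by (simp add: r_def)
        then show ?thesis unfolding k0W2 by simp
      qed
      have e3: "s * T = a / q8 * N powr e" using k0T by (simp add: s_def mult.assoc)
      have e4: "C * k0 * X / s = C / a * X" for X using pos a by (simp add: s_def)
      show "C * k0 * (exp 2 * (34 * a * k0 * W\<^sup>2 * En + 6 * En) + 400 * a * exp (- (k0 * r / 2))) / (2 * a * k0 - s)
        + 2 * exp 2 * C * exp (- (2 * a * k0 - s) * T) \<le>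
        C / a * (exp 2 * (34 * a / q8 * (N powr (2 * e) * En) + 6 * En) + 400 * a * exp (- (a / (4 * q8) * N powr (2 * e))))
        + 2 * exp 2 * C * exp (- (a / q8 * N powr e))"
        unfolding s2 e4 e1 e2 minus_mult_left[symmetric] e3 by simp
      show "0 \<le> L * (sqrt (2 * W) * ((M' + 1) * (N powr K * K0) * sqrt R2 * (exp (\<alpha> * (z0 + 1)) * sqrt I0)))"
        using L pos M' R2 I0p by (auto simp: K0_def)
      show "0 \<le> C * k0 * (exp 2 * (34 * a * k0 * W\<^sup>2 * En + 6 * En) + 400 * a * exp (- (k0 * r / 2))) / (2 * a * k0 - s)
        + 2 * exp 2 * C * exp (- (2 * a * k0 - s) * T)"
        unfolding s2 using C pos a En by auto
    qed
    with main have m2': "R2 * I0 \<le> L * (sqrt (2 * W) * ((M' + 1) * (N powr K * K0) * sqrt R2 * (exp (\<alpha> * (z0 + 1)) * sqrt I0))) *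
        (C / a * (exp 2 * (34 * a / q8 * (N powr (2 * e) * En) + 6 * En) + 400 * a * exp (- (a / (4 * q8) * N powr (2 * e))))
        + 2 * exp 2 * C * exp (- (a / q8 * N powr e)))" (is "_ \<le> _ * ?B") by linarith
    \<comment> \<open>The norm of the data contributes sqrt I0 on the right, so one factor sqrt I0
      cancels; the one left on the right-hand side of the comparison is matched with sqrt (2 l c0).
      Since W = l N^e, the factor sqrt l also cancels and leaves N^(e/2).\<close>
    have "sqrt (2 * l * c0) * (R2 * sqrt I0) \<le> sqrt I0 * (R2 * sqrt I0)"
      using I0 R2 I0p by (intro mult_right_mono) auto
    also have "\<dots> = R2 * I0" using I0p by (simp add: mult_ac)
    also note m2'
    finally have "(sqrt (2 * l * c0) * R2) * sqrt I0 \<le> (L * (sqrt (2 * W) * ((M' + 1) * (N powr K * K0) * sqrt R2 * exp (\<alpha> * (z0 + 1)))) * ?B) * sqrt I0"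
      by (simp add: mult_ac)
    then have "sqrt (2 * l * c0) * R2 \<le> L * (sqrt (2 * W) * ((M' + 1) * (N powr K * K0) * sqrt R2 * exp (\<alpha> * (z0 + 1)))) * ?B"
      using I0p by (simp add: mult_le_cancel_right)
    moreover have "sqrt (2 * l * c0) = sqrt l * sqrt (2 * c0)" by (simp add: real_sqrt_mult)
    moreover have "sqrt (2 * W) = sqrt l * N powr (e / 2) * sqrt 2"
    proof -
      have "W = l * N powr e" using N by (simp add: W_def l_def flip: powr_add)
      moreover have "sqrt (N powr e) = N powr (e / 2)" using N by (simp add: powr_half_sqrt[symmetric] powr_powr)
      ultimately show ?thesis by (simp add: real_sqrt_mult)
    qed
    ultimately have "sqrt l * (R2 * sqrt (2 * c0)) \<le> sqrt l * (c2 * (N powr (e / 2) * N powr K * ?B))"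
      by (simp add: c2_def mult_ac)
    then have "R2 * sqrt (2 * c0) \<le> c2 * (N powr (e / 2) * N powr K * ?B)"
      using pos by (simp add: mult_le_cancel_left)
    also have "N powr (e / 2) * N powr K * ?B = growth_defect a C e K N En"
      by (simp add: growth_defect_def q8_def powr_add mult_ac)
    finally show ?thesis .
  qed
  have ev: "\<forall>\<^sub>F n in sequentially. R2 * sqrt (2 * c0) \<le> c2 * growth_defect a C e K (real n) (E n)"
  proof -
    have nat: "filterlim real at_top sequentially" by (rule filterlim_real_sequentially)
    have neg: "(\<lambda>n. real n powr (- x)) \<longlonglongrightarrow> 0" if "0 < x" for x
      by (rule filterlim_compose[OF _ nat]) (use that in real_asymp)
    have big: "filterlim (\<lambda>n. real n powr (2 * e)) at_top sequentially"
      by (rule filterlim_compose[OF _ nat]) (use e in real_asymp)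
    have Elim: "(\<lambda>n. real n powr x * E n) \<longlonglongrightarrow> 0" if "x \<le> K + 3 * e" for x
    proof (rule Lim_null_comparison[OF _ decay])
      show "\<forall>\<^sub>F n in sequentially. norm (real n powr x * E n) \<le> real n powr (K + 3 * e) * E n"
        using eventually_ge_at_top[of 1]
      proof eventually_elim
        case (elim n)
        then have "real n powr x \<le> real n powr (K + 3 * e)" using that by (intro powr_mono) auto
        then show ?case using E[of n] by (simp add: abs_mult mult_right_mono)
      qed
    qed
    have E0: "(\<lambda>n. real n powr 0 * E n) \<longlonglongrightarrow> 0" by (rule Elim) (use K e in simp)
    have E1: "\<forall>\<^sub>F n in sequentially. real n powr 0 * E n < a / 16"
      using E0 by (rule order_tendstoD) (use a in simp)
    have E2: "\<forall>\<^sub>F n in sequentially. real n powr (2 * e) * E n < q8"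
      using Elim[of "2 * e"] by (rule order_tendstoD) (use K e q8 in auto)
    have W1: "\<forall>\<^sub>F n in sequentially. real n powr (- (1/4 - e)) < min z0 1"
      using neg[of "1/4 - e"] by (rule order_tendstoD) (use e z0 in auto)
    have T1: "\<forall>\<^sub>F n in sequentially. real n powr (- (1/2 - e)) < \<delta>"
      using neg[of "1/2 - e"] by (rule order_tendstoD) (use e \<delta> in auto)
    have B1: "\<forall>\<^sub>F n in sequentially. max (4 * q8 / a) 17 \<le> real n powr (2 * e)"
      using big unfolding filterlim_at_top by blast
    show ?thesis
      using E1 E2 W1 T1 B1 region eventually_ge_at_top[of 1]
    proof eventually_elim
      case (elim n)
      have "\<bar>U1 t z0\<bar> \<le> real n powr (e - 1/4) * E n" if "0 \<le> t" "t \<le> real n powr (e - 1/2)" for t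
        using elim(6)[rule_format, OF that, of z0] by simp
      then show ?case
        by (intro step[OF refl]) (use elim E[of n] in auto)
    qed
  qed
  have "(\<lambda>n. c2 * growth_defect a C e K (real n) (E n)) \<longlonglongrightarrow> c2 * 0"
    by (intro tendsto_mult_left growth_defect_tendsto_0 a e E decay)
  then have "R2 * sqrt (2 * c0) \<le> c2 * 0"
    by (rule tendsto_lowerbound[OF _ ev]) simp
  moreover have "0 < R2 * sqrt (2 * c0)" using R2 by (simp add: c0_def)
  ultimately show False by simp
qed

section \<open>Algebraic ill-posedness around a general shear flow\<close>

text \<open>The ratio h = f / g has derivative D / g^2, nonzero near z0 by \<open>nd\<close>. Hence
  h is not constant there, and the interval h(B) contains a rational i / j. At a point where h takes
  this value, D \<noteq> 0 prevents the combination of the derivatives from vanishing together with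
  that of the functions.\<close>

lemma rational_critical_direction_aux:
  fixes f g f' g' :: "real \<Rightarrow> real"
  assumes z0: "0 < z0" and d: "\<And>z. 0 < z \<Longrightarrow> (f has_real_derivative f' z) (at z)" "\<And>z. 0 < z \<Longrightarrow> (g has_real_derivative g' z) (at z)"
    and c: "continuous_on {0<..} f'" "continuous_on {0<..} g'"
    and g0: "g z0 \<noteq> 0" and nd: "g z0 * f' z0 \<noteq> f z0 * g' z0"
  shows "\<exists>i j :: int. \<exists>z>0. j \<noteq> 0 \<and> of_int j * f z = of_int i * g z \<and> of_int j * f' z \<noteq> of_int i * g' z"
proof -
  have cf: "continuous_on {0<..} f" "continuous_on {0<..} g"
    by (rule continuous_at_imp_continuous_on, rule ballI, rule DERIV_isCont, rule d, simp)+
  define D where "D z = g z * f' z - f z * g' z" for z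
  have cD: "continuous_on {0<..} D" unfolding D_def by (intro continuous_intros c cf)
  have op: "open {0::real<..}" by simp
  have "isCont D z0" "isCont g z0" using cD cf z0 by (auto simp: continuous_on_eq_continuous_at[OF op])
  then have "(D \<longlongrightarrow> D z0) (nhds z0)" "(g \<longlongrightarrow> g z0) (nhds z0)"
    by (simp_all add: isCont_def tendsto_at_iff_tendsto_nhds)
  moreover have "D z0 \<noteq> 0" using nd by (simp add: D_def)
  ultimately have "\<forall>\<^sub>F z in nhds z0. D z \<noteq> 0" "\<forall>\<^sub>F z in nhds z0. g z \<noteq> 0"
    using g0 by (auto intro: tendsto_imp_eventually_ne)
  moreover have "\<forall>\<^sub>F z in nhds z0. z \<in> {0<..}" by (rule eventually_nhds_in_open[OF op]) (use z0 in simp)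
  ultimately have "\<forall>\<^sub>F z in nhds z0. D z \<noteq> 0 \<and> g z \<noteq> 0 \<and> 0 < z" by eventually_elim auto
  then obtain e where e: "0 < e" "\<And>z. dist z z0 < e \<Longrightarrow> D z \<noteq> 0 \<and> g z \<noteq> 0 \<and> 0 < z"
    unfolding eventually_nhds_metric by blast
  define B where "B = {z0 - e<..<z0 + e}"
  have B: "D z \<noteq> 0" "g z \<noteq> 0" "0 < z" if "z \<in> B" for z
  proof -
    have "dist z z0 < e" using that by (auto simp: B_def dist_real_def abs_less_iff)
    then show "D z \<noteq> 0" "g z \<noteq> 0" "0 < z" using e(2) by auto
  qed
  define h where "h z = f z / g z" for z
  have dh: "(h has_real_derivative D z / (g z)\<^sup>2) (at z)" if "z \<in> B" for z
    unfolding h_def D_def power2_eq_square using DERIV_divide[OF d(1)[OF B(3)[OF that]] d(2)[OF B(3)[OF that]] B(2)[OF that]]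
    by (simp add: mult.commute)
  have z0B: "z0 \<in> B" using e by (simp add: B_def)
  obtain y where y: "y \<in> B" "h y \<noteq> h z0"
  proof (rule ccontr)
    assume "\<not> thesis"
    then have cst: "\<And>y. y \<in> B \<Longrightarrow> h z0 = h y" using that by metis
    have "(h has_real_derivative 0) (at z0)"
      by (rule has_field_derivative_transform_within_open[OF DERIV_const, of B z0 "h z0"]) (use z0B cst in \<open>auto simp: B_def\<close>)
    then have "D z0 / (g z0)\<^sup>2 = 0" using DERIV_unique dh[OF z0B] by blast
    then show False using B[OF z0B] by simp
  qed
  obtain r where r: "r \<in> \<rat>" "min (h y) (h z0) < r" "r < max (h y) (h z0)"
  proof -
    have "min (h y) (h z0) < max (h y) (h z0)" using y(2) by auto
    from Rats_dense_in_real[OF this] show thesis using that by auto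
  qed
  have conn: "connected (h ` B)"
  proof (rule connected_continuous_image)
    show "continuous_on B h"
      by (rule continuous_at_imp_continuous_on, rule ballI, rule DERIV_isCont, rule dh)
    show "connected B" by (simp add: B_def)
  qed
  have "r \<in> h ` B"
  proof (rule connectedD_interval[OF conn])
    show "min (h y) (h z0) \<in> h ` B" "max (h y) (h z0) \<in> h ` B" using y(1) z0B by (auto simp: min_def max_def)
  qed (use r in auto)
  then obtain z where z: "z \<in> B" "r = h z" by blast
  obtain i j :: int where ij: "j \<noteq> 0" "r = of_int i / of_int j" using r(1) unfolding Rats_eq_int_div_int by blast
  have eq: "of_int j * f z = of_int i * g z"
    using ij z B[OF z(1)] by (simp add: h_def field_simps)
  have "of_int j * f' z \<noteq> of_int i * g' z"
  proof
    assume a: "of_int j * f' z = of_int i * g' z"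
    have "of_int j * D z = g z * (of_int j * f' z) - (of_int j * f z) * g' z" by (simp add: D_def algebra_simps)
    also have "\<dots> = 0" unfolding a eq by simp
    finally show False using ij(1) B(1)[OF z(1)] by simp
  qed
  then show ?thesis using ij(1) eq B(3)[OF z(1)] by blast
qed

text \<open>If g vanishes at z0 then f does not, and the two exchange roles. Replacing (p, q) by its
  negative makes the second combination positive.\<close>

lemma rational_critical_direction:
  fixes f g f' g' :: "real \<Rightarrow> real"
  assumes z0: "0 < z0" and d: "\<And>z. 0 < z \<Longrightarrow> (f has_real_derivative f' z) (at z)" "\<And>z. 0 < z \<Longrightarrow> (g has_real_derivative g' z) (at z)"
    and c: "continuous_on {0<..} f'" "continuous_on {0<..} g'"
    and ne: "(f z0)\<^sup>2 + (g z0)\<^sup>2 \<noteq> 0" and nd: "g z0 * f' z0 \<noteq> f z0 * g' z0"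
  obtains p q :: int and z where "0 < z" "(p, q) \<noteq> (0, 0)" "of_int p * f z + of_int q * g z = 0" "0 < of_int p * f' z + of_int q * g' z"
proof -
  have "\<exists>p q :: int. \<exists>z>0. (p, q) \<noteq> (0, 0) \<and> of_int p * f z + of_int q * g z = 0 \<and> of_int p * f' z + of_int q * g' z \<noteq> 0"
  proof (cases "g z0 = 0")
    case False
    from rational_critical_direction_aux[OF z0 d c False nd] obtain i j :: int and z
      where "0 < z" "j \<noteq> 0" "of_int j * f z = of_int i * g z" "of_int j * f' z \<noteq> of_int i * g' z" by blast
    then show ?thesis by (intro exI[of _ j] exI[of _ "- i"] exI[of _ z]) auto
  next
    case True
    then have "f z0 \<noteq> 0" "f z0 * g' z0 \<noteq> g z0 * f' z0" using ne nd by auto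
    from rational_critical_direction_aux[OF z0 d(2,1) c(2,1) this] obtain i j :: int and z
      where "0 < z" "j \<noteq> 0" "of_int j * g z = of_int i * f z" "of_int j * g' z \<noteq> of_int i * f' z" by blast
    then show ?thesis by (intro exI[of _ "- i"] exI[of _ j] exI[of _ z]) auto
  qed
  then obtain p q :: int and z where *: "0 < z" "(p, q) \<noteq> (0, 0)" "of_int p * f z + of_int q * g z = 0" "of_int p * f' z + of_int q * g' z \<noteq> 0"
    by blast
  show ?thesis
  proof (cases "0 < of_int p * f' z + of_int q * g' z")
    case True
    then show ?thesis using * that by blast
  next
    case False
    then show ?thesis using * by (intro that[of z "- p" "- q"]) auto
  qed
qed

lemma heat_profile_initial_derivs:
  assumes \<alpha>: "0 < \<alpha>" and hp: "heat_profile \<alpha> U0 Us us" and z: "0 < z"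
  shows "deriv Us z = deriv (us 0) z" "deriv (deriv Us) z = deriv (deriv (us 0)) z"
proof -
  have eq: "us 0 z = Us z" if "0 < z" for z using hp that by (simp add: heat_profile_def)
  have d: "deriv Us z = deriv (us 0) z" if z: "0 < z" for z
    by (rule DERIV_imp_deriv, rule DERIV_transform_pos[OF heat_profile_C2(1)[OF \<alpha> hp order_refl z] z]) (simp add: eq)
  show "deriv Us z = deriv (us 0) z" using d z by simp
  show "deriv (deriv Us) z = deriv (deriv (us 0)) z"
    by (rule DERIV_imp_deriv, rule DERIV_transform_pos[OF heat_profile_C2(2)[OF \<alpha> hp order_refl z] z]) (simp add: d)
qed

text \<open>The error has two sources: the Lipschitz variation of the curvature over the window, of
  size W, and its drift in time, of size T \<le> W. With W = n^(e - 1/4) the first is the source of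
  the threshold 1/4.\<close>

lemma algebraic_ill_posedness:
  fixes \<alpha> U0 V0 :: real and us vs :: "real \<Rightarrow> real \<Rightarrow> real"
  assumes \<alpha>: "0 < \<alpha>" and hu: "heat_profile \<alpha> U0 Us us" and hv: "heat_profile \<alpha> V0 Vs vs"
    and nd: "nondegenerate_layer Us Vs" and \<xi>: "\<xi> \<in> {fst, snd}"
  shows "\<exists>\<sigma>>0. \<forall>\<delta>>0. \<forall>m. \<forall>\<mu>\<in>{0..<1/4}. \<forall>\<rho> \<beta>. analytic_loss_rate \<alpha> us vs \<rho> \<longrightarrow>
         (\<forall>s t. 0 \<le> s \<longrightarrow> s \<le> t \<longrightarrow> \<rho> * (t - s) < \<beta> s t) \<longrightarrow>
         sup_op_norm \<alpha> us vs \<rho> \<beta> \<xi> \<sigma> \<delta> m (m - \<mu>) = \<infinity>"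
proof -
  let ?f = "deriv (us 0)" and ?g = "deriv (vs 0)" and ?f' = "deriv (deriv (us 0))" and ?g' = "deriv (deriv (vs 0))"
  obtain zz where zz: "0 < zz" "(?f zz)\<^sup>2 + (?g zz)\<^sup>2 \<noteq> 0" "?g zz * ?f' zz \<noteq> ?f zz * ?g' zz"
    using nd heat_profile_initial_derivs[OF \<alpha> hu] heat_profile_initial_derivs[OF \<alpha> hv]
    unfolding nondegenerate_layer_def by auto
  have cont2: "continuous_on {0<..} (deriv (deriv (w 0)))" if "heat_profile \<alpha> X Y w" for w X Y
  proof -
    have "continuous_on {0<..} (\<lambda>z. (\<lambda>(t, z). deriv (deriv (w t)) z) (0, z))"
      by (rule continuous_on_compose2[OF heat_profile_jointly_continuous(3)[OF \<alpha> that]]) (auto intro!: continuous_intros)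
    then show ?thesis by simp
  qed
  obtain p q :: int and z0 where z0: "0 < z0" and pq: "(p, q) \<noteq> (0, 0)"
    and crit: "of_int p * ?f z0 + of_int q * ?g z0 = 0" and curv: "0 < of_int p * ?f' z0 + of_int q * ?g' z0"
  proof -
    note crit = rational_critical_direction[OF zz(1) heat_profile_C2(2)[OF \<alpha> hu order_refl] heat_profile_C2(2)[OF \<alpha> hv order_refl]
          cont2[OF hu] cont2[OF hv] zz(2,3)]
    show thesis by (rule crit) (assumption | rule that)+
  qed
  define a where "a = (of_int p * ?f' z0 + of_int q * ?g' z0) / 2"
  have a: "0 < a" using curv by (simp add: a_def)
  define L where "L = \<bar>of_int p\<bar> + (\<bar>of_int q\<bar> :: real)"
  have L: "0 < L" using pq by (auto simp: L_def)
  \<comment> \<open>Depends only on the curvature a and on p, q, hence is fixed before \<delta>, m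
    and \<mu>.\<close>
  define \<sigma> where "\<sigma> = sqrt (a / 8) / sqrt L"
  have \<sigma>: "0 < \<sigma>" "\<sigma> * sqrt (\<bar>of_int p\<bar> + \<bar>of_int q\<bar>) \<le> sqrt (a / 8)"
    using a L by (auto simp: \<sigma>_def L_def[symmetric])
  obtain Cu du where Cu: "0 \<le> Cu" "0 < du" "\<And>r z. 0 \<le> r \<Longrightarrow> r < du \<Longrightarrow> 0 < z \<Longrightarrow>
    \<bar>deriv (us r) z - deriv (us 0) z\<bar> \<le> Cu * r \<and> \<bar>deriv (deriv (us r)) z - deriv (deriv (us 0)) z\<bar> \<le> Cu * r"
    by (rule heat_profile_rate_at_0[OF \<alpha> hu], rule that)
  obtain Cv dv where Cv: "0 \<le> Cv" "0 < dv" "\<And>r z. 0 \<le> r \<Longrightarrow> r < dv \<Longrightarrow> 0 < z \<Longrightarrow>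
    \<bar>deriv (vs r) z - deriv (vs 0) z\<bar> \<le> Cv * r \<and> \<bar>deriv (deriv (vs r)) z - deriv (deriv (vs 0)) z\<bar> \<le> Cv * r"
    by (rule heat_profile_rate_at_0[OF \<alpha> hv], rule that)
  obtain Mu where Mu: "0 \<le> Mu" "\<And>y z. 0 < y \<Longrightarrow> 0 < z \<Longrightarrow> \<bar>deriv (deriv (us 0)) z - deriv (deriv (us 0)) y\<bar> \<le> Mu * \<bar>z - y\<bar>"
    by (rule heat_profile_lipschitz[OF \<alpha> hu order_refl], rule that)
  obtain Mv where Mv: "0 \<le> Mv" "\<And>y z. 0 < y \<Longrightarrow> 0 < z \<Longrightarrow> \<bar>deriv (deriv (vs 0)) z - deriv (deriv (vs 0)) y\<bar> \<le> Mv * \<bar>z - y\<bar>"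
    by (rule heat_profile_lipschitz[OF \<alpha> hv order_refl], rule that)
  define C1 where "C1 = \<bar>of_int p\<bar> * Cu + \<bar>of_int q\<bar> * Cv"
  define C2 where "C2 = \<bar>of_int p\<bar> * Mu + \<bar>of_int q\<bar> * Mv"
  have C0: "0 \<le> C1" "0 \<le> C2" using Cu Cv Mu Mv by (auto simp: C1_def C2_def)
  let ?U1 = "combine p q (\<lambda>t. deriv (us t)) (\<lambda>t. deriv (vs t))"
  let ?U2 = "combine p q (\<lambda>t. deriv (deriv (us t))) (\<lambda>t. deriv (deriv (vs t)))"
  have lin: "\<bar>of_int p * x + of_int q * y\<bar> \<le> \<bar>of_int p\<bar> * X + \<bar>of_int q\<bar> * Y" if "\<bar>x\<bar> \<le> X" "\<bar>y\<bar> \<le> Y" for x y X Y :: real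
  proof -
    have "\<bar>of_int p * x + of_int q * y\<bar> \<le> \<bar>of_int p\<bar> * \<bar>x\<bar> + \<bar>of_int q\<bar> * \<bar>y\<bar>"
      using abs_triangle_ineq[of "of_int p * x" "of_int q * y"] by (simp add: abs_mult)
    also have "\<dots> \<le> \<bar>of_int p\<bar> * X + \<bar>of_int q\<bar> * Y" using that by (intro add_mono mult_left_mono) auto
    finally show ?thesis .
  qed
  have U1b: "\<bar>?U1 t z0\<bar> \<le> C1 * t" if "0 \<le> t" "t < du" "t < dv" for t
  proof -
    have "?U1 t z0 = of_int p * (deriv (us t) z0 - ?f z0) + of_int q * (deriv (vs t) z0 - ?g z0)"
      using crit by (simp add: combine_def algebra_simps)
    then show ?thesis
      using lin[of "deriv (us t) z0 - ?f z0" "Cu * t" "deriv (vs t) z0 - ?g z0" "Cv * t"] Cu(3)[of t z0] Cv(3)[of t z0] that z0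
      by (simp add: C1_def algebra_simps)
  qed
  have U2b: "\<bar>?U2 t z - 2 * a\<bar> \<le> C1 * t + C2 * \<bar>z - z0\<bar>" if "0 \<le> t" "t < du" "t < dv" "0 < z" for t z
  proof -
    have "?U2 t z - 2 * a = (of_int p * (deriv (deriv (us t)) z - ?f' z) + of_int q * (deriv (deriv (vs t)) z - ?g' z))
        + (of_int p * (?f' z - ?f' z0) + of_int q * (?g' z - ?g' z0))"
      by (simp add: combine_def a_def algebra_simps)
    moreover have "\<bar>of_int p * (deriv (deriv (us t)) z - ?f' z) + of_int q * (deriv (deriv (vs t)) z - ?g' z)\<bar> \<le> C1 * t"
      using lin[of "deriv (deriv (us t)) z - ?f' z" "Cu * t" "deriv (deriv (vs t)) z - ?g' z" "Cv * t"] Cu(3)[of t z] Cv(3)[of t z] that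
      by (simp add: C1_def algebra_simps)
    moreover have "\<bar>of_int p * (?f' z - ?f' z0) + of_int q * (?g' z - ?g' z0)\<bar> \<le> C2 * \<bar>z - z0\<bar>"
      using lin[of "?f' z - ?f' z0" "Mu * \<bar>z - z0\<bar>" "?g' z - ?g' z0" "Mv * \<bar>z - z0\<bar>"] Mu(2)[of z0 z] Mv(2)[of z0 z] that z0
      by (simp add: C2_def algebra_simps)
    ultimately show ?thesis by linarith
  qed
  show ?thesis
  proof (intro exI[of _ \<sigma>] conjI allI impI ballI \<sigma>(1))
    fix \<delta> m \<mu> \<rho> :: real and \<beta> :: "real \<Rightarrow> real \<Rightarrow> real"
    assume \<delta>: "0 < \<delta>" and \<mu>: "\<mu> \<in> {0..<1/4}" and loss: "analytic_loss_rate \<alpha> us vs \<rho>"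
      and \<beta>: "\<forall>s t. 0 \<le> s \<longrightarrow> s \<le> t \<longrightarrow> \<rho> * (t - s) < \<beta> s t"
    \<comment> \<open>Chosen so that \<mu> + 4 e < 1/4: the criterion asks n^(\<mu> + 3 e) times the
      error to vanish, and the error is of size n^(e - 1/4).\<close>
    define e where "e = (1/4 - \<mu>) / 8"
    have e: "0 < e" "e < 1/4" "\<mu> + 4 * e - 1/4 < 0" using \<mu> by (auto simp: e_def field_simps)
    define E where "E n = (C1 + C2) * real n powr (e - 1/4)" for n :: nat
    have nat: "filterlim real at_top sequentially" by (rule filterlim_real_sequentially)
    have neg: "(\<lambda>n. real n powr (- x)) \<longlonglongrightarrow> 0" if "0 < x" for x
      by (rule filterlim_compose[OF _ nat]) (use that in real_asymp)
    have W1: "\<forall>\<^sub>F n in sequentially. real n powr (- (1/4 - e)) < z0"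
      using neg[of "1/4 - e"] by (rule order_tendstoD) (use e z0 in auto)
    have T1: "\<forall>\<^sub>F n in sequentially. real n powr (- (1/2 - e)) < min du dv"
      using neg[of "1/2 - e"] by (rule order_tendstoD) (use e Cu Cv in auto)
    show "sup_op_norm \<alpha> us vs \<rho> \<beta> \<xi> \<sigma> \<delta> m (m - \<mu>) = \<infinity>"
    proof (rule ill_posedness_criterion[OF \<alpha> hu hv pq z0 a e(1,2) _ _ _ _ _ \<xi> \<sigma> \<delta> loss])
      show "0 \<le> E n" for n using C0 by (simp add: E_def)
      show "\<forall>\<^sub>F n in sequentially. \<forall>t z. 0 \<le> t \<longrightarrow> t \<le> real n powr (e - 1/2) \<longrightarrow>
       z \<in> {z0 - real n powr (e - 1/4)..z0 + real n powr (e - 1/4)} \<longrightarrow>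
       \<bar>?U2 t z - 2 * a\<bar> \<le> E n \<and> \<bar>?U1 t z0\<bar> \<le> real n powr (e - 1/4) * E n"
        using W1 T1 eventually_ge_at_top[of 1]
      proof eventually_elim
        case (elim n)
        define W where "W = real n powr (e - 1/4)"
        have n: "1 \<le> real n" using elim by simp
        \<comment> \<open>Up to the final time the curvature drifts by at most C1 W, and the slope
          at z0 by at most C1 W^2, which is W times the admissible error.\<close>
        have Tw: "real n powr (e - 1/2) \<le> W" "real n powr (e - 1/2) \<le> W * W"
          using n e unfolding W_def powr_add[symmetric] by (auto intro!: powr_mono)
        show ?case
        proof (intro allI impI)
          fix t z assume t: "0 \<le> t" "t \<le> real n powr (e - 1/2)" and z: "z \<in> {z0 - real n powr (e - 1/4)..z0 + real n powr (e - 1/4)}"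
          have zW: "\<bar>z - z0\<bar> \<le> W" "0 < z" using z elim by (auto simp: W_def)
          have td: "t < du" "t < dv" using t elim by auto
          have "C1 * t + C2 * \<bar>z - z0\<bar> \<le> C1 * W + C2 * W"
            using t Tw zW C0 by (intro add_mono mult_left_mono) auto
          then have 1: "\<bar>?U2 t z - 2 * a\<bar> \<le> E n" using U2b[OF t(1) td zW(2)] by (simp add: E_def W_def algebra_simps)
          have "C1 * t \<le> (C1 + C2) * (W * W)" using t Tw C0 by (intro mult_mono) auto
          then have "\<bar>?U1 t z0\<bar> \<le> W * E n" using U1b[OF t(1) td] by (simp add: E_def W_def mult_ac)
          then show "\<bar>?U2 t z - 2 * a\<bar> \<le> E n \<and> \<bar>?U1 t z0\<bar> \<le> real n powr (e - 1/4) * E n"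
            using 1 by (simp add: W_def)
        qed
      qed
      show "0 \<le> \<mu>" "m - (m - \<mu>) \<le> \<mu>" using \<mu> by auto
      have "(\<lambda>n. (C1 + C2) * real n powr (- (- (\<mu> + 4 * e - 1/4)))) \<longlonglongrightarrow> (C1 + C2) * 0"
        by (intro tendsto_mult_left neg) (use e in simp)
      moreover have "real n powr (\<mu> + 3 * e) * E n = (C1 + C2) * real n powr (- (- (\<mu> + 4 * e - 1/4)))" for n
        by (simp add: E_def powr_add[symmetric] algebra_simps)
      ultimately show "(\<lambda>n. real n powr (\<mu> + 3 * e) * E n) \<longlonglongrightarrow> 0" by simp
      show "\<rho> * (t - s) < \<beta> s t" if "0 \<le> s" "s \<le> t" for s t using \<beta> that by blast
    qed
  qed
qed

section \<open>Heat flows of prescribed profiles\<close>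

lemma weak_deriv_chain:
  assumes D: "\<And>k z. (D k has_real_derivative D (Suc k) z) (at z)"
  shows "weak_deriv k (D 0) (D k)"
proof -
  have cD: "continuous_on A (D k)" for A k
    by (rule continuous_at_imp_continuous_on, rule ballI, rule DERIV_isCont, rule D)
  have li: "locally_integrable (D k)" for k
    unfolding locally_integrable_def by (intro allI impI absolutely_integrable_continuous_real cD)
  have parts: "(LINT z:{0<..}|lebesgue. D j z * (deriv ^^ Suc l) \<phi> z) = - (LINT z:{0<..}|lebesgue. D (Suc j) z * (deriv ^^ l) \<phi> z)"
    if phi: "test_function \<phi>" for j l \<phi>
  proof -
    obtain a b where ab: "0 < a" "a < b" "\<And>k x. x \<notin> {a..b} \<Longrightarrow> (deriv ^^ k) \<phi> x = 0"
      by (rule test_function_support[OF phi], rule that)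
    define P where "P z = D j z * (deriv ^^ l) \<phi> z" for z
    define Q where "Q z = D j z * (deriv ^^ Suc l) \<phi> z + D (Suc j) z * (deriv ^^ l) \<phi> z" for z
    have dP: "(P has_real_derivative Q z) (at z)" for z
      unfolding P_def[abs_def] Q_def
      using DERIV_mult[OF D[of j z] smooth_fun_has_deriv[OF test_function_smooth[OF phi], of l z]] by (simp add: mult.commute add.commute)
    \<comment> \<open>The interval is enlarged so that the boundary values of \<open>P\<close> are
      taken outside the support of the test function.\<close>
    have "(LINT z:{0<..}|lebesgue. Q z) = (LINT z:{a/2..b+1}|lebesgue. Q z)"
      unfolding set_lebesgue_integral_def
    proof (rule Bochner_Integration.integral_cong)
      show "indicator {0<..} z *\<^sub>R Q z = indicator {a/2..b+1} z *\<^sub>R Q z" for z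
        using ab by (cases "z \<in> {a..b}") (auto simp: Q_def simp del: funpow.simps)
    qed simp
    also have "\<dots> = integral {a/2..b+1} Q"
    proof (rule set_lebesgue_integral_eq_integral(2), rule absolutely_integrable_continuous_real)
      show "continuous_on {a/2..b+1} Q"
        unfolding Q_def by (intro continuous_intros cD smooth_fun_cont[OF test_function_smooth[OF phi]])
    qed
    also have "\<dots> = P (b + 1) - P (a / 2)"
    proof (rule integral_unique, rule fundamental_theorem_of_calculus)
      show "(P has_vector_derivative Q x) (at x within {a/2..b+1})" for x
        using dP has_real_derivative_iff_has_vector_derivative has_vector_derivative_at_within by blast
    qed (use ab in auto)
    also have "\<dots> = 0" using ab by (simp add: P_def)
    finally have "(LINT z:{0<..}|lebesgue. Q z) = 0" .
    then show ?thesis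
      unfolding Q_def
      by (subst (asm) set_integral_add(2)[OF set_integrable_mult_test_function[OF li phi] set_integrable_mult_test_function[OF li phi]]) linarith
  qed
  have "(LINT z:{0<..}|lebesgue. D j z * (deriv ^^ (l + k)) \<phi> z) = (-1) ^ k * (LINT z:{0<..}|lebesgue. D (j + k) z * (deriv ^^ l) \<phi> z)"
    if "test_function \<phi>" for j l \<phi>
  proof (induction k arbitrary: j)
    case 0
    then show ?case by simp
  next
    case (Suc k)
    have "(LINT z:{0<..}|lebesgue. D j z * (deriv ^^ Suc (l + k)) \<phi> z) = - (LINT z:{0<..}|lebesgue. D (Suc j) z * (deriv ^^ (l + k)) \<phi> z)"
      by (rule parts[OF that])
    then show ?case using Suc[of "Suc j"] by simp
  qed
  from this[of _ 0 0] show ?thesis unfolding weak_deriv_def using li by simp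
qed

lemma L2_norm_le_of_exp_decay:
  fixes f :: "real \<Rightarrow> real"
  assumes f: "continuous_on {0<..} f" and b: "0 \<le> b" "\<And>z. 0 < z \<Longrightarrow> \<bar>f z\<bar> \<le> b * exp (- z)"
  shows "L2_norm f \<le> ennreal b"
proof -
  have m: "f \<in> borel_measurable (lebesgue_on {0<..})"
    by (rule continuous_imp_measurable_on_sets_lebesgue[OF f]) simp
  have "(\<integral>\<^sup>+ z. (ennreal (norm (f z)))\<^sup>2 \<partial>lebesgue_on {0<..}) = (\<integral>\<^sup>+ z. (ennreal (norm (f z)))\<^sup>2 * indicator {0<..} z \<partial>lebesgue)"
    by (rule nn_integral_restrict_space) simp
  also have "\<dots> \<le> (\<integral>\<^sup>+ z. ennreal (b\<^sup>2 * exp (- (2 * z))) * indicator {0..} z \<partial>lebesgue)"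
  proof (rule nn_integral_mono)
    show "(ennreal (norm (f z)))\<^sup>2 * indicator {0<..} z \<le> ennreal (b\<^sup>2 * exp (- (2 * z))) * indicator {0..} z" for z
    proof (cases "0 < z")
      case True
      have "(norm (f z))\<^sup>2 \<le> (b * exp (- z))\<^sup>2" using b(2)[OF True] by (intro power_mono) auto
      also have "\<dots> = b\<^sup>2 * exp (- (2 * z))" by (simp add: power_mult_distrib power2_eq_square flip: exp_add)
      finally show ?thesis using True by (simp add: ennreal_power)
    qed simp
  qed
  also have "\<dots> = (\<integral>\<^sup>+ z. ennreal (b\<^sup>2 * exp (- (2 * z))) * indicator {0..} z \<partial>lborel)"
    by (rule nn_integral_completion)
  also have "\<dots> = ennreal (0 - (- (b\<^sup>2 / 2) * exp (- (2 * 0))))"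
  proof (rule nn_integral_FTC_atLeast)
    show "((\<lambda>z. - (b\<^sup>2 / 2) * exp (- (2 * z))) has_real_derivative b\<^sup>2 * exp (- (2 * x))) (at x)" for x
      by (auto intro!: derivative_eq_intros)
    show "((\<lambda>z. - (b\<^sup>2 / 2) * exp (- (2 * z))) \<longlongrightarrow> 0) at_top" by real_asymp
  qed auto
  also have "\<dots> \<le> ennreal (b\<^sup>2)" by (intro ennreal_leI) simp
  finally have "L2_norm f \<le> ennsqrt (ennreal (b\<^sup>2))" unfolding L2_norm_def using m ennsqrt_mono by simp
  then show ?thesis using b by (simp add: ennsqrt_def)
qed

text \<open>Decay at rate \<alpha> + 1 beats the weight by exp(- z), which is both bounded and
  square integrable. As C depends on \<alpha> and m alone, the estimate also serves for differences
  and difference quotients in time, where B carries the smallness.\<close>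

lemma WH_norm_le_of_exp_decay:
  assumes \<alpha>: "0 \<le> \<alpha>"
  obtains C where "0 \<le> C" "\<And>h B. \<lbrakk>\<And>k z. (h k has_real_derivative h (Suc k) z) (at z); 0 \<le> B;
      \<And>k z. k \<le> m \<Longrightarrow> 0 < z \<Longrightarrow> \<bar>h k z\<bar> \<le> B * exp (- (\<alpha> + 1) * z)\<rbrakk> \<Longrightarrow> WH_norm \<alpha> m (h 0) \<le> ennreal (C * B)"
proof -
  define c where "c = (\<alpha> + 1) ^ m"
  define C where "C = c + sqrt (real m + 1) * c"
  have c: "0 \<le> c" using \<alpha> by (simp add: c_def)
  show ?thesis
  proof (rule that[of C])
    show "0 \<le> C" using c by (simp add: C_def)
    fix h B assume h: "\<And>k z. (h k has_real_derivative h (Suc k) z) (at z)" and B: "0 \<le> B"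
      and hb: "\<And>k z. k \<le> m \<Longrightarrow> 0 < z \<Longrightarrow> \<bar>h k z\<bar> \<le> B * exp (- (\<alpha> + 1) * z)"
    \<comment> \<open>By the product rule \<open>E k j\<close> is the k-th derivative of
      exp(\<alpha> z) \<open>h j\<close>. Each step of the recursion multiplies the bound by
      \<alpha> + 1.\<close>
    define E where "E = rec_nat (\<lambda>j z. exp (\<alpha> * z) * h j z) (\<lambda>_ e j z. \<alpha> * e j z + e (Suc j) z)"
    have E0: "E 0 j z = exp (\<alpha> * z) * h j z" and ES: "E (Suc k) j z = \<alpha> * E k j z + E k (Suc j) z" for j k z
      by (simp_all add: E_def)
    have dE: "(E k j has_real_derivative E (Suc k) j z) (at z)" for k j z
    proof (induction k arbitrary: j)
      case 0
      show ?case unfolding E0[abs_def] ES by (auto intro!: derivative_eq_intros h)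
    next
      case (Suc k)
      have "((\<lambda>z. \<alpha> * E k j z + E k (Suc j) z) has_real_derivative \<alpha> * E (Suc k) j z + E (Suc k) (Suc j) z) (at z)"
        by (intro DERIV_add DERIV_cmult Suc)
      moreover have "E (Suc k) j = (\<lambda>z. \<alpha> * E k j z + E k (Suc j) z)" by (rule ext, rule ES)
      ultimately show ?case by (simp only: ES[of "Suc k" j])
    qed
    have bE: "\<bar>E k j z\<bar> \<le> (\<alpha> + 1) ^ k * B * exp (- z)" if "k + j \<le> m" "0 < z" for k j z
      using that
    proof (induction k arbitrary: j)
      case 0
      have "\<bar>E 0 j z\<bar> = exp (\<alpha> * z) * \<bar>h j z\<bar>" by (simp add: E0 abs_mult)
      also have "\<dots> \<le> exp (\<alpha> * z) * (B * exp (- (\<alpha> + 1) * z))" using hb 0 by (intro mult_left_mono) auto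
      also have "\<dots> = B * exp (- z)" by (simp add: algebra_simps flip: exp_add)
      finally show ?case by simp
    next
      case (Suc k)
      have "\<bar>E (Suc k) j z\<bar> \<le> \<alpha> * \<bar>E k j z\<bar> + \<bar>E k (Suc j) z\<bar>"
        unfolding ES using abs_triangle_ineq[of "\<alpha> * E k j z"] \<alpha> by (simp add: abs_mult)
      also have "\<dots> \<le> \<alpha> * ((\<alpha> + 1) ^ k * B * exp (- z)) + (\<alpha> + 1) ^ k * B * exp (- z)"
        using Suc \<alpha> by (intro add_mono mult_left_mono) auto
      finally show ?case by (simp add: algebra_simps)
    qed
    define D where "D k = E k 0" for k
    have D0: "D 0 = weighted \<alpha> (h 0)" by (simp add: D_def E0[abs_def] weighted_def[abs_def])
    have Db: "\<bar>D k z\<bar> \<le> c * B * exp (- z)" if "k \<le> m" "0 < z" for k z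
    proof -
      have "(\<alpha> + 1) ^ k \<le> c" using \<alpha> that unfolding c_def by (intro power_increasing) auto
      then have "(\<alpha> + 1) ^ k * B * exp (- z) \<le> c * B * exp (- z)" using B by (intro mult_right_mono) auto
      with bE[of k 0 z] that show ?thesis by (simp add: D_def)
    qed
    have wD: "weak_deriv k (weighted \<alpha> (h 0)) (D k)" for k
      unfolding D0[symmetric] by (rule weak_deriv_chain) (simp add: D_def dE)
    have cD: "continuous_on A (D k)" for A k
      unfolding D_def by (rule continuous_at_imp_continuous_on, rule ballI, rule DERIV_isCont, rule dE)
    have mD: "D k \<in> borel_measurable (lebesgue_on {0<..})" for k
      by (rule continuous_imp_measurable_on_sets_lebesgue[OF cD]) simp
    have cB: "0 \<le> c * B" using c B by simp
    have "Winf_norm m (weighted \<alpha> (h 0)) \<le> (SUP k\<in>{..m}. esssup (lebesgue_on {0<..}) (\<lambda>z. ennreal \<bar>D k z\<bar>))"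
      unfolding Winf_norm_def by (rule INF_lower) (simp add: wD)
    also have "\<dots> \<le> ennreal (c * B)"
    proof (rule SUP_least, rule esssup_I)
      fix k assume k: "k \<in> {..m}"
      show "(\<lambda>z. ennreal \<bar>D k z\<bar>) \<in> borel_measurable (lebesgue_on {0<..})" using mD[of k] by measurable
      have "\<bar>D k z\<bar> \<le> c * B" if "0 < z" for z
      proof -
        have "c * B * exp (- z) \<le> c * B * 1" using that cB by (intro mult_left_mono) auto
        then show ?thesis using Db[of k z] k that by simp
      qed
      then show "AE z in lebesgue_on {0<..}. ennreal \<bar>D k z\<bar> \<le> ennreal (c * B)"
        by (intro AE_I2) (auto intro: ennreal_leI)
    qed
    finally have 1: "Winf_norm m (weighted \<alpha> (h 0)) \<le> ennreal (c * B)" .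
    have "H_norm m (weighted \<alpha> (h 0)) \<le> ennsqrt (\<Sum>k\<le>m. (L2_norm (D k))\<^sup>2)"
      unfolding H_norm_def by (rule INF_lower) (simp add: wD)
    also have "\<dots> \<le> ennsqrt (\<Sum>k\<le>m. (ennreal (c * B))\<^sup>2)"
      by (intro ennsqrt_mono sum_mono power_mono L2_norm_le_of_exp_decay cD cB Db) auto
    also have "(\<Sum>k\<le>m. (ennreal (c * B))\<^sup>2) = ennreal ((real m + 1) * (c * B)\<^sup>2)"
      using cB by (simp add: ennreal_power ennreal_mult ennreal_of_nat_eq_real_of_nat add.commute)
    also have "ennsqrt \<dots> = ennreal (sqrt (real m + 1) * (c * B))" using cB by (simp add: ennsqrt_def real_sqrt_mult)
    finally have "WH_norm \<alpha> m (h 0) \<le> ennreal (c * B) + ennreal (sqrt (real m + 1) * (c * B))"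
      unfolding WH_norm_def using 1 by (rule add_mono[rotated])
    also have "\<dots> = ennreal (c * B + sqrt (real m + 1) * (c * B))" by (rule ennreal_plus[symmetric]) (use cB in auto)
    also have "\<dots> = ennreal (C * B)" by (simp add: C_def algebra_simps)
    finally show "WH_norm \<alpha> m (h 0) \<le> ennreal (C * B)" .
  qed
qed

section \<open>Integrals against the standard Gaussian density\<close>

lemma integrable_std_normal_mult:
  assumes "f \<in> borel_measurable borel" "\<And>y. \<bar>f y\<bar> \<le> A + B * y\<^sup>2"
  shows "integrable lborel (\<lambda>y. std_normal_density y * f y)"
proof (rule Bochner_Integration.integrable_bound)
  show "integrable lborel (\<lambda>y. A * std_normal_density y + B * (std_normal_density y * y ^ 2))"
    by (intro Bochner_Integration.integrable_add integrable_mult_right integrable_std_normal_moment integrable_normal_density) simp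
  show "(\<lambda>y. std_normal_density y * f y) \<in> borel_measurable lborel" using assms(1) by simp
  have "\<bar>std_normal_density y * f y\<bar> \<le> \<bar>A * std_normal_density y + B * (std_normal_density y * y ^ 2)\<bar>" for y
  proof -
    have "\<bar>std_normal_density y * f y\<bar> \<le> std_normal_density y * (A + B * y\<^sup>2)"
      using assms(2)[of y] by (simp add: abs_mult mult_left_mono)
    then show ?thesis by (simp add: algebra_simps)
  qed
  then show "AE y in lborel. norm (std_normal_density y * f y) \<le> norm (A * std_normal_density y + B * (std_normal_density y * y ^ 2))"
    by simp
qed

text \<open>The total mass and the second moment of the Gaussian are both 1.\<close>

lemma std_normal_integral_abs_le:
  assumes f: "f \<in> borel_measurable borel" "\<And>y. \<bar>f y\<bar> \<le> A + B * y\<^sup>2"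
  shows "\<bar>\<integral>y. std_normal_density y * f y \<partial>lborel\<bar> \<le> A + B"
proof -
  have "\<bar>\<integral>y. std_normal_density y * f y \<partial>lborel\<bar> \<le> (\<integral>y. \<bar>std_normal_density y * f y\<bar> \<partial>lborel)"
    using integral_norm_bound[of lborel "\<lambda>y. std_normal_density y * f y"] by simp
  also have "\<dots> \<le> (\<integral>y. A * std_normal_density y + B * (std_normal_density y * y ^ 2) \<partial>lborel)"
  proof (rule integral_mono)
    show "integrable lborel (\<lambda>y. A * std_normal_density y + B * (std_normal_density y * y ^ 2))"
      by (intro Bochner_Integration.integrable_add integrable_mult_right integrable_std_normal_moment integrable_normal_density) simp
    show "integrable lborel (\<lambda>y. \<bar>std_normal_density y * f y\<bar>)"
      by (rule integrable_abs, rule integrable_std_normal_mult[OF f])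
    show "\<bar>std_normal_density y * f y\<bar> \<le> A * std_normal_density y + B * (std_normal_density y * y ^ 2)" for y
    proof -
      have "\<bar>std_normal_density y * f y\<bar> \<le> std_normal_density y * (A + B * y\<^sup>2)"
        using f(2)[of y] by (simp add: abs_mult mult_left_mono)
      then show ?thesis by (simp add: algebra_simps)
    qed
  qed
  also have "\<dots> = A * (\<integral>y. std_normal_density y \<partial>lborel) + B * (\<integral>y. std_normal_density y * y ^ 2 \<partial>lborel)"
    by (subst Bochner_Integration.integral_add) (auto intro!: integrable_mult_right integrable_std_normal_moment)
  also have "\<dots> = A + B" using integral_std_normal_moment_even[of 1] by (simp add: fact_numeral)
  finally show ?thesis .
qed

text \<open>Lets a Gaussian average be differentiated through the Taylor estimate of its integrand:
  the averaged remainder is still quadratic in h, and no limit is taken under the integral.\<close>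

lemma DERIV_of_quadratic_error:
  fixes f :: "real \<Rightarrow> real"
  assumes "\<And>h. \<bar>f (x + h) - f x - h * D\<bar> \<le> K * h\<^sup>2"
  shows "(f has_real_derivative D) (at x)"
proof -
  have "((\<lambda>h. (f (x + h) - f x) / h - D) \<longlongrightarrow> 0) (at 0)"
  proof (rule tendsto_rabs_zero_cancel, rule tendsto_sandwich[of "\<lambda>_. 0"])
    have "\<bar>(f (x + h) - f x) / h - D\<bar> \<le> K * \<bar>h\<bar>" if "h \<noteq> 0" for h
    proof -
      have "\<bar>(f (x + h) - f x) / h - D\<bar> = \<bar>f (x + h) - f x - h * D\<bar> / \<bar>h\<bar>"
        using that by (simp add: field_simps flip: abs_divide)
      also have "\<dots> \<le> K * h\<^sup>2 / \<bar>h\<bar>" using assms[of h] by (intro divide_right_mono) auto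
      also have "\<dots> = K * \<bar>h\<bar>" using that by (simp add: power2_eq_square abs_if)
      finally show ?thesis .
    qed
    then show "\<forall>\<^sub>F h in at 0. \<bar>(f (x + h) - f x) / h - D\<bar> \<le> K * \<bar>h\<bar>" by (simp add: eventually_at_filter)
    show "((\<lambda>h. K * \<bar>h\<bar>) \<longlongrightarrow> 0) (at 0)" by real_asymp
  qed auto
  then have "((\<lambda>h. (f (x + h) - f x) / h) \<longlongrightarrow> D) (at 0)" by (simp add: LIM_zero_iff)
  then show ?thesis by (simp add: DERIV_def)
qed

lemma integral_derivative_eq_0:
  fixes F :: "real \<Rightarrow> real"
  assumes F: "\<And>x. (F has_real_derivative f x) (at x)" and f: "continuous_on UNIV f" "integrable lborel f"
    and lim: "(F \<longlongrightarrow> 0) at_top" "(F \<longlongrightarrow> 0) at_bot"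
  shows "(\<integral>x. f x \<partial>lborel) = 0"
proof -
  have "(LBINT x=-\<infinity>..\<infinity>. f x) = 0 - 0"
  proof (rule interval_integral_FTC_integrable[where F = F])
    show "(F has_vector_derivative f x) (at x)" for x
      using F by (simp add: has_real_derivative_iff_has_vector_derivative)
    show "isCont f x" for x using f(1) by (simp add: continuous_on_eq_continuous_at)
    show "set_integrable lborel (einterval (- \<infinity>) \<infinity>) f" using f(2) by (simp add: set_integrable_def)
    show "((F \<circ> real_of_ereal) \<longlongrightarrow> 0) (at_right (- \<infinity>))" "((F \<circ> real_of_ereal) \<longlongrightarrow> 0) (at_left \<infinity>)"
      using lim by (simp_all add: ereal_tendsto_simps1)
  qed simp
  then show ?thesis by (simp add: interval_lebesgue_integral_def set_lebesgue_integral_def)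
qed

lemma std_normal_density_deriv: "(std_normal_density has_real_derivative - (y * std_normal_density y)) (at y)"
  unfolding std_normal_density_def[abs_def] by (auto intro!: derivative_eq_intros simp: field_simps)

lemma continuous_on_std_normal_density: "continuous_on A std_normal_density"
  unfolding std_normal_density_def[abs_def] by (intro continuous_intros) auto

lemma std_normal_density_tendsto_0: "(std_normal_density \<longlongrightarrow> 0) at_top" "(std_normal_density \<longlongrightarrow> 0) at_bot"
  unfolding std_normal_density_def[abs_def] by real_asymp+

text \<open>Stein's identity: y times the Gaussian density is minus its derivative. It trades the
  factor y, produced by differentiating in the scale, for one more space derivative.\<close>

lemma std_normal_integral_by_parts:
  fixes f f' :: "real \<Rightarrow> real"
  assumes d: "\<And>y. (f has_real_derivative f' y) (at y)" and c: "continuous_on UNIV f'"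
    and b: "\<And>y. \<bar>f y\<bar> \<le> A" "\<And>y. \<bar>f' y\<bar> \<le> B"
  shows "(\<integral>y. std_normal_density y * (y * f y) \<partial>lborel) = (\<integral>y. std_normal_density y * f' y \<partial>lborel)"
proof -
  let ?g = std_normal_density
  have cf: "continuous_on UNIV f"
    by (rule continuous_at_imp_continuous_on, rule ballI, rule DERIV_isCont, rule d)
  have yA: "\<bar>y * f y\<bar> \<le> A + A * y\<^sup>2" for y
  proof -
    have A0: "0 \<le> A" using b(1)[of 0] by linarith
    have "2 * \<bar>y\<bar> \<le> 1 + y\<^sup>2" using sum_squares_bound[of "\<bar>y\<bar>" 1] by simp
    then have "\<bar>y\<bar> * \<bar>f y\<bar> \<le> (1 + y\<^sup>2) * A" using b(1)[of y] by (intro mult_mono) auto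
    then show ?thesis by (simp add: abs_mult algebra_simps)
  qed
  have i1: "integrable lborel (\<lambda>y. ?g y * (y * f y))"
    by (rule integrable_std_normal_mult[OF _ yA]) (intro borel_measurable_continuous_onI continuous_intros cf)
  have i2: "integrable lborel (\<lambda>y. ?g y * f' y)"
    by (rule integrable_std_normal_mult[of _ B 0]) (use b c in \<open>auto intro: borel_measurable_continuous_onI\<close>)
  have "(\<integral>y. ?g y * f' y - ?g y * (y * f y) \<partial>lborel) = 0"
  proof (rule integral_derivative_eq_0)
    show "((\<lambda>y. ?g y * f y) has_real_derivative ?g y * f' y - ?g y * (y * f y)) (at y)" for y
      using DERIV_mult[OF std_normal_density_deriv d, of y] by (simp add: algebra_simps)
    show "continuous_on UNIV (\<lambda>y. ?g y * f' y - ?g y * (y * f y))"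
      by (intro continuous_intros continuous_on_std_normal_density cf c)
    show "integrable lborel (\<lambda>y. ?g y * f' y - ?g y * (y * f y))" using i1 i2 by simp
    have "((\<lambda>y. ?g y * f y) \<longlongrightarrow> 0) F" if "(?g \<longlongrightarrow> 0) F" for F
    proof (rule tendsto_rabs_zero_cancel, rule tendsto_sandwich[of "\<lambda>_. 0"])
      show "\<forall>\<^sub>F y in F. \<bar>?g y * f y\<bar> \<le> ?g y * A" by (simp add: abs_mult b mult_left_mono)
      show "((\<lambda>y. ?g y * A) \<longlongrightarrow> 0) F" using tendsto_mult_left_zero[OF that, of A] by simp
    qed auto
    then show "((\<lambda>y. ?g y * f y) \<longlongrightarrow> 0) at_top" "((\<lambda>y. ?g y * f y) \<longlongrightarrow> 0) at_bot"
      using std_normal_density_tendsto_0 by auto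
  qed
  then show ?thesis using i1 i2 by simp
qed

lemma tendsto_ennreal_of_abs_bound:
  assumes "\<And>r. 0 \<le> r \<Longrightarrow> r \<le> t + 1 \<Longrightarrow> r \<noteq> t \<Longrightarrow> F r \<le> ennreal (C * (\<bar>r - t\<bar> * B))"
  shows "(F \<longlongrightarrow> 0) (at t within {0..})"
proof (rule tendsto_sandwich[of "\<lambda>_. 0"])
  have "\<forall>\<^sub>F r in at t within {0..}. r < t + 1" by (rule order_tendstoD(2)[OF tendsto_ident_at]) simp
  moreover have "\<forall>\<^sub>F r in at t within {0..}. 0 \<le> r \<and> r \<noteq> t" by (simp add: eventually_at_filter)
  ultimately show "\<forall>\<^sub>F r in at t within {0..}. F r \<le> ennreal (C * (\<bar>r - t\<bar> * B))"
    by eventually_elim (simp add: assms)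
  have "((\<lambda>r. ennreal (C * (\<bar>r - t\<bar> * B))) \<longlongrightarrow> ennreal (C * (\<bar>t - t\<bar> * B))) (at t within {0..})"
    by (intro tendsto_ennrealI tendsto_intros)
  then show "((\<lambda>r. ennreal (C * (\<bar>r - t\<bar> * B))) \<longlongrightarrow> 0) (at t within {0..})" by simp
qed auto

text \<open>\<open>f k\<close> are the successive derivatives of one profile on the whole line. The
  vanishing is one-sided because the odd extension through the wall leaves a nonzero constant on the
  far left.\<close>

locale heat_chain =
  fixes f :: "nat \<Rightarrow> real \<Rightarrow> real" and M :: "nat \<Rightarrow> real" and c :: real
  assumes f_deriv: "\<And>k x. (f k has_real_derivative f (Suc k) x) (at x)"
    and f_bound: "\<And>k x. \<bar>f k x\<bar> \<le> M k"
    and f_support: "\<And>k x. c \<le> x \<Longrightarrow> f k x = 0"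
begin

text \<open>The mean of \<open>f k (z - s * Y)\<close> for a standard normal Y. With the density
  fixed and the scale in the argument, s = 0 is an ordinary point and derivatives in s fall on
  f.\<close>

definition avg :: "nat \<Rightarrow> real \<Rightarrow> real \<Rightarrow> real" where
  "avg k s z = (\<integral>y. std_normal_density y * f k (z - s * y) \<partial>lborel)"

lemma M_nonneg: "0 \<le> M k"
  using f_bound[of k 0] by linarith

lemma f_cont: "continuous_on A (f k)"
  by (rule continuous_at_imp_continuous_on, rule ballI, rule DERIV_isCont, rule f_deriv)

lemma f_measurable: "(\<lambda>y. f k (z - s * y)) \<in> borel_measurable borel"
  by (intro borel_measurable_continuous_onI continuous_on_compose2[OF f_cont[of UNIV]] continuous_intros) auto

lemma avg_integrable: "integrable lborel (\<lambda>y. std_normal_density y * f k (z - s * y))"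
  by (rule integrable_std_normal_mult[OF f_measurable, of _ _ _ "M k" 0]) (simp add: f_bound)

lemma f_lipschitz: "\<bar>f k x - f k y\<bar> \<le> M (Suc k) * \<bar>x - y\<bar>"
  using field_differentiable_bound[OF convex_UNIV has_field_derivative_at_within[OF f_deriv], of k "M (Suc k)" x y]
  by (simp add: f_bound)

lemma f_taylor: "\<bar>f k (x + h) - f k x - h * f (Suc k) x\<bar> \<le> M (k + 2) * h\<^sup>2"
proof -
  define p where "p r = f k (x + r) - r * f (Suc k) x" for r
  have dp: "(p has_real_derivative f (Suc k) (x + r) - f (Suc k) x) (at r)" for r
    unfolding p_def by (auto intro!: derivative_eq_intros DERIV_chain'[OF _ f_deriv])
  have "norm (p h - p 0) \<le> (M (k + 2) * \<bar>h\<bar>) * norm (h - 0)"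
  proof (rule field_differentiable_bound)
    show "(p has_field_derivative f (Suc k) (x + r) - f (Suc k) x) (at r within {- \<bar>h\<bar>..\<bar>h\<bar>})" for r
      by (rule has_field_derivative_at_within[OF dp])
    show "norm (f (Suc k) (x + r) - f (Suc k) x) \<le> M (k + 2) * \<bar>h\<bar>" if "r \<in> {- \<bar>h\<bar>..\<bar>h\<bar>}" for r
    proof -
      have "\<bar>f (Suc k) (x + r) - f (Suc k) x\<bar> \<le> M (k + 2) * \<bar>r\<bar>" using f_lipschitz[of "Suc k" "x + r" x] by simp
      also have "\<dots> \<le> M (k + 2) * \<bar>h\<bar>" using that by (intro mult_left_mono M_nonneg) auto
      finally show ?thesis by simp
    qed
  qed auto
  then show ?thesis by (simp add: p_def power2_eq_square mult.assoc)
qed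

lemma avg_deriv_space: "(avg k s has_real_derivative avg (Suc k) s z) (at z)"
proof (rule DERIV_of_quadratic_error)
  fix h
  have "avg k s (z + h) - avg k s z - h * avg (Suc k) s z =
     (\<integral>y. std_normal_density y * f k (z + h - s * y) - std_normal_density y * f k (z - s * y)
        - h * (std_normal_density y * f (Suc k) (z - s * y)) \<partial>lborel)"
    unfolding avg_def using avg_integrable by simp
  also have "\<dots> = (\<integral>y. std_normal_density y * (f k (z + h - s * y) - f k (z - s * y) - h * f (Suc k) (z - s * y)) \<partial>lborel)"
    by (simp add: algebra_simps)
  also have "\<bar>\<dots>\<bar> \<le> M (k + 2) * h\<^sup>2 + 0"
  proof (rule std_normal_integral_abs_le)
    show "\<bar>f k (z + h - s * y) - f k (z - s * y) - h * f (Suc k) (z - s * y)\<bar> \<le> M (k + 2) * h\<^sup>2 + 0 * y\<^sup>2" for y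
      using f_taylor[of k "z - s * y" h] by (simp add: algebra_simps)
  qed (intro borel_measurable_diff borel_measurable_times f_measurable borel_measurable_const)
  finally show "\<bar>avg k s (z + h) - avg k s z - h * avg (Suc k) s z\<bar> \<le> M (k + 2) * h\<^sup>2" by simp
qed

text \<open>Differentiation in s brings down - y f', and Stein's identity turns this into s times
  the mean of f''. With s = sqrt (2 t) and ds/dt = 1/s the result is the heat equation.\<close>

lemma avg_deriv_scale: "((\<lambda>s. avg k s z) has_real_derivative s * avg (k + 2) s z) (at s)"
proof (rule DERIV_of_quadratic_error)
  fix h
  have "(\<integral>y. std_normal_density y * (y * f (Suc k) (z - s * y)) \<partial>lborel) = (\<integral>y. std_normal_density y * (- s * f (k + 2) (z - s * y)) \<partial>lborel)"
  proof (rule std_normal_integral_by_parts)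
    show "((\<lambda>y. f (Suc k) (z - s * y)) has_real_derivative - s * f (k + 2) (z - s * y)) (at y)" for y
      by (rule DERIV_cong[OF DERIV_chain'[OF _ f_deriv]]) (auto intro!: derivative_eq_intros)
    show "continuous_on UNIV (\<lambda>y. - s * f (k + 2) (z - s * y))"
      by (intro continuous_intros continuous_on_compose2[OF f_cont[of UNIV]]) auto
    show "\<bar>f (Suc k) (z - s * y)\<bar> \<le> M (Suc k)" for y by (rule f_bound)
    show "\<bar>- s * f (k + 2) (z - s * y)\<bar> \<le> \<bar>s\<bar> * M (k + 2)" for y by (simp add: abs_mult mult_left_mono f_bound)
  qed
  then have parts: "s * avg (k + 2) s z = - (\<integral>y. std_normal_density y * (y * f (Suc k) (z - s * y)) \<partial>lborel)"
    unfolding avg_def by (simp add: mult.left_commute)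
  have i: "integrable lborel (\<lambda>y. std_normal_density y * (y * f (Suc k) (z - s * y)))"
  proof (rule integrable_std_normal_mult)
    show "(\<lambda>y. y * f (Suc k) (z - s * y)) \<in> borel_measurable borel"
      by (intro borel_measurable_times f_measurable) simp
    show "\<bar>y * f (Suc k) (z - s * y)\<bar> \<le> M (Suc k) + M (Suc k) * y\<^sup>2" for y
    proof -
      have "2 * \<bar>y\<bar> \<le> 1 + y\<^sup>2" using sum_squares_bound[of "\<bar>y\<bar>" 1] by simp
      then have "\<bar>y\<bar> * \<bar>f (Suc k) (z - s * y)\<bar> \<le> (1 + y\<^sup>2) * M (Suc k)"
        using f_bound[of "Suc k" "z - s * y"] by (intro mult_mono) auto
      then show ?thesis by (simp add: abs_mult algebra_simps)
    qed
  qed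
  have "avg k (s + h) z - avg k s z - h * (s * avg (k + 2) s z) =
     (\<integral>y. std_normal_density y * f k (z - (s + h) * y) - std_normal_density y * f k (z - s * y)
        + h * (std_normal_density y * (y * f (Suc k) (z - s * y))) \<partial>lborel)"
    unfolding parts unfolding avg_def using avg_integrable i by simp
  also have "\<dots> = (\<integral>y. std_normal_density y * (f k (z - (s + h) * y) - f k (z - s * y) + h * (y * f (Suc k) (z - s * y))) \<partial>lborel)"
    by (simp add: algebra_simps)
  also have "\<bar>\<dots>\<bar> \<le> 0 + M (k + 2) * h\<^sup>2"
  proof (rule std_normal_integral_abs_le)
    show "\<bar>f k (z - (s + h) * y) - f k (z - s * y) + h * (y * f (Suc k) (z - s * y))\<bar> \<le> 0 + M (k + 2) * h\<^sup>2 * y\<^sup>2" for y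
      using f_taylor[of k "z - s * y" "- (h * y)"] by (simp add: algebra_simps power_mult_distrib)
    show "(\<lambda>y. f k (z - (s + h) * y) - f k (z - s * y) + h * (y * f (Suc k) (z - s * y))) \<in> borel_measurable borel"
      by (intro borel_measurable_diff borel_measurable_add borel_measurable_times f_measurable borel_measurable_const) simp
  qed
  finally show "\<bar>avg k (s + h) z - avg k s z - h * (s * avg (k + 2) s z)\<bar> \<le> M (k + 2) * h\<^sup>2" by simp
qed

text \<open>An exponential Chebyshev bound: where f does not vanish z - s y < c, so the factor exp(b
  (c - z + s y)) is at least 1 and may be inserted. Completing the square turns the density into a
  shifted Gaussian of mass 1.\<close>

lemma avg_exp_decay:
  assumes b: "0 \<le> b"
  shows "\<bar>avg k s z\<bar> \<le> M k * exp (b * (c - z) + (b * s)\<^sup>2 / 2)"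
proof -
  have "\<bar>avg k s z\<bar> \<le> (\<integral>y. \<bar>std_normal_density y * f k (z - s * y)\<bar> \<partial>lborel)"
    unfolding avg_def using integral_norm_bound[of lborel "\<lambda>y. std_normal_density y * f k (z - s * y)"] by (simp only: real_norm_def)
  also have "\<dots> \<le> (\<integral>y. M k * exp (b * (c - z) + (b * s)\<^sup>2 / 2) * normal_density (b * s) 1 y \<partial>lborel)"
  proof (rule integral_mono)
    show "integrable lborel (\<lambda>y. \<bar>std_normal_density y * f k (z - s * y)\<bar>)" by (rule integrable_abs, rule avg_integrable)
    show "integrable lborel (\<lambda>y. M k * exp (b * (c - z) + (b * s)\<^sup>2 / 2) * normal_density (b * s) 1 y)"
      by (intro integrable_mult_right integrable_normal_density) simp
    show "\<bar>std_normal_density y * f k (z - s * y)\<bar> \<le> M k * exp (b * (c - z) + (b * s)\<^sup>2 / 2) * normal_density (b * s) 1 y" for y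
    proof -
      have "\<bar>f k (z - s * y)\<bar> \<le> M k * exp (b * (c - (z - s * y)))"
      proof (cases "c \<le> z - s * y")
        case True
        then show ?thesis using M_nonneg f_support by simp
      next
        case False
        then have "1 \<le> exp (b * (c - (z - s * y)))" using b by simp
        then have "M k * 1 \<le> M k * exp (b * (c - (z - s * y)))" by (intro mult_left_mono M_nonneg)
        with f_bound[of k "z - s * y"] show ?thesis by simp
      qed
      then have "\<bar>std_normal_density y * f k (z - s * y)\<bar> \<le> std_normal_density y * (M k * exp (b * (c - (z - s * y))))"
        by (simp add: abs_mult mult_left_mono)
      also have "\<dots> = M k * exp (b * (c - z) + (b * s)\<^sup>2 / 2) * normal_density (b * s) 1 y"
      proof -
        have "exp (- y\<^sup>2 / 2) * exp (b * (c - (z - s * y))) = exp (b * (c - z) + (b * s)\<^sup>2 / 2) * exp (- (y - b * s)\<^sup>2 / 2)"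
          unfolding exp_add[symmetric] by (rule arg_cong[of _ _ exp]) (simp add: power2_eq_square field_simps)
        then show ?thesis unfolding normal_density_def by simp
      qed
      finally show ?thesis .
    qed
  qed
  also have "\<dots> = M k * exp (b * (c - z) + (b * s)\<^sup>2 / 2)" by simp
  finally show ?thesis .
qed

text \<open>Only \<bar>s y\<bar> > 1/2 contributes, where y^2 \<ge> 1/(4 s^2). Half of the Gaussian
  exponent pays for the small factor; the other half remains as a normal density of variance 2, at
  the price of a constant below 2.\<close>

lemma avg_local_decay:
  assumes f0: "\<And>x. \<bar>x - z1\<bar> \<le> 1 \<Longrightarrow> f k x = 0" and z: "\<bar>z - z1\<bar> \<le> 1 / 2" and s: "0 < s"
  shows "\<bar>avg k s z\<bar> \<le> 2 * M k * exp (- (1 / (16 * s\<^sup>2)))"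
proof -
  let ?e = "exp (- (1 / (16 * s\<^sup>2)))"
  have "\<bar>avg k s z\<bar> \<le> (\<integral>y. \<bar>std_normal_density y * f k (z - s * y)\<bar> \<partial>lborel)"
    unfolding avg_def using integral_norm_bound[of lborel "\<lambda>y. std_normal_density y * f k (z - s * y)"] by (simp only: real_norm_def)
  also have "\<dots> \<le> (\<integral>y. 2 * M k * ?e * normal_density 0 (sqrt 2) y \<partial>lborel)"
  proof (rule integral_mono)
    show "integrable lborel (\<lambda>y. \<bar>std_normal_density y * f k (z - s * y)\<bar>)" by (rule integrable_abs, rule avg_integrable)
    show "integrable lborel (\<lambda>y. 2 * M k * ?e * normal_density 0 (sqrt 2) y)"
      by (intro integrable_mult_right integrable_normal_density) simp
    show "\<bar>std_normal_density y * f k (z - s * y)\<bar> \<le> 2 * M k * ?e * normal_density 0 (sqrt 2) y" for y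
    proof (cases "\<bar>s * y\<bar> \<le> 1 / 2")
      case True
      then have "\<bar>z - s * y - z1\<bar> \<le> 1" using z by linarith
      then show ?thesis using f0 M_nonneg by simp
    next
      case False
      then have "(1 / 2)\<^sup>2 \<le> \<bar>s * y\<bar>\<^sup>2" by (intro power_mono) auto
      then have "1 / (4 * s\<^sup>2) \<le> y\<^sup>2" using s by (simp add: power_mult_distrib power2_eq_square field_simps)
      then have "- y\<^sup>2 / 2 \<le> - (1 / (16 * s\<^sup>2)) - y\<^sup>2 / 4" by simp
      then have "exp (- y\<^sup>2 / 2) \<le> ?e * exp (- y\<^sup>2 / 4)" unfolding exp_add[symmetric] by simp
      moreover have "1 / sqrt (2 * pi) \<le> 2 / sqrt (2 * pi * 2)"
      proof -
        have "sqrt (2 * pi * 2) \<le> 2 * sqrt (2 * pi)" by (rule real_le_lsqrt) (simp_all add: power_mult_distrib)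
        then show ?thesis by (simp add: field_simps)
      qed
      ultimately have "1 / sqrt (2 * pi) * exp (- y\<^sup>2 / 2) \<le> 2 / sqrt (2 * pi * 2) * (?e * exp (- y\<^sup>2 / 4))"
        by (intro mult_mono) auto
      then have "std_normal_density y \<le> 2 / sqrt (2 * pi * 2) * (?e * exp (- y\<^sup>2 / 4))"
        by (simp add: normal_density_def)
      also have "\<dots> = 2 * ?e * normal_density 0 (sqrt 2) y" by (simp add: normal_density_def)
      finally have "std_normal_density y * \<bar>f k (z - s * y)\<bar> \<le> (2 * ?e * normal_density 0 (sqrt 2) y) * M k"
        by (intro mult_mono f_bound) auto
      then show ?thesis by (simp add: abs_mult mult_ac)
    qed
  qed
  also have "\<dots> = 2 * M k * ?e" by simp
  finally show ?thesis .
qed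

lemma avg_lipschitz: "\<bar>avg k s z - avg k s' z'\<bar> \<le> M (Suc k) * (\<bar>z - z'\<bar> + \<bar>s - s'\<bar>)"
proof -
  have "avg k s z - avg k s' z' = (\<integral>y. std_normal_density y * f k (z - s * y) - std_normal_density y * f k (z' - s' * y) \<partial>lborel)"
    unfolding avg_def using avg_integrable by simp
  also have "\<dots> = (\<integral>y. std_normal_density y * (f k (z - s * y) - f k (z' - s' * y)) \<partial>lborel)" by (simp add: algebra_simps)
  also have "\<bar>\<dots>\<bar> \<le> M (Suc k) * (\<bar>z - z'\<bar> + \<bar>s - s'\<bar> / 2) + M (Suc k) * \<bar>s - s'\<bar> / 2"
  proof (rule std_normal_integral_abs_le)
    show "\<bar>f k (z - s * y) - f k (z' - s' * y)\<bar> \<le> M (Suc k) * (\<bar>z - z'\<bar> + \<bar>s - s'\<bar> / 2) + M (Suc k) * \<bar>s - s'\<bar> / 2 * y\<^sup>2" for y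
    proof -
      have "2 * \<bar>y\<bar> \<le> 1 + y\<^sup>2" using sum_squares_bound[of "\<bar>y\<bar>" 1] by simp
      then have y: "\<bar>s - s'\<bar> * \<bar>y\<bar> \<le> \<bar>s - s'\<bar> * ((1 + y\<^sup>2) / 2)" by (intro mult_left_mono) auto
      have "\<bar>(z - s * y) - (z' - s' * y)\<bar> \<le> \<bar>z - z'\<bar> + \<bar>(s - s') * y\<bar>" by (simp add: algebra_simps)
      also have "\<dots> \<le> \<bar>z - z'\<bar> + \<bar>s - s'\<bar> * ((1 + y\<^sup>2) / 2)" using y by (simp add: abs_mult)
      finally have "M (Suc k) * \<bar>(z - s * y) - (z' - s' * y)\<bar> \<le> M (Suc k) * (\<bar>z - z'\<bar> + \<bar>s - s'\<bar> * ((1 + y\<^sup>2) / 2))"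
        by (intro mult_left_mono M_nonneg)
      with f_lipschitz[of k "z - s * y" "z' - s' * y"] show ?thesis by (simp add: field_simps)
    qed
  qed (intro borel_measurable_diff f_measurable)
  finally show ?thesis by (simp add: algebra_simps)
qed

lemma avg_continuous: "continuous_on UNIV (\<lambda>(s, z). avg k s z)"
proof (rule continuous_at_imp_continuous_on, rule ballI)
  fix p :: "real \<times> real"
  obtain s0 z0 where p: "p = (s0, z0)" by (cases p)
  have "((\<lambda>x. avg k (fst x) (snd x) - avg k s0 z0) \<longlongrightarrow> 0) (at p)"
  proof (rule tendsto_rabs_zero_cancel, rule tendsto_sandwich[of "\<lambda>_. 0"])
    show "\<forall>\<^sub>F x in at p. \<bar>avg k (fst x) (snd x) - avg k s0 z0\<bar> \<le> M (Suc k) * (\<bar>snd x - z0\<bar> + \<bar>fst x - s0\<bar>)"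
      by (simp add: avg_lipschitz)
    have "((\<lambda>x. M (Suc k) * (\<bar>snd x - z0\<bar> + \<bar>fst x - s0\<bar>)) \<longlongrightarrow> M (Suc k) * (\<bar>snd p - z0\<bar> + \<bar>fst p - s0\<bar>)) (at p)"
      by (intro tendsto_intros)
    then show "((\<lambda>x. M (Suc k) * (\<bar>snd x - z0\<bar> + \<bar>fst x - s0\<bar>)) \<longlongrightarrow> 0) (at p)" by (simp add: p)
  qed auto
  then show "isCont (\<lambda>(s, z). avg k s z) p" by (simp add: isCont_def LIM_zero_iff p case_prod_unfold)
qed

text \<open>sqrt (2 t) is the standard deviation of the heat kernel at time t for unit
  diffusivity.\<close>

definition flow :: "nat \<Rightarrow> real \<Rightarrow> real \<Rightarrow> real" where
  "flow k t z = avg k (sqrt (2 * t)) z"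

lemma flow_deriv_space: "(flow k t has_real_derivative flow (Suc k) t z) (at z)"
  unfolding flow_def[abs_def] by (rule avg_deriv_space)

lemma flow_0: "flow k 0 z = f k z"
  by (simp add: flow_def avg_def)

lemma flow_deriv_time:
  assumes "0 < t"
  shows "((\<lambda>t. flow k t z) has_real_derivative flow (k + 2) t z) (at t)"
proof -
  have "((\<lambda>t. sqrt (2 * t)) has_real_derivative inverse (sqrt (2 * t))) (at t)"
    using assms by (auto intro!: derivative_eq_intros)
  then show ?thesis
    unfolding flow_def by (rule DERIV_cong[OF DERIV_chain'[OF _ avg_deriv_scale]]) (use assms in simp)
qed

lemma flow_continuous: "continuous_on A (\<lambda>(t, z). flow k t z)"
proof -
  have "continuous_on A (\<lambda>p. (\<lambda>(s, z). avg k s z) (sqrt (2 * fst p), snd p))"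
    by (rule continuous_on_compose2[OF avg_continuous]) (auto intro!: continuous_intros)
  then show ?thesis by (simp add: flow_def case_prod_unfold)
qed

text \<open>The mean value theorem uses the time derivative only at interior points, so the heat
  equation for t > 0 gives rates down to t = 0. The location of the intermediate time allows a
  uniform decay bound.\<close>

lemma flow_mean_value:
  assumes "0 \<le> t" "0 \<le> r"
  obtains x where "0 \<le> x" "x \<le> max t r" "\<bar>x - t\<bar> \<le> \<bar>r - t\<bar>" "flow k r z - flow k t z = (r - t) * flow (k + 2) x z"
proof -
  have *: "\<exists>x. a < x \<and> x < b \<and> flow k b z - flow k a z = (b - a) * flow (k + 2) x z" if "0 \<le> a" "a < b" for a b
  proof -
    have "continuous_on {a..b} (\<lambda>t. flow k t z)"
      using continuous_on_compose2[OF flow_continuous[of UNIV k], of "{a..b}" "\<lambda>t. (t, z)"]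
      by (simp add: continuous_on_Pair)
    moreover have d: "((\<lambda>t. flow k t z) has_real_derivative flow (k + 2) x z) (at x)" if "a < x" for x
      by (rule flow_deriv_time) (use that \<open>0 \<le> a\<close> in simp)
    ultimately obtain l x where x: "a < x" "x < b" "((\<lambda>t. flow k t z) has_real_derivative l) (at x)"
        "flow k b z - flow k a z = (b - a) * l"
      using MVT[OF \<open>a < b\<close>, of "\<lambda>t. flow k t z"] real_differentiable_def by metis
    then have "l = flow (k + 2) x z" using d DERIV_unique by blast
    with x show ?thesis by blast
  qed
  show ?thesis
  proof (cases r t rule: linorder_cases)
    case less
    from *[OF assms(2) less] obtain x where "r < x" "x < t" "flow k t z - flow k r z = (t - r) * flow (k + 2) x z" by blast
    then show ?thesis using assms by (intro that[of x]) (auto simp: algebra_simps)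
  next
    case equal
    then show ?thesis using assms by (intro that[of t]) auto
  next
    case greater
    from *[OF assms(1) greater] obtain x where "t < x" "x < r" "flow k r z - flow k t z = (r - t) * flow (k + 2) x z" by blast
    then show ?thesis using assms by (intro that[of x]) auto
  qed
qed

section \<open>Decay and time regularity of the flow in the weighted norms\<close>

definition decay_const :: "real \<Rightarrow> nat \<Rightarrow> real \<Rightarrow> real" where
  "decay_const b n T = (\<Sum>j\<le>n. M j * exp (b * c + b\<^sup>2 * T))"

lemma decay_const_nonneg: "0 \<le> decay_const b n T"
  unfolding decay_const_def by (intro sum_nonneg mult_nonneg_nonneg M_nonneg) simp

lemma flow_decay:
  assumes "0 \<le> b" "0 \<le> t" "t \<le> T" "k \<le> n"
  shows "\<bar>flow k t z\<bar> \<le> decay_const b n T * exp (- b * z)"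
proof -
  have "\<bar>flow k t z\<bar> \<le> M k * exp (b * (c - z) + (b * sqrt (2 * t))\<^sup>2 / 2)"
    unfolding flow_def by (rule avg_exp_decay[OF assms(1)])
  also have "\<dots> \<le> M k * exp (b * (c - z) + b\<^sup>2 * T)"
    using assms by (intro mult_left_mono M_nonneg) (simp add: power_mult_distrib mult_left_mono)
  also have "\<dots> = M k * exp (b * c + b\<^sup>2 * T) * exp (- b * z)" by (simp add: algebra_simps flip: exp_add)
  also have "\<dots> \<le> decay_const b n T * exp (- b * z)"
  proof (rule mult_right_mono)
    show "M k * exp (b * c + b\<^sup>2 * T) \<le> decay_const b n T"
      unfolding decay_const_def by (rule member_le_sum) (use assms M_nonneg in auto)
  qed simp
  finally show ?thesis .
qed

lemma flow_C0:
  assumes \<alpha>: "0 < \<alpha>"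
  shows "C0_into (WH_norm \<alpha> m) (flow k)"
  unfolding C0_into_def
proof (intro allI impI conjI)
  fix t :: real assume t: "0 \<le> t"
  obtain C where C: "0 \<le> C" "\<And>h B. \<lbrakk>\<And>k z. (h k has_real_derivative h (Suc k) z) (at z); 0 \<le> B;
      \<And>k z. k \<le> m \<Longrightarrow> 0 < z \<Longrightarrow> \<bar>h k z\<bar> \<le> B * exp (- (\<alpha> + 1) * z)\<rbrakk> \<Longrightarrow> WH_norm \<alpha> m (h 0) \<le> ennreal (C * B)"
    by (rule WH_norm_le_of_exp_decay[of \<alpha> m]) (use \<alpha> in auto)
  have "WH_norm \<alpha> m ((\<lambda>j z. flow (k + j) t z) 0) \<le> ennreal (C * decay_const (\<alpha> + 1) (k + m) t)"
  proof (rule C(2))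
    show "(flow (k + j) t has_real_derivative flow (k + Suc j) t z) (at z)" for j z
      using flow_deriv_space[of "k + j"] by simp
    show "0 \<le> decay_const (\<alpha> + 1) (k + m) t" by (rule decay_const_nonneg)
    show "\<bar>flow (k + j) t z\<bar> \<le> decay_const (\<alpha> + 1) (k + m) t * exp (- (\<alpha> + 1) * z)" if "j \<le> m" for j z
      by (rule flow_decay) (use that t \<alpha> in auto)
  qed
  then show "WH_norm \<alpha> m (flow k t) < \<infinity>" by (simp add: le_less_trans[OF _ ennreal_less_top])
  show "((\<lambda>r. WH_norm \<alpha> m (\<lambda>z. flow k r z - flow k t z)) \<longlongrightarrow> 0) (at t within {0..})"
  proof (rule tendsto_ennreal_of_abs_bound)
    fix r assume r: "0 \<le> r" "r \<le> t + 1" "r \<noteq> t"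
    let ?B = "decay_const (\<alpha> + 1) (k + m + 2) (t + 1)"
    have "WH_norm \<alpha> m ((\<lambda>j z. flow (k + j) r z - flow (k + j) t z) 0) \<le> ennreal (C * (\<bar>r - t\<bar> * ?B))"
    proof (rule C(2))
      show "((\<lambda>z. flow (k + j) r z - flow (k + j) t z) has_real_derivative flow (k + Suc j) r z - flow (k + Suc j) t z) (at z)" for j z
        using flow_deriv_space[of "k + j"] by (auto intro: DERIV_diff)
      show "0 \<le> \<bar>r - t\<bar> * ?B" by (simp add: decay_const_nonneg)
      show "\<bar>flow (k + j) r z - flow (k + j) t z\<bar> \<le> \<bar>r - t\<bar> * ?B * exp (- (\<alpha> + 1) * z)" if "j \<le> m" for j z
      proof -
        obtain x where x: "0 \<le> x" "x \<le> max t r" "flow (k + j) r z - flow (k + j) t z = (r - t) * flow (k + j + 2) x z"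
          by (rule flow_mean_value[OF t r(1)], rule that)
        have "\<bar>flow (k + j + 2) x z\<bar> \<le> ?B * exp (- (\<alpha> + 1) * z)"
          by (rule flow_decay) (use x r t that \<alpha> in auto)
        then show ?thesis unfolding x(3) by (simp add: abs_mult mult_left_mono mult.assoc)
      qed
    qed
    then show "WH_norm \<alpha> m (\<lambda>z. flow k r z - flow k t z) \<le> ennreal (C * (\<bar>r - t\<bar> * ?B))" by simp
  qed
qed

text \<open>Two mean value steps: the difference quotient is \<open>flow (j + 2)\<close> at an
  intermediate time x, and its deviation from the value at t is x - t times a value of
  \<open>flow (j + 4)\<close>.\<close>

lemma flow_C1:
  assumes \<alpha>: "0 < \<alpha>"
  shows "C1_into (WH_norm \<alpha> m) (flow 0)"
  unfolding C1_into_def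
proof (intro conjI flow_C0[OF \<alpha>] exI[of _ "flow 2"] allI impI)
  fix t :: real assume t: "0 \<le> t"
  obtain C where C: "0 \<le> C" "\<And>h B. \<lbrakk>\<And>k z. (h k has_real_derivative h (Suc k) z) (at z); 0 \<le> B;
      \<And>k z. k \<le> m \<Longrightarrow> 0 < z \<Longrightarrow> \<bar>h k z\<bar> \<le> B * exp (- (\<alpha> + 1) * z)\<rbrakk> \<Longrightarrow> WH_norm \<alpha> m (h 0) \<le> ennreal (C * B)"
    by (rule WH_norm_le_of_exp_decay[of \<alpha> m]) (use \<alpha> in auto)
  show "((\<lambda>r. WH_norm \<alpha> m (\<lambda>z. (flow 0 r z - flow 0 t z) / (r - t) - flow 2 t z)) \<longlongrightarrow> 0) (at t within {0..})"
  proof (rule tendsto_ennreal_of_abs_bound)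
    fix r assume r: "0 \<le> r" "r \<le> t + 1" "r \<noteq> t"
    let ?B = "decay_const (\<alpha> + 1) (m + 4) (t + 1)"
    have "WH_norm \<alpha> m ((\<lambda>j z. (flow j r z - flow j t z) / (r - t) - flow (j + 2) t z) 0) \<le> ennreal (C * (\<bar>r - t\<bar> * ?B))"
    proof (rule C(2))
      show "((\<lambda>z. (flow j r z - flow j t z) / (r - t) - flow (j + 2) t z) has_real_derivative
          (flow (Suc j) r z - flow (Suc j) t z) / (r - t) - flow (Suc j + 2) t z) (at z)" for j z
        using flow_deriv_space[of j] flow_deriv_space[of "j + 2"] by (auto intro!: DERIV_diff DERIV_cdivide)
      show "0 \<le> \<bar>r - t\<bar> * ?B" by (simp add: decay_const_nonneg)
      show "\<bar>(flow j r z - flow j t z) / (r - t) - flow (j + 2) t z\<bar> \<le> \<bar>r - t\<bar> * ?B * exp (- (\<alpha> + 1) * z)" if j: "j \<le> m" for j z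
      proof -
        obtain x where x: "0 \<le> x" "x \<le> max t r" "\<bar>x - t\<bar> \<le> \<bar>r - t\<bar>" "flow j r z - flow j t z = (r - t) * flow (j + 2) x z"
          by (rule flow_mean_value[OF t r(1)], rule that)
        obtain y where y: "0 \<le> y" "y \<le> max t x" "flow (j + 2) x z - flow (j + 2) t z = (x - t) * flow (j + 2 + 2) y z"
          by (rule flow_mean_value[OF t x(1)], rule that)
        have b: "\<bar>flow (j + 2 + 2) y z\<bar> \<le> ?B * exp (- (\<alpha> + 1) * z)"
          by (rule flow_decay) (use x y r t j \<alpha> in auto)
        have "(flow j r z - flow j t z) / (r - t) - flow (j + 2) t z = (x - t) * flow (j + 2 + 2) y z"
          unfolding x(4) using r(3) y(3) by simp
        then have "\<bar>(flow j r z - flow j t z) / (r - t) - flow (j + 2) t z\<bar> \<le> \<bar>r - t\<bar> * (?B * exp (- (\<alpha> + 1) * z))"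
          using mult_mono[OF x(3) b] by (simp add: abs_mult)
        then show ?thesis by (simp add: mult.assoc)
      qed
    qed
    then show "WH_norm \<alpha> m (\<lambda>z. (flow 0 r z - flow 0 t z) / (r - t) - flow 2 t z) \<le> ennreal (C * (\<bar>r - t\<bar> * ?B))"
      by (simp add: numeral_2_eq_2)
  qed
qed

text \<open>The drift is the elapsed time multiplied by a value of \<open>flow (k + 2)\<close>.
  Since \<open>f (k + 2)\<close> vanishes near z1, that value feels only distant data and is
  exponentially small; the constant 32 is the 16 of \<open>avg_local_decay\<close> at the scale sqrt
  (2 x).\<close>

lemma flow_local_drift:
  assumes f0: "\<And>x. \<bar>x - z1\<bar> \<le> 1 \<Longrightarrow> f (k + 2) x = 0" and z: "\<bar>z - z1\<bar> \<le> 1 / 2" and t: "0 \<le> t" "t \<le> T" "0 < T"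
  shows "\<bar>flow k t z - f k z\<bar> \<le> T * (2 * M (k + 2) * exp (- (1 / (32 * T))))"
proof -
  obtain x where x: "0 \<le> x" "x \<le> max 0 t" "flow k t z - flow k 0 z = (t - 0) * flow (k + 2) x z"
    by (rule flow_mean_value[of 0 t k z]) (use t that in auto)
  have "\<bar>flow (k + 2) x z\<bar> \<le> 2 * M (k + 2) * exp (- (1 / (32 * T)))"
  proof (cases "x = 0")
    case True
    then show ?thesis using f0[of z] z M_nonneg by (simp add: flow_0)
  next
    case False
    then have x0: "0 < x" "x \<le> T" using x t by auto
    have "\<bar>flow (k + 2) x z\<bar> \<le> 2 * M (k + 2) * exp (- (1 / (16 * (sqrt (2 * x))\<^sup>2)))"
      unfolding flow_def by (rule avg_local_decay[OF f0 z]) (use x0 in auto)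
    also have "\<dots> = 2 * M (k + 2) * exp (- (1 / (32 * x)))" using x0 by simp
    also have "\<dots> \<le> 2 * M (k + 2) * exp (- (1 / (32 * T)))"
    proof -
      have "1 / (32 * T) \<le> 1 / (32 * x)" using x0 by (intro divide_left_mono) auto
      then show ?thesis by (intro mult_left_mono) (auto simp: M_nonneg)
    qed
    finally show ?thesis .
  qed
  moreover have "\<bar>flow k t z - f k z\<bar> = t * \<bar>flow (k + 2) x z\<bar>" using x(3) t by (simp add: flow_0 abs_mult)
  ultimately show ?thesis using t M_nonneg by (simp add: mult_mono)
qed

text \<open>\<open>U + f 0\<close> is odd, and an even kernel averages an odd function to 0 at the
  origin; this is the no-slip condition.\<close>

lemma flow_at_wall:
  assumes odd: "\<And>x. f 0 (- x) + f 0 x = - 2 * U"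
  shows "flow 0 t 0 = - U"
proof -
  let ?s = "sqrt (2 * t)" and ?g = std_normal_density
  have i: "integrable lborel (\<lambda>y. ?g y * f 0 (- (?s * y)))" "integrable lborel (\<lambda>y. ?g y * f 0 (?s * y))"
    using avg_integrable[of 0 0 ?s] avg_integrable[of 0 0 "- ?s"] by simp_all
  have "flow 0 t 0 = (\<integral>y. ?g y * f 0 (- (?s * y)) \<partial>lborel)" by (simp add: flow_def avg_def)
  also have "\<dots> = (\<integral>y. ?g y * f 0 (?s * y) \<partial>lborel)"
    by (subst lborel_integral_real_affine[where c = "- 1" and t = 0]) (simp_all add: normal_density_def)
  finally have "2 * flow 0 t 0 = (\<integral>y. ?g y * f 0 (- (?s * y)) \<partial>lborel) + (\<integral>y. ?g y * f 0 (?s * y) \<partial>lborel)"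
    by (simp add: flow_def avg_def)
  also have "\<dots> = (\<integral>y. ?g y * f 0 (- (?s * y)) + ?g y * f 0 (?s * y) \<partial>lborel)" using i by simp
  also have "\<dots> = (\<integral>y. ?g y * (- 2 * U) \<partial>lborel)" by (simp only: odd flip: distrib_left)
  also have "\<dots> = - 2 * U" by simp
  finally show ?thesis by simp
qed

lemma flow_heat_profile:
  assumes \<alpha>: "0 < \<alpha>" and odd: "\<And>x. f 0 (- x) + f 0 x = - 2 * U"
  shows "heat_profile \<alpha> U (\<lambda>z. U + f 0 z) (\<lambda>t z. U + flow 0 t z)"
proof -
  have d: "((\<lambda>z. U + flow 0 t z) has_real_derivative flow 1 t z) (at z)" for t z
    using flow_deriv_space[of 0 t z] by (auto intro!: derivative_eq_intros)
  then have d1: "deriv (\<lambda>z. U + flow 0 t z) = flow 1 t" for t by (intro ext DERIV_imp_deriv)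
  have d2: "deriv (flow 1 t) = flow 2 t" for t
    using flow_deriv_space[of 1 t] by (intro ext DERIV_imp_deriv) (simp add: numeral_2_eq_2)
  have "((\<lambda>z. U + flow 0 t z) \<longlongrightarrow> U) at_top" if "0 \<le> t" for t
  proof -
    have "((\<lambda>z. flow 0 t z) \<longlongrightarrow> 0) at_top"
    proof (rule tendsto_rabs_zero_cancel, rule tendsto_sandwich[of "\<lambda>_. 0"])
      show "\<forall>\<^sub>F z in at_top. \<bar>flow 0 t z\<bar> \<le> decay_const 1 0 t * exp (- 1 * z)"
        by (intro always_eventually allI flow_decay) (use that in auto)
      have "((\<lambda>z::real. exp (- 1 * z)) \<longlongrightarrow> 0) at_top" by real_asymp
      then show "((\<lambda>z. decay_const 1 0 t * exp (- 1 * z)) \<longlongrightarrow> 0) at_top" by (rule tendsto_mult_right_zero)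
    qed auto
    from tendsto_add[OF tendsto_const[of U] this] show ?thesis by simp
  qed
  moreover have "continuous_on ({0..} \<times> {0..}) (\<lambda>(t, z). U + flow 0 t z)"
    using continuous_on_add[OF continuous_on_const[of _ U] flow_continuous[of "{0..} \<times> {0..}" 0]] by (simp add: case_prod_unfold)
  moreover have "(\<lambda>z. U + flow 0 t z) differentiable (at z)" "flow 1 t differentiable (at z)"
    "0 < t \<Longrightarrow> ((\<lambda>r. U + flow 0 r z) has_real_derivative flow 2 t z) (at t)" for t z
    using d flow_deriv_space[of 1] flow_deriv_time[of t 0 z] real_differentiable_def
    by (blast, blast, auto intro!: derivative_eq_intros simp: numeral_2_eq_2)
  moreover have "(\<lambda>t z. U + flow 0 t z - U) = flow 0" by simp
  ultimately show ?thesis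
    unfolding heat_profile_def d1 d2 using flow_C0[OF \<alpha>] flow_C1[OF \<alpha>] flow_at_wall[OF odd] by (simp add: flow_0)
qed

end

section \<open>Ill-posedness for a locally quadratic shear layer\<close>

text \<open>A half-line profile that vanishes near the wall, is quadratic around 2 and reaches its
  limit at a finite height is extended to an odd function. As the profile vanishes on the negative
  axis, the reflection does not touch the neighbourhood of 2.\<close>

lemma quadratic_shear_exists:
  fixes A B U :: real
  obtains f M where "heat_chain f M 5" "\<And>x. f 0 (- x) + f 0 x = - 2 * U"
    "\<And>x. \<bar>x - 2\<bar> \<le> 1 \<Longrightarrow> f 1 x = 2 * A * (x - 2) + B" "\<And>x. \<bar>x - 2\<bar> \<le> 1 \<Longrightarrow> f 2 x = 2 * A"
    "\<And>k x. 3 \<le> k \<Longrightarrow> \<bar>x - 2\<bar> \<le> 1 \<Longrightarrow> f k x = 0"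
proof -
  obtain S :: "real \<Rightarrow> real" where S: "smooth_fun S" "\<And>x. x \<le> 0 \<Longrightarrow> S x = 0" "\<And>x. 1 \<le> x \<Longrightarrow> S x = 1"
    using smooth_step_exists by blast
  define q where "q k x = (if k = 0 then A * (x - 2)\<^sup>2 + B * (x - 2) else if k = 1 then 2 * A * (x - 2) + B
      else if k = 2 then 2 * A else 0)" for k :: nat and x :: real
  have dq: "(q k has_real_derivative q (Suc k) x) (at x)" for k x
  proof -
    consider "k = 0" | "k = 1" | "k = 2" | "3 \<le> k" by linarith
    then show ?thesis unfolding q_def[abs_def] by cases (auto intro!: derivative_eq_intros)
  qed
  have sq: "smooth_fun (q 0)" by (rule smooth_fun_chain[of q, OF refl dq])
  \<comment> \<open>The first step switches the quadratic on over [1/2, 3/4], the second replaces it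
    by U over [7/2, 4].\<close>
  define P where "P x = S (4 * x + - 2) * q 0 x + S (2 * x + - 7) * (U - q 0 x)" for x
  have sP: "smooth_fun P" unfolding P_def[abs_def]
    by (intro smooth_fun_add smooth_fun_mult smooth_fun_diff smooth_fun_affine[OF S(1)] sq smooth_fun_const)
  have P0: "P x = 0" if "x \<le> 1 / 2" for x using that by (simp add: P_def S)
  have P1: "P x = U" if "4 \<le> x" for x using that by (simp add: P_def S)
  have Pq: "P x = q 0 x" if "3 / 4 < x" "x < 7 / 2" for x using that by (simp add: P_def S)
  define F where "F x = P x - P ((- 1) * x + 0) - U" for x
  have sF: "smooth_fun F" unfolding F_def[abs_def]
    by (intro smooth_fun_diff smooth_fun_affine[OF sP] sP smooth_fun_const)
  define f where "f k = (deriv ^^ k) F" for k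
  have df: "(f k has_real_derivative f (Suc k) x) (at x)" for k x
    unfolding f_def by (rule smooth_fun_has_deriv[OF sF])
  have far: "f k x = 0" if "5 \<le> x" for k x
  proof (cases "k = 0")
    case True
    then show ?thesis using that P1[of x] P0[of "- x"] by (simp add: f_def F_def)
  next
    case False
    show ?thesis unfolding f_def
      by (rule deriv_iter_eq_0[of "{4<..}" _ 0]) (use that False P1 P0 in \<open>auto simp: F_def\<close>)
  qed
  have far': "f k x = (if k = 0 then - 2 * U else 0)" if "x \<le> - 5" for k x
  proof (cases "k = 0")
    case True
    then show ?thesis using that P1[of "- x"] P0[of x] by (simp add: f_def F_def)
  next
    case False
    then have "f k x = 0" unfolding f_def
      by (intro deriv_iter_eq_0[of "{..<- 4}" _ "- 2 * U"]) (use that P1 P0 in \<open>auto simp: F_def\<close>)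
    then show ?thesis using False by simp
  qed
  have "\<exists>M. \<forall>x. \<bar>f k x\<bar> \<le> M" for k
  proof -
    have c: "continuous_on {-5..5} (f k)"
      by (rule continuous_at_imp_continuous_on, rule ballI, rule DERIV_isCont, rule df)
    have "compact (f k ` {-5..5})" by (rule compact_continuous_image[OF c]) simp
    then obtain M where M: "\<And>x. x \<in> {-5..5} \<Longrightarrow> \<bar>f k x\<bar> \<le> M"
      using compact_imp_bounded bounded_iff by (metis imageI real_norm_def)
    have "\<bar>f k x\<bar> \<le> \<bar>M\<bar> + 2 * \<bar>U\<bar>" for x
    proof -
      consider "x \<le> - 5" | "x \<in> {-5..5}" | "5 \<le> x" by fastforce
      then show ?thesis
      proof cases
        case 1
        then show ?thesis using far'[of x k] by (auto simp: abs_mult)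
      next
        case 2
        then show ?thesis using M[of x] by linarith
      next
        case 3
        then show ?thesis using far[of x k] by simp
      qed
    qed
    then show ?thesis by blast
  qed
  then obtain M where M: "\<And>k x. \<bar>f k x\<bar> \<le> M k" by metis
  have near: "f (Suc k) x = q (Suc k) x" if "x \<in> {3/4<..<7/2}" for k x
    using that
  proof (induction k arbitrary: x)
    case 0
    have "(F has_real_derivative q (Suc 0) x) (at x)"
    proof (rule has_field_derivative_transform_within_open[of "\<lambda>x. q 0 x - U" _ _ "{3/4<..<7/2}"])
      show "((\<lambda>x. q 0 x - U) has_real_derivative q (Suc 0) x) (at x)"
        using DERIV_diff[OF dq[of 0 x] DERIV_const[of U]] by simp
      show "q 0 y - U = F y" if "y \<in> {3/4<..<7/2}" for y
        using that Pq[of y] P0[of "- y"] by (simp add: F_def)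
    qed (use 0 in auto)
    then show ?case by (simp add: f_def DERIV_imp_deriv)
  next
    case (Suc k)
    have "(f (Suc k) has_real_derivative q (Suc (Suc k)) x) (at x)"
      by (rule has_field_derivative_transform_within_open[OF dq[of "Suc k" x], of "{3/4<..<7/2}"]) (use Suc in auto)
    then show ?case using df[of "Suc k" x] DERIV_unique by blast
  qed
  have near': "f k x = q k x" if "0 < k" "\<bar>x - 2\<bar> \<le> 1" for k x
    using near[of x "k - 1"] that by (auto simp: abs_le_iff)
  show ?thesis
  proof (rule that[of f M])
    show "heat_chain f M 5" by unfold_locales (use df M far in auto)
    show "f 0 (- x) + f 0 x = - 2 * U" for x by (simp add: f_def F_def)
    show "f 1 x = 2 * A * (x - 2) + B" "f 2 x = 2 * A" if "\<bar>x - 2\<bar> \<le> 1" for x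
      using near'[of 1 x] near'[of 2 x] that by (simp_all add: q_def)
    show "f k x = 0" if "3 \<le> k" "\<bar>x - 2\<bar> \<le> 1" for k x using near'[of k x] that by (simp add: q_def)
  qed
qed

text \<open>The first component is (z - 2)^2 near 2, up to a constant, so (p, q) = (1, 0) and a = 1;
  the second is linear there with slope 1, which gives nondegeneracy. With e = 1/8 the time scale is
  T = n^(-3/8), and the drift exp(- 1/(32 T)) decays faster than any power of n.\<close>

lemma superalgebraic_ill_posedness:
  fixes \<alpha> U0 V0 :: real
  assumes \<alpha>: "0 < \<alpha>" and \<xi>: "\<xi> \<in> {fst, snd}"
  shows "\<exists>Us Vs us vs. shear_flow \<alpha> U0 V0 Us Vs us vs \<and> nondegenerate_layer Us Vs \<and>
     (\<exists>\<sigma>>0. \<forall>\<delta>>0. \<forall>m1 m2. \<forall>\<rho> \<beta>. analytic_loss_rate \<alpha> us vs \<rho> \<longrightarrow>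
         (\<forall>s t. 0 \<le> s \<longrightarrow> s \<le> t \<longrightarrow> \<rho> * (t - s) < \<beta> s t) \<longrightarrow>
         sup_op_norm \<alpha> us vs \<rho> \<beta> \<xi> \<sigma> \<delta> m1 m2 = \<infinity>)"
proof -
  obtain f M where "heat_chain f M 5" and f: "\<And>x. f 0 (- x) + f 0 x = - 2 * U0"
    "\<And>x. \<bar>x - 2\<bar> \<le> 1 \<Longrightarrow> f 1 x = 2 * 1 * (x - 2) + 0" "\<And>x. \<bar>x - 2\<bar> \<le> 1 \<Longrightarrow> f 2 x = 2 * 1"
    "\<And>k x. 3 \<le> k \<Longrightarrow> \<bar>x - 2\<bar> \<le> 1 \<Longrightarrow> f k x = 0"
    by (rule quadratic_shear_exists[of U0 1 0], rule that)
  then interpret u: heat_chain f M 5 by simp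
  obtain g N where "heat_chain g N 5" and g: "\<And>x. g 0 (- x) + g 0 x = - 2 * V0"
    "\<And>x. \<bar>x - 2\<bar> \<le> 1 \<Longrightarrow> g 1 x = 2 * 0 * (x - 2) + 1" "\<And>x. \<bar>x - 2\<bar> \<le> 1 \<Longrightarrow> g 2 x = 2 * 0"
    "\<And>k x. 3 \<le> k \<Longrightarrow> \<bar>x - 2\<bar> \<le> 1 \<Longrightarrow> g k x = 0"
    by (rule quadratic_shear_exists[of V0 0 1], rule that)
  then interpret v: heat_chain g N 5 by simp
  let ?us = "\<lambda>t z. U0 + u.flow 0 t z" and ?vs = "\<lambda>t z. V0 + v.flow 0 t z"
  note hu = u.flow_heat_profile[OF \<alpha> f(1)] and hv = v.flow_heat_profile[OF \<alpha> g(1)]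
  have dU: "deriv (\<lambda>z. U0 + f 0 z) = f 1" "deriv (f 1) = f 2" and dV: "deriv (\<lambda>z. V0 + g 0 z) = g 1" "deriv (g 1) = g 2"
    using u.f_deriv[of 0] u.f_deriv[of 1] v.f_deriv[of 0] v.f_deriv[of 1]
    by (auto intro!: ext DERIV_imp_deriv derivative_eq_intros simp: numeral_2_eq_2)
  have nd: "nondegenerate_layer (\<lambda>z. U0 + f 0 z) (\<lambda>z. V0 + g 0 z)"
    unfolding nondegenerate_layer_def dU dV by (rule exI[of _ 2]) (use f(2)[of 2] f(3)[of 2] g(2)[of 2] g(3)[of 2] in simp)
  have dflow: "deriv (?us t) = u.flow 1 t" "deriv (u.flow 1 t) = u.flow 2 t" for t
    using u.flow_deriv_space[of 0 t] u.flow_deriv_space[of 1 t]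
    by (auto intro!: ext DERIV_imp_deriv derivative_eq_intros simp: numeral_2_eq_2)
  \<comment> \<open>Orders 3 and 4 are two above the slope and the curvature, whose drift they
    drive.\<close>
  define E where "E n = 2 * (M 3 + M 4) * exp (- ((1 / 32) * real n powr (3 / 8)))" for n :: nat
  \<comment> \<open>The value sqrt (a / 8) for a = 1, with \<bar>p\<bar> + \<bar>q\<bar> =
    1.\<close>
  define \<sigma> where "\<sigma> = sqrt (1 / 8 :: real)"
  have "sup_op_norm \<alpha> ?us ?vs \<rho> \<beta> \<xi> \<sigma> \<delta> m1 m2 = \<infinity>"
    if \<delta>: "0 < \<delta>" and loss: "analytic_loss_rate \<alpha> ?us ?vs \<rho>" and \<beta>: "\<And>s t. 0 \<le> s \<Longrightarrow> s \<le> t \<Longrightarrow> \<rho> * (t - s) < \<beta> s t"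
    for \<delta> m1 m2 \<rho> \<beta>
  proof (rule ill_posedness_criterion[OF \<alpha> hu hv, of 1 0 2 1 "1/8" E "max 0 (m1 - m2)"])
    have "(\<lambda>n. real n powr (max 0 (m1 - m2) + 3 * (1 / 8)) * exp (- ((1 / 32) * real n powr (3 / 8)))) \<longlonglongrightarrow> 0"
      by (rule filterlim_compose[OF powr_mult_exp_neg_powr_tendsto_0 filterlim_real_sequentially]) auto
    then have "(\<lambda>n. 2 * (M 3 + M 4) * (real n powr (max 0 (m1 - m2) + 3 * (1 / 8)) * exp (- ((1 / 32) * real n powr (3 / 8))))) \<longlonglongrightarrow> 0"
      by (rule tendsto_mult_right_zero)
    then show "(\<lambda>n. real n powr (max 0 (m1 - m2) + 3 * (1 / 8)) * E n) \<longlonglongrightarrow> 0"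
      unfolding E_def by (simp only: mult.left_commute)
    show "0 \<le> E n" for n using u.M_nonneg by (simp add: E_def)
    have "\<forall>\<^sub>F n in sequentially. real n powr (1 / 8 - 1 / 4) < 1 / 2" by real_asymp
    then show "\<forall>\<^sub>F n in sequentially. \<forall>t z. 0 \<le> t \<longrightarrow> t \<le> real n powr (1 / 8 - 1 / 2) \<longrightarrow>
       z \<in> {2 - real n powr (1 / 8 - 1 / 4)..2 + real n powr (1 / 8 - 1 / 4)} \<longrightarrow>
       \<bar>combine 1 0 (\<lambda>t. deriv (deriv (?us t))) (\<lambda>t. deriv (deriv (?vs t))) t z - 2 * 1\<bar> \<le> E n \<and>
       \<bar>combine 1 0 (\<lambda>t. deriv (?us t)) (\<lambda>t. deriv (?vs t)) t 2\<bar> \<le> real n powr (1 / 8 - 1 / 4) * E n"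
      using eventually_ge_at_top[of 1]
    proof eventually_elim
      case (elim n)
      define W where "W = real n powr (1 / 8 - 1 / 4)"
      define T where "T = real n powr (1 / 8 - 1 / 2)"
      have n: "1 \<le> real n" using elim by simp
      have T: "0 < T" "T \<le> W" "T \<le> 1"
        using n powr_mono[of "1 / 8 - 1 / 2" 0 "real n"] by (auto simp: T_def W_def intro!: powr_mono)
      have T': "1 / (32 * T) = (1 / 32) * real n powr (3 / 8)"
        using n by (simp add: T_def powr_minus_divide)
      have nn: "0 \<le> 2 * M j * exp (- (1 / (32 * T)))" for j by (simp add: u.M_nonneg)
      have le: "2 * M j * exp (- (1 / (32 * T))) \<le> E n" if "j = 3 \<or> j = 4" for j
        unfolding E_def T' using that u.M_nonneg[of 3] u.M_nonneg[of 4] by (intro mult_right_mono) auto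
      have "\<bar>u.flow 2 t z - 2\<bar> \<le> E n \<and> \<bar>u.flow 1 t 2\<bar> \<le> W * E n"
        if t: "0 \<le> t" "t \<le> T" and z: "\<bar>z - 2\<bar> \<le> 1 / 2" for t z
      proof
        have "\<bar>u.flow 2 t z - f 2 z\<bar> \<le> T * (2 * M (2 + 2) * exp (- (1 / (32 * T))))"
          by (rule u.flow_local_drift[of 2]) (use f(4) z t T in auto)
        also have "\<dots> \<le> 1 * E n" using T le[of 4] nn[of 4] by (intro mult_mono) auto
        finally show "\<bar>u.flow 2 t z - 2\<bar> \<le> E n" using f(3)[of z] z by simp
        have "\<bar>u.flow 1 t 2 - f 1 2\<bar> \<le> T * (2 * M (1 + 2) * exp (- (1 / (32 * T))))"
          by (rule u.flow_local_drift[of 2]) (use f(4) t T in auto)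
        also have "\<dots> \<le> W * E n" using T le[of 3] nn[of 3] by (intro mult_mono) (auto simp: numeral_3_eq_3)
        finally show "\<bar>u.flow 1 t 2\<bar> \<le> W * E n" using f(2)[of 2] by simp
      qed
      note bounds = this
      show ?case unfolding dflow
      proof (intro allI impI)
        fix t z assume t: "0 \<le> t" "t \<le> real n powr (1 / 8 - 1 / 2)" and z: "z \<in> {2 - real n powr (1 / 8 - 1 / 4)..2 + real n powr (1 / 8 - 1 / 4)}"
        have "\<bar>z - 2\<bar> \<le> 1 / 2" using z elim(1) by (simp only: abs_le_iff atLeastAtMost_iff) linarith
        from bounds[OF t(1) _ this] t
        show "\<bar>combine 1 0 (u.flow 2) (\<lambda>t. deriv (deriv (?vs t))) t z - 2 * 1\<bar> \<le> E n \<and> \<bar>combine 1 0 (u.flow 1) (\<lambda>t. deriv (?vs t)) t 2\<bar> \<le> real n powr (1 / 8 - 1 / 4) * E n"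
          by (simp add: combine_def W_def T_def)
      qed
    qed
  qed (use \<xi> \<delta> loss \<beta> in \<open>auto simp: \<sigma>_def\<close>)
  moreover have "0 < \<sigma>" by (simp add: \<sigma>_def)
  ultimately have "\<exists>\<sigma>>0. \<forall>\<delta>>0. \<forall>m1 m2. \<forall>\<rho> \<beta>. analytic_loss_rate \<alpha> ?us ?vs \<rho> \<longrightarrow>
         (\<forall>s t. 0 \<le> s \<longrightarrow> s \<le> t \<longrightarrow> \<rho> * (t - s) < \<beta> s t) \<longrightarrow>
         sup_op_norm \<alpha> ?us ?vs \<rho> \<beta> \<xi> \<sigma> \<delta> m1 m2 = \<infinity>" by blast
  moreover have "shear_flow \<alpha> U0 V0 (\<lambda>z. U0 + f 0 z) (\<lambda>z. V0 + g 0 z) ?us ?vs"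
    unfolding shear_flow_def using hu hv by simp
  ultimately show ?thesis using nd by blast
qed

theorem theorem1:
  fixes \<alpha> U0 V0 :: real
    and Us Vs :: "real \<Rightarrow> real"
    and us vs :: "real \<Rightarrow> real \<Rightarrow> real"
  assumes "0 < \<alpha>" and "0 < U0" and "0 < V0"
    and "shear_flow \<alpha> U0 V0 Us Vs us vs"
    and "nondegenerate_layer Us Vs"
  shows "\<forall>\<xi>\<in>{fst, snd}.
    (\<exists>\<sigma>>0. \<forall>\<delta>>0. \<forall>m>0. \<forall>\<mu>\<in>{0..<1/4}.
       \<forall>\<rho> \<beta>. analytic_loss_rate \<alpha> us vs \<rho> \<longrightarrow>
         (\<forall>s t. 0 \<le> s \<longrightarrow> s \<le> t \<longrightarrow> \<rho> * (t - s) < \<beta> s t) \<longrightarrow>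
         sup_op_norm \<alpha> us vs \<rho> \<beta> \<xi> \<sigma> \<delta> m (m - \<mu>) = \<infinity>) \<and>
    (\<exists>Us' Vs' us' vs'.
       shear_flow \<alpha> U0 V0 Us' Vs' us' vs' \<and> nondegenerate_layer Us' Vs' \<and>
       (\<exists>\<sigma>>0. \<forall>\<delta>>0. \<forall>m1>0. \<forall>m2>0.
          \<forall>\<rho> \<beta>. analytic_loss_rate \<alpha> us' vs' \<rho> \<longrightarrow>
            (\<forall>s t. 0 \<le> s \<longrightarrow> s \<le> t \<longrightarrow> \<rho> * (t - s) < \<beta> s t) \<longrightarrow>
            sup_op_norm \<alpha> us' vs' \<rho> \<beta> \<xi> \<sigma> \<delta> m1 m2 = \<infinity>))"
proof (intro ballI conjI)
  fix \<xi> :: "int \<times> int \<Rightarrow> int" assume \<xi>: "\<xi> \<in> {fst, snd}"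
  have "heat_profile \<alpha> U0 Us us" "heat_profile \<alpha> V0 Vs vs" using assms(4) by (simp_all add: shear_flow_def)
  from algebraic_ill_posedness[OF assms(1) this assms(5) \<xi>]
  obtain \<sigma> where "0 < \<sigma>" "\<forall>\<delta>>0. \<forall>m. \<forall>\<mu>\<in>{0..<1/4}. \<forall>\<rho> \<beta>. analytic_loss_rate \<alpha> us vs \<rho> \<longrightarrow>
         (\<forall>s t. 0 \<le> s \<longrightarrow> s \<le> t \<longrightarrow> \<rho> * (t - s) < \<beta> s t) \<longrightarrow>
         sup_op_norm \<alpha> us vs \<rho> \<beta> \<xi> \<sigma> \<delta> m (m - \<mu>) = \<infinity>" by (elim exE conjE) (rule that)
  then show "\<exists>\<sigma>>0. \<forall>\<delta>>0. \<forall>m>0. \<forall>\<mu>\<in>{0..<1/4}.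
       \<forall>\<rho> \<beta>. analytic_loss_rate \<alpha> us vs \<rho> \<longrightarrow>
         (\<forall>s t. 0 \<le> s \<longrightarrow> s \<le> t \<longrightarrow> \<rho> * (t - s) < \<beta> s t) \<longrightarrow>
         sup_op_norm \<alpha> us vs \<rho> \<beta> \<xi> \<sigma> \<delta> m (m - \<mu>) = \<infinity>"
    by (intro exI[of _ \<sigma>]) simp
  from superalgebraic_ill_posedness[OF assms(1) \<xi>, of U0 V0]
  obtain Us' Vs' us' vs' \<sigma>' where "shear_flow \<alpha> U0 V0 Us' Vs' us' vs'" "nondegenerate_layer Us' Vs'" "0 < \<sigma>'"
    "\<forall>\<delta>>0. \<forall>m1 m2. \<forall>\<rho> \<beta>. analytic_loss_rate \<alpha> us' vs' \<rho> \<longrightarrow>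
         (\<forall>s t. 0 \<le> s \<longrightarrow> s \<le> t \<longrightarrow> \<rho> * (t - s) < \<beta> s t) \<longrightarrow>
         sup_op_norm \<alpha> us' vs' \<rho> \<beta> \<xi> \<sigma>' \<delta> m1 m2 = \<infinity>" by (elim exE conjE) (rule that)
  then show "\<exists>Us' Vs' us' vs'.
       shear_flow \<alpha> U0 V0 Us' Vs' us' vs' \<and> nondegenerate_layer Us' Vs' \<and>
       (\<exists>\<sigma>>0. \<forall>\<delta>>0. \<forall>m1>0. \<forall>m2>0.
          \<forall>\<rho> \<beta>. analytic_loss_rate \<alpha> us' vs' \<rho> \<longrightarrow>
            (\<forall>s t. 0 \<le> s \<longrightarrow> s \<le> t \<longrightarrow> \<rho> * (t - s) < \<beta> s t) \<longrightarrow>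
            sup_op_norm \<alpha> us' vs' \<rho> \<beta> \<xi> \<sigma> \<delta> m1 m2 = \<infinity>)"
    by (intro exI[of _ Us'] exI[of _ Vs'] exI[of _ us'] exI[of _ vs'] exI[of _ \<sigma>'] conjI) simp_all
qed

end
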